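(* Let $1\le r_1,s_1,r_2,s_2<\infty$ and let $T:M^{r_1,s_1}_A\to M^{r_2,s_2}_A$ be a bounded linear operator between $A$-modulation spaces. Then: (i) If $TT_x^A=T_x^AT$ for all $x\in\mathbb{R}$, then there exists a unique $u\in S_0'(\mathbb{R})$ such that $Tf=u\star_A f$ for all $f\in S_0(\mathbb{R})$. (ii) If $TT_x=T_xT$ for all $x\in\mathbb{R}$, then there exists a unique $u\in S_0'(\mathbb{R})$ such that $Tf=u\star f$ for all $f\in S_0(\mathbb{R})$.
   Context: $A=\{a,b,c,d,p,q\}$ are real parameters with $ad-bc=1$ and $b\neq 0$. $S(\mathbb{R})$ is the Schwartz space, $S'(\mathbb{R})$ the tempered distributions. $T_sf(t)=f(t-s)$, $M_sf(t)=e^{2\pi i st}f(t)$, $C_sf(t)=e^{\pi i s t^2}f(t)$, $\phi^{\checkmark}(t)=\phi(-t)$. The $A$-translation is $T_s^Af(t)=e^{-\frac{2\pi i a}{b}s(t-s)}f(t-s)$, i.e. $T_s^A=T_sM_{-as/b}$ (this also defines it on distributions). The $A$-modulation is $M_s^Af(t)=e^{\frac{\pi i}{b}(as^2-2ps+2st)}f(t)$. For $\Lambda\in S'(\mathbb{R})$, $\phi\in S(\mathbb{R})$ (and likewise for $\Lambda\in S_0'(\mathbb{R})$, $\phi\in S_0(\mathbb{R})$): $(\Lambda\star\phi)(x)=\Lambda(T_x\phi^{\checkmark})$ and $(\Lambda\star_A\phi)(x)=\frac{1}{\sqrt{|b|}}e^{-\frac{2\pi i a}{b}x^2}\Lambda\big(C_{2a/b}T_x^A\phi^{\checkmark}\big)$;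 for functions this agrees with $(f\star_Ag)(x)=\frac{1}{\sqrt{|b|}}\int_{\mathbb{R}} f(s)T_s^Ag(x)\,ds$. Fix a nonzero $g\in S(\mathbb{R})$. For $1\le r,s<\infty$, the $A$-modulation space $M^{r,s}_A$ is the set of $f\in S'(\mathbb{R})$ with $\|f\|_{M^{r,s}_A}=\big(\int_{\mathbb{R}}\big(\int_{\mathbb{R}}|f\star_AM_\omega^Ag(x)|^r\,dx\big)^{s/r}d\omega\big)^{1/s}<\infty$. Different nonzero windows $g$ give the same space with equivalent norms. $S_0(\mathbb{R})=M^1$ is the Feichtinger algebra, i.e. the classical modulation space of $f\in S'(\mathbb{R})$ with $\int_{\mathbb{R}}\int_{\mathbb{R}}|f\star M_\omega g(x)|\,dx\,d\omega<\infty$, and $S_0'(\mathbb{R})$ is its dual. One has $S_0(\mathbb{R})\subseteq M^{r,s}_A\subseteq S_0'(\mathbb{R})$. *)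

theory Defs
  imports "HOL-Analysis.Analysis"
begin

section \<open>Schwartz functions and tempered distributions\<close>

definition schwartz_seminorm :: "nat \<Rightarrow> nat \<Rightarrow> (real \<Rightarrow> complex) \<Rightarrow> real" where
  "schwartz_seminorm m n f =
     (SUP x. \<bar>x\<bar> ^ m * cmod (((\<lambda>h x. vector_derivative h (at x)) ^^ n) f x))"

definition schwartz :: "(real \<Rightarrow> complex) set" where
  "schwartz = {f.
     (\<forall>n x. ((\<lambda>h x. vector_derivative h (at x)) ^^ n) f differentiable (at x)) \<and>
     (\<forall>m n. bdd_above (range (\<lambda>x. \<bar>x\<bar> ^ m *
        cmod (((\<lambda>h x. vector_derivative h (at x)) ^^ n) f x))))}"

text \<open>A functional is a total function that vanishes off its domain, so that equality in HOL
  is equality of functionals on the domain. The operators below are bijections of the domains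
  and therefore respect this convention.\<close>

type_synonym functional = "(real \<Rightarrow> complex) \<Rightarrow> complex"

definition tempered :: "functional set" where
  "tempered = {\<Lambda>.
     (\<forall>\<phi>\<in>schwartz. \<forall>\<psi>\<in>schwartz. \<Lambda> (\<lambda>t. \<phi> t + \<psi> t) = \<Lambda> \<phi> + \<Lambda> \<psi>) \<and>
     (\<forall>\<phi>\<in>schwartz. \<forall>k. \<Lambda> (\<lambda>t. k * \<phi> t) = k * \<Lambda> \<phi>) \<and>
     (\<exists>K N. \<forall>\<phi>\<in>schwartz. cmod (\<Lambda> \<phi>) \<le> K * (\<Sum>m\<le>N. \<Sum>n\<le>N. schwartz_seminorm m n \<phi>)) \<and>
     (\<forall>\<phi>. \<phi> \<notin> schwartz \<longrightarrow> \<Lambda> \<phi> = 0)}"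

text \<open>The (bilinear) identification of a function with a distribution.\<close>

definition distr_of :: "(real \<Rightarrow> complex) \<Rightarrow> functional" where
  "distr_of f = (\<lambda>\<phi>. if \<phi> \<in> schwartz then (\<integral>t. f t * \<phi> t \<partial>lborel) else 0)"


section \<open>Operators on functions and, by duality, on distributions\<close>

record lct_params =
  par_a :: real
  par_b :: real
  par_c :: real
  par_d :: real
  par_p :: real
  par_q :: real

definition translate :: "real \<Rightarrow> (real \<Rightarrow> complex) \<Rightarrow> real \<Rightarrow> complex" where
  "translate s f t = f (t - s)"

definition modul :: "real \<Rightarrow> (real \<Rightarrow> complex) \<Rightarrow> real \<Rightarrow> complex" where
  "modul s f t = cis (2 * pi * s * t) * f t"

definition chirp :: "real \<Rightarrow> (real \<Rightarrow> complex) \<Rightarrow> real \<Rightarrow> complex" where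
  "chirp s f t = cis (pi * s * t\<^sup>2) * f t"

definition reflect :: "(real \<Rightarrow> complex) \<Rightarrow> real \<Rightarrow> complex" where
  "reflect f t = f (- t)"

definition A_trans :: "lct_params \<Rightarrow> real \<Rightarrow> (real \<Rightarrow> complex) \<Rightarrow> real \<Rightarrow> complex" where
  "A_trans A s f t = cis (- (2 * pi * par_a A / par_b A) * s * (t - s)) * f (t - s)"

definition A_modul :: "lct_params \<Rightarrow> real \<Rightarrow> (real \<Rightarrow> complex) \<Rightarrow> real \<Rightarrow> complex" where
  "A_modul A s f t =
     cis (pi / par_b A * (par_a A * s\<^sup>2 - 2 * par_p A * s + 2 * s * t)) * f t"

definition distr_translate :: "real \<Rightarrow> functional \<Rightarrow> functional" where
  "distr_translate s \<Lambda> = (\<lambda>\<phi>. \<Lambda> (translate (- s) \<phi>))"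

definition distr_modul :: "real \<Rightarrow> functional \<Rightarrow> functional" where
  "distr_modul s \<Lambda> = (\<lambda>\<phi>. \<Lambda> (modul s \<phi>))"

definition distr_chirp :: "real \<Rightarrow> functional \<Rightarrow> functional" where
  "distr_chirp s \<Lambda> = (\<lambda>\<phi>. \<Lambda> (chirp s \<phi>))"

definition distr_reflect :: "functional \<Rightarrow> functional" where
  "distr_reflect \<Lambda> = (\<lambda>\<phi>. \<Lambda> (reflect \<phi>))"

lemma A_trans_eq: "A_trans A s f = translate s (modul (- (par_a A * s / par_b A)) f)"
  by (simp add: fun_eq_iff A_trans_def translate_def modul_def mult.assoc)

definition distr_A_trans :: "lct_params \<Rightarrow> real \<Rightarrow> functional \<Rightarrow> functional" where
  "distr_A_trans A s \<Lambda> = distr_translate s (distr_modul (- (par_a A * s / par_b A)) \<Lambda>)"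


section \<open>Convolution of a tempered distribution with a Schwartz function\<close>

definition conv :: "functional \<Rightarrow> (real \<Rightarrow> complex) \<Rightarrow> real \<Rightarrow> complex" where
  "conv \<Lambda> \<phi> x = \<Lambda> (translate x (reflect \<phi>))"

definition A_conv :: "lct_params \<Rightarrow> functional \<Rightarrow> (real \<Rightarrow> complex) \<Rightarrow> real \<Rightarrow> complex" where
  "A_conv A \<Lambda> \<phi> x =
     of_real (1 / sqrt \<bar>par_b A\<bar>) * cis (- (2 * pi * par_a A / par_b A) * x\<^sup>2) *
     \<Lambda> (chirp (2 * par_a A / par_b A) (A_trans A x (reflect \<phi>)))"


section \<open>Modulation spaces\<close>

definition ennreal_powr :: "ennreal \<Rightarrow> real \<Rightarrow> ennreal" where
  "ennreal_powr y e = (if y = \<infinity> then \<infinity> else ennreal (enn2real y powr e))"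

definition A_mod_norm ::
    "lct_params \<Rightarrow> (real \<Rightarrow> complex) \<Rightarrow> real \<Rightarrow> real \<Rightarrow> functional \<Rightarrow> ennreal" where
  "A_mod_norm A g r s f = ennreal_powr
     (\<integral>\<^sup>+ \<omega>. ennreal_powr
        (\<integral>\<^sup>+ x. ennreal (cmod (A_conv A f (A_modul A \<omega> g) x) powr r) \<partial>lborel) (s / r)
      \<partial>lborel) (1 / s)"

definition A_mod_space ::
    "lct_params \<Rightarrow> (real \<Rightarrow> complex) \<Rightarrow> real \<Rightarrow> real \<Rightarrow> functional set" where
  "A_mod_space A g r s = {f \<in> tempered. A_mod_norm A g r s f < \<infinity>}"

text \<open>The Feichtinger algebra is a set of tempered distributions, so an element of its dual
  is a functional on distributions.\<close>

definition S0_norm :: "(real \<Rightarrow> complex) \<Rightarrow> functional \<Rightarrow> ennreal" where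
  "S0_norm g f =
     (\<integral>\<^sup>+ \<omega>. (\<integral>\<^sup>+ x. ennreal (cmod (conv f (modul \<omega> g) x)) \<partial>lborel) \<partial>lborel)"

definition S0 :: "(real \<Rightarrow> complex) \<Rightarrow> functional set" where
  "S0 g = {f \<in> tempered. S0_norm g f < \<infinity>}"

definition S0_dual :: "(real \<Rightarrow> complex) \<Rightarrow> (functional \<Rightarrow> complex) set" where
  "S0_dual g = {u.
     (\<forall>f\<in>S0 g. \<forall>h\<in>S0 g. u (\<lambda>\<phi>. f \<phi> + h \<phi>) = u f + u h) \<and>
     (\<forall>f\<in>S0 g. \<forall>k. u (\<lambda>\<phi>. k * f \<phi>) = k * u f) \<and>
     (\<exists>K::real. \<forall>f\<in>S0 g. ennreal (cmod (u f)) \<le> ennreal K * S0_norm g f) \<and>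
     (\<forall>f. f \<notin> S0 g \<longrightarrow> u f = 0)}"

definition S0_conv :: "(functional \<Rightarrow> complex) \<Rightarrow> functional \<Rightarrow> real \<Rightarrow> complex" where
  "S0_conv u f x = u (distr_translate x (distr_reflect f))"

definition S0_A_conv ::
    "lct_params \<Rightarrow> (functional \<Rightarrow> complex) \<Rightarrow> functional \<Rightarrow> real \<Rightarrow> complex" where
  "S0_A_conv A u f x =
     of_real (1 / sqrt \<bar>par_b A\<bar>) * cis (- (2 * pi * par_a A / par_b A) * x\<^sup>2) *
     u (distr_chirp (2 * par_a A / par_b A) (distr_A_trans A x (distr_reflect f)))"

definition bounded_linear_op ::
    "functional set \<Rightarrow> (functional \<Rightarrow> ennreal) \<Rightarrow> functional set \<Rightarrow> (functional \<Rightarrow> ennreal) \<Rightarrow>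
     (functional \<Rightarrow> functional) \<Rightarrow> bool" where
  "bounded_linear_op X nX Y nY T \<longleftrightarrow>
     (\<forall>f\<in>X. T f \<in> Y) \<and>
     (\<forall>f\<in>X. \<forall>h\<in>X. T (\<lambda>\<phi>. f \<phi> + h \<phi>) = (\<lambda>\<phi>. T f \<phi> + T h \<phi>)) \<and>
     (\<forall>f\<in>X. \<forall>k. T (\<lambda>\<phi>. k * f \<phi>) = (\<lambda>\<phi>. k * T f \<phi>)) \<and>
     (\<exists>K::real. \<forall>f\<in>X. nY (T f) \<le> ennreal K * nX f)"

end

theory Submission
  imports Defs "HOL-Probability.Probability"
begin

text \<open>
  Conjugation by the chirp of rate \<open>a/b\<close> turns \<open>A\<close>-modulation spaces, \<open>A\<close>-translations and the
  \<open>A\<close>-convolution into their classical counterparts, and it preserves the Feichtinger algebra. Both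
  claims therefore reduce to one: a bounded operator \<open>S\<close> from the Feichtinger algebra to tempered
  distributions with uniformly bounded short-time Fourier transform, commuting with translations, is
  the convolution with a unique \<open>u\<close>.

  For Schwartz functions \<open>\<phi>, \<psi>\<close> invariance gives \<open>S(\<phi> * \<psi>) = S\<phi> * \<psi>\<close>, which is a continuous
  function. With \<open>H = \<gamma> * \<gamma>\<close> for a Gaussian \<open>\<gamma>\<close>, the image of every time-frequency shift of \<open>H\<close> is
  such a function, bounded uniformly in the shift. Writing \<open>f\<close> as an integral of time-frequency shifts
  of \<open>H\<close> with integrable coefficients represents \<open>S f\<close> by a bounded function, and \<open>u(f)\<close> is the value
  at \<open>0\<close> of the function representing \<open>S\<close> applied to the reflection of \<open>f\<close>. Uniqueness holds because
  Schwartz functions are dense.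

  All norm comparisons come from the inversion formula of the short-time Fourier transform, which
  bounds the transform for one window by that for another, smeared with the kernel
  \<open>1/((1 + x\<^sup>2)(1 + \<omega>\<^sup>2))\<close>.
\<close>

section \<open>Derivative sequences and Schwartz functions\<close>

text \<open>The obstacle is that the operator is a bare map on distributions: pulling it under an
  integral sign would call for integrals with values in the Schwartz space or in the Feichtinger
  algebra. Freezing the output test function avoids them: for fixed \<open>\<phi>\<close> the map
  sending \<open>h\<close> to \<open>S (distr_of h) \<phi>\<close> is a tempered distribution
  (\<open>pairing\<close>), and tempered distributions commute with integrals of Schwartz families
  (\<open>tempered_integral_line\<close>, \<open>tempered_synthesis\<close>). The synthesis window
  is a convolution because invariance turns exactly convolutions into functions; modulating a
  convolution modulates both factors, so one \<open>H\<close> serves all shifts. Uniformity in the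
  shift comes from the invariance of the Feichtinger norm under time-frequency shifts. The exponents
  enter through two embeddings: of the Feichtinger algebra into the source, and of the target into
  the distributions with bounded transform. For ordinary translations conjugation by the chirp would
  change the commutation hypothesis; there the chirp is used only to carry the bound across, since
  it shears the plane and a supremum does not notice a shear.\<close>

abbreviation nth_deriv :: "nat \<Rightarrow> (real \<Rightarrow> complex) \<Rightarrow> real \<Rightarrow> complex" where
  "nth_deriv n f \<equiv> ((\<lambda>h x. vector_derivative h (at x)) ^^ n) f"

text \<open>Carrying all derivatives along as a sequence makes products, shifts and parameter
  integrals explicit at every order; the iterated \<open>vector_derivative\<close> is identified
  once, in \<open>nth_deriv_deriv_seq\<close>.\<close>

definition deriv_seq :: "(nat \<Rightarrow> real \<Rightarrow> complex) \<Rightarrow> bool" where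
  "deriv_seq D \<longleftrightarrow> (\<forall>n t. (D n has_vector_derivative D (Suc n) t) (at t))"

text \<open>Powers of \<open>1 + t\<^sup>2\<close> replace those of the absolute value: they are at
  least 1, hence invertible and increasing in \<open>k\<close>, and they behave well under shifts
  (\<open>peetre\<close>).\<close>

definition rapid :: "(nat \<Rightarrow> real \<Rightarrow> complex) \<Rightarrow> bool" where
  "rapid D \<longleftrightarrow> (\<forall>k n. \<exists>B. \<forall>t. (1 + t\<^sup>2) ^ k * cmod (D n t) \<le> B)"

lemma nth_deriv_deriv_seq:
  assumes "deriv_seq D"
  shows "nth_deriv n (D 0) = D n"
proof (induction n)
  case (Suc n)
  have "nth_deriv (Suc n) (D 0) = (\<lambda>x. vector_derivative (D n) (at x))"
    using Suc by simp
  also have "\<dots> = D (Suc n)"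
    using assms by (auto simp: deriv_seq_def vector_derivative_at)
  finally show ?case .
qed simp

lemma abs_power_le_weight: "\<bar>t::real\<bar> ^ m \<le> (1 + t\<^sup>2) ^ m"
proof (rule power_mono)
  have "0 \<le> (\<bar>t\<bar> - 1/2)\<^sup>2" by simp
  then show "\<bar>t\<bar> \<le> 1 + t\<^sup>2" by (simp add: power2_eq_square algebra_simps abs_mult_self_eq)
qed simp

lemma weight_le_power: "(1 + t\<^sup>2) ^ k \<le> 2 ^ k * (1 + \<bar>t::real\<bar> ^ (2 * k))"
proof -
  have "(1 + t\<^sup>2) ^ k \<le> (2 * max 1 (t\<^sup>2)) ^ k"
    by (rule power_mono) auto
  also have "\<dots> = 2 ^ k * (max 1 (t\<^sup>2)) ^ k" by (simp add: power_mult_distrib)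
  also have "\<dots> \<le> 2 ^ k * (1 + \<bar>t\<bar> ^ (2 * k))"
  proof (rule mult_left_mono)
    show "max 1 (t\<^sup>2) ^ k \<le> 1 + \<bar>t\<bar> ^ (2 * k)"
      by (auto simp: max_def power_mult power2_eq_square)
  qed simp
  finally show ?thesis .
qed

lemma weight_ge_1: "1 \<le> (1 + (t::real)\<^sup>2) ^ k"
  by (simp add: one_le_power)

lemma schwartzI:
  assumes "deriv_seq D" "rapid D"
  shows "D 0 \<in> schwartz"
  unfolding schwartz_def mem_Collect_eq nth_deriv_deriv_seq[OF assms(1)]
proof (intro conjI allI)
  fix n x
  show "D n differentiable at x"
    using assms(1) unfolding deriv_seq_def by (metis differentiableI_vector)
next
  fix m n
  obtain B where B: "\<And>t. (1 + t\<^sup>2) ^ m * cmod (D n t) \<le> B"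
    using assms(2) unfolding rapid_def by blast
  show "bdd_above (range (\<lambda>x. \<bar>x\<bar> ^ m * cmod (D n x)))"
  proof (rule bdd_aboveI2)
    fix x
    have "\<bar>x\<bar> ^ m * cmod (D n x) \<le> (1 + x\<^sup>2) ^ m * cmod (D n x)"
      by (intro mult_right_mono abs_power_le_weight) simp
    with B[of x] show "\<bar>x\<bar> ^ m * cmod (D n x) \<le> B" by linarith
  qed
qed

lemma schwartz_deriv_seq: "f \<in> schwartz \<Longrightarrow> deriv_seq (\<lambda>n. nth_deriv n f)"
  unfolding schwartz_def deriv_seq_def by (simp add: vector_derivative_works)

abbreviation schwartz_norm :: "nat \<Rightarrow> (real \<Rightarrow> complex) \<Rightarrow> real" where
  "schwartz_norm N f \<equiv> (\<Sum>m\<le>N. \<Sum>n\<le>N. schwartz_seminorm m n f)"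

lemma seminorm_upper:
  assumes "f \<in> schwartz"
  shows "\<bar>x\<bar> ^ m * cmod (nth_deriv n f x) \<le> schwartz_seminorm m n f"
  unfolding schwartz_seminorm_def
  using assms by (intro cSUP_upper) (auto simp: schwartz_def)

lemma seminorm_nonneg: "f \<in> schwartz \<Longrightarrow> 0 \<le> schwartz_seminorm m n f"
  using seminorm_upper[of f 0 m n] order_trans[of 0 "\<bar>0\<bar> ^ m * cmod (nth_deriv n f 0)"]
  by (meson mult_nonneg_nonneg norm_ge_zero zero_le_power abs_ge_zero)

lemma seminorm_le_schwartz_norm:
  assumes "f \<in> schwartz" "m \<le> N" "n \<le> N"
  shows "schwartz_seminorm m n f \<le> schwartz_norm N f"
proof -
  have "schwartz_seminorm m n f \<le> (\<Sum>n\<le>N. schwartz_seminorm m n f)"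
    using assms by (intro member_le_sum) (auto intro: seminorm_nonneg)
  also have "\<dots> \<le> schwartz_norm N f"
    using assms by (intro member_le_sum[where f="\<lambda>m. \<Sum>n\<le>N. schwartz_seminorm m n f"])
      (auto intro!: sum_nonneg seminorm_nonneg)
  finally show ?thesis .
qed

lemma schwartz_norm_nonneg: "f \<in> schwartz \<Longrightarrow> 0 \<le> schwartz_norm N f"
  by (intro sum_nonneg seminorm_nonneg)

text \<open>\<open>weight_le_power\<close> leaves the powers 0 and \<open>2 * k\<close>, each
  controlled by one seminorm; hence \<open>2 * k \<le> N\<close>, and the two summands turn
  \<open>2 ^ k\<close> into \<open>2 ^ (k + 1)\<close>.\<close>

lemma schwartz_weight_le:
  assumes "f \<in> schwartz" "2 * k \<le> N" "n \<le> N"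
  shows "(1 + t\<^sup>2) ^ k * cmod (nth_deriv n f t) \<le> 2 ^ (k + 1) * schwartz_norm N f"
proof -
  have 1: "\<bar>t\<bar> ^ m * cmod (nth_deriv n f t) \<le> schwartz_norm N f" if "m \<le> N" for m
    using seminorm_upper[OF assms(1), of t m n] seminorm_le_schwartz_norm[OF assms(1) that assms(3)]
    by linarith
  have "(1 + t\<^sup>2) ^ k * cmod (nth_deriv n f t) \<le> 2 ^ k * (1 + \<bar>t\<bar> ^ (2 * k)) * cmod (nth_deriv n f t)"
    by (intro mult_right_mono weight_le_power) simp
  also have "\<dots> = 2 ^ k * (\<bar>t\<bar> ^ 0 * cmod (nth_deriv n f t) + \<bar>t\<bar> ^ (2 * k) * cmod (nth_deriv n f t))"
    by (simp add: algebra_simps)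
  also have "\<dots> \<le> 2 ^ k * (schwartz_norm N f + schwartz_norm N f)"
    using 1[of 0] 1[of "2 * k"] assms(2) by (intro mult_left_mono add_mono) auto
  finally show ?thesis by simp
qed

lemma schwartz_rapid: "f \<in> schwartz \<Longrightarrow> rapid (\<lambda>n. nth_deriv n f)"
  unfolding rapid_def
proof (intro allI)
  fix k n assume "f \<in> schwartz"
  then show "\<exists>B. \<forall>t. (1 + t\<^sup>2) ^ k * cmod (nth_deriv n f t) \<le> B"
    by (intro exI[of _ "2 ^ (k + 1) * schwartz_norm (2 * k + n) f"] allI schwartz_weight_le) auto
qed

text \<open>The converse of \<open>schwartz_weight_le\<close>; the factor counts the pairs of
  indices up to \<open>N\<close>.\<close>

lemma schwartz_norm_le:
  assumes D: "deriv_seq D" and B: "\<And>n t. n \<le> N \<Longrightarrow> (1 + t\<^sup>2) ^ N * cmod (D n t) \<le> B"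
  shows "schwartz_norm N (D 0) \<le> (real N + 1)\<^sup>2 * B"
proof -
  have "schwartz_seminorm m n (D 0) \<le> B" if "m \<le> N" "n \<le> N" for m n
    unfolding schwartz_seminorm_def nth_deriv_deriv_seq[OF D]
  proof (rule cSUP_least)
    fix x
    have "\<bar>x\<bar> ^ m * cmod (D n x) \<le> (1 + x\<^sup>2) ^ m * cmod (D n x)"
      by (intro mult_right_mono abs_power_le_weight) simp
    also have "\<dots> \<le> (1 + x\<^sup>2) ^ N * cmod (D n x)"
      using that by (intro mult_right_mono power_increasing) auto
    finally show "\<bar>x\<bar> ^ m * cmod (D n x) \<le> B" using B[OF that(2), of x] by linarith
  qed simp
  then have "schwartz_norm N (D 0) \<le> (\<Sum>m\<le>N. \<Sum>n\<le>N. B)"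
    by (intro sum_mono) auto
  also have "\<dots> = (real N + 1)\<^sup>2 * B" by (simp add: power2_eq_square algebra_simps)
  finally show ?thesis .
qed

lemma schwartz_norm_mono: "f \<in> schwartz \<Longrightarrow> N \<le> M \<Longrightarrow> schwartz_norm N f \<le> schwartz_norm M f"
  by (rule order_trans[OF sum_mono sum_mono2])
     (auto intro!: sum_mono2 sum_nonneg seminorm_nonneg)

subsection \<open>Products\<close>

text \<open>The Leibniz rule in a form without binomial coefficients.\<close>

primrec leibniz :: "nat \<Rightarrow> (nat \<Rightarrow> real \<Rightarrow> complex) \<Rightarrow> (nat \<Rightarrow> real \<Rightarrow> complex) \<Rightarrow> real \<Rightarrow> complex" where
  "leibniz 0 D E t = D 0 t * E 0 t"
| "leibniz (Suc n) D E t = leibniz n (\<lambda>i. D (Suc i)) E t + leibniz n D (\<lambda>i. E (Suc i)) t"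

lemma deriv_seq_Suc: "deriv_seq D \<Longrightarrow> deriv_seq (\<lambda>i. D (Suc i))"
  by (simp add: deriv_seq_def)

lemma deriv_seq_leibniz:
  assumes "deriv_seq D" "deriv_seq E"
  shows "deriv_seq (\<lambda>n. leibniz n D E)"
proof -
  have "(leibniz n D E has_vector_derivative leibniz (Suc n) D E t) (at t)"
    if "deriv_seq D" "deriv_seq E" for n t D E
    using that
  proof (induction n arbitrary: D E)
    case 0
    then have "((\<lambda>t. D 0 t * E 0 t) has_vector_derivative D 0 t * E (Suc 0) t + D (Suc 0) t * E 0 t) (at t)"
      unfolding deriv_seq_def by (intro has_vector_derivative_mult) auto
    moreover have "leibniz 0 D E = (\<lambda>t. D 0 t * E 0 t)" by auto
    ultimately show ?case by (simp add: add.commute)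
  next
    case (Suc n)
    have "((\<lambda>t. leibniz n (\<lambda>i. D (Suc i)) E t + leibniz n D (\<lambda>i. E (Suc i)) t) has_vector_derivative
       leibniz (Suc n) (\<lambda>i. D (Suc i)) E t + leibniz (Suc n) D (\<lambda>i. E (Suc i)) t) (at t)"
      by (intro has_vector_derivative_add Suc.IH Suc.prems deriv_seq_Suc)
    moreover have "leibniz (Suc n) D E = (\<lambda>t. leibniz n (\<lambda>i. D (Suc i)) E t + leibniz n D (\<lambda>i. E (Suc i)) t)"
      by auto
    ultimately show ?case by simp
  qed
  then show ?thesis unfolding deriv_seq_def[of "\<lambda>n. leibniz n D E"] using assms by blast
qed

text \<open>Unfolding the recursion completely yields \<open>2 ^ n\<close> products, each of
  derivatives of order at most \<open>n\<close>.\<close>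

lemma leibniz_le:
  assumes "\<And>i. i \<le> n \<Longrightarrow> cmod (D i t) \<le> a" "\<And>i. i \<le> n \<Longrightarrow> cmod (E i t) \<le> b"
  shows "cmod (leibniz n D E t) \<le> 2 ^ n * (a * b)"
  using assms
proof (induction n arbitrary: D E)
  case 0
  have "0 \<le> a" using 0(1)[of 0] norm_ge_zero[of "D 0 t"] by linarith
  then show ?case using 0 by (simp add: norm_mult mult_mono)
next
  case (Suc n)
  have "cmod (leibniz n (\<lambda>i. D (Suc i)) E t) \<le> 2 ^ n * (a * b)"
    by (rule Suc.IH) (use Suc.prems in auto)
  moreover have "cmod (leibniz n D (\<lambda>i. E (Suc i)) t) \<le> 2 ^ n * (a * b)"
    by (rule Suc.IH) (use Suc.prems in auto)
  moreover have "cmod (leibniz (Suc n) D E t) \<le>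
      cmod (leibniz n (\<lambda>i. D (Suc i)) E t) + cmod (leibniz n D (\<lambda>i. E (Suc i)) t)"
    by (simp add: norm_triangle_ineq)
  ultimately show ?case by simp
qed

lemma finite_upto_bound:
  assumes "\<And>n::nat. \<exists>B::real. \<forall>x\<in>S. F n x \<le> B"
  obtains B where "0 \<le> B" "\<And>n x. n \<le> N \<Longrightarrow> x \<in> S \<Longrightarrow> F n x \<le> B"
proof -
  obtain B where B: "\<And>n x. x \<in> S \<Longrightarrow> F n x \<le> B n" using assms by metis
  show ?thesis
  proof
    show "0 \<le> (\<Sum>n\<le>N. \<bar>B n\<bar>)" by (simp add: sum_nonneg)
    fix n x assume "n \<le> N" "x \<in> S"
    then have "F n x \<le> \<bar>B n\<bar>" using B[of x n] by linarith
    also have "\<dots> \<le> (\<Sum>n\<le>N. \<bar>B n\<bar>)" using \<open>n \<le> N\<close> by (intro member_le_sum) auto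
    finally show "F n x \<le> (\<Sum>n\<le>N. \<bar>B n\<bar>)" .
  qed
qed

section \<open>Multipliers of polynomial growth\<close>

definition slow :: "(nat \<Rightarrow> real \<Rightarrow> complex) \<Rightarrow> bool" where
  "slow D \<longleftrightarrow> (\<forall>n. \<exists>B k. \<forall>t. cmod (D n t) \<le> B * (1 + t\<^sup>2) ^ k)"

lemma slow_upto:
  assumes "slow D"
  obtains B k where "0 \<le> B" "\<And>n t. n \<le> N \<Longrightarrow> cmod (D n t) \<le> B * (1 + t\<^sup>2) ^ k"
proof -
  obtain B k where Bk: "\<And>n t. cmod (D n t) \<le> B n * (1 + t\<^sup>2) ^ k n"
    using assms unfolding slow_def by metis
  define K where "K = (\<Sum>n\<le>N. k n)"
  show ?thesis
  proof
    show "0 \<le> (\<Sum>n\<le>N. \<bar>B n\<bar>)" by (simp add: sum_nonneg)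
    fix n t assume n: "n \<le> N"
    have "cmod (D n t) \<le> \<bar>B n\<bar> * (1 + t\<^sup>2) ^ k n"
      using Bk[of n t] by (smt (verit) mult_right_mono weight_ge_1)
    also have "\<dots> \<le> (\<Sum>n\<le>N. \<bar>B n\<bar>) * (1 + t\<^sup>2) ^ K"
      unfolding K_def using n by (intro mult_mono power_increasing member_le_sum) (auto intro: sum_nonneg)
    finally show "cmod (D n t) \<le> (\<Sum>n\<le>N. \<bar>B n\<bar>) * (1 + t\<^sup>2) ^ K" .
  qed
qed

text \<open>\<open>K\<close> and \<open>j\<close> depend on \<open>E\<close>, \<open>n\<close> and
  \<open>k\<close> and are chosen before \<open>D\<close>, \<open>B\<close> and \<open>t\<close>.
  One statement thus gives both membership (\<open>schwartz_mult_slow\<close>) and continuity in the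
  seminorms (\<open>schwartz_norm_mult_slow\<close>).\<close>

lemma slow_leibniz_bound:
  assumes "slow E"
  shows "\<exists>K j. 0 \<le> K \<and> (\<forall>D B t. (\<forall>i\<le>n. (1 + t\<^sup>2) ^ (k + j) * cmod (D i t) \<le> B) \<longrightarrow>
     (1 + t\<^sup>2) ^ k * cmod (leibniz n E D t) \<le> K * B)"
proof -
  obtain b j where b: "0 \<le> b" "\<And>i t. i \<le> n \<Longrightarrow> cmod (E i t) \<le> b * (1 + t\<^sup>2) ^ j"
    using slow_upto[OF assms] by blast
  have "(1 + t\<^sup>2) ^ k * cmod (leibniz n E D t) \<le> (2 ^ n * b) * B"
    if B: "\<And>i. i \<le> n \<Longrightarrow> (1 + t\<^sup>2) ^ (k + j) * cmod (D i t) \<le> B" for D B t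
  proof -
    have w: "(1 + t\<^sup>2) ^ m > 0" for m by (smt (verit) weight_ge_1)
    have "cmod (leibniz n E D t) \<le> 2 ^ n * ((b * (1 + t\<^sup>2) ^ j) * (B / (1 + t\<^sup>2) ^ (k + j)))"
      using b B w by (intro leibniz_le) (auto simp: field_simps)
    then have "(1 + t\<^sup>2) ^ k * cmod (leibniz n E D t) \<le>
        (1 + t\<^sup>2) ^ k * (2 ^ n * ((b * (1 + t\<^sup>2) ^ j) * (B / (1 + t\<^sup>2) ^ (k + j))))"
      by (intro mult_left_mono) auto
    also have "\<dots> = (2 ^ n * b) * B"
    proof -
      have "1 + t\<^sup>2 \<noteq> 0" by (metis add_pos_nonneg less_irrefl zero_le_power2 zero_less_one)
      then show ?thesis by (simp add: power_add)
    qed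
    finally show ?thesis .
  qed
  then show ?thesis using b(1) by (intro exI[of _ "2 ^ n * b"] exI[of _ j]) auto
qed

lemma schwartz_mult_slow:
  assumes "deriv_seq E" "slow E" "f \<in> schwartz"
  shows "(\<lambda>t. E 0 t * f t) \<in> schwartz"
proof -
  let ?D = "\<lambda>n. leibniz n E (\<lambda>n. nth_deriv n f)"
  have "rapid ?D"
    unfolding rapid_def
  proof (intro allI)
    fix k n
    obtain K j where K: "\<And>D B t. (\<forall>i\<le>n. (1 + t\<^sup>2) ^ (k + j) * cmod (D i t) \<le> B) \<Longrightarrow>
     (1 + t\<^sup>2) ^ k * cmod (leibniz n E D t) \<le> K * B" using slow_leibniz_bound[OF assms(2), of n k] by auto
    have "\<exists>B. \<forall>t\<in>UNIV. (1 + t\<^sup>2) ^ (k + j) * cmod (nth_deriv i f t) \<le> B" for i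
      using schwartz_rapid[OF assms(3)] unfolding rapid_def by auto
    from finite_upto_bound[OF this] obtain B
      where "\<And>i t. i \<le> n \<Longrightarrow> t \<in> UNIV \<Longrightarrow> (1 + t\<^sup>2) ^ (k + j) * cmod (nth_deriv i f t) \<le> B"
      by meson
    then show "\<exists>B. \<forall>t. (1 + t\<^sup>2) ^ k * cmod (?D n t) \<le> B"
      by (intro exI[of _ "K * B"] allI K) auto
  qed
  from schwartzI[OF deriv_seq_leibniz[OF assms(1) schwartz_deriv_seq[OF assms(3)]] this]
  have "leibniz 0 E (\<lambda>n. nth_deriv n f) \<in> schwartz" .
  moreover have "leibniz 0 E (\<lambda>n. nth_deriv n f) = (\<lambda>t. E 0 t * f t)" by auto
  ultimately show ?thesis by simp
qed

lemma schwartz_norm_mult_slow: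
  assumes "deriv_seq E" "slow E"
  shows "\<exists>K M. 0 \<le> K \<and> (\<forall>f\<in>schwartz. schwartz_norm N (\<lambda>t. E 0 t * f t) \<le> K * schwartz_norm M f)"
proof -
  obtain K j where K: "\<And>n. 0 \<le> K n" "\<And>n D B t. (\<forall>i\<le>n. (1 + t\<^sup>2) ^ (N + j n) * cmod (D i t) \<le> B) \<Longrightarrow>
     (1 + t\<^sup>2) ^ N * cmod (leibniz n E D t) \<le> K n * B" using slow_leibniz_bound[OF assms(2), of _ N] by metis
  \<comment> \<open>The sum is a common bound for the finitely many exponents \<open>j n\<close>;
    \<open>M\<close> is twice \<open>J\<close> because \<open>schwartz_weight_le\<close> asks for
    twice the exponent of the weight.\<close>
  define J where "J = N + (\<Sum>n\<le>N. j n)"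
  define M where "M = 2 * J"
  define C where "C = (\<Sum>n\<le>N. K n) * 2 ^ (J + 1)"
  show ?thesis
  proof (intro exI[of _ "(real N + 1)\<^sup>2 * C"] exI[of _ M] conjI ballI)
    show "0 \<le> (real N + 1)\<^sup>2 * C" unfolding C_def by (intro mult_nonneg_nonneg sum_nonneg K) auto
    fix f assume f: "f \<in> schwartz"
    have "(1 + t\<^sup>2) ^ N * cmod (leibniz n E (\<lambda>n. nth_deriv n f) t) \<le> C * schwartz_norm M f" if n: "n \<le> N" for n t
    proof -
      have jJ: "N + j n \<le> J" unfolding J_def using n by (auto intro: member_le_sum)
      have "(1 + t\<^sup>2) ^ N * cmod (leibniz n E (\<lambda>n. nth_deriv n f) t) \<le> K n * (2 ^ (J + 1) * schwartz_norm M f)"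
      proof (intro K(2) allI impI)
        fix i assume "i \<le> n"
        then have "(1 + t\<^sup>2) ^ J * cmod (nth_deriv i f t) \<le> 2 ^ (J + 1) * schwartz_norm M f"
          using n jJ by (intro schwartz_weight_le[OF f]) (auto simp: M_def J_def)
        moreover have "(1 + t\<^sup>2) ^ (N + j n) * cmod (nth_deriv i f t) \<le> (1 + t\<^sup>2) ^ J * cmod (nth_deriv i f t)"
          using jJ by (intro mult_right_mono power_increasing) auto
        ultimately show "(1 + t\<^sup>2) ^ (N + j n) * cmod (nth_deriv i f t) \<le> 2 ^ (J + 1) * schwartz_norm M f"
          by linarith
      qed
      also have "\<dots> \<le> (\<Sum>n\<le>N. K n) * (2 ^ (J + 1) * schwartz_norm M f)"
        using n by (intro mult_right_mono member_le_sum K mult_nonneg_nonneg schwartz_norm_nonneg f) auto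
      finally show ?thesis by (simp add: C_def mult.assoc)
    qed
    from schwartz_norm_le[OF deriv_seq_leibniz[OF assms(1) schwartz_deriv_seq[OF f]] this]
    have "schwartz_norm N (leibniz 0 E (\<lambda>n. nth_deriv n f)) \<le> (real N + 1)\<^sup>2 * C * schwartz_norm M f"
      by (simp only: mult.assoc)
    moreover have "leibniz 0 E (\<lambda>n. nth_deriv n f) = (\<lambda>t. E 0 t * f t)" by auto
    ultimately show "schwartz_norm N (\<lambda>t. E 0 t * f t) \<le> (real N + 1)\<^sup>2 * C * schwartz_norm M f"
      by (simp only: mult.assoc)
  qed
qed

section \<open>Operators on Schwartz functions\<close>

lemma deriv_seq_eqI: "deriv_seq D \<Longrightarrow> f = D 0 \<Longrightarrow> nth_deriv n f = D n"
  by (simp add: nth_deriv_deriv_seq)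

lemma schwartz_add:
  assumes "f \<in> schwartz" "h \<in> schwartz"
  shows "(\<lambda>t. f t + h t) \<in> schwartz"
proof -
  let ?D = "\<lambda>n t. nth_deriv n f t + nth_deriv n h t"
  have "deriv_seq ?D"
    using assms[THEN schwartz_deriv_seq] unfolding deriv_seq_def by (intro allI has_vector_derivative_add) auto
  moreover have "rapid ?D"
    unfolding rapid_def
  proof (intro allI)
    fix k n
    obtain B C where B: "\<And>t. (1 + t\<^sup>2) ^ k * cmod (nth_deriv n f t) \<le> B"
      and C: "\<And>t. (1 + t\<^sup>2) ^ k * cmod (nth_deriv n h t) \<le> C"
      using assms[THEN schwartz_rapid] unfolding rapid_def by metis
    have "(1 + t\<^sup>2) ^ k * cmod (nth_deriv n f t + nth_deriv n h t) \<le> B + C" for t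
    proof -
      have "(1 + t\<^sup>2) ^ k * cmod (nth_deriv n f t + nth_deriv n h t) \<le>
         (1 + t\<^sup>2) ^ k * (cmod (nth_deriv n f t) + cmod (nth_deriv n h t))"
        by (intro mult_left_mono norm_triangle_ineq) simp
      with B[of t] C[of t] show ?thesis by (simp add: distrib_left)
    qed
    then show "\<exists>B. \<forall>t. (1 + t\<^sup>2) ^ k * cmod (nth_deriv n f t + nth_deriv n h t) \<le> B" by blast
  qed
  ultimately show ?thesis using schwartzI[of ?D] by simp
qed

lemma deriv_seq_const: "deriv_seq (\<lambda>n t. if n = 0 then k else 0)"
  by (auto simp: deriv_seq_def)

lemma slow_const: "slow (\<lambda>n t. if n = 0 then k else 0)"
  unfolding slow_def by (intro allI exI[of _ "cmod k"] exI[of _ 0]) simp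

lemma schwartz_cmult: "f \<in> schwartz \<Longrightarrow> (\<lambda>t. k * f t) \<in> schwartz"
  using schwartz_mult_slow[OF deriv_seq_const slow_const, of f k] by simp

lemma schwartz_cmult_iff: "k \<noteq> 0 \<Longrightarrow> (\<lambda>t. k * f t) \<in> schwartz \<longleftrightarrow> f \<in> schwartz"
  using schwartz_cmult[of f k] schwartz_cmult[of "\<lambda>t. k * f t" "inverse k"] by (auto simp: mult.assoc[symmetric])

lemma schwartz_diff: "f \<in> schwartz \<Longrightarrow> h \<in> schwartz \<Longrightarrow> (\<lambda>t. f t - h t) \<in> schwartz"
  using schwartz_add[of f "\<lambda>t. - 1 * h t"] schwartz_cmult[of h "- 1"] by simp

lemma schwartz_zero: "(\<lambda>t. 0) \<in> schwartz"
proof -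
  have "(\<lambda>n t. 0) 0 \<in> schwartz"
    by (rule schwartzI) (auto simp: deriv_seq_def rapid_def)
  then show ?thesis by simp
qed

section \<open>Continuous operators on the Schwartz space: multipliers, shifts, reflection\<close>

definition continuous_op :: "((real \<Rightarrow> complex) \<Rightarrow> real \<Rightarrow> complex) \<Rightarrow> bool" where
  "continuous_op L \<longleftrightarrow> (\<forall>\<phi>\<in>schwartz. L \<phi> \<in> schwartz) \<and>
     (\<forall>N. \<exists>K M. 0 \<le> K \<and> (\<forall>\<phi>\<in>schwartz. schwartz_norm N (L \<phi>) \<le> K * schwartz_norm M \<phi>))"

lemma continuous_op_mult:
  assumes "deriv_seq E" "slow E" "L = (\<lambda>\<phi> t. E 0 t * \<phi> t)"
  shows "continuous_op L"
  unfolding continuous_op_def assms(3)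
  using schwartz_mult_slow[OF assms(1,2)] schwartz_norm_mult_slow[OF assms(1,2)] by blast

definition cis_seq :: "real \<Rightarrow> nat \<Rightarrow> real \<Rightarrow> complex" where
  "cis_seq s n t = (2 * pi * \<i> * s) ^ n * cis (2 * pi * s * t)"

lemma deriv_seq_cis: "deriv_seq (cis_seq s)"
  unfolding deriv_seq_def
proof (intro allI)
  fix n t
  have "((\<lambda>z. (2 * pi * \<i> * s) ^ n * exp (2 * pi * \<i> * s * z)) has_field_derivative
      (2 * pi * \<i> * s) ^ n * (exp (2 * pi * \<i> * s * of_real t) * (2 * pi * \<i> * s))) (at (of_real t))"
    by (auto intro!: derivative_eq_intros)
  from has_vector_derivative_real_field[OF this]
  show "(cis_seq s n has_vector_derivative cis_seq s (Suc n) t) (at t)"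
    by (simp add: cis_seq_def[abs_def] cis_conv_exp mult_ac)
qed

lemma norm_cis_seq: "cmod (cis_seq s n t) = (2 * pi * \<bar>s\<bar>) ^ n"
  by (simp add: cis_seq_def norm_mult norm_power)

lemma slow_cis: "slow (cis_seq s)"
  unfolding slow_def
proof
  fix n
  show "\<exists>B k. \<forall>t. cmod (cis_seq s n t) \<le> B * (1 + t\<^sup>2) ^ k"
    by (intro exI[of _ "(2 * pi * \<bar>s\<bar>) ^ n"] exI[of _ 0]) (simp add: norm_cis_seq)
qed

text \<open>The successive derivatives of \<open>exp (c t\<^sup>2)\<close> are polynomial multiples of it.\<close>

primrec gauss_poly :: "complex \<Rightarrow> nat \<Rightarrow> complex poly" where
  "gauss_poly c 0 = 1"
| "gauss_poly c (Suc n) = pderiv (gauss_poly c n) + [:0, 2 * c:] * gauss_poly c n"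

definition gauss_seq :: "complex \<Rightarrow> nat \<Rightarrow> real \<Rightarrow> complex" where
  "gauss_seq c n t = poly (gauss_poly c n) (of_real t) * exp (c * (of_real t)\<^sup>2)"

lemma deriv_seq_gauss: "deriv_seq (gauss_seq c)"
  unfolding deriv_seq_def
proof (intro allI)
  fix n t
  have "((\<lambda>z. poly (gauss_poly c n) z * exp (c * z\<^sup>2)) has_field_derivative
      poly (gauss_poly c n) (of_real t) * (exp (c * (of_real t)\<^sup>2) * (c * (2 * of_real t))) +
      poly (pderiv (gauss_poly c n)) (of_real t) * exp (c * (of_real t)\<^sup>2)) (at (of_real t))"
    by (auto intro!: derivative_eq_intros poly_DERIV)
  from has_vector_derivative_real_field[OF this]
  show "(gauss_seq c n has_vector_derivative gauss_seq c (Suc n) t) (at t)"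
    by (simp add: gauss_seq_def[abs_def] algebra_simps)
qed

lemma poly_slow: "\<exists>B k. 0 \<le> B \<and> (\<forall>t::real. cmod (poly q (of_real t)) \<le> B * (1 + t\<^sup>2) ^ k)"
proof (induction q)
  case 0
  then show ?case by (auto intro!: exI[of _ 0])
next
  case (pCons a q)
  then obtain B k where Bk: "0 \<le> B" "\<And>t::real. cmod (poly q (of_real t)) \<le> B * (1 + t\<^sup>2) ^ k" by blast
  have "cmod (poly (pCons a q) (of_real t)) \<le> (cmod a + B) * (1 + t\<^sup>2) ^ Suc k" for t :: real
  proof -
    have "cmod (poly (pCons a q) (of_real t)) \<le> cmod a + \<bar>t\<bar> * cmod (poly q (of_real t))"
      using norm_triangle_ineq[of a "of_real t * poly q (of_real t)"] by (simp add: norm_mult)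
    also have "\<dots> \<le> cmod a * (1 + t\<^sup>2) ^ Suc k + (1 + t\<^sup>2) * (B * (1 + t\<^sup>2) ^ k)"
    proof (intro add_mono mult_mono Bk)
      show "cmod a \<le> cmod a * (1 + t\<^sup>2) ^ Suc k" using weight_ge_1[of t "Suc k"]
        by (metis mult.right_neutral mult_left_mono norm_ge_zero)
      show "\<bar>t\<bar> \<le> 1 + t\<^sup>2" using abs_power_le_weight[of t 1] by simp
    qed auto
    finally show ?thesis by (simp add: algebra_simps)
  qed
  then show ?case using Bk(1) by (intro exI[of _ "cmod a + B"] exI[of _ "Suc k"]) auto
qed

text \<open>The closed half-plane contains the imaginary axis, so chirps are covered; the decay of
  real Gaussians is the subject of \<open>schwartz_gauss\<close>.\<close>

lemma slow_gauss: "Re c \<le> 0 \<Longrightarrow> slow (gauss_seq c)"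
  unfolding slow_def
proof
  fix n assume c: "Re c \<le> 0"
  obtain B k where Bk: "0 \<le> B" "\<And>t::real. cmod (poly (gauss_poly c n) (of_real t)) \<le> B * (1 + t\<^sup>2) ^ k"
    using poly_slow by blast
  have "cmod (gauss_seq c n t) \<le> B * (1 + t\<^sup>2) ^ k" for t
  proof -
    have "cmod (exp (c * (of_real t)\<^sup>2)) \<le> 1"
      using c by (simp add: norm_exp_eq_Re mult_nonpos_nonneg flip: of_real_power)
    then have "cmod (gauss_seq c n t) \<le> cmod (poly (gauss_poly c n) (of_real t)) * 1"
      unfolding gauss_seq_def norm_mult by (intro mult_left_mono) auto
    with Bk(2)[of t] show ?thesis by simp
  qed
  then show "\<exists>B k. \<forall>t. cmod (gauss_seq c n t) \<le> B * (1 + t\<^sup>2) ^ k" by blast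
qed

text \<open>Rests on \<open>(1 + a * x / k) ^ k \<le> exp (a * x)\<close>, which gives the explicit
  bound \<open>(k / a) ^ k\<close>.\<close>

lemma power_mult_exp_le:
  assumes "0 < a"
  shows "\<exists>C. \<forall>x\<ge>0. x ^ k * exp (- a * x) \<le> (C::real)"
proof (cases "k = 0")
  case True
  then show ?thesis using assms by (intro exI[of _ 1]) auto
next
  case False
  have "x ^ k * exp (- a * x) \<le> (k / a) ^ k" if "0 \<le> x" for x
  proof -
    have "(a * x / k) ^ k \<le> (1 + a * x / k) ^ k"
      using that assms by (intro power_mono) auto
    also have "\<dots> \<le> exp (a * x)"
      using False that assms by (intro exp_ge_one_plus_x_over_n_power_n) (auto intro: order_trans[of _ 0])
    finally have "(a * x / k) ^ k * exp (- a * x) \<le> exp (a * x) * exp (- a * x)"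
      by (rule mult_right_mono) simp
    also have "\<dots> = 1" by (simp flip: exp_add)
    finally have "(a * x / k) ^ k * exp (- a * x) \<le> 1" .
    moreover have "x ^ k * exp (- a * x) = (k / a) ^ k * ((a * x / k) ^ k * exp (- a * x))"
      using assms False by (simp add: power_mult_distrib[symmetric] mult.assoc[symmetric])
    ultimately show ?thesis using assms
      by (metis divide_nonneg_pos mult.right_neutral mult_left_mono of_nat_0_le_iff zero_le_power)
  qed
  then show ?thesis by blast
qed

lemma schwartz_gauss:
  assumes "0 < a"
  shows "(\<lambda>t. of_real (exp (- a * t\<^sup>2))) \<in> schwartz"
proof -
  define c where "c = complex_of_real (- a)"
  have "rapid (gauss_seq c)"
    unfolding rapid_def
  proof (intro allI)
    fix k n
    obtain B j where B: "0 \<le> B" "\<And>t::real. cmod (poly (gauss_poly c n) (of_real t)) \<le> B * (1 + t\<^sup>2) ^ j"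
      using poly_slow by blast
    obtain C where C: "\<And>x. 0 \<le> x \<Longrightarrow> x ^ (k + j) * exp (- a * x) \<le> C"
      using power_mult_exp_le[OF assms, of "k + j"] by blast
    have "(1 + t\<^sup>2) ^ k * cmod (gauss_seq c n t) \<le> B * (exp a * C)" for t
    proof -
      have "cmod (exp (c * (of_real t)\<^sup>2)) = exp (- a * t\<^sup>2)"
        by (simp add: c_def norm_exp_eq_Re flip: of_real_power)
      then have "(1 + t\<^sup>2) ^ k * cmod (gauss_seq c n t) =
          (1 + t\<^sup>2) ^ k * (cmod (poly (gauss_poly c n) (of_real t)) * exp (- a * t\<^sup>2))"
        by (simp add: gauss_seq_def norm_mult)
      also have "\<dots> \<le> (1 + t\<^sup>2) ^ k * ((B * (1 + t\<^sup>2) ^ j) * exp (- a * t\<^sup>2))"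
        by (intro mult_left_mono mult_right_mono B) auto
      \<comment> \<open>The factor \<open>exp a\<close> changes \<open>t\<^sup>2\<close> into
        \<open>1 + t\<^sup>2\<close> in the exponent, so that the bound by \<open>C\<close> applies
        at the point \<open>1 + t\<^sup>2\<close>.\<close>
      also have "\<dots> = B * (exp a * ((1 + t\<^sup>2) ^ (k + j) * exp (- a * (1 + t\<^sup>2))))"
        by (simp add: power_add exp_diff field_simps exp_minus exp_add)
      also have "\<dots> \<le> B * (exp a * C)"
        by (intro mult_left_mono C B) auto
      finally show ?thesis .
    qed
    then show "\<exists>B. \<forall>t. (1 + t\<^sup>2) ^ k * cmod (gauss_seq c n t) \<le> B" by blast
  qed
  from schwartzI[OF deriv_seq_gauss this] have "gauss_seq c 0 \<in> schwartz" .
  moreover have "gauss_seq c 0 = (\<lambda>t. of_real (exp (- a * t\<^sup>2)))"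
    by (simp add: gauss_seq_def fun_eq_iff c_def flip: exp_of_real)
  ultimately show ?thesis by simp
qed

lemma continuous_op_modul: "continuous_op (modul s)"
  by (rule continuous_op_mult[OF deriv_seq_cis[of s] slow_cis])
     (simp add: modul_def[abs_def] cis_seq_def)

lemma continuous_op_chirp: "continuous_op (chirp s)"
  by (rule continuous_op_mult[OF deriv_seq_gauss[of "\<i> * pi * s"] slow_gauss])
     (auto simp: chirp_def[abs_def] gauss_seq_def cis_conv_exp mult_ac)

text \<open>Peetre's inequality: the weight is submultiplicative up to a factor 2, so a shift costs
  only a power of the weight of the shift.\<close>

lemma peetre: "1 + (x + y)\<^sup>2 \<le> 2 * (1 + x\<^sup>2) * (1 + (y::real)\<^sup>2)"
proof -
  have "2 * (1 + x\<^sup>2) * (1 + y\<^sup>2) - (1 + (x + y)\<^sup>2) = 1 + (x - y)\<^sup>2 + 2 * x\<^sup>2 * y\<^sup>2"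
    by (simp add: power2_eq_square algebra_simps)
  also have "\<dots> \<ge> 0" by simp
  finally show ?thesis by linarith
qed

lemma weight_shift: "(1 + t\<^sup>2) ^ k \<le> (2 * (1 + s\<^sup>2)) ^ k * (1 + (t - s)\<^sup>2) ^ k" for t s :: real
proof -
  have "(1 + t\<^sup>2) ^ k \<le> (2 * (1 + s\<^sup>2) * (1 + (t - s)\<^sup>2)) ^ k"
    using peetre[of s "t - s"] by (intro power_mono) (auto simp: algebra_simps)
  then show ?thesis by (simp add: power_mult_distrib)
qed

lemma deriv_seq_translate: "deriv_seq D \<Longrightarrow> deriv_seq (\<lambda>n t. D n (t - s))"
  unfolding deriv_seq_def
proof (intro allI)
  fix n t assume *: "\<forall>n t. (D n has_vector_derivative D (Suc n) t) (at t)"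
  have "((\<lambda>t. t - s) has_vector_derivative 1) (at t)"
    by (auto intro!: derivative_eq_intros)
  from vector_diff_chain_at[OF this, of "D n" "D (Suc n) (t - s)"] *
  show "((\<lambda>t. D n (t - s)) has_vector_derivative D (Suc n) (t - s)) (at t)"
    by (simp add: o_def)
qed

lemma deriv_seq_reflect: "deriv_seq D \<Longrightarrow> deriv_seq (\<lambda>n t. (- 1) ^ n * D n (- t))"
  unfolding deriv_seq_def
proof (intro allI)
  fix n t assume *: "\<forall>n t. (D n has_vector_derivative D (Suc n) t) (at t)"
  have "((\<lambda>t. - t :: real) has_vector_derivative - 1) (at t)"
    by (auto intro!: derivative_eq_intros)
  from vector_diff_chain_at[OF this, of "D n" "D (Suc n) (- t)"] *
  have "((\<lambda>t. D n (- t)) has_vector_derivative - D (Suc n) (- t)) (at t)"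
    by (simp add: o_def)
  from has_vector_derivative_mult_right[OF this, of "(- 1) ^ n"]
  show "((\<lambda>t. (- 1) ^ n * D n (- t)) has_vector_derivative (- 1) ^ Suc n * D (Suc n) (- t)) (at t)"
    by simp
qed

text \<open>Meant for operators that move the argument: each value of the image is compared with a
  value at some other point \<open>u\<close>. The point may depend on all the data, the constant
  \<open>C\<close> only on \<open>k\<close>.\<close>

lemma continuous_opI:
  assumes "\<And>\<phi>. \<phi> \<in> schwartz \<Longrightarrow> deriv_seq (D \<phi>) \<and> D \<phi> 0 = L \<phi>"
    and "\<And>k. \<exists>C. \<forall>\<phi>\<in>schwartz. \<forall>n t. \<exists>u. (1 + t\<^sup>2) ^ k * cmod (D \<phi> n t) \<le> C * ((1 + u\<^sup>2) ^ k * cmod (nth_deriv n \<phi> u))"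
  shows "continuous_op L"
  unfolding continuous_op_def
proof (intro conjI ballI allI)
  obtain C where C: "\<And>k \<phi> n t. \<phi> \<in> schwartz \<Longrightarrow>
    \<exists>u. (1 + t\<^sup>2) ^ k * cmod (D \<phi> n t) \<le> C k * ((1 + u\<^sup>2) ^ k * cmod (nth_deriv n \<phi> u))"
    using assms(2) by metis
  have le: "(1 + t\<^sup>2) ^ k * cmod (D \<phi> n t) \<le> \<bar>C k\<bar> * B"
    if \<phi>: "\<phi> \<in> schwartz" and B: "\<And>u. (1 + u\<^sup>2) ^ k * cmod (nth_deriv n \<phi> u) \<le> B" for \<phi> k n t B
  proof -
    obtain u where "(1 + t\<^sup>2) ^ k * cmod (D \<phi> n t) \<le> C k * ((1 + u\<^sup>2) ^ k * cmod (nth_deriv n \<phi> u))"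
      using C[OF \<phi>] by blast
    also have "\<dots> \<le> \<bar>C k\<bar> * B" using B[of u] by (intro mult_mono) auto
    finally show ?thesis .
  qed
  {
    fix \<phi> assume \<phi>: "\<phi> \<in> schwartz"
    have "rapid (D \<phi>)"
      unfolding rapid_def
    proof (intro allI)
      fix k n
      obtain B where "\<And>u. (1 + u\<^sup>2) ^ k * cmod (nth_deriv n \<phi> u) \<le> B"
        using schwartz_rapid[OF \<phi>] unfolding rapid_def by blast
      from le[OF \<phi> this] show "\<exists>B. \<forall>t. (1 + t\<^sup>2) ^ k * cmod (D \<phi> n t) \<le> B" by blast
    qed
    with assms(1)[OF \<phi>] show "L \<phi> \<in> schwartz" using schwartzI by metis
  }
  fix N
  show "\<exists>K M. 0 \<le> K \<and> (\<forall>\<phi>\<in>schwartz. schwartz_norm N (L \<phi>) \<le> K * schwartz_norm M \<phi>)"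
  proof (intro exI[of _ "(real N + 1)\<^sup>2 * (\<bar>C N\<bar> * 2 ^ (N + 1))"] exI[of _ "2 * N"] conjI ballI)
    fix \<phi> assume \<phi>: "\<phi> \<in> schwartz"
    have "(1 + t\<^sup>2) ^ N * cmod (D \<phi> n t) \<le> \<bar>C N\<bar> * (2 ^ (N + 1) * schwartz_norm (2 * N) \<phi>)" if "n \<le> N" for n t
      using that by (intro le \<phi> schwartz_weight_le) auto
    from schwartz_norm_le[of "D \<phi>", OF _ this] assms(1)[OF \<phi>]
    show "schwartz_norm N (L \<phi>) \<le> (real N + 1)\<^sup>2 * (\<bar>C N\<bar> * 2 ^ (N + 1)) * schwartz_norm (2 * N) \<phi>"
      by (simp only: mult.assoc)
  qed auto
qed

lemma continuous_op_translate: "continuous_op (translate s)"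
proof (rule continuous_opI)
  fix \<phi> assume "\<phi> \<in> schwartz"
  then show "deriv_seq (\<lambda>n t. nth_deriv n \<phi> (t - s)) \<and> (\<lambda>t. nth_deriv 0 \<phi> (t - s)) = translate s \<phi>"
    by (auto simp: translate_def[abs_def] intro!: deriv_seq_translate schwartz_deriv_seq)
next
  fix k
  show "\<exists>C. \<forall>\<phi>\<in>schwartz. \<forall>n t. \<exists>u. (1 + t\<^sup>2) ^ k * cmod (nth_deriv n \<phi> (t - s)) \<le>
     C * ((1 + u\<^sup>2) ^ k * cmod (nth_deriv n \<phi> u))"
  proof (intro exI ballI allI)
    fix \<phi> :: "real \<Rightarrow> complex" and n t
    show "(1 + t\<^sup>2) ^ k * cmod (nth_deriv n \<phi> (t - s)) \<le>
     (2 * (1 + s\<^sup>2)) ^ k * ((1 + (t - s)\<^sup>2) ^ k * cmod (nth_deriv n \<phi> (t - s)))"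
      unfolding mult.assoc[symmetric] by (intro mult_right_mono weight_shift) auto
  qed
qed

lemma continuous_op_reflect: "continuous_op reflect"
proof (rule continuous_opI)
  fix \<phi> assume "\<phi> \<in> schwartz"
  then show "deriv_seq (\<lambda>n t. (- 1) ^ n * nth_deriv n \<phi> (- t)) \<and> (\<lambda>t. (- 1) ^ 0 * nth_deriv 0 \<phi> (- t)) = reflect \<phi>"
    using deriv_seq_reflect[OF schwartz_deriv_seq[of \<phi>]] by (auto simp: reflect_def[abs_def])
next
  fix k
  show "\<exists>C. \<forall>\<phi>\<in>schwartz. \<forall>n t. \<exists>u. (1 + t\<^sup>2) ^ k * cmod ((- 1) ^ n * nth_deriv n \<phi> (- t)) \<le>
     C * ((1 + u\<^sup>2) ^ k * cmod (nth_deriv n \<phi> u))"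
  proof (rule exI[of _ 1], intro ballI allI)
    fix \<phi> :: "real \<Rightarrow> complex" and n t
    show "\<exists>u. (1 + t\<^sup>2) ^ k * cmod ((- 1) ^ n * nth_deriv n \<phi> (- t)) \<le> 1 * ((1 + u\<^sup>2) ^ k * cmod (nth_deriv n \<phi> u))"
      by (rule exI[of _ "- t"]) (simp add: norm_mult norm_power)
  qed
qed

lemma translate_translate [simp]: "translate s (translate r f) = translate (s + r) f"
  by (auto simp: translate_def fun_eq_iff algebra_simps)

lemma translate_0 [simp]: "translate 0 f = f"
  by (auto simp: translate_def)

lemma modul_modul [simp]: "modul s (modul r f) = modul (s + r) f"
  by (simp add: modul_def fun_eq_iff cis_mult distrib_right distrib_left mult.assoc[symmetric])

lemma modul_0 [simp]: "modul 0 f = f"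
  by (auto simp: modul_def)

lemma chirp_chirp [simp]: "chirp s (chirp r f) = chirp (s + r) f"
  by (simp add: chirp_def fun_eq_iff cis_mult distrib_right distrib_left mult.assoc[symmetric])

lemma chirp_0 [simp]: "chirp 0 f = f"
  by (auto simp: chirp_def)

lemma reflect_reflect [simp]: "reflect (reflect f) = f"
  by (auto simp: reflect_def)

lemma schwartz_ops:
  assumes "f \<in> schwartz"
  shows "translate s f \<in> schwartz" "modul s f \<in> schwartz" "chirp s f \<in> schwartz" "reflect f \<in> schwartz"
  using assms continuous_op_translate continuous_op_modul continuous_op_chirp continuous_op_reflect
  unfolding continuous_op_def by auto

lemma schwartz_ops_iff [simp]:
  "translate s f \<in> schwartz \<longleftrightarrow> f \<in> schwartz"
  "modul s f \<in> schwartz \<longleftrightarrow> f \<in> schwartz"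
  "chirp s f \<in> schwartz \<longleftrightarrow> f \<in> schwartz"
  "reflect f \<in> schwartz \<longleftrightarrow> f \<in> schwartz"
  using schwartz_ops(1)[of "translate s f" "- s"] schwartz_ops(2)[of "modul s f" "- s"]
    schwartz_ops(3)[of "chirp s f" "- s"] schwartz_ops(4)[of "reflect f"]
  by (auto intro: schwartz_ops)

lemma schwartz_mult:
  assumes "f \<in> schwartz" "h \<in> schwartz"
  shows "(\<lambda>t. f t * h t) \<in> schwartz"
proof -
  have "slow (\<lambda>n. nth_deriv n f)"
    unfolding slow_def
  proof
    fix n
    obtain B where "\<And>t. (1 + t\<^sup>2) ^ 0 * cmod (nth_deriv n f t) \<le> B"
      using schwartz_rapid[OF assms(1)] unfolding rapid_def by blast
    then show "\<exists>B k. \<forall>t. cmod (nth_deriv n f t) \<le> B * (1 + t\<^sup>2) ^ k"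
      by (intro exI[of _ B] exI[of _ 0]) auto
  qed
  from schwartz_mult_slow[OF schwartz_deriv_seq[OF assms(1)] this assms(2)] show ?thesis by simp
qed

lemma schwartz_cnj:
  assumes "f \<in> schwartz"
  shows "(\<lambda>t. cnj (f t)) \<in> schwartz"
proof -
  have "deriv_seq (\<lambda>n t. cnj (nth_deriv n f t))"
    using schwartz_deriv_seq[OF assms] unfolding deriv_seq_def by (auto intro: has_vector_derivative_cnj)
  moreover have "rapid (\<lambda>n t. cnj (nth_deriv n f t))"
    using schwartz_rapid[OF assms] unfolding rapid_def by simp
  ultimately show ?thesis using schwartzI by fastforce
qed

section \<open>Tempered distributions\<close>

lemma tempered_add: "\<Lambda> \<in> tempered \<Longrightarrow> \<phi> \<in> schwartz \<Longrightarrow> \<psi> \<in> schwartz \<Longrightarrow> \<Lambda> (\<lambda>t. \<phi> t + \<psi> t) = \<Lambda> \<phi> + \<Lambda> \<psi>"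
  by (simp add: tempered_def)

text \<open>Off the Schwartz space both sides vanish by convention: for \<open>k \<noteq> 0\<close>
  the multiple stays outside, and for \<open>k = 0\<close> it is the zero function, on which
  \<Lambda> is 0 by linearity. Phases can therefore be pulled out without side conditions.\<close>

lemma tempered_cmult: "\<Lambda> \<in> tempered \<Longrightarrow> \<Lambda> (\<lambda>t. k * \<phi> t) = k * \<Lambda> \<phi>"
proof (cases "\<phi> \<in> schwartz")
  case False
  assume \<Lambda>: "\<Lambda> \<in> tempered"
  show ?thesis
  proof (cases "k = 0")
    case True
    have "\<forall>\<phi>\<in>schwartz. \<forall>k. \<Lambda> (\<lambda>t. k * \<phi> t) = k * \<Lambda> \<phi>"
      using \<Lambda> unfolding tempered_def by blast
    from bspec[OF this schwartz_zero, THEN spec, of 0] show ?thesis using True by simp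
  next
    case kn: False
    then show ?thesis using False \<Lambda> schwartz_cmult_iff[OF kn, of \<phi>] by (simp add: tempered_def)
  qed
qed (simp add: tempered_def)

lemma tempered_outside: "\<Lambda> \<in> tempered \<Longrightarrow> \<phi> \<notin> schwartz \<Longrightarrow> \<Lambda> \<phi> = 0"
  by (simp add: tempered_def)

lemma tempered_diff:
  assumes "\<Lambda> \<in> tempered" "\<phi> \<in> schwartz" "\<psi> \<in> schwartz"
  shows "\<Lambda> (\<lambda>t. \<phi> t - \<psi> t) = \<Lambda> \<phi> - \<Lambda> \<psi>"
  using tempered_add[OF assms(1,2) schwartz_cmult[OF assms(3), of "- 1"]] tempered_cmult[OF assms(1), of "- 1" \<psi>]
  by simp

lemma tempered_bound:
  assumes "\<Lambda> \<in> tempered"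
  obtains K N where "0 \<le> K" "\<And>\<phi>. \<phi> \<in> schwartz \<Longrightarrow> cmod (\<Lambda> \<phi>) \<le> K * schwartz_norm N \<phi>"
proof -
  obtain K N where K: "\<And>\<phi>. \<phi> \<in> schwartz \<Longrightarrow> cmod (\<Lambda> \<phi>) \<le> K * schwartz_norm N \<phi>"
    using assms unfolding tempered_def by blast
  have "cmod (\<Lambda> \<phi>) \<le> \<bar>K\<bar> * schwartz_norm N \<phi>" if "\<phi> \<in> schwartz" for \<phi>
  proof -
    have "K * schwartz_norm N \<phi> \<le> \<bar>K\<bar> * schwartz_norm N \<phi>"
      by (intro mult_right_mono schwartz_norm_nonneg that) simp
    with K[OF that] show ?thesis by linarith
  qed
  with that[of "\<bar>K\<bar>" N] show ?thesis by simp
qed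

lemma temperedI:
  assumes "\<And>\<phi> \<psi>. \<phi> \<in> schwartz \<Longrightarrow> \<psi> \<in> schwartz \<Longrightarrow> \<Lambda> (\<lambda>t. \<phi> t + \<psi> t) = \<Lambda> \<phi> + \<Lambda> \<psi>"
    and "\<And>\<phi> k. \<phi> \<in> schwartz \<Longrightarrow> \<Lambda> (\<lambda>t. k * \<phi> t) = k * \<Lambda> \<phi>"
    and "\<And>\<phi>. \<phi> \<in> schwartz \<Longrightarrow> cmod (\<Lambda> \<phi>) \<le> K * schwartz_norm N \<phi>"
    and "\<And>\<phi>. \<phi> \<notin> schwartz \<Longrightarrow> \<Lambda> \<phi> = 0"
  shows "\<Lambda> \<in> tempered"
  unfolding tempered_def using assms by blast

text \<open>Continuity in the form in which it is applied below: derivatives are estimated along an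
  explicit sequence, with the largest weight only.\<close>

lemma tempered_bound_deriv_seq:
  assumes "\<Lambda> \<in> tempered"
  obtains K N where "0 \<le> K"
    "\<And>D B. deriv_seq D \<Longrightarrow> D 0 \<in> schwartz \<Longrightarrow> (\<And>n t. n \<le> N \<Longrightarrow> (1 + t\<^sup>2) ^ N * cmod (D n t) \<le> B) \<Longrightarrow> cmod (\<Lambda> (D 0)) \<le> K * B"
proof -
  obtain K N where K: "0 \<le> K" "\<And>\<phi>. \<phi> \<in> schwartz \<Longrightarrow> cmod (\<Lambda> \<phi>) \<le> K * schwartz_norm N \<phi>"
    using tempered_bound[OF assms] by blast
  show ?thesis
  proof (rule that[of "K * (real N + 1)\<^sup>2" N])
    show "0 \<le> K * (real N + 1)\<^sup>2" using K(1) by simp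
    fix D B
    assume D: "deriv_seq D" "D 0 \<in> schwartz" "\<And>n t. n \<le> N \<Longrightarrow> (1 + t\<^sup>2) ^ N * cmod (D n t) \<le> B"
    have "cmod (\<Lambda> (D 0)) \<le> K * schwartz_norm N (D 0)" by (rule K(2)[OF D(2)])
    also have "\<dots> \<le> K * ((real N + 1)\<^sup>2 * B)" by (intro mult_left_mono schwartz_norm_le D K)
    finally show "cmod (\<Lambda> (D 0)) \<le> K * (real N + 1)\<^sup>2 * B" by (simp only: mult.assoc)
  qed
qed

text \<open>That \<open>L\<close> maps nothing from outside the Schwartz space into it keeps the
  composite zero off its domain.\<close>

lemma tempered_compose:
  assumes \<Lambda>: "\<Lambda> \<in> tempered" and L: "continuous_op L" "\<And>\<phi>. L \<phi> \<in> schwartz \<Longrightarrow> \<phi> \<in> schwartz"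
    and "\<And>\<phi> \<psi>. L (\<lambda>t. \<phi> t + \<psi> t) = (\<lambda>t. L \<phi> t + L \<psi> t)" "\<And>k \<phi>. L (\<lambda>t. k * \<phi> t) = (\<lambda>t. k * L \<phi> t)"
  shows "(\<lambda>\<phi>. \<Lambda> (L \<phi>)) \<in> tempered"
proof -
  have LS: "L \<phi> \<in> schwartz" if "\<phi> \<in> schwartz" for \<phi> using L(1) that by (simp add: continuous_op_def)
  obtain K N where K: "0 \<le> K" "\<And>\<phi>. \<phi> \<in> schwartz \<Longrightarrow> cmod (\<Lambda> \<phi>) \<le> K * schwartz_norm N \<phi>"
    using tempered_bound[OF \<Lambda>] by blast
  obtain C M where C: "0 \<le> C" "\<And>\<phi>. \<phi> \<in> schwartz \<Longrightarrow> schwartz_norm N (L \<phi>) \<le> C * schwartz_norm M \<phi>"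
    using L(1) unfolding continuous_op_def by blast
  show ?thesis
  proof (rule temperedI[where K="K * C" and N=M])
    fix \<phi> assume \<phi>: "\<phi> \<in> schwartz"
    have "cmod (\<Lambda> (L \<phi>)) \<le> K * schwartz_norm N (L \<phi>)" by (rule K(2)[OF LS[OF \<phi>]])
    also have "\<dots> \<le> K * (C * schwartz_norm M \<phi>)" by (intro mult_left_mono C \<phi> K)
    finally show "cmod (\<Lambda> (L \<phi>)) \<le> K * C * schwartz_norm M \<phi>" by (simp only: mult.assoc)
  next
    fix \<phi> \<psi> assume "\<phi> \<in> schwartz" "\<psi> \<in> schwartz"
    then show "\<Lambda> (L (\<lambda>t. \<phi> t + \<psi> t)) = \<Lambda> (L \<phi>) + \<Lambda> (L \<psi>)"
      unfolding assms(4) by (intro tempered_add \<Lambda> LS)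
  next
    fix \<phi> k
    show "\<Lambda> (L (\<lambda>t. k * \<phi> t)) = k * \<Lambda> (L \<phi>)"
      unfolding assms(5) by (rule tempered_cmult[OF \<Lambda>])
  next
    fix \<phi> :: "real \<Rightarrow> complex" assume "\<phi> \<notin> schwartz"
    then show "\<Lambda> (L \<phi>) = 0" using L(2) tempered_outside[OF \<Lambda>] by blast
  qed
qed

lemma tempered_translate: "\<Lambda> \<in> tempered \<Longrightarrow> distr_translate s \<Lambda> \<in> tempered"
  unfolding distr_translate_def
  by (erule tempered_compose[OF _ continuous_op_translate]) (auto simp: translate_def)

lemma tempered_chirp: "\<Lambda> \<in> tempered \<Longrightarrow> distr_chirp s \<Lambda> \<in> tempered"
  unfolding distr_chirp_def
  by (erule tempered_compose[OF _ continuous_op_chirp]) (auto simp: chirp_def algebra_simps)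

lemma tempered_reflect: "\<Lambda> \<in> tempered \<Longrightarrow> distr_reflect \<Lambda> \<in> tempered"
  unfolding distr_reflect_def
  by (erule tempered_compose[OF _ continuous_op_reflect]) (auto simp: reflect_def)

lemma tempered_plus:
  assumes "\<Lambda> \<in> tempered" "\<Gamma> \<in> tempered"
  shows "(\<lambda>\<phi>. \<Lambda> \<phi> + \<Gamma> \<phi>) \<in> tempered"
proof -
  obtain K N where K: "0 \<le> K" "\<And>\<phi>. \<phi> \<in> schwartz \<Longrightarrow> cmod (\<Lambda> \<phi>) \<le> K * schwartz_norm N \<phi>"
    using tempered_bound[OF assms(1)] by blast
  obtain L M where L: "0 \<le> L" "\<And>\<phi>. \<phi> \<in> schwartz \<Longrightarrow> cmod (\<Gamma> \<phi>) \<le> L * schwartz_norm M \<phi>"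
    using tempered_bound[OF assms(2)] by blast
  show ?thesis
  proof (rule temperedI[where K="K + L" and N="max N M"])
    fix \<phi> assume \<phi>: "\<phi> \<in> schwartz"
    have "cmod (\<Lambda> \<phi> + \<Gamma> \<phi>) \<le> K * schwartz_norm N \<phi> + L * schwartz_norm M \<phi>"
      using norm_triangle_ineq[of "\<Lambda> \<phi>" "\<Gamma> \<phi>"] K(2)[OF \<phi>] L(2)[OF \<phi>] by linarith
    also have "\<dots> \<le> K * schwartz_norm (max N M) \<phi> + L * schwartz_norm (max N M) \<phi>"
      by (intro add_mono mult_left_mono schwartz_norm_mono \<phi> K L) auto
    finally show "cmod (\<Lambda> \<phi> + \<Gamma> \<phi>) \<le> (K + L) * schwartz_norm (max N M) \<phi>"
      by (simp only: distrib_right)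
  qed (simp_all add: assms tempered_add tempered_cmult tempered_outside algebra_simps)
qed

lemma tempered_scale:
  assumes "\<Lambda> \<in> tempered"
  shows "(\<lambda>\<phi>. k * \<Lambda> \<phi>) \<in> tempered"
proof -
  obtain K N where K: "0 \<le> K" "\<And>\<phi>. \<phi> \<in> schwartz \<Longrightarrow> cmod (\<Lambda> \<phi>) \<le> K * schwartz_norm N \<phi>"
    using tempered_bound[OF assms(1)] by blast
  show ?thesis
  proof (rule temperedI[where K="cmod k * K" and N=N])
    fix \<phi> assume \<phi>: "\<phi> \<in> schwartz"
    show "cmod (k * \<Lambda> \<phi>) \<le> cmod k * K * schwartz_norm N \<phi>"
      unfolding norm_mult mult.assoc by (intro mult_left_mono K \<phi>) auto
  qed (simp_all add: assms tempered_add tempered_cmult tempered_outside algebra_simps)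
qed

section \<open>Families of Schwartz functions\<close>

text \<open>\<open>D n w\<close> is the n-th derivative in the real variable at the parameter
  \<open>w\<close>. Joint continuity and uniform decay are asked; continuity in the Schwartz
  topology follows from them (\<open>schwartz_family_close\<close>).\<close>

definition schwartz_family :: "'w::metric_space set \<Rightarrow> (nat \<Rightarrow> 'w \<Rightarrow> real \<Rightarrow> complex) \<Rightarrow> bool" where
  "schwartz_family W D \<longleftrightarrow> (\<forall>n. continuous_on (W \<times> UNIV) (\<lambda>(w, t). D n w t)) \<and>
     (\<forall>w\<in>W. deriv_seq (\<lambda>n. D n w)) \<and>
     (\<forall>k n. \<exists>B. \<forall>w\<in>W. \<forall>t. (1 + t\<^sup>2) ^ k * cmod (D n w t) \<le> B)"

lemma schwartz_familyD:
  assumes "schwartz_family W D"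
  shows "continuous_on (W \<times> UNIV) (\<lambda>(w, t). D n w t)"
    and "w \<in> W \<Longrightarrow> deriv_seq (\<lambda>n. D n w)"
    and "w \<in> W \<Longrightarrow> D 0 w \<in> schwartz"
    and "\<exists>B. \<forall>w\<in>W. \<forall>t. (1 + t\<^sup>2) ^ k * cmod (D n w t) \<le> B"
proof -
  show "D 0 w \<in> schwartz" if "w \<in> W"
  proof (rule schwartzI)
    show "deriv_seq (\<lambda>n. D n w)" using assms that by (simp add: schwartz_family_def)
    show "rapid (\<lambda>n. D n w)" using assms that unfolding schwartz_family_def rapid_def by metis
  qed
qed (use assms in \<open>auto simp: schwartz_family_def\<close>)

lemma schwartz_family_subset: "schwartz_family W D \<Longrightarrow> V \<subseteq> W \<Longrightarrow> schwartz_family V D"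
  unfolding schwartz_family_def by (blast intro: continuous_on_subset Sigma_mono)

lemma schwartz_family_continuous_param:
  assumes "schwartz_family W D"
  shows "continuous_on W (\<lambda>w. D n w t)"
proof -
  have "continuous_on W (\<lambda>w. (\<lambda>(w, t). D n w t) (w, t))"
    by (rule continuous_on_compose2[OF schwartz_familyD(1)[OF assms, of n]]) (auto intro!: continuous_intros)
  then show ?thesis by simp
qed

lemma deriv_seq_diff:
  assumes "deriv_seq D" "deriv_seq E"
  shows "deriv_seq (\<lambda>n t. D n t - E n t)"
  using assms unfolding deriv_seq_def by (intro allI has_vector_derivative_diff) auto

lemma deriv_seq_cmult:
  assumes "deriv_seq D"
  shows "deriv_seq (\<lambda>n t. k * D n t)"
  using assms unfolding deriv_seq_def by (intro allI has_vector_derivative_mult_right) auto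

lemma inverse_weight_small:
  assumes "0 < e"
  obtains R :: real where "0 < R" "\<And>t. R < \<bar>t\<bar> \<Longrightarrow> B \<le> e * (1 + t\<^sup>2)"
proof
  show "0 < 1 + \<bar>B\<bar> / e" using assms by (simp add: add_pos_nonneg)
  fix t :: real assume t: "1 + \<bar>B\<bar> / e < \<bar>t\<bar>"
  have "\<bar>t\<bar> \<le> 1 + t\<^sup>2" using abs_power_le_weight[of t 1] by simp
  with t have "\<bar>B\<bar> / e \<le> 1 + t\<^sup>2" by linarith
  then have "\<bar>B\<bar> \<le> e * (1 + t\<^sup>2)" using assms by (simp add: field_simps)
  then show "B \<le> e * (1 + t\<^sup>2)" by linarith
qed

text \<open>Far out, one spare power of the weight beats the uniform bound; on the remaining compact
  interval joint continuity is uniform in \<open>t\<close>.\<close>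

lemma schwartz_family_close:
  assumes D: "schwartz_family W D" and w0: "w0 \<in> W" and e: "0 < e"
  shows "\<exists>d>0. \<forall>w\<in>W. dist w w0 < d \<longrightarrow> (\<forall>t. (1 + t\<^sup>2) ^ k * cmod (D n w t - D n w0 t) \<le> e)"
proof -
  obtain B where B: "\<And>w t. w \<in> W \<Longrightarrow> (1 + t\<^sup>2) ^ Suc k * cmod (D n w t) \<le> B"
    using schwartz_familyD(4)[OF D] by blast
  obtain R where R: "0 < R" "\<And>t. R < \<bar>t\<bar> \<Longrightarrow> 2 * B \<le> e * (1 + t\<^sup>2)"
    using inverse_weight_small[OF e] by blast
  let ?f = "\<lambda>(w, t). of_real ((1 + t\<^sup>2) ^ k) * D n w t"
  have "continuous_on (W \<times> UNIV) (\<lambda>p. of_real ((1 + (snd p)\<^sup>2) ^ k) * (\<lambda>(w, t). D n w t) p)"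
    by (intro continuous_intros schwartz_familyD(1)[OF D])
  then have "continuous_on (W \<times> UNIV) ?f" by (simp add: case_prod_beta)
  then have "continuous_on (W \<times> {-R..R}) ?f" by (rule continuous_on_subset) auto
  then obtain X0 where X0: "w0 \<in> X0" "open X0"
    "\<forall>x\<in>X0 \<inter> W. \<forall>t\<in>{-R..R}. dist (?f (x, t)) (?f (w0, t)) \<le> e"
    by (rule continuous_on_prod_compactE[OF _ compact_Icc w0 e])
  obtain d where d: "0 < d" "\<And>w. dist w w0 < d \<Longrightarrow> w \<in> X0"
    using X0(1,2) unfolding open_dist by blast
  have "(1 + t\<^sup>2) ^ k * cmod (D n w t - D n w0 t) \<le> e" if w: "w \<in> W" "dist w w0 < d" for w t
  proof (cases "R < \<bar>t\<bar>")
    case True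
    have "cmod (D n w t - D n w0 t) \<le> cmod (D n w t) + cmod (D n w0 t)" by (rule norm_triangle_ineq4)
    then have "(1 + t\<^sup>2) ^ Suc k * cmod (D n w t - D n w0 t) \<le>
        (1 + t\<^sup>2) ^ Suc k * (cmod (D n w t) + cmod (D n w0 t))"
      by (rule mult_left_mono) simp
    also have "\<dots> \<le> 2 * B" using B[OF w(1), of t] B[OF w0, of t] by (simp add: distrib_left)
    also have "\<dots> \<le> e * (1 + t\<^sup>2)" by (rule R(2)[OF True])
    finally have "(1 + t\<^sup>2) * ((1 + t\<^sup>2) ^ k * cmod (D n w t - D n w0 t)) \<le> (1 + t\<^sup>2) * e"
      by (simp add: mult_ac)
    moreover have "0 < 1 + t\<^sup>2" by (simp add: add_pos_nonneg)
    ultimately show ?thesis by (simp only: mult_le_cancel_left_pos)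
  next
    case False
    then have "dist (?f (w, t)) (?f (w0, t)) \<le> e" using d w by (intro X0(3)[rule_format]) auto
    then have "cmod (of_real ((1 + t\<^sup>2) ^ k) * (D n w t - D n w0 t)) \<le> e"
      by (simp only: dist_norm right_diff_distrib prod.case)
    then show ?thesis unfolding norm_mult norm_of_real by simp
  qed
  with d(1) show ?thesis by blast
qed

lemma schwartz_family_close_upto:
  assumes D: "schwartz_family W D" and w0: "w0 \<in> W" and e: "0 < e"
  shows "\<exists>d>0. \<forall>w\<in>W. dist w w0 < d \<longrightarrow> (\<forall>n\<le>N. \<forall>t. (1 + t\<^sup>2) ^ k * cmod (D n w t - D n w0 t) \<le> e)"
proof -
  obtain d where d: "\<And>n. d n > 0" "\<And>n w t. w \<in> W \<Longrightarrow> dist w w0 < d n \<Longrightarrow> (1 + t\<^sup>2) ^ k * cmod (D n w t - D n w0 t) \<le> e"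
    using schwartz_family_close[OF assms] by metis
  show ?thesis
  proof (intro exI[of _ "Min (d ` {..N})"] conjI ballI impI allI)
    show "0 < Min (d ` {..N})" using d(1) by (subst Min_gr_iff) auto
    fix w n t assume "w \<in> W" "dist w w0 < Min (d ` {..N})" "n \<le> N"
    then show "(1 + t\<^sup>2) ^ k * cmod (D n w t - D n w0 t) \<le> e"
      by (intro d(2)) auto
  qed
qed

lemma tempered_continuous_on:
  assumes \<Lambda>: "\<Lambda> \<in> tempered" and D: "schwartz_family W D"
  shows "continuous_on W (\<lambda>w. \<Lambda> (D 0 w))"
  unfolding continuous_on_iff
proof (intro ballI allI impI)
  fix w0 and e :: real assume w0: "w0 \<in> W" and e: "0 < e"
  obtain K N where K: "0 \<le> K"
    "\<And>D B. deriv_seq D \<Longrightarrow> D 0 \<in> schwartz \<Longrightarrow> (\<And>n t. n \<le> N \<Longrightarrow> (1 + t\<^sup>2) ^ N * cmod (D n t) \<le> B) \<Longrightarrow> cmod (\<Lambda> (D 0)) \<le> K * B"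
    using tempered_bound_deriv_seq[OF \<Lambda>] by blast
  \<comment> \<open>\<open>K\<close> may be 0; dividing by \<open>K + 1\<close> avoids this and
    makes the final inequality strict.\<close>
  have "0 < e / (K + 1)" using e K(1) by simp
  from schwartz_family_close_upto[OF D w0 this, of N N]
  obtain d where d: "0 < d" "\<And>w n t. w \<in> W \<Longrightarrow> dist w w0 < d \<Longrightarrow> n \<le> N \<Longrightarrow>
     (1 + t\<^sup>2) ^ N * cmod (D n w t - D n w0 t) \<le> e / (K + 1)" by blast
  have "dist (\<Lambda> (D 0 w)) (\<Lambda> (D 0 w0)) < e" if w: "w \<in> W" "dist w w0 < d" for w
  proof -
    have "dist (\<Lambda> (D 0 w)) (\<Lambda> (D 0 w0)) = cmod (\<Lambda> ((\<lambda>n t. D n w t - D n w0 t) 0))"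
      using schwartz_familyD(3)[OF D] w w0 by (simp add: dist_norm tempered_diff[OF \<Lambda>])
    also have "\<dots> \<le> K * (e / (K + 1))"
      using schwartz_familyD(2,3)[OF D] w w0 d
      by (intro K(2) deriv_seq_diff schwartz_diff) auto
    also have "\<dots> < e" using e K(1) by (simp add: field_simps)
    finally show ?thesis .
  qed
  with d(1) show "\<exists>d>0. \<forall>x'\<in>W. dist x' w0 < d \<longrightarrow> dist (\<Lambda> (D 0 x')) (\<Lambda> (D 0 w0)) < e" by blast
qed

subsection \<open>Integrals over compact intervals\<close>

lemma deriv_seq_integral:
  fixes a b :: real
  assumes D: "schwartz_family {a..b} D"
  shows "deriv_seq (\<lambda>n t. integral {a..b} (\<lambda>w. D n w t))"
  unfolding deriv_seq_def
proof (intro allI)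
  fix n t
  have "((\<lambda>t. integral (cbox a b) (\<lambda>w. D n w t)) has_vector_derivative integral (cbox a b) (\<lambda>w. D (Suc n) w t)) (at t within UNIV)"
  proof (rule leibniz_rule_vector_derivative)
    show "((\<lambda>t. D n w t) has_vector_derivative D (Suc n) w t) (at t within UNIV)" if "w \<in> cbox a b" for t w
      using schwartz_familyD(2)[OF D, of w] that by (auto simp: deriv_seq_def cbox_interval)
    show "(\<lambda>w. D n w t) integrable_on cbox a b" for t
      using schwartz_family_continuous_param[OF D, of n t] by (intro integrable_continuous) auto
    have "continuous_on (UNIV \<times> {a..b}) (\<lambda>p. (\<lambda>(w, t). D (Suc n) w t) (snd p, fst p))"
      by (rule continuous_on_compose2[OF schwartz_familyD(1)[OF D, of "Suc n"]]) (auto intro!: continuous_intros)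
    then show "continuous_on (UNIV \<times> cbox a b) (\<lambda>(t, w). D (Suc n) w t)"
      by (simp add: case_prod_beta)
  qed auto
  then show "((\<lambda>t. integral {a..b} (\<lambda>w. D n w t)) has_vector_derivative integral {a..b} (\<lambda>w. D (Suc n) w t)) (at t)"
    by simp
qed

lemma weighted_integral_le:
  fixes a b :: real
  assumes "a \<le> b" "continuous_on {a..b} f" "0 \<le> c" "\<And>w. w \<in> {a..b} \<Longrightarrow> c * cmod (f w) \<le> B"
  shows "c * cmod (integral {a..b} f) \<le> B * (b - a)"
proof -
  have "norm (integral {a..b} (\<lambda>w. of_real c * f w)) \<le> B * (b - a)"
    using assms by (intro integral_bound continuous_intros) (auto simp: norm_mult)
  then show ?thesis using assms(3) by (simp add: norm_mult)
qed

lemma schwartz_integral: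
  fixes a b :: real
  assumes D: "schwartz_family {a..b} D" and ab: "a \<le> b"
  shows "(\<lambda>t. integral {a..b} (\<lambda>w. D 0 w t)) \<in> schwartz"
proof -
  have "rapid (\<lambda>n t. integral {a..b} (\<lambda>w. D n w t))"
    unfolding rapid_def
  proof (intro allI)
    fix k n
    obtain B where "\<And>w t. w \<in> {a..b} \<Longrightarrow> (1 + t\<^sup>2) ^ k * cmod (D n w t) \<le> B"
      using schwartz_familyD(4)[OF D] by blast
    then show "\<exists>B. \<forall>t. (1 + t\<^sup>2) ^ k * cmod (integral {a..b} (\<lambda>w. D n w t)) \<le> B"
      using schwartz_family_continuous_param[OF D] ab
      by (intro exI[of _ "B * (b - a)"] allI weighted_integral_le) auto
  qed
  from schwartzI[OF deriv_seq_integral[OF D] this] show ?thesis .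
qed

text \<open>As a function of the upper limit, the left-hand side has the integrand on the right as its
  derivative; this avoids integrals with values in the Schwartz space.\<close>

theorem tempered_integral:
  fixes a b :: real
  assumes \<Lambda>: "\<Lambda> \<in> tempered" and D: "schwartz_family {a..b} D" and ab: "a \<le> b"
  shows "\<Lambda> (\<lambda>t. integral {a..b} (\<lambda>w. D 0 w t)) = integral {a..b} (\<lambda>w. \<Lambda> (D 0 w))"
proof -
  define J where "J s = (\<lambda>t. integral {a..s} (\<lambda>w. D 0 w t))" for s
  obtain K N where K: "0 \<le> K"
    "\<And>D B. deriv_seq D \<Longrightarrow> D 0 \<in> schwartz \<Longrightarrow> (\<And>n t. n \<le> N \<Longrightarrow> (1 + t\<^sup>2) ^ N * cmod (D n t) \<le> B) \<Longrightarrow> cmod (\<Lambda> (D 0)) \<le> K * B"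
    using tempered_bound_deriv_seq[OF \<Lambda>] by blast
  have sub: "schwartz_family {c..d} D" if "a \<le> c" "d \<le> b" for c d
    using that by (intro schwartz_family_subset[OF D]) auto
  have cont: "continuous_on {c..d} (\<lambda>w. D n w t)" if "a \<le> c" "d \<le> b" for n t c d
    by (rule schwartz_family_continuous_param[OF sub[OF that]])
  have JS: "J s \<in> schwartz" if "a \<le> s" "s \<le> b" for s
    unfolding J_def using that by (intro schwartz_integral sub) auto
  \<comment> \<open>The base point \<open>p\<close> may be either end of the interval, so one
    estimate serves the difference quotients from the right and from the left.\<close>
  have step: "cmod (\<Lambda> (J d) - \<Lambda> (J c) - of_real (d - c) * \<Lambda> (D 0 p)) \<le> K * (e * (d - c))"
    if cd: "a \<le> c" "c \<le> d" "d \<le> b" "c \<le> p" "p \<le> d"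
      and e: "\<And>w n t. c \<le> w \<Longrightarrow> w \<le> d \<Longrightarrow> n \<le> N \<Longrightarrow> (1 + t\<^sup>2) ^ N * cmod (D n w t - D n p t) \<le> e" for c d p e
  proof -
    let ?E = "\<lambda>n t. integral {c..d} (\<lambda>w. D n w t) - of_real (d - c) * D n p t"
    have E: "?E n t = integral {c..d} (\<lambda>w. D n w t - D n p t)" for n t
      using cd cont[of c d n t] by (subst integral_diff) (auto intro!: integrable_continuous_real simp: scaleR_conv_of_real)
    have ds: "deriv_seq (\<lambda>n t. integral {c..d} (\<lambda>w. D n w t))" "deriv_seq (\<lambda>n. D n p)"
      using deriv_seq_integral[OF sub[of c d]] schwartz_familyD(2)[OF D, of p] cd by auto
    have sc: "(\<lambda>t. integral {c..d} (\<lambda>w. D 0 w t)) \<in> schwartz" "D 0 p \<in> schwartz"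
      using schwartz_integral[OF sub[of c d]] schwartz_familyD(3)[OF D, of p] cd by auto
    have "(\<lambda>t. J d t - J c t) = (\<lambda>t. integral {c..d} (\<lambda>w. D 0 w t))"
    proof
      fix t
      have "integral {a..c} (\<lambda>w. D 0 w t) + integral {c..d} (\<lambda>w. D 0 w t) = integral {a..d} (\<lambda>w. D 0 w t)"
        using cd by (intro Henstock_Kurzweil_Integration.integral_combine integrable_continuous_real cont) auto
      then show "J d t - J c t = integral {c..d} (\<lambda>w. D 0 w t)"
        by (simp add: J_def algebra_simps)
    qed
    then have "\<Lambda> (J d) - \<Lambda> (J c) = \<Lambda> (\<lambda>t. integral {c..d} (\<lambda>w. D 0 w t))"
      using tempered_diff[OF \<Lambda> JS JS, of d c] cd by simp
    then have "\<Lambda> (J d) - \<Lambda> (J c) - of_real (d - c) * \<Lambda> (D 0 p) = \<Lambda> (?E 0)"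
      using sc by (simp add: tempered_diff[OF \<Lambda>] schwartz_cmult tempered_cmult[OF \<Lambda>])
    also have "cmod \<dots> \<le> K * (e * (d - c))"
    proof (rule K(2)[of ?E])
      show "deriv_seq ?E" by (intro deriv_seq_diff deriv_seq_cmult ds)
      show "?E 0 \<in> schwartz" by (intro schwartz_diff schwartz_cmult sc)
      fix n t assume "n \<le> N"
      then show "(1 + t\<^sup>2) ^ N * cmod (?E n t) \<le> e * (d - c)"
        unfolding E using cd e cont[of c d] by (intro weighted_integral_le continuous_intros) auto
    qed
    finally show ?thesis .
  qed
  have "((\<lambda>s. \<Lambda> (J s)) has_vector_derivative \<Lambda> (D 0 s)) (at s within {a..b})" if s: "s \<in> {a..b}" for s
    unfolding has_vector_derivative_def has_derivative_within_alt
  proof (intro conjI allI impI)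
    fix e :: real assume e: "0 < e"
    have "0 < e / (K + 1)" using e K(1) by simp
    from schwartz_family_close_upto[OF D s this, of N N]
    obtain d where d: "0 < d" "\<And>w n t. w \<in> {a..b} \<Longrightarrow> dist w s < d \<Longrightarrow> n \<le> N \<Longrightarrow>
       (1 + t\<^sup>2) ^ N * cmod (D n w t - D n s t) \<le> e / (K + 1)" by blast
    have "norm (\<Lambda> (J y) - \<Lambda> (J s) - (y - s) *\<^sub>R \<Lambda> (D 0 s)) \<le> e * norm (y - s)"
      if y: "y \<in> {a..b}" "norm (y - s) < d" for y
    proof -
      have le: "K * (e / (K + 1) * \<bar>y - s\<bar>) \<le> e * \<bar>y - s\<bar>"
      proof -
        have "K * (e / (K + 1)) \<le> e" using e K(1) by (simp add: field_simps)
        from mult_right_mono[OF this, of "\<bar>y - s\<bar>"] show ?thesis by (simp add: mult.assoc)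
      qed
      show ?thesis
      proof (cases "s \<le> y")
        case True
        have "cmod (\<Lambda> (J y) - \<Lambda> (J s) - of_real (y - s) * \<Lambda> (D 0 s)) \<le> K * (e / (K + 1) * (y - s))"
          using True s y by (intro step d) (auto simp: dist_real_def)
        with le True show ?thesis by (simp add: scaleR_conv_of_real)
      next
        case False
        have "cmod (\<Lambda> (J s) - \<Lambda> (J y) - of_real (s - y) * \<Lambda> (D 0 s)) \<le> K * (e / (K + 1) * (s - y))"
          using False s y by (intro step d) (auto simp: dist_real_def)
        moreover have "cmod (\<Lambda> (J y) - \<Lambda> (J s) - (y - s) *\<^sub>R \<Lambda> (D 0 s)) =
          cmod (\<Lambda> (J s) - \<Lambda> (J y) - of_real (s - y) * \<Lambda> (D 0 s))"
          by (subst norm_minus_cancel[symmetric]) (simp add: scaleR_conv_of_real algebra_simps)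
        ultimately show ?thesis using le False by simp
      qed
    qed
    with d(1) show "\<exists>d>0. \<forall>y\<in>{a..b}. norm (y - s) < d \<longrightarrow>
       norm (\<Lambda> (J y) - \<Lambda> (J s) - (y - s) *\<^sub>R \<Lambda> (D 0 s)) \<le> e * norm (y - s)" by blast
  qed (rule bounded_linear_scaleR_left)
  from fundamental_theorem_of_calculus[OF ab this]
  have "integral {a..b} (\<lambda>w. \<Lambda> (D 0 w)) = \<Lambda> (J b) - \<Lambda> (J a)"
    by (rule integral_unique)
  moreover have "J a = (\<lambda>t. 0)" by (auto simp: J_def)
  moreover have "\<Lambda> (\<lambda>t. 0) = 0" using tempered_cmult[OF \<Lambda>, of 0 "\<lambda>t. 0"] by simp
  ultimately show ?thesis by (simp add: J_def)
qed

subsection \<open>Integrals over the line\<close>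

text \<open>The standard integrable majorant: at most 1, of integral \<open>pi\<close>, and obtained
  from any bound with one spare power of the weight.\<close>

definition kern :: "real \<Rightarrow> real" where "kern x = inverse (1 + x\<^sup>2)"

lemma kern_pos: "0 < kern x" by (simp add: kern_def add_pos_nonneg)
lemma kern_le_1: "kern x \<le> 1" by (simp add: kern_def inverse_le_1_iff)
lemma kern_minus [simp]: "kern (- x) = kern x" by (simp add: kern_def)
lemma kern_nonneg: "0 \<le> kern x" using kern_pos[of x] by simp
lemma weight_kern: "(1 + x\<^sup>2) * kern x = 1"
proof -
  have "0 < 1 + x\<^sup>2" by (simp add: add_pos_nonneg)
  then show ?thesis by (metis kern_def less_irrefl right_inverse)
qed

lemma kern_measurable [measurable]: "kern \<in> borel_measurable borel"
  unfolding kern_def[abs_def] by measurable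

lemma integrable_kern: "integrable lborel kern" and integral_kern: "(\<integral>x. kern x \<partial>lborel) = pi"
proof -
  have 1: "set_integrable lborel (einterval (- \<infinity>) \<infinity>) (\<lambda>x. inverse (1 + x\<^sup>2))"
    by (rule integrable_inverse_1_plus_square)
  then show "integrable lborel kern" by (simp add: set_integrable_def kern_def[abs_def])
  show "(\<integral>x. kern x \<partial>lborel) = pi"
    using LBINT_inverse_1_plus_square
    by (simp add: interval_lebesgue_integral_def set_lebesgue_integral_def kern_def[abs_def])
qed

lemma le_kernI: "(1 + x\<^sup>2) * y \<le> B \<Longrightarrow> y \<le> B * kern x"
proof -
  assume "(1 + x\<^sup>2) * y \<le> B"
  from mult_right_mono[OF this kern_nonneg[of x]] show ?thesis
    using weight_kern[of x] by (metis mult.assoc mult.commute mult.right_neutral)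
qed

lemma tail_kern: "(\<lambda>m. \<integral>w. indicator (- {- real m..real m}) w * kern w \<partial>lborel) \<longlonglongrightarrow> 0"
proof -
  have "(\<lambda>m. \<integral>w. indicator (- {- real m..real m}) w * kern w \<partial>lborel) \<longlonglongrightarrow> (\<integral>w. 0 \<partial>(lborel :: real measure))"
  proof (rule integral_dominated_convergence[where w=kern])
    show "AE w in lborel. (\<lambda>m. indicator (- {- real m..real m}) w * kern w) \<longlonglongrightarrow> 0"
    proof (intro AE_I2 tendsto_eventually)
      fix w :: real
      obtain M where "\<bar>w\<bar> \<le> real M" using real_arch_simple by blast
      then show "\<forall>\<^sub>F m in sequentially. indicator (- {- real m..real m}) w * kern w = 0"
        by (intro eventually_sequentiallyI[of M]) (auto simp: indicator_def)
    qed
  qed (auto simp: integrable_kern kern_nonneg indicator_def)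
  then show ?thesis by simp
qed

text \<open>Compact intervals are handled with the gauge integral, for differentiation under the
  integral sign, the line with the Lebesgue integral; this is the bridge.\<close>

lemma integral_Icc_eq:
  fixes f :: "real \<Rightarrow> complex"
  assumes "continuous_on {a..b} f"
  shows "integral {a..b} f = (\<integral>w. indicator {a..b} w *\<^sub>R f w \<partial>lborel)"
  using set_borel_integral_eq_integral(2)[OF borel_integrable_atLeastAtMost'[OF assms]]
  by (simp add: set_lebesgue_integral_def)

lemma measurable_continuous_UNIV: "continuous_on UNIV f \<Longrightarrow> f \<in> borel_measurable borel"
  by (rule borel_measurable_continuous_onI)

lemma integrable_kern_bound:
  fixes f :: "real \<Rightarrow> 'a::{banach, second_countable_topology}"
  assumes "f \<in> borel_measurable borel" "\<And>w. norm (f w) \<le> B * kern w"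
  shows "integrable lborel f"
proof (rule Bochner_Integration.integrable_bound)
  show "integrable lborel (\<lambda>w. B * kern w)" using integrable_kern by simp
  show "AE x in lborel. norm (f x) \<le> norm (B * kern x)"
    using assms(2) by (auto intro: order_trans[OF _ abs_ge_self])
qed (use assms in auto)

text \<open>The factor \<open>kern w\<close> makes the integral over the whole line converge
  absolutely in every seminorm.\<close>

definition schwartz_family_weighted :: "(nat \<Rightarrow> real \<Rightarrow> real \<Rightarrow> complex) \<Rightarrow> bool" where
  "schwartz_family_weighted D \<longleftrightarrow> (\<forall>n. continuous_on UNIV (\<lambda>(w, t). D n w t)) \<and>
     (\<forall>w. deriv_seq (\<lambda>n. D n w)) \<and>
     (\<forall>k n. \<exists>B. \<forall>w t. (1 + t\<^sup>2) ^ k * cmod (D n w t) \<le> B * kern w)"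

text \<open>Truncation to \<open>[- m, m]\<close> costs at most \<open>B * \<tau> m\<close> in each
  weighted norm. Uniform convergence of the derivatives then makes the limit differentiable, and
  continuity of \<Lambda> carries \<open>tempered_integral\<close> to the limit.\<close>

theorem
  assumes D: "schwartz_family_weighted D"
  shows schwartz_integral_line: "(\<lambda>t. \<integral>w. D 0 w t \<partial>lborel) \<in> schwartz" (is ?A)
    and tempered_integral_line: "\<Lambda> \<in> tempered \<Longrightarrow> \<Lambda> (\<lambda>t. \<integral>w. D 0 w t \<partial>lborel) = (\<integral>w. \<Lambda> (D 0 w) \<partial>lborel)"
proof -
  define J where "J n t = (\<integral>w. D n w t \<partial>lborel)" for n t
  define I where "I m n t = integral {- real m..real m} (\<lambda>w. D n w t)" for m n t
  define \<tau> where "\<tau> m = (\<integral>w. indicator (- {- real m..real m}) w * kern w \<partial>lborel)" for m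
  have \<tau>: "\<tau> \<longlonglongrightarrow> 0" unfolding \<tau>_def[abs_def] by (rule tail_kern)
  have fam: "schwartz_family UNIV D"
    unfolding schwartz_family_def
  proof (intro conjI allI ballI)
    fix k n
    obtain B where B: "\<And>w t. (1 + t\<^sup>2) ^ k * cmod (D n w t) \<le> B * kern w"
      using D unfolding schwartz_family_weighted_def by blast
    have "0 \<le> B * kern 0" using B[of 0 0] by (smt (verit) norm_ge_zero mult_nonneg_nonneg weight_ge_1)
    then have "0 \<le> B" using kern_pos[of 0] by (simp add: zero_le_mult_iff)
    then have "B * kern w \<le> B" for w using kern_le_1[of w] by (simp add: mult_left_le)
    then show "\<exists>B. \<forall>w\<in>UNIV. \<forall>t. (1 + t\<^sup>2) ^ k * cmod (D n w t) \<le> B" using B by (metis order_trans)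
  qed (use D in \<open>auto simp: schwartz_family_weighted_def\<close>)
  have famI: "schwartz_family {- real m..real m} D" for m
    by (rule schwartz_family_subset[OF fam]) simp
  have cont: "continuous_on S (\<lambda>w. D n w t)" for S n t
    using schwartz_family_continuous_param[OF fam, of n t] continuous_on_subset by blast
  have B: "\<exists>B. \<forall>w t. (1 + t\<^sup>2) ^ k * cmod (D n w t) \<le> B * kern w" for k n
    using D unfolding schwartz_family_weighted_def by blast
  have int: "integrable lborel (\<lambda>w. D n w t)" for n t
  proof -
    obtain B where "\<And>w t. (1 + t\<^sup>2) ^ 0 * cmod (D n w t) \<le> B * kern w" using B by blast
    then show ?thesis using measurable_continuous_UNIV[OF cont, of n t] by (intro integrable_kern_bound[where B=B]) auto
  qed
  \<comment> \<open>The weight is carried into the integral, so that this estimate serves three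
    times: for uniform convergence with \<open>k = 0\<close>, for rapid decay with any
    \<open>k\<close>, and for \<Lambda> with \<open>k = N\<close>.\<close>
  have diff: "(1 + t\<^sup>2) ^ k * cmod (J n t - I m n t) \<le> B * \<tau> m"
    if B: "\<And>w. (1 + t\<^sup>2) ^ k * cmod (D n w t) \<le> B * kern w" for k n m t B
  proof -
    have I: "I m n t = (\<integral>w. indicator {- real m..real m} w *\<^sub>R D n w t \<partial>lborel)"
      unfolding I_def by (rule integral_Icc_eq[OF cont])
    have i: "integrable lborel (\<lambda>w. indicator {- real m..real m} w *\<^sub>R D n w t)"
      by (intro integrable_mult_indicator int) auto
    have i': "integrable lborel (\<lambda>w. indicator (- {- real m..real m}) w *\<^sub>R D n w t)"
      by (intro integrable_mult_indicator int) auto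
    have "J n t - I m n t = (\<integral>w. D n w t - indicator {- real m..real m} w *\<^sub>R D n w t \<partial>lborel)"
      unfolding J_def I using int i by simp
    also have "\<dots> = (\<integral>w. indicator (- {- real m..real m}) w *\<^sub>R D n w t \<partial>lborel)"
      by (intro Bochner_Integration.integral_cong) (auto simp: indicator_def)
    finally have eq: "of_real ((1 + t\<^sup>2) ^ k) * (J n t - I m n t) =
      (\<integral>w. of_real ((1 + t\<^sup>2) ^ k) * (indicator (- {- real m..real m}) w *\<^sub>R D n w t) \<partial>lborel)"
      by (simp only: integral_mult_right_zero)
    have "(1 + t\<^sup>2) ^ k * cmod (J n t - I m n t) = cmod (of_real ((1 + t\<^sup>2) ^ k) * (J n t - I m n t))"
      unfolding norm_mult norm_of_real by simp
    also have "\<dots> \<le> (\<integral>w. B * (indicator (- {- real m..real m}) w * kern w) \<partial>lborel)"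
      unfolding eq
    proof (rule Bochner_Integration.integral_norm_bound_integral)
      show "integrable lborel (\<lambda>w. of_real ((1 + t\<^sup>2) ^ k) * (indicator (- {- real m..real m}) w *\<^sub>R D n w t))"
        using i' by (intro integrable_mult_right) auto
      show "integrable lborel (\<lambda>w. B * (indicator (- {- real m..real m}) w * kern w))"
        using integrable_mult_indicator[of "- {- real m..real m}" lborel kern] integrable_kern by auto
      show "norm (of_real ((1 + t\<^sup>2) ^ k) * (indicator (- {- real m..real m}) w *\<^sub>R D n w t)) \<le>
         B * (indicator (- {- real m..real m}) w * kern w)" for w
        unfolding norm_mult norm_of_real using B[of w] by (auto simp: indicator_def)
    qed
    also have "\<dots> = B * \<tau> m" by (simp add: \<tau>_def)
    finally show ?thesis .
  qed
  have dsI: "deriv_seq (I m)" for m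
    unfolding I_def[abs_def] by (rule deriv_seq_integral[OF famI])
  have "deriv_seq J"
    unfolding deriv_seq_def
  proof (intro allI)
    fix n t0
    have conv: "(\<lambda>m. I m n t) \<longlonglongrightarrow> J n t" for n t
    proof -
      obtain B where B: "\<And>w t. (1 + t\<^sup>2) ^ 0 * cmod (D n w t) \<le> B * kern w" using B by blast
      have "(\<lambda>m. J n t - I m n t) \<longlonglongrightarrow> 0"
      proof (rule tendsto_0_le[where K=1 and f="\<lambda>m. B * \<tau> m"])
        show "(\<lambda>m. B * \<tau> m) \<longlonglongrightarrow> 0" using tendsto_mult[OF tendsto_const[of B] \<tau>] by simp
        show "\<forall>\<^sub>F m in sequentially. norm (J n t - I m n t) \<le> norm (B * \<tau> m) * 1"
          using diff[of t 0 n, OF B] by (auto intro!: always_eventually order_trans[OF _ abs_ge_self])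
      qed
      from tendsto_diff[OF tendsto_const[of "J n t"] this] show ?thesis by simp
    qed
    have "\<exists>g. \<forall>x\<in>UNIV. (\<lambda>m. I m n x) \<longlonglongrightarrow> g x \<and> (g has_derivative (\<lambda>h. h *\<^sub>R J (Suc n) x)) (at x within UNIV)"
    proof (rule has_derivative_sequence[where f'="\<lambda>m x h. h *\<^sub>R I m (Suc n) x"])
      show "((\<lambda>x. I m n x) has_derivative (\<lambda>h. h *\<^sub>R I m (Suc n) x)) (at x within UNIV)" for m x
        using dsI unfolding deriv_seq_def has_vector_derivative_def by simp
      fix e :: real assume e: "0 < e"
      obtain B where B: "\<And>w t. (1 + t\<^sup>2) ^ 0 * cmod (D (Suc n) w t) \<le> B * kern w" using B by blast
      have "(\<lambda>m. B * \<tau> m) \<longlonglongrightarrow> 0" using tendsto_mult[OF tendsto_const[of B] \<tau>] by simp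
      from order_tendstoD(2)[OF this e]
      show "\<forall>\<^sub>F m in sequentially. \<forall>x\<in>UNIV. \<forall>h. norm (h *\<^sub>R I m (Suc n) x - h *\<^sub>R J (Suc n) x) \<le> e * norm h"
      proof eventually_elim
        case (elim m)
        have "norm (h *\<^sub>R I m (Suc n) x - h *\<^sub>R J (Suc n) x) \<le> e * norm h" for x h
        proof -
          have "norm (h *\<^sub>R I m (Suc n) x - h *\<^sub>R J (Suc n) x) = \<bar>h\<bar> * cmod (J (Suc n) x - I m (Suc n) x)"
            by (simp add: norm_minus_commute flip: scaleR_diff_right)
          also have "\<dots> \<le> \<bar>h\<bar> * e"
            using diff[of x 0 "Suc n", OF B] elim by (intro mult_left_mono) (auto intro: less_imp_le order.strict_trans1)
          finally show ?thesis by (simp add: mult.commute)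
        qed
        then show ?case by blast
      qed
    qed (use conv[of n 0] in auto)
    then obtain g where g: "\<And>x. (\<lambda>m. I m n x) \<longlonglongrightarrow> g x" "\<And>x. (g has_derivative (\<lambda>h. h *\<^sub>R J (Suc n) x)) (at x)"
      by auto
    have "g = J n" using LIMSEQ_unique[OF g(1) conv] by blast
    with g(2) show "(J n has_vector_derivative J (Suc n) t0) (at t0)"
      by (simp add: has_vector_derivative_def)
  qed
  moreover have "rapid J"
    unfolding rapid_def
  proof (intro allI)
    fix k n
    obtain B where B: "\<And>w t. (1 + t\<^sup>2) ^ k * cmod (D n w t) \<le> B * kern w" using B by blast
    \<comment> \<open>For \<open>m = 0\<close> the interval is a point and the truncated integral is
      0, so \<open>diff\<close> bounds \<open>J\<close> itself.\<close>
    have "(1 + t\<^sup>2) ^ k * cmod (J n t) \<le> B * \<tau> 0" for t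
      using diff[of t k n B 0, OF B] by (simp add: I_def)
    then show "\<exists>B. \<forall>t. (1 + t\<^sup>2) ^ k * cmod (J n t) \<le> B" by blast
  qed
  ultimately have JS: "J 0 \<in> schwartz" by (rule schwartzI)
  then show ?A by (simp add: J_def[abs_def])
  fix \<Lambda> assume \<Lambda>: "\<Lambda> \<in> tempered"
  obtain K N where K: "0 \<le> K"
    "\<And>D B. deriv_seq D \<Longrightarrow> D 0 \<in> schwartz \<Longrightarrow> (\<And>n t. n \<le> N \<Longrightarrow> (1 + t\<^sup>2) ^ N * cmod (D n t) \<le> B) \<Longrightarrow> cmod (\<Lambda> (D 0)) \<le> K * B"
    using tempered_bound_deriv_seq[OF \<Lambda>] by blast
  \<comment> \<open>The factor \<open>kern w\<close> is moved to the left as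
    \<open>1 + w\<^sup>2\<close>, so that one constant can be taken for all orders up to
    \<open>N\<close> and all \<open>w\<close>.\<close>
  have "\<exists>B. \<forall>p\<in>UNIV. (\<lambda>(w, t). (1 + w\<^sup>2) * ((1 + t\<^sup>2) ^ N * cmod (D n w t))) p \<le> B" for n
  proof -
    obtain B where B: "\<And>w t. (1 + t\<^sup>2) ^ N * cmod (D n w t) \<le> B * kern w" using B by blast
    have "(1 + w\<^sup>2) * ((1 + t\<^sup>2) ^ N * cmod (D n w t)) \<le> (1 + w\<^sup>2) * (B * kern w)" for w t
      by (intro mult_left_mono B) simp
    moreover have "(1 + w\<^sup>2) * (B * kern w) = B" for w using weight_kern[of w] by (metis mult.left_commute mult.right_neutral)
    ultimately show ?thesis by auto
  qed
  from finite_upto_bound[where F="\<lambda>n (w, t). (1 + w\<^sup>2) * ((1 + t\<^sup>2) ^ N * cmod (D n w t))" and S=UNIV and N=N, OF this]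
  obtain B where B: "0 \<le> B" "\<And>n w t. n \<le> N \<Longrightarrow> (1 + w\<^sup>2) * ((1 + t\<^sup>2) ^ N * cmod (D n w t)) \<le> B"
    by (metis (mono_tags, lifting) UNIV_I case_prod_conv)
  have Bk: "(1 + t\<^sup>2) ^ N * cmod (D n w t) \<le> B * kern w" if "n \<le> N" for n w t
    using B(2)[OF that] by (rule le_kernI)
  have cL: "continuous_on S (\<lambda>w. \<Lambda> (D 0 w))" for S
    using tempered_continuous_on[OF \<Lambda> fam] continuous_on_subset by blast
  have bL: "cmod (\<Lambda> (D 0 w)) \<le> K * B * kern w" for w
    using K(2)[of "\<lambda>n. D n w" "B * kern w"] schwartz_familyD(2,3)[OF fam, of w] Bk by (simp add: mult.assoc)
  have iL: "integrable lborel (\<lambda>w. \<Lambda> (D 0 w))"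
    using measurable_continuous_UNIV[OF cL] bL by (rule integrable_kern_bound)
  have IS: "I m 0 \<in> schwartz" for m unfolding I_def[abs_def] by (rule schwartz_integral[OF famI]) simp
  have "(\<lambda>m. \<Lambda> (J 0) - \<Lambda> (I m 0)) \<longlonglongrightarrow> 0"
  proof (rule tendsto_0_le[where K=1 and f="\<lambda>m. K * (B * \<tau> m)"])
    show "(\<lambda>m. K * (B * \<tau> m)) \<longlonglongrightarrow> 0"
      using tendsto_mult[OF tendsto_const[of "K * B"] \<tau>] by (simp add: mult.assoc)
    have "cmod (\<Lambda> (J 0) - \<Lambda> (I m 0)) \<le> K * (B * \<tau> m)" for m
    proof -
      have "\<Lambda> (J 0) - \<Lambda> (I m 0) = \<Lambda> ((\<lambda>n t. J n t - I m n t) 0)"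
        using tempered_diff[OF \<Lambda> JS IS] by simp
      also have "cmod \<dots> \<le> K * (B * \<tau> m)"
        using diff Bk by (intro K(2) deriv_seq_diff schwartz_diff JS IS \<open>deriv_seq J\<close> dsI) auto
      finally show ?thesis .
    qed
    then show "\<forall>\<^sub>F m in sequentially. norm (\<Lambda> (J 0) - \<Lambda> (I m 0)) \<le> norm (K * (B * \<tau> m)) * 1"
      by (auto intro!: always_eventually order_trans[OF _ abs_ge_self])
  qed
  from tendsto_diff[OF tendsto_const[of "\<Lambda> (J 0)"] this]
  have 1: "(\<lambda>m. \<Lambda> (I m 0)) \<longlonglongrightarrow> \<Lambda> (J 0)" by simp
  have "\<Lambda> (I m 0) = (\<integral>w. indicator {- real m..real m} w *\<^sub>R \<Lambda> (D 0 w) \<partial>lborel)" for m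
    unfolding I_def[abs_def] tempered_integral[OF \<Lambda> famI, of m, simplified] by (rule integral_Icc_eq[OF cL])
  moreover have "(\<lambda>m. \<integral>w. indicator {- real m..real m} w *\<^sub>R \<Lambda> (D 0 w) \<partial>lborel) \<longlonglongrightarrow> (\<integral>w. \<Lambda> (D 0 w) \<partial>lborel)"
  proof (rule integral_dominated_convergence[where w="\<lambda>w. cmod (\<Lambda> (D 0 w))"])
    show "(\<lambda>w. \<Lambda> (D 0 w)) \<in> borel_measurable lborel" using iL by auto
    then show "(\<lambda>w. indicator {- real m..real m} w *\<^sub>R \<Lambda> (D 0 w)) \<in> borel_measurable lborel" for m by measurable
    show "AE w in lborel. (\<lambda>m. indicator {- real m..real m} w *\<^sub>R \<Lambda> (D 0 w)) \<longlonglongrightarrow> \<Lambda> (D 0 w)"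
    proof (intro AE_I2 tendsto_eventually)
      fix w :: real
      obtain M where "\<bar>w\<bar> \<le> real M" using real_arch_simple by blast
      then show "\<forall>\<^sub>F m in sequentially. indicator {- real m..real m} w *\<^sub>R \<Lambda> (D 0 w) = \<Lambda> (D 0 w)"
        by (intro eventually_sequentiallyI[of M]) (auto simp: indicator_def)
    qed
  qed (use iL in \<open>auto simp: indicator_def\<close>)
  ultimately have 2: "(\<lambda>m. \<Lambda> (I m 0)) \<longlonglongrightarrow> (\<integral>w. \<Lambda> (D 0 w) \<partial>lborel)" by simp
  from LIMSEQ_unique[OF 1 2] show "\<Lambda> (\<lambda>t. \<integral>w. D 0 w t \<partial>lborel) = (\<integral>w. \<Lambda> (D 0 w) \<partial>lborel)"
    by (simp add: J_def[abs_def])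
qed

section \<open>Integrals of Schwartz functions\<close>

lemma schwartz_nth_deriv_continuous: "f \<in> schwartz \<Longrightarrow> continuous_on S (nth_deriv n f)"
  using schwartz_deriv_seq[of f] unfolding deriv_seq_def
  by (meson continuous_at_imp_continuous_on has_vector_derivative_continuous)

lemma schwartz_continuous: "f \<in> schwartz \<Longrightarrow> continuous_on S f"
  using schwartz_nth_deriv_continuous[of f S 0] by simp

lemma schwartz_measurable: "f \<in> schwartz \<Longrightarrow> f \<in> borel_measurable borel"
  by (rule measurable_continuous_UNIV[OF schwartz_continuous])

lemma schwartz_bound:
  assumes "f \<in> schwartz"
  obtains B where "0 \<le> B" "\<And>t. (1 + t\<^sup>2) ^ k * cmod (nth_deriv n f t) \<le> B"
proof -
  obtain B where B: "\<And>t. (1 + t\<^sup>2) ^ k * cmod (nth_deriv n f t) \<le> B"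
    using schwartz_rapid[OF assms] unfolding rapid_def by blast
  have "0 \<le> B" by (rule order_trans[OF _ B[of 0]]) simp
  with B that show ?thesis by blast
qed

lemma schwartz_bound_upto:
  assumes "f \<in> schwartz"
  obtains B where "0 \<le> B" "\<And>i t. i \<le> n \<Longrightarrow> (1 + t\<^sup>2) ^ k * cmod (nth_deriv i f t) \<le> B"
proof -
  have "\<exists>B. \<forall>t\<in>UNIV. (1 + t\<^sup>2) ^ k * cmod (nth_deriv i f t) \<le> B" for i
    using schwartz_rapid[OF assms] unfolding rapid_def by auto
  from finite_upto_bound[where F="\<lambda>i t. (1 + t\<^sup>2) ^ k * cmod (nth_deriv i f t)" and S=UNIV and N=n, OF this]
  show ?thesis using that by (metis UNIV_I)
qed

lemma schwartz_le_kern: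
  assumes "f \<in> schwartz"
  obtains B where "0 \<le> B" "\<And>t. cmod (f t) \<le> B * kern t"
proof -
  obtain B where B: "0 \<le> B" "\<And>t. (1 + t\<^sup>2) ^ 1 * cmod (nth_deriv 0 f t) \<le> B"
    using schwartz_bound[OF assms] by blast
  have "cmod (f t) \<le> B * kern t" for t using le_kernI[of t "cmod (f t)" B] B(2)[of t] by simp
  with B(1) that show ?thesis by blast
qed

lemma schwartz_integrable: "f \<in> schwartz \<Longrightarrow> integrable lborel f"
  by (metis schwartz_le_kern integrable_kern_bound schwartz_measurable)

lemma integrable_mult_schwartz:
  assumes "\<phi> \<in> schwartz" "f \<in> borel_measurable borel" "\<And>t. cmod (f t) \<le> B"
  shows "integrable lborel (\<lambda>t. f t * \<phi> t)"
proof -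
  obtain C where C: "0 \<le> C" "\<And>t. cmod (\<phi> t) \<le> C * kern t" using schwartz_le_kern[OF assms(1)] by blast
  have "0 \<le> B" using order_trans[OF norm_ge_zero assms(3)] .
  have "norm (f t * \<phi> t) \<le> B * C * kern t" for t
    unfolding norm_mult mult.assoc using assms(3) C \<open>0 \<le> B\<close> by (intro mult_mono) auto
  then show ?thesis using assms schwartz_measurable[OF assms(1)]
    by (intro integrable_kern_bound[where B="B * C"]) auto
qed

lemma tempered_distr_of:
  assumes "\<phi> \<in> schwartz"
  shows "distr_of \<phi> \<in> tempered"
proof -
  have le: "cmod (f t) \<le> schwartz_norm 0 f" if "f \<in> schwartz" for f t
    using seminorm_upper[OF that, of t 0 0] by simp
  have int: "integrable lborel (\<lambda>t. \<phi> t * f t)" if "f \<in> schwartz" for f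
    using integrable_mult_schwartz[OF assms schwartz_measurable[OF that] le[OF that]]
    by (simp add: mult.commute)
  show ?thesis
  proof (rule temperedI[where K="\<integral>t. cmod (\<phi> t) \<partial>lborel" and N=0])
    fix f assume f: "f \<in> schwartz"
    have "cmod (distr_of \<phi> f) \<le> (\<integral>t. cmod (\<phi> t) * schwartz_norm 0 f \<partial>lborel)"
      unfolding distr_of_def using f
    proof (simp only: if_True, intro Bochner_Integration.integral_norm_bound_integral int)
      show "integrable lborel (\<lambda>t. cmod (\<phi> t) * schwartz_norm 0 f)"
        using schwartz_integrable[OF assms] by auto
      show "norm (\<phi> t * f t) \<le> cmod (\<phi> t) * schwartz_norm 0 f" for t
        unfolding norm_mult by (intro mult_left_mono le f) auto
    qed
    then show "cmod (distr_of \<phi> f) \<le> (\<integral>t. cmod (\<phi> t) \<partial>lborel) * schwartz_norm 0 f" by simp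
  qed (auto simp: distr_of_def schwartz_add schwartz_cmult int distrib_left mult.left_commute)
qed

text \<open>Peetre's inequality in reciprocal form: two decaying factors centred at 0 and at
  \<open>y\<close> leave decay in \<open>y\<close>.\<close>

lemma kern_shift: "kern s * kern (s - y) \<le> 2 * kern y"
proof -
  have "1 + y\<^sup>2 \<le> 2 * (1 + s\<^sup>2) * (1 + (s - y)\<^sup>2)"
    using peetre[of s "y - s"] by (simp add: power2_commute)
  then have "kern s * kern (s - y) * (1 + y\<^sup>2) \<le> kern s * kern (s - y) * (2 * (1 + s\<^sup>2) * (1 + (s - y)\<^sup>2))"
    by (intro mult_left_mono) (auto simp: kern_nonneg)
  also have "\<dots> = 2 * ((1 + s\<^sup>2) * kern s) * ((1 + (s - y)\<^sup>2) * kern (s - y))" by (simp add: mult_ac)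
  also have "\<dots> = 2" by (simp only: weight_kern mult_1_right)
  finally show ?thesis using le_kernI[of y "kern s * kern (s - y)" 2] by (simp add: mult.commute)
qed

lemma kern_power_weight: "(1 + t\<^sup>2) ^ (k + 1) * c \<le> B \<Longrightarrow> (1 + t\<^sup>2) ^ k * c \<le> B * kern t"
  using le_kernI[of t "(1 + t\<^sup>2) ^ k * c" B] by (simp add: mult_ac)

subsection \<open>Convolutions\<close>

definition convolution :: "(real \<Rightarrow> complex) \<Rightarrow> (real \<Rightarrow> complex) \<Rightarrow> real \<Rightarrow> complex" where
  "convolution \<phi> \<psi> t = (\<integral>x. \<phi> x * \<psi> (t - x) \<partial>lborel)"

lemma convolution_commute: "convolution \<phi> \<psi> = convolution \<psi> \<phi>"
proof
  fix t
  show "convolution \<phi> \<psi> t = convolution \<psi> \<phi> t"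
    unfolding convolution_def
    by (subst lborel_integral_real_affine[where c="- 1" and t=t]) (simp_all add: mult.commute)
qed

text \<open>Peetre's inequality distributes the weight at \<open>t\<close> over \<open>x\<close> and
  \<open>t - x\<close>; \<open>\<phi>\<close> absorbs its share and one power more, which produces
  \<open>kern x\<close>.\<close>

lemma convolution_family:
  assumes \<phi>: "\<phi> \<in> schwartz" and \<psi>: "\<psi> \<in> schwartz"
  shows "schwartz_family_weighted (\<lambda>n x t. \<phi> x * nth_deriv n \<psi> (t - x))"
  unfolding schwartz_family_weighted_def
proof (intro conjI allI)
  fix n
  have "continuous_on UNIV (\<lambda>p. \<phi> (fst p) * nth_deriv n \<psi> (snd p - fst p))"
    by (intro continuous_intros continuous_on_compose2[OF schwartz_continuous[OF \<phi>, of UNIV]]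
        continuous_on_compose2[OF schwartz_nth_deriv_continuous[OF \<psi>, of UNIV n]]) auto
  then show "continuous_on UNIV (\<lambda>(x, t). \<phi> x * nth_deriv n \<psi> (t - x))"
    by (simp add: case_prod_beta)
next
  fix x
  show "deriv_seq (\<lambda>n t. \<phi> x * nth_deriv n \<psi> (t - x))"
    by (intro deriv_seq_cmult deriv_seq_translate schwartz_deriv_seq \<psi>)
next
  fix k n
  obtain B where B: "0 \<le> B" "\<And>t. (1 + t\<^sup>2) ^ (k + 1) * cmod (nth_deriv 0 \<phi> t) \<le> B"
    using schwartz_bound[OF \<phi>] by blast
  obtain C where C: "0 \<le> C" "\<And>t. (1 + t\<^sup>2) ^ k * cmod (nth_deriv n \<psi> t) \<le> C"
    using schwartz_bound[OF \<psi>] by blast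
  have "(1 + t\<^sup>2) ^ k * cmod (\<phi> x * nth_deriv n \<psi> (t - x)) \<le> 2 ^ k * B * C * kern x" for x t
  proof -
    have "(1 + t\<^sup>2) ^ k * cmod (\<phi> x * nth_deriv n \<psi> (t - x)) \<le>
      ((2 * (1 + x\<^sup>2)) ^ k * (1 + (t - x)\<^sup>2) ^ k) * cmod (\<phi> x * nth_deriv n \<psi> (t - x))"
      by (intro mult_right_mono weight_shift) auto
    also have "\<dots> = 2 ^ k * (((1 + x\<^sup>2) ^ k * cmod (\<phi> x)) * ((1 + (t - x)\<^sup>2) ^ k * cmod (nth_deriv n \<psi> (t - x))))"
      by (simp only: norm_mult power_mult_distrib mult_ac)
    also have "\<dots> \<le> 2 ^ k * ((B * kern x) * C)"
      using kern_power_weight[OF B(2)[of x]] C(2)[of "t - x"] C(1) B(1) kern_nonneg[of x]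
      by (intro mult_left_mono mult_mono[of _ "B * kern x"]) auto
    finally show ?thesis by (simp add: mult_ac)
  qed
  then show "\<exists>B. \<forall>x t. (1 + t\<^sup>2) ^ k * cmod (\<phi> x * nth_deriv n \<psi> (t - x)) \<le> B * kern x" by blast
qed

lemma convolution_schwartz: "\<phi> \<in> schwartz \<Longrightarrow> \<psi> \<in> schwartz \<Longrightarrow> convolution \<phi> \<psi> \<in> schwartz"
  using schwartz_integral_line[OF convolution_family, of \<phi> \<psi>] by (simp add: convolution_def[abs_def])

text \<open>The convolution is a superposition of the translates of \<open>\<psi>\<close> with
  density \<open>\<phi>\<close>, through which \<Lambda> passes.\<close>

lemma tempered_convolution:
  assumes "\<Lambda> \<in> tempered" "\<phi> \<in> schwartz" "\<psi> \<in> schwartz"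
  shows "\<Lambda> (convolution \<phi> \<psi>) = (\<integral>x. \<phi> x * \<Lambda> (translate x \<psi>) \<partial>lborel)"
proof -
  have "\<Lambda> (\<lambda>t. \<integral>x. \<phi> x * nth_deriv 0 \<psi> (t - x) \<partial>lborel) = (\<integral>x. \<Lambda> (\<lambda>t. \<phi> x * nth_deriv 0 \<psi> (t - x)) \<partial>lborel)"
    using tempered_integral_line[OF convolution_family[OF assms(2,3)] assms(1)] .
  then show ?thesis
    using tempered_cmult[OF assms(1), where \<phi>="translate _ \<psi>"]
    by (simp add: convolution_def[abs_def] translate_def[abs_def])
qed

section \<open>Time-frequency shifts\<close>

definition time_freq :: "real \<Rightarrow> real \<Rightarrow> (real \<Rightarrow> complex) \<Rightarrow> real \<Rightarrow> complex" where
  "time_freq y \<eta> \<psi> = modul \<eta> (translate y \<psi>)"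

definition time_freq_seq :: "(real \<Rightarrow> complex) \<Rightarrow> nat \<Rightarrow> real \<times> real \<Rightarrow> real \<Rightarrow> complex" where
  "time_freq_seq \<psi> n p = leibniz n (cis_seq (snd p)) (\<lambda>j t. nth_deriv j \<psi> (t - fst p))"

lemma time_freq_seq_0: "time_freq_seq \<psi> 0 p = time_freq (fst p) (snd p) \<psi>"
  by (auto simp: time_freq_seq_def time_freq_def modul_def translate_def cis_seq_def fun_eq_iff)

lemma schwartz_time_freq [simp]: "time_freq y \<eta> \<psi> \<in> schwartz \<longleftrightarrow> \<psi> \<in> schwartz"
  by (simp add: time_freq_def)

lemma continuous_on_leibniz:
  assumes "\<And>i. continuous_on S (\<lambda>p. D i p (\<tau> p))" "\<And>i. continuous_on S (\<lambda>p. E i p (\<tau> p))"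
  shows "continuous_on S (\<lambda>p. leibniz n (\<lambda>i. D i p) (\<lambda>i. E i p) (\<tau> p))"
  using assms
proof (induction n arbitrary: D E)
  case (Suc n)
  have "continuous_on S (\<lambda>p. leibniz n (\<lambda>i. D (Suc i) p) (\<lambda>i. E i p) (\<tau> p))"
    "continuous_on S (\<lambda>p. leibniz n (\<lambda>i. D i p) (\<lambda>i. E (Suc i) p) (\<tau> p))"
    by (rule Suc.IH; use Suc.prems in blast)+
  then show ?case by (auto intro: continuous_on_add)
qed (auto intro: continuous_on_mult)

lemma continuous_time_freq_seq:
  assumes "\<psi> \<in> schwartz"
  shows "continuous_on UNIV (\<lambda>(p, t). time_freq_seq \<psi> n p t)"
proof -
  have "continuous_on UNIV (\<lambda>x. leibniz n (\<lambda>i. cis_seq (snd (fst x)) i) (\<lambda>j t. nth_deriv j \<psi> (t - fst (fst x))) (snd x))"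
  proof (rule continuous_on_leibniz)
    show "continuous_on UNIV (\<lambda>x. nth_deriv i \<psi> (snd x - fst (fst x)))" for i
      by (rule continuous_on_compose2[OF schwartz_nth_deriv_continuous[OF assms, of UNIV]])
        (auto intro!: continuous_intros)
    show "continuous_on UNIV (\<lambda>x. cis_seq (snd (fst x)) i (snd x))" for i
      unfolding cis_seq_def by (intro continuous_intros)
  qed
  then show ?thesis by (simp add: time_freq_seq_def case_prod_beta)
qed

lemma deriv_seq_time_freq: "\<psi> \<in> schwartz \<Longrightarrow> deriv_seq (\<lambda>n. time_freq_seq \<psi> n p)"
  unfolding time_freq_seq_def
  by (intro deriv_seq_leibniz deriv_seq_cis deriv_seq_translate schwartz_deriv_seq)

lemma leibniz_weight_le:
  assumes "0 < w" "\<And>i. i \<le> n \<Longrightarrow> cmod (D i t) \<le> a" "\<And>i. i \<le> n \<Longrightarrow> w * cmod (E i t) \<le> b"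
  shows "w * cmod (leibniz n D E t) \<le> 2 ^ n * (a * b)"
proof -
  have "cmod (leibniz n D E t) \<le> 2 ^ n * (a * (b / w))"
    using assms by (intro leibniz_le) (auto simp: field_simps)
  with assms(1) show ?thesis by (simp add: field_simps)
qed

text \<open>The weight is paid for by the position (power \<open>k\<close>), the derivatives by the
  frequency (power \<open>n\<close>); \<open>2 * pi < 8\<close> gives the base 8.\<close>

lemma time_freq_seq_bound:
  assumes "\<psi> \<in> schwartz"
  obtains B where "0 \<le> B" "\<And>p t. (1 + t\<^sup>2) ^ k * cmod (time_freq_seq \<psi> n p t) \<le> B * ((1 + (fst p)\<^sup>2) ^ k * (1 + (snd p)\<^sup>2) ^ n)"
proof -
  obtain C where C: "0 \<le> C" "\<And>i t. i \<le> n \<Longrightarrow> (1 + t\<^sup>2) ^ k * cmod (nth_deriv i \<psi> t) \<le> C"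
    using schwartz_bound_upto[OF assms] by blast
  have "(1 + t\<^sup>2) ^ k * cmod (time_freq_seq \<psi> n p t) \<le> 2 ^ n * ((8 ^ n * (1 + (snd p)\<^sup>2) ^ n) * ((2 * (1 + (fst p)\<^sup>2)) ^ k * C))" for p t
    unfolding time_freq_seq_def
  proof (rule leibniz_weight_le)
    show "0 < (1 + t\<^sup>2) ^ k" by (simp add: add_pos_nonneg)
    fix i assume i: "i \<le> n"
    have "\<bar>snd p\<bar> \<le> 1 + (snd p)\<^sup>2" using abs_power_le_weight[of "snd p" 1] by simp
    moreover have "pi < 4" using pi_less_4 .
    ultimately have "2 * pi * \<bar>snd p\<bar> \<le> 8 * (1 + (snd p)\<^sup>2)"
      by (intro mult_mono) auto
    then have "(2 * pi * \<bar>snd p\<bar>) ^ i \<le> (8 * (1 + (snd p)\<^sup>2)) ^ i"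
      by (intro power_mono) auto
    also have "\<dots> \<le> (8 * (1 + (snd p)\<^sup>2)) ^ n"
      using i by (intro power_increasing) (auto intro: order_trans[of _ 8])
    finally show "cmod (cis_seq (snd p) i t) \<le> 8 ^ n * (1 + (snd p)\<^sup>2) ^ n"
      by (simp only: norm_cis_seq power_mult_distrib)
    have "(1 + t\<^sup>2) ^ k * cmod (nth_deriv i \<psi> (t - fst p)) \<le>
      ((2 * (1 + (fst p)\<^sup>2)) ^ k * (1 + (t - fst p)\<^sup>2) ^ k) * cmod (nth_deriv i \<psi> (t - fst p))"
      by (intro mult_right_mono weight_shift) auto
    also have "\<dots> \<le> (2 * (1 + (fst p)\<^sup>2)) ^ k * C"
      unfolding mult.assoc using C(2)[OF i, of "t - fst p"] by (intro mult_left_mono) auto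
    finally show "(1 + t\<^sup>2) ^ k * cmod (nth_deriv i \<psi> (t - fst p)) \<le> (2 * (1 + (fst p)\<^sup>2)) ^ k * C" .
  qed
  then have "(1 + t\<^sup>2) ^ k * cmod (time_freq_seq \<psi> n p t) \<le> (2 ^ n * 8 ^ n * 2 ^ k * C) * ((1 + (fst p)\<^sup>2) ^ k * (1 + (snd p)\<^sup>2) ^ n)" for p t
    by (simp only: power_mult_distrib mult_ac)
  with that[of "2 ^ n * 8 ^ n * 2 ^ k * C"] C(1) show ?thesis by simp
qed

text \<open>The bounds grow polynomially with the parameter, hence the restriction to bounded sets;
  for continuity at a point a ball is enough.\<close>

lemma time_freq_family:
  assumes "\<psi> \<in> schwartz" "bounded W"
  shows "schwartz_family W (time_freq_seq \<psi>)"
  unfolding schwartz_family_def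
proof (intro conjI allI ballI)
  show "continuous_on (W \<times> UNIV) (\<lambda>(p, t). time_freq_seq \<psi> n p t)" for n
    by (rule continuous_on_subset[OF continuous_time_freq_seq[OF assms(1)]]) simp
  show "deriv_seq (\<lambda>n. time_freq_seq \<psi> n p)" for p by (rule deriv_seq_time_freq[OF assms(1)])
  fix k n
  obtain R where R: "\<And>p. p \<in> W \<Longrightarrow> norm p \<le> R" using assms(2) unfolding bounded_iff by blast
  obtain B where B: "0 \<le> B" "\<And>p t. (1 + t\<^sup>2) ^ k * cmod (time_freq_seq \<psi> n p t) \<le> B * ((1 + (fst p)\<^sup>2) ^ k * (1 + (snd p)\<^sup>2) ^ n)"
    using time_freq_seq_bound[OF assms(1)] by blast
  show "\<exists>B. \<forall>p\<in>W. \<forall>t. (1 + t\<^sup>2) ^ k * cmod (time_freq_seq \<psi> n p t) \<le> B"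
  proof (intro exI ballI allI order_trans[OF B(2)])
    fix p t assume "p \<in> W"
    then have "\<bar>fst p\<bar> \<le> R" "\<bar>snd p\<bar> \<le> R"
      using R[of p] norm_fst_le[of "fst p" "snd p"] norm_snd_le[of "snd p" "fst p"] by auto
    then have "(fst p)\<^sup>2 \<le> R\<^sup>2" "(snd p)\<^sup>2 \<le> R\<^sup>2" by (auto intro: abs_le_square_iff[THEN iffD1] order_trans[OF _ abs_ge_self])
    then show "B * ((1 + (fst p)\<^sup>2) ^ k * (1 + (snd p)\<^sup>2) ^ n) \<le> B * ((1 + R\<^sup>2) ^ k * (1 + R\<^sup>2) ^ n)"
      using B(1) by (intro mult_left_mono mult_mono power_mono) auto
  qed
qed

text \<open>The pairing is bilinear: in the usual notation this is the transform with window
  \<open>cnj \<psi>\<close> at the frequency \<open>- \<eta>\<close>.\<close>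

definition stft :: "(real \<Rightarrow> complex) \<Rightarrow> functional \<Rightarrow> real \<Rightarrow> real \<Rightarrow> complex" where
  "stft \<psi> \<Lambda> y \<eta> = \<Lambda> (time_freq y \<eta> \<psi>)"

lemma continuous_stft:
  assumes "\<Lambda> \<in> tempered" "\<psi> \<in> schwartz"
  shows "continuous_on S (\<lambda>p. stft \<psi> \<Lambda> (fst p) (snd p))"
proof (rule continuous_on_subset)
  show "continuous_on UNIV (\<lambda>p. stft \<psi> \<Lambda> (fst p) (snd p))"
    unfolding continuous_on_eq_continuous_within
  proof
    fix z :: "real \<times> real"
    have "continuous_on (ball z 1) (\<lambda>p. \<Lambda> (time_freq_seq \<psi> 0 p))"
      by (rule tempered_continuous_on[OF assms(1) time_freq_family[OF assms(2) bounded_ball]])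
    then have "continuous (at z) (\<lambda>p. \<Lambda> (time_freq_seq \<psi> 0 p))"
      by (simp add: continuous_on_eq_continuous_at)
    then show "continuous (at z) (\<lambda>p. stft \<psi> \<Lambda> (fst p) (snd p))"
      by (simp add: time_freq_seq_0 stft_def)
  qed
qed simp

lemma continuous_stft_compose:
  assumes "\<Lambda> \<in> tempered" "\<psi> \<in> schwartz" "continuous_on S f" "continuous_on S h"
  shows "continuous_on S (\<lambda>x. stft \<psi> \<Lambda> (f x) (h x))"
  using continuous_on_compose2[OF continuous_stft[OF assms(1,2), of UNIV] continuous_on_Pair[OF assms(3,4)]] by simp

lemma measurable_stft:
  assumes "\<Lambda> \<in> tempered" "\<psi> \<in> schwartz" "f \<in> borel_measurable M" "h \<in> borel_measurable M"
  shows "(\<lambda>x. stft \<psi> \<Lambda> (f x) (h x)) \<in> borel_measurable M"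
proof -
  have "(\<lambda>p. stft \<psi> \<Lambda> (fst p) (snd p)) \<in> borel_measurable borel"
    by (rule measurable_continuous_UNIV[OF continuous_stft[OF assms(1,2)]])
  then have 1: "(\<lambda>p. stft \<psi> \<Lambda> (fst p) (snd p)) \<in> borel_measurable (borel \<Otimes>\<^sub>M borel)"
    by (simp add: borel_prod)
  have 2: "(\<lambda>x. (f x, h x)) \<in> M \<rightarrow>\<^sub>M borel \<Otimes>\<^sub>M borel" using assms(3,4) by measurable
  from measurable_compose[OF 2 1] show ?thesis by simp
qed

subsection \<open>The Fourier transform\<close>

definition fourier :: "(real \<Rightarrow> complex) \<Rightarrow> real \<Rightarrow> complex" where
  "fourier \<theta> \<eta> = (\<integral>s. \<theta> s * cis (- (2 * pi * \<eta> * s)) \<partial>lborel)"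

lemma schwartz_nth_deriv: "f \<in> schwartz \<Longrightarrow> nth_deriv n f \<in> schwartz"
proof -
  assume f: "f \<in> schwartz"
  have "deriv_seq (\<lambda>m. nth_deriv (m + n) f)"
    using schwartz_deriv_seq[OF f] by (auto simp: deriv_seq_def)
  moreover have "rapid (\<lambda>m. nth_deriv (m + n) f)"
    using schwartz_rapid[OF f] unfolding rapid_def by blast
  ultimately show ?thesis using schwartzI by fastforce
qed

lemma schwartz_tendsto_0:
  assumes "f \<in> schwartz"
  shows "(f \<longlongrightarrow> 0) at_top" "(f \<longlongrightarrow> 0) at_bot"
proof -
  obtain B where B: "0 \<le> B" "\<And>t. cmod (f t) \<le> B * kern t" using schwartz_le_kern[OF assms] by blast
  have "filterlim (\<lambda>t::real. 1 + t\<^sup>2) at_top at_top" by real_asymp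
  then have 1: "(kern \<longlongrightarrow> 0) at_top" unfolding kern_def[abs_def] by (rule tendsto_inverse_0_at_top)
  have "filterlim (\<lambda>t::real. 1 + t\<^sup>2) at_top at_bot" by real_asymp
  then have 2: "(kern \<longlongrightarrow> 0) at_bot" unfolding kern_def[abs_def] by (rule tendsto_inverse_0_at_top)
  have "\<forall>\<^sub>F t in F. norm (f t) \<le> norm (kern t) * B" for F
    using B kern_nonneg by (intro always_eventually) (simp add: mult.commute)
  then show "(f \<longlongrightarrow> 0) at_top" "(f \<longlongrightarrow> 0) at_bot" using 1 2 by (blast intro: tendsto_0_le)+
qed

lemma integral_schwartz_deriv:
  assumes f: "f \<in> schwartz"
  shows "(\<integral>t. nth_deriv 1 f t \<partial>lborel) = 0"
proof -
  have "(LBINT x=-\<infinity>..\<infinity>. nth_deriv 1 f x) = 0 - 0"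
  proof (rule interval_integral_FTC_integrable[where F=f])
    show "(f has_vector_derivative nth_deriv 1 f x) (at x)" for x
    proof -
      have "(nth_deriv 0 f has_vector_derivative nth_deriv (Suc 0) f x) (at x)"
        using schwartz_deriv_seq[OF f] unfolding deriv_seq_def by blast
      then show ?thesis by simp
    qed
    show "isCont (nth_deriv 1 f) x" for x
      using schwartz_nth_deriv_continuous[OF f, of UNIV 1] by (simp add: continuous_on_eq_continuous_at)
    show "set_integrable lborel (einterval (- \<infinity>) \<infinity>) (nth_deriv 1 f)"
      using schwartz_integrable[OF schwartz_nth_deriv[OF f, of 1]] by (simp add: set_integrable_def)
    show "((f \<circ> real_of_ereal) \<longlongrightarrow> 0) (at_right (- \<infinity>))"
      using schwartz_tendsto_0(2)[OF f] by (simp add: ereal_tendsto_simps)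
    show "((f \<circ> real_of_ereal) \<longlongrightarrow> 0) (at_left \<infinity>)"
      using schwartz_tendsto_0(1)[OF f] by (simp add: ereal_tendsto_simps)
  qed simp
  then show ?thesis by (simp add: interval_lebesgue_integral_def set_lebesgue_integral_def)
qed

text \<open>Integration by parts: the derivative of \<open>\<theta>\<close> times the character has
  integral 0.\<close>

lemma fourier_deriv:
  assumes "\<theta> \<in> schwartz"
  shows "fourier (nth_deriv 1 \<theta>) \<eta> = 2 * pi * \<i> * \<eta> * fourier \<theta> \<eta>"
proof -
  have "time_freq_seq \<theta> 0 (0, - \<eta>) \<in> schwartz" using assms by (simp add: time_freq_seq_0)
  from integral_schwartz_deriv[OF this]
  have "(\<integral>s. time_freq_seq \<theta> 1 (0, - \<eta>) s \<partial>lborel) = 0"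
    by (simp add: nth_deriv_deriv_seq[OF deriv_seq_time_freq[OF assms], of 1, simplified])
  moreover have "time_freq_seq \<theta> 1 (0, - \<eta>) s = nth_deriv 1 \<theta> s * cis (- (2 * pi * \<eta> * s)) -
       2 * pi * \<i> * \<eta> * (\<theta> s * cis (- (2 * pi * \<eta> * s)))" for s
    by (simp add: time_freq_seq_def cis_seq_def algebra_simps)
  moreover have "integrable lborel (\<lambda>s. \<psi> s * cis (- (2 * pi * \<eta> * s)))" if "\<psi> \<in> schwartz" for \<psi>
  proof -
    have "continuous_on UNIV (\<lambda>s. cis (- (2 * pi * \<eta> * s)))" by (intro continuous_intros)
    from integrable_mult_schwartz[OF that measurable_continuous_UNIV[OF this], of 1]
    show ?thesis by (simp add: mult.commute)
  qed
  ultimately show ?thesis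
    using assms schwartz_nth_deriv[OF assms, of 1] by (simp add: fourier_def)
qed

lemma fourier_le:
  assumes "\<theta> \<in> schwartz"
  shows "cmod (fourier \<theta> \<eta>) \<le> (\<integral>s. cmod (\<theta> s) \<partial>lborel)"
  unfolding fourier_def
  using integral_norm_bound[of lborel "\<lambda>s. \<theta> s * cis (- (2 * pi * \<eta> * s))"] by (simp add: norm_mult)

text \<open>Two derivatives produce \<open>(2 * pi * \<eta>)\<^sup>2\<close> up to sign, which
  dominates \<open>\<eta>\<^sup>2\<close>.\<close>

lemma fourier_weight:
  assumes "\<theta> \<in> schwartz"
  shows "(1 + \<eta>\<^sup>2) * cmod (fourier \<theta> \<eta>) \<le> cmod (fourier \<theta> \<eta>) + cmod (fourier (nth_deriv 2 \<theta>) \<eta>)"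
proof -
  have "nth_deriv 2 \<theta> = nth_deriv 1 (nth_deriv 1 \<theta>)" by (simp add: numeral_2_eq_2)
  then have "fourier (nth_deriv 2 \<theta>) \<eta> = 2 * pi * \<i> * \<eta> * (2 * pi * \<i> * \<eta> * fourier \<theta> \<eta>)"
    using fourier_deriv[OF assms, of \<eta>] fourier_deriv[OF schwartz_nth_deriv[OF assms, of 1], of \<eta>] by simp
  then have "cmod (fourier (nth_deriv 2 \<theta>) \<eta>) = (2 * pi)\<^sup>2 * (\<eta>\<^sup>2 * cmod (fourier \<theta> \<eta>))"
    by (simp add: norm_mult power2_eq_square)
  moreover have "1 * (\<eta>\<^sup>2 * cmod (fourier \<theta> \<eta>)) \<le> (2 * pi)\<^sup>2 * (\<eta>\<^sup>2 * cmod (fourier \<theta> \<eta>))"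
    using pi_ge_two by (intro mult_right_mono one_le_power) auto
  ultimately show ?thesis by (simp add: distrib_right)
qed

text \<open>Each power of the weight is traded for two more derivatives, so the induction runs over
  all \<open>\<theta>\<close>.\<close>

lemma fourier_rapid:
  assumes "\<theta> \<in> schwartz"
  shows "\<exists>C. \<forall>\<eta>. (1 + \<eta>\<^sup>2) ^ k * cmod (fourier \<theta> \<eta>) \<le> C"
  using assms
proof (induction k arbitrary: \<theta>)
  case 0
  then show ?case using fourier_le by auto
next
  case (Suc k)
  obtain C1 C2 where C: "\<And>\<eta>. (1 + \<eta>\<^sup>2) ^ k * cmod (fourier \<theta> \<eta>) \<le> C1"
    "\<And>\<eta>. (1 + \<eta>\<^sup>2) ^ k * cmod (fourier (nth_deriv 2 \<theta>) \<eta>) \<le> C2"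
    using Suc.IH[OF Suc.prems] Suc.IH[OF schwartz_nth_deriv[OF Suc.prems, of 2]] by blast
  have "(1 + \<eta>\<^sup>2) ^ Suc k * cmod (fourier \<theta> \<eta>) \<le> C1 + C2" for \<eta>
  proof -
    have "(1 + \<eta>\<^sup>2) ^ k * ((1 + \<eta>\<^sup>2) * cmod (fourier \<theta> \<eta>)) \<le>
        (1 + \<eta>\<^sup>2) ^ k * (cmod (fourier \<theta> \<eta>) + cmod (fourier (nth_deriv 2 \<theta>) \<eta>))"
      by (intro mult_left_mono fourier_weight Suc.prems) simp
    moreover have "(1 + \<eta>\<^sup>2) ^ Suc k * cmod (fourier \<theta> \<eta>) = (1 + \<eta>\<^sup>2) ^ k * ((1 + \<eta>\<^sup>2) * cmod (fourier \<theta> \<eta>))"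
      by (simp only: power_Suc mult_ac)
    ultimately show ?thesis using C[of \<eta>] unfolding distrib_left by linarith
  qed
  then show ?case by blast
qed

lemma integrable_kern_kern:
  fixes f :: "real \<times> real \<Rightarrow> 'a::{banach, second_countable_topology}"
  assumes "f \<in> borel_measurable borel" "\<And>x y. norm (f (x, y)) \<le> B * (kern x * kern y)"
  shows "integrable (lborel \<Otimes>\<^sub>M lborel) f"
proof (rule Bochner_Integration.integrable_bound)
  have "integrable (lborel \<Otimes>\<^sub>M lborel) (\<lambda>p. kern (fst p) * kern (snd p))"
  proof (rule lborel_pair.Fubini_integrable)
    show "integrable lborel (\<lambda>x. \<integral>y. norm (kern (fst (x, y)) * kern (snd (x, y))) \<partial>lborel)"
      using integrable_kern by (simp add: abs_mult kern_nonneg)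
    show "AE x in lborel. integrable lborel (\<lambda>y. kern (fst (x, y)) * kern (snd (x, y)))"
      using integrable_kern by simp
  qed measurable
  then show "integrable (lborel \<Otimes>\<^sub>M lborel) (\<lambda>p. B * (kern (fst p) * kern (snd p)))" by simp
  show "AE p in lborel \<Otimes>\<^sub>M lborel. norm (f p) \<le> norm (B * (kern (fst p) * kern (snd p)))"
  proof (intro AE_I2)
    fix p :: "real \<times> real"
    have "norm (f p) \<le> B * (kern (fst p) * kern (snd p))" using assms(2)[of "fst p" "snd p"] by simp
    also have "\<dots> \<le> norm (B * (kern (fst p) * kern (snd p)))" by simp
    finally show "norm (f p) \<le> norm (B * (kern (fst p) * kern (snd p)))" .
  qed
  show "f \<in> borel_measurable (lborel \<Otimes>\<^sub>M lborel)"
    using assms(1) by (simp add: lborel_prod)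
qed

subsection \<open>Fourier inversion\<close>

lemma integral_std_normal_cis:
  "(\<integral>x. cis (\<tau> * x) * std_normal_density x \<partial>lborel) = exp (- \<tau>\<^sup>2 / 2)"
proof -
  have "char std_normal_distribution \<tau> = (\<integral>x. std_normal_density x *\<^sub>R iexp (\<tau> * x) \<partial>lborel)"
    unfolding char_def by (subst integral_density) auto
  also have "\<dots> = (\<integral>x. cis (\<tau> * x) * std_normal_density x \<partial>lborel)"
    by (intro Bochner_Integration.integral_cong) (auto simp: scaleR_conv_of_real cis_conv_exp)
  finally show ?thesis by (simp add: char_std_normal_distribution)
qed

lemma integral_scaled_std_normal_cis:
  assumes "0 < \<delta>"
  shows "(\<integral>\<eta>. cis (2 * pi * \<eta> * t) * std_normal_density (\<delta> * \<eta>) \<partial>lborel) =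
     of_real (sqrt (2 * pi) / \<delta> * std_normal_density (2 * pi * t / \<delta>))"
proof -
  have "(\<integral>\<eta>. cis (2 * pi * \<eta> * t) * std_normal_density (\<delta> * \<eta>) \<partial>lborel) =
    (1 / \<delta>) *\<^sub>R (\<integral>x. cis (2 * pi * (0 + 1 / \<delta> * x) * t) * std_normal_density (\<delta> * (0 + 1 / \<delta> * x)) \<partial>lborel)"
    using assms by (subst lborel_integral_real_affine[where c="1 / \<delta>" and t=0]) auto
  also have "\<dots> = (1 / \<delta>) *\<^sub>R (\<integral>x. cis ((2 * pi * t / \<delta>) * x) * std_normal_density x \<partial>lborel)"
    using assms by (simp add: mult_ac)
  also have "\<dots> = of_real (sqrt (2 * pi) / \<delta> * std_normal_density (2 * pi * t / \<delta>))"
    unfolding integral_std_normal_cis using assms by (simp add: std_normal_density_def scaleR_conv_of_real)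
  finally show ?thesis .
qed

lemma std_normal_density_le_1: "std_normal_density x \<le> 1"
proof -
  have "1 \<le> sqrt (2 * pi)" using pi_ge_two by simp
  then have "exp (- x\<^sup>2 / 2) \<le> sqrt (2 * pi)" by (rule order_trans[rotated]) simp
  then show ?thesis by (simp add: std_normal_density_def)
qed

lemma continuous_std_normal_density [continuous_intros]:
  "continuous_on S f \<Longrightarrow> continuous_on S (\<lambda>x. std_normal_density (f x))"
  unfolding std_normal_density_def by (intro continuous_intros) auto

lemma std_normal_density_le_kern:
  assumes "0 < \<delta>"
  obtains C where "0 \<le> C" "\<And>x. std_normal_density (\<delta> * x) \<le> C * kern x"
proof -
  have "(\<lambda>x. complex_of_real (exp (- (\<delta>\<^sup>2 / 2) * x\<^sup>2))) \<in> schwartz"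
    using assms by (intro schwartz_gauss) simp
  then obtain C where C: "0 \<le> C" "\<And>x. cmod (of_real (exp (- (\<delta>\<^sup>2 / 2) * x\<^sup>2))) \<le> C * kern x"
    using schwartz_le_kern by blast
  have "std_normal_density (\<delta> * x) \<le> C * kern x" for x
  proof -
    have "std_normal_density (\<delta> * x) = (1 / sqrt (2 * pi)) * exp (- (\<delta>\<^sup>2 / 2) * x\<^sup>2)"
      by (simp add: std_normal_density_def power_mult_distrib)
    also have "\<dots> \<le> 1 * exp (- (\<delta>\<^sup>2 / 2) * x\<^sup>2)"
      using pi_ge_two by (intro mult_right_mono) auto
    finally show ?thesis using C(2)[of x] by simp
  qed
  with C(1) that show ?thesis by blast
qed

text \<open>The coefficient of a test function in the inversion formula. For Schwartz windows it is
  \<open>stft H (distr_of \<phi>)\<close> at the opposite frequency (\<open>cross_eq_stft\<close>);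
  as a Fourier transform it has explicit decay.\<close>

definition cross :: "(real \<Rightarrow> complex) \<Rightarrow> (real \<Rightarrow> complex) \<Rightarrow> real \<Rightarrow> real \<Rightarrow> complex" where
  "cross \<phi> H y \<eta> = fourier (\<lambda>s. \<phi> s * H (s - y)) \<eta>"

lemma cross_eq_stft:
  assumes "H \<in> schwartz"
  shows "cross \<phi> H y \<eta> = stft H (distr_of \<phi>) y (- \<eta>)"
  using assms unfolding cross_def stft_def distr_of_def fourier_def
  by (auto simp: time_freq_def modul_def translate_def mult_ac intro!: Bochner_Integration.integral_cong)

lemma schwartz_cross_product:
  assumes "\<phi> \<in> schwartz" "H \<in> schwartz"
  shows "(\<lambda>s. \<phi> s * H (s - y)) \<in> schwartz"
  using schwartz_mult[OF assms(1) schwartz_ops(1)[OF assms(2), of y]] by (simp add: translate_def)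

lemma fourier_measurable:
  assumes "\<theta> \<in> schwartz"
  shows "fourier \<theta> \<in> borel_measurable borel"
proof -
  have "(\<lambda>\<eta>. \<integral>s. (\<lambda>(\<eta>, s). \<theta> s * cis (- (2 * pi * \<eta> * s))) (\<eta>, s) \<partial>lborel) \<in> borel_measurable borel"
  proof (rule lborel.borel_measurable_lebesgue_integral)
    have "continuous_on UNIV (\<lambda>p. \<theta> (snd p) * cis (- (2 * pi * fst p * snd p)))"
      by (intro continuous_intros continuous_on_compose2[OF schwartz_continuous[OF assms, of UNIV]]) auto
    from measurable_continuous_UNIV[OF this]
    show "case_prod (\<lambda>\<eta> s. (\<lambda>(\<eta>, s). \<theta> s * cis (- (2 * pi * \<eta> * s))) (\<eta>, s)) \<in> borel_measurable (borel \<Otimes>\<^sub>M lborel)"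
      unfolding measurable_cong_sets[OF sets_pair_measure_cong[OF refl sets_lborel] refl]
      by (simp add: case_prod_beta borel_prod)
  qed
  then show ?thesis by (simp add: fourier_def[abs_def])
qed

lemma fourier_le_kern:
  assumes "\<theta> \<in> schwartz"
  obtains C where "\<And>\<eta>. cmod (fourier \<theta> \<eta>) \<le> C * kern \<eta>"
proof -
  obtain C where C: "\<And>\<eta>. (1 + \<eta>\<^sup>2) ^ 1 * cmod (fourier \<theta> \<eta>) \<le> C"
    using fourier_rapid[OF assms] by blast
  have "cmod (fourier \<theta> \<eta>) \<le> C * kern \<eta>" for \<eta> by (rule le_kernI) (use C[of \<eta>] in simp)
  with that show ?thesis by blast
qed

text \<open>A Gaussian factor \<open>?N (\<delta> m * \<eta>)\<close> makes the double integral
  absolutely convergent. Fubini turns the damped integral into a Gaussian average of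
  \<open>\<theta>\<close> near \<open>t\<close>; as \<open>\<delta> m\<close> tends to 0 both sides
  carry the factor \<open>1 / sqrt (2 * pi)\<close>, which cancels.\<close>

theorem fourier_inversion:
  assumes \<theta>: "\<theta> \<in> schwartz"
  shows "(\<integral>\<eta>. fourier \<theta> \<eta> * cis (2 * pi * \<eta> * t) \<partial>lborel) = \<theta> t"
proof -
  let ?N = std_normal_density
  define \<delta> where "\<delta> m = inverse (real (Suc m))" for m
  have \<delta>: "\<delta> m > 0" for m by (simp add: \<delta>_def)
  have \<delta>0: "\<delta> \<longlonglongrightarrow> 0" unfolding \<delta>_def by (rule LIMSEQ_inverse_real_of_nat)
  obtain B where B: "0 \<le> B" "\<And>t. cmod (\<theta> t) \<le> B * kern t" using schwartz_le_kern[OF \<theta>] by blast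
  obtain C where C: "\<And>\<eta>. cmod (fourier \<theta> \<eta>) \<le> C * kern \<eta>" using fourier_le_kern[OF \<theta>] by blast
  define a where "a m = (\<integral>\<eta>. fourier \<theta> \<eta> * (cis (2 * pi * \<eta> * t) * ?N (\<delta> m * \<eta>)) \<partial>lborel)" for m
  have N_meas [measurable]: "(\<lambda>\<eta>. complex_of_real (?N (c * \<eta>))) \<in> borel_measurable borel" for c
    by (intro measurable_continuous_UNIV continuous_intros)
  have cis_meas [measurable]: "(\<lambda>\<eta>. cis (c * \<eta>)) \<in> borel_measurable borel" for c
    by (intro measurable_continuous_UNIV continuous_intros)
  have cis_meas' [measurable]: "(\<lambda>\<eta>. cis (2 * pi * \<eta> * t)) \<in> borel_measurable borel"
    by (intro measurable_continuous_UNIV continuous_intros)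
  note [measurable] = fourier_measurable[OF \<theta>] schwartz_measurable[OF \<theta>]
  have lim1: "a \<longlonglongrightarrow> (\<integral>\<eta>. fourier \<theta> \<eta> * (cis (2 * pi * \<eta> * t) * ?N 0) \<partial>lborel)"
    unfolding a_def
  proof (rule integral_dominated_convergence[where w="\<lambda>\<eta>. C * kern \<eta>"])
    show "integrable lborel (\<lambda>\<eta>. C * kern \<eta>)" using integrable_kern by simp
    show "AE \<eta> in lborel. (\<lambda>m. fourier \<theta> \<eta> * (cis (2 * pi * \<eta> * t) * ?N (\<delta> m * \<eta>))) \<longlonglongrightarrow> fourier \<theta> \<eta> * (cis (2 * pi * \<eta> * t) * ?N 0)"
    proof (intro AE_I2 tendsto_intros)
      fix \<eta>
      have "(\<lambda>m. \<delta> m * \<eta>) \<longlonglongrightarrow> 0" using tendsto_mult[OF \<delta>0 tendsto_const[of \<eta>]] by simp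
      moreover have "isCont ?N 0"
        using continuous_std_normal_density[OF continuous_on_id, of UNIV] by (simp add: continuous_on_eq_continuous_at)
      ultimately show "(\<lambda>m. ?N (\<delta> m * \<eta>)) \<longlonglongrightarrow> ?N 0" by (rule isCont_tendsto_compose[rotated])
    qed
    show "AE \<eta> in lborel. norm (fourier \<theta> \<eta> * (cis (2 * pi * \<eta> * t) * ?N (\<delta> m * \<eta>))) \<le> C * kern \<eta>" for m
    proof (intro AE_I2)
      fix \<eta>
      have "norm (fourier \<theta> \<eta> * (cis (2 * pi * \<eta> * t) * ?N (\<delta> m * \<eta>))) = cmod (fourier \<theta> \<eta>) * ?N (\<delta> m * \<eta>)"
        by (simp add: norm_mult)
      also have "\<dots> \<le> cmod (fourier \<theta> \<eta>) * 1" by (intro mult_left_mono std_normal_density_le_1) simp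
      finally show "norm (fourier \<theta> \<eta> * (cis (2 * pi * \<eta> * t) * ?N (\<delta> m * \<eta>))) \<le> C * kern \<eta>" using C[of \<eta>] by simp
    qed
  qed measurable
  have a: "a m = (\<integral>u. \<theta> (t - \<delta> m / (2 * pi) * u) * ?N u \<partial>lborel) / sqrt (2 * pi)" for m
  proof -
    obtain D where D: "0 \<le> D" "\<And>x. ?N (\<delta> m * x) \<le> D * kern x" using std_normal_density_le_kern[OF \<delta>] by blast
    have "a m = (\<integral>\<eta>. \<integral>s. \<theta> s * cis (- (2 * pi * \<eta> * s)) * (cis (2 * pi * \<eta> * t) * ?N (\<delta> m * \<eta>)) \<partial>lborel \<partial>lborel)"
      by (simp add: a_def fourier_def)
    also have "\<dots> = (\<integral>s. \<integral>\<eta>. \<theta> s * cis (- (2 * pi * \<eta> * s)) * (cis (2 * pi * \<eta> * t) * ?N (\<delta> m * \<eta>)) \<partial>lborel \<partial>lborel)"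
    proof (rule lborel_pair.Fubini_integral)
      show "integrable (lborel \<Otimes>\<^sub>M lborel) (\<lambda>(s, \<eta>). \<theta> s * cis (- (2 * pi * \<eta> * s)) * (cis (2 * pi * \<eta> * t) * ?N (\<delta> m * \<eta>)))"
      proof (rule integrable_kern_kern)
        have "continuous_on UNIV (\<lambda>p. \<theta> (fst p) * cis (- (2 * pi * snd p * fst p)) * (cis (2 * pi * snd p * t) * ?N (\<delta> m * snd p)))"
          by (intro continuous_intros continuous_on_compose2[OF schwartz_continuous[OF \<theta>, of UNIV]]) auto
        then show "(\<lambda>(s, \<eta>). \<theta> s * cis (- (2 * pi * \<eta> * s)) * (cis (2 * pi * \<eta> * t) * ?N (\<delta> m * \<eta>))) \<in> borel_measurable borel"
          by (simp add: case_prod_beta measurable_continuous_UNIV)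
        fix s \<eta>
        have "cmod (\<theta> s) * ?N (\<delta> m * \<eta>) \<le> (B * kern s) * (D * kern \<eta>)"
          using B D kern_nonneg[of s] by (intro mult_mono) auto
        then show "norm (case (s, \<eta>) of (s, \<eta>) \<Rightarrow> \<theta> s * cis (- (2 * pi * \<eta> * s)) * (cis (2 * pi * \<eta> * t) * ?N (\<delta> m * \<eta>))) \<le> B * D * (kern s * kern \<eta>)"
          by (simp add: norm_mult mult_ac)
      qed
    qed
    also have "\<dots> = (\<integral>s. \<theta> s * (\<integral>\<eta>. cis (2 * pi * \<eta> * (t - s)) * ?N (\<delta> m * \<eta>) \<partial>lborel) \<partial>lborel)"
    proof (intro Bochner_Integration.integral_cong refl)
      fix s
      have "\<theta> s * cis (- (2 * pi * \<eta> * s)) * (cis (2 * pi * \<eta> * t) * ?N (\<delta> m * \<eta>)) =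
        \<theta> s * (cis (2 * pi * \<eta> * (t - s)) * ?N (\<delta> m * \<eta>))" for \<eta>
      proof -
        have "cis (- (2 * pi * \<eta> * s)) * cis (2 * pi * \<eta> * t) = cis (2 * pi * \<eta> * (t - s))"
          by (simp add: cis_mult right_diff_distrib)
        then show ?thesis by (simp add: mult.assoc[symmetric])
      qed
      then show "(\<integral>\<eta>. \<theta> s * cis (- (2 * pi * \<eta> * s)) * (cis (2 * pi * \<eta> * t) * ?N (\<delta> m * \<eta>)) \<partial>lborel) =
        \<theta> s * (\<integral>\<eta>. cis (2 * pi * \<eta> * (t - s)) * ?N (\<delta> m * \<eta>) \<partial>lborel)"
        by (simp only: integral_mult_right_zero)
    qed
    also have "\<dots> = (\<integral>s. \<theta> s * of_real (sqrt (2 * pi) / \<delta> m * ?N (2 * pi * (t - s) / \<delta> m)) \<partial>lborel)"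
      by (simp only: integral_scaled_std_normal_cis[OF \<delta>])
    \<comment> \<open>Substitution \<open>s = t - \<delta> m / (2 * pi) * u\<close>, chosen so that
      the argument of the density becomes \<open>u\<close>.\<close>
    also have "\<dots> = (\<delta> m / (2 * pi)) *\<^sub>R (\<integral>u. \<theta> (t + (- (\<delta> m / (2 * pi))) * u) *
       of_real (sqrt (2 * pi) / \<delta> m * ?N (2 * pi * (t - (t + (- (\<delta> m / (2 * pi))) * u)) / \<delta> m)) \<partial>lborel)"
      using \<delta>[of m] by (subst lborel_integral_real_affine[where c="- (\<delta> m / (2 * pi))" and t=t]) auto
    also have "\<dots> = (\<delta> m / (2 * pi)) *\<^sub>R (\<integral>u. of_real (sqrt (2 * pi) / \<delta> m) * (\<theta> (t - \<delta> m / (2 * pi) * u) * ?N u) \<partial>lborel)"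
      using \<delta>[of m] by (intro arg_cong2[where f="(*\<^sub>R)"] Bochner_Integration.integral_cong refl) (simp add: mult_ac)
    also have "\<dots> = of_real (\<delta> m / (2 * pi) * (sqrt (2 * pi) / \<delta> m)) * (\<integral>u. \<theta> (t - \<delta> m / (2 * pi) * u) * ?N u \<partial>lborel)"
      by (simp only: integral_mult_right_zero scaleR_conv_of_real of_real_mult mult.assoc)
    also have "\<delta> m / (2 * pi) * (sqrt (2 * pi) / \<delta> m) = 1 / sqrt (2 * pi)"
      using \<delta>[of m] by (simp add: field_simps)
    finally show ?thesis by simp
  qed
  have "(\<lambda>m. \<integral>u. \<theta> (t - \<delta> m / (2 * pi) * u) * ?N u \<partial>lborel) \<longlonglongrightarrow> (\<integral>u. \<theta> t * ?N u \<partial>lborel)"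
  proof (rule integral_dominated_convergence[where w="\<lambda>u. B * ?N u"])
    show "integrable lborel (\<lambda>u. B * ?N u)" by simp
    show "AE u in lborel. (\<lambda>m. \<theta> (t - \<delta> m / (2 * pi) * u) * ?N u) \<longlonglongrightarrow> \<theta> t * ?N u"
    proof (intro AE_I2 tendsto_intros)
      fix u
      have "(\<lambda>m. t - \<delta> m / (2 * pi) * u) \<longlonglongrightarrow> t - 0 / (2 * pi) * u" by (intro tendsto_intros \<delta>0) auto
      moreover have "isCont \<theta> t" using schwartz_continuous[OF \<theta>, of UNIV] by (simp add: continuous_on_eq_continuous_at)
      ultimately show "(\<lambda>m. \<theta> (t - \<delta> m / (2 * pi) * u)) \<longlonglongrightarrow> \<theta> t" by (intro isCont_tendsto_compose[of t \<theta>]) auto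
    qed
    show "AE u in lborel. norm (\<theta> (t - \<delta> m / (2 * pi) * u) * ?N u) \<le> B * ?N u" for m
    proof (intro AE_I2)
      fix u
      have "cmod (\<theta> (t - \<delta> m / (2 * pi) * u)) \<le> B"
        using B(2)[of "t - \<delta> m / (2 * pi) * u"] mult_left_mono[OF kern_le_1 B(1)] by (meson order_trans mult_left_le kern_le_1 B(1))
      then show "norm (\<theta> (t - \<delta> m / (2 * pi) * u) * ?N u) \<le> B * ?N u"
        by (simp add: norm_mult mult_right_mono)
    qed
  qed measurable
  also have "(\<integral>u. \<theta> t * ?N u \<partial>lborel) = \<theta> t" by simp
  finally have "a \<longlonglongrightarrow> \<theta> t / sqrt (2 * pi)"
    unfolding a by (intro tendsto_intros) auto
  from LIMSEQ_unique[OF lim1 this]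
  have "(\<integral>\<eta>. fourier \<theta> \<eta> * (cis (2 * pi * \<eta> * t) * ?N 0) \<partial>lborel) = \<theta> t / sqrt (2 * pi)" .
  moreover have "(\<integral>\<eta>. fourier \<theta> \<eta> * (cis (2 * pi * \<eta> * t) * ?N 0) \<partial>lborel) =
    (\<integral>\<eta>. fourier \<theta> \<eta> * cis (2 * pi * \<eta> * t) \<partial>lborel) / sqrt (2 * pi)"
    by (simp add: std_normal_density_def mult.assoc[symmetric])
  ultimately show ?thesis by simp
qed

section \<open>Decay and inversion of the short-time Fourier transform\<close>

lemma nth_deriv_cross_product:
  assumes "\<phi> \<in> schwartz" "H \<in> schwartz"
  shows "nth_deriv n (\<lambda>s. \<phi> s * H (s - y)) = leibniz n (\<lambda>i. nth_deriv i \<phi>) (\<lambda>j s. nth_deriv j H (s - y))"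
  by (rule deriv_seq_eqI)
    (auto intro!: deriv_seq_leibniz deriv_seq_translate schwartz_deriv_seq assms)

text \<open>Two derivatives give the decay in \<open>\<eta>\<close>. \<open>\<phi>\<close> supplies
  \<open>kern s\<close> twice: once to be integrated, once to be joined with
  \<open>kern (s - y)\<close> into decay in \<open>y\<close>. The constant is
  \<open>2 * 256 * pi\<close>, with \<open>256 = 4 * 8 * 4 * 2\<close> from the Leibniz rule, the
  two weight estimates and \<open>kern_shift\<close>, and \<open>pi\<close> the integral of
  \<open>kern\<close>; the order 4 is twice the weight exponent 2.\<close>

lemma cross_decay:
  assumes \<phi>: "\<phi> \<in> schwartz" and H: "H \<in> schwartz"
  shows "cmod (cross \<phi> H y \<eta>) \<le> 512 * pi * schwartz_norm 4 \<phi> * schwartz_norm 4 H * (kern y * kern \<eta>)"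
proof -
  define a where "a = schwartz_norm 4 \<phi>"
  define b where "b = schwartz_norm 4 H"
  let ?\<theta> = "\<lambda>s. \<phi> s * H (s - y)"
  have \<theta>: "?\<theta> \<in> schwartz" by (rule schwartz_cross_product[OF \<phi> H])
  have ab: "0 \<le> a" "0 \<le> b" unfolding a_def b_def using assms by (auto intro: schwartz_norm_nonneg)
  have k: "c \<le> C * kern t * kern t" if "(1 + t\<^sup>2) ^ 2 * c \<le> C" for t c C
  proof -
    have "(1 + t\<^sup>2) ^ 1 * c \<le> C * kern t"
      by (rule kern_power_weight) (use that in \<open>simp only: one_add_one\<close>)
    then show ?thesis using le_kernI[of t c "C * kern t"] by simp
  qed
  have le: "cmod (nth_deriv n ?\<theta> s) \<le> 256 * a * b * kern y * kern s" if n: "n \<le> 2" for n s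
  proof -
    have "cmod (nth_deriv n ?\<theta> s) \<le> 2 ^ n * ((8 * a * kern s * kern s) * (4 * b * kern (s - y)))"
      unfolding nth_deriv_cross_product[OF assms]
    proof (rule leibniz_le)
      fix i assume i: "i \<le> n"
      have "(1 + s\<^sup>2) ^ 2 * cmod (nth_deriv i \<phi> s) \<le> 2 ^ (2 + 1) * schwartz_norm 4 \<phi>"
        using i n by (intro schwartz_weight_le \<phi>) auto
      from k[OF this] show "cmod (nth_deriv i \<phi> s) \<le> 8 * a * kern s * kern s" by (simp add: a_def)
      have "(1 + (s - y)\<^sup>2) ^ 1 * cmod (nth_deriv i H (s - y)) \<le> 2 ^ (1 + 1) * schwartz_norm 4 H"
        using i n by (intro schwartz_weight_le H) auto
      then show "cmod (nth_deriv i H (s - y)) \<le> 4 * b * kern (s - y)"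
        using le_kernI[of "s - y" "cmod (nth_deriv i H (s - y))" "4 * b"] by (simp add: b_def)
    qed
    also have "\<dots> = 2 ^ n * (32 * a * b * kern s * (kern s * kern (s - y)))" by (simp add: mult_ac)
    also have "\<dots> \<le> 4 * (32 * a * b * kern s * (2 * kern y))"
    proof (rule mult_mono)
      show "(2::real) ^ n \<le> 4" using power_increasing[OF n, of "2::real"] by simp
      show "32 * a * b * kern s * (kern s * kern (s - y)) \<le> 32 * a * b * kern s * (2 * kern y)"
        using ab kern_nonneg by (intro mult_left_mono kern_shift) auto
    qed (use ab kern_nonneg in auto)
    finally show ?thesis by (simp add: mult_ac)
  qed
  have int: "(\<integral>s. cmod (nth_deriv n ?\<theta> s) \<partial>lborel) \<le> 256 * a * b * kern y * pi" if n: "n \<le> 2" for n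
  proof -
    have "(\<integral>s. cmod (nth_deriv n ?\<theta> s) \<partial>lborel) \<le> (\<integral>s. 256 * a * b * kern y * kern s \<partial>lborel)"
    proof (rule integral_mono)
      show "integrable lborel (\<lambda>s. cmod (nth_deriv n ?\<theta> s))"
        by (intro integrable_norm schwartz_integrable schwartz_nth_deriv \<theta>)
    qed (use le[OF n] integrable_kern in auto)
    then show ?thesis by (simp add: integral_kern)
  qed
  have "(1 + \<eta>\<^sup>2) * cmod (cross \<phi> H y \<eta>) \<le> cmod (fourier (nth_deriv 0 ?\<theta>) \<eta>) + cmod (fourier (nth_deriv 2 ?\<theta>) \<eta>)"
    using fourier_weight[OF \<theta>, of \<eta>] by (simp add: cross_def)
  also have "\<dots> \<le> 256 * a * b * kern y * pi + 256 * a * b * kern y * pi"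
    using int[of 0] int[of 2] fourier_le[OF schwartz_nth_deriv[OF \<theta>], of 0 \<eta>] fourier_le[OF schwartz_nth_deriv[OF \<theta>], of 2 \<eta>]
    by (intro add_mono) auto
  finally have "cmod (cross \<phi> H y \<eta>) \<le> (512 * a * b * kern y * pi) * kern \<eta>"
    by (intro le_kernI) (simp add: mult_ac)
  then show ?thesis by (simp add: a_def b_def mult_ac)
qed

lemma continuous_cross:
  assumes "\<phi> \<in> schwartz" "H \<in> schwartz" "continuous_on S f" "continuous_on S h"
  shows "continuous_on S (\<lambda>x. cross \<phi> H (f x) (h x))"
  unfolding cross_eq_stft[OF assms(2)]
  by (intro continuous_stft_compose tempered_distr_of assms continuous_intros)

text \<open>Inversion in two steps: Fourier inversion of \<open>\<phi> \<cdot> H(\<cdot> - y)\<close> gives the inner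
  integral, after which only \<open>\<integral> (H G)(t - y) dy\<close> remains.\<close>

lemma stft_inversion_inner:
  assumes \<Lambda>: "\<Lambda> \<in> tempered" and \<phi>: "\<phi> \<in> schwartz" and H: "H \<in> schwartz" and G: "G \<in> schwartz"
  shows "\<Lambda> (\<lambda>t. \<phi> t * (H (t - y) * G (t - y))) = (\<integral>\<eta>. cross \<phi> H y \<eta> * stft G \<Lambda> y \<eta> \<partial>lborel)"
proof -
  define D where "D n \<eta> t = cross \<phi> H y \<eta> * time_freq_seq G n (y, \<eta>) t" for n \<eta> t
  have \<theta>: "(\<lambda>s. \<phi> s * H (s - y)) \<in> schwartz" by (rule schwartz_cross_product[OF \<phi> H])
  have "schwartz_family_weighted D"
    unfolding schwartz_family_weighted_def
  proof (intro conjI allI)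
    fix n
    have "continuous_on UNIV (\<lambda>x. cross \<phi> H y (fst x) * (\<lambda>(p, t). time_freq_seq G n p t) ((y, fst x), snd x))"
      by (intro continuous_on_mult continuous_cross \<phi> H continuous_on_compose2[OF continuous_time_freq_seq[OF G]])
        (auto intro!: continuous_intros)
    then show "continuous_on UNIV (\<lambda>(\<eta>, t). D n \<eta> t)" by (simp add: D_def case_prod_beta)
  next
    fix \<eta> show "deriv_seq (\<lambda>n. D n \<eta>)"
      unfolding D_def by (intro deriv_seq_cmult deriv_seq_time_freq G)
  next
    fix k n
    obtain B where B: "0 \<le> B" "\<And>p t. (1 + t\<^sup>2) ^ k * cmod (time_freq_seq G n p t) \<le> B * ((1 + (fst p)\<^sup>2) ^ k * (1 + (snd p)\<^sup>2) ^ n)"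
      using time_freq_seq_bound[OF G] by blast
    obtain C where C: "\<And>\<eta>. (1 + \<eta>\<^sup>2) ^ (n + 1) * cmod (cross \<phi> H y \<eta>) \<le> C"
      using fourier_rapid[OF \<theta>] unfolding cross_def by blast
    have "(1 + t\<^sup>2) ^ k * cmod (D n \<eta> t) \<le> B * (1 + y\<^sup>2) ^ k * C * kern \<eta>" for \<eta> t
    proof -
      have "(1 + t\<^sup>2) ^ k * cmod (D n \<eta> t) = cmod (cross \<phi> H y \<eta>) * ((1 + t\<^sup>2) ^ k * cmod (time_freq_seq G n (y, \<eta>) t))"
        by (simp add: D_def norm_mult)
      also have "\<dots> \<le> cmod (cross \<phi> H y \<eta>) * (B * ((1 + y\<^sup>2) ^ k * (1 + \<eta>\<^sup>2) ^ n))"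
        using B(2)[of t "(y, \<eta>)"] by (intro mult_left_mono) auto
      also have "\<dots> = B * (1 + y\<^sup>2) ^ k * ((1 + \<eta>\<^sup>2) ^ n * cmod (cross \<phi> H y \<eta>))" by (simp only: mult_ac)
      also have "\<dots> \<le> B * (1 + y\<^sup>2) ^ k * (C * kern \<eta>)"
        using B(1) by (intro mult_left_mono kern_power_weight C) auto
      finally show ?thesis by (simp only: mult.assoc)
    qed
    then show "\<exists>B. \<forall>\<eta> t. (1 + t\<^sup>2) ^ k * cmod (D n \<eta> t) \<le> B * kern \<eta>" by blast
  qed
  from tempered_integral_line[OF this \<Lambda>]
  have "\<Lambda> (\<lambda>t. \<integral>\<eta>. D 0 \<eta> t \<partial>lborel) = (\<integral>\<eta>. \<Lambda> (D 0 \<eta>) \<partial>lborel)" .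
  moreover have "(\<integral>\<eta>. D 0 \<eta> t \<partial>lborel) = \<phi> t * (H (t - y) * G (t - y))" for t
  proof -
    have "(\<integral>\<eta>. D 0 \<eta> t \<partial>lborel) = (\<integral>\<eta>. fourier (\<lambda>s. \<phi> s * H (s - y)) \<eta> * cis (2 * pi * \<eta> * t) * G (t - y) \<partial>lborel)"
      by (simp add: D_def time_freq_seq_0 time_freq_def modul_def translate_def cross_def mult.assoc)
    also have "\<dots> = (\<integral>\<eta>. fourier (\<lambda>s. \<phi> s * H (s - y)) \<eta> * cis (2 * pi * \<eta> * t) \<partial>lborel) * G (t - y)"
      by (rule integral_mult_left_zero)
    finally show ?thesis unfolding fourier_inversion[OF \<theta>] by (simp only: mult.assoc)
  qed
  moreover have "\<Lambda> (D 0 \<eta>) = cross \<phi> H y \<eta> * stft G \<Lambda> y \<eta>" for \<eta>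
    using tempered_cmult[OF \<Lambda>] by (simp add: D_def[abs_def] time_freq_seq_0 stft_def)
  ultimately show ?thesis by simp
qed

text \<open>The outer integral reduces to the total mass of the product of the windows, by
  translation and reflection of the line. The integrals stay iterated; joint integrability over the
  plane is added in \<open>stft_inversion_plane\<close>, where the transform of \<Lambda> is
  integrable.\<close>

theorem stft_inversion:
  assumes \<Lambda>: "\<Lambda> \<in> tempered" and \<phi>: "\<phi> \<in> schwartz" and H: "H \<in> schwartz" and G: "G \<in> schwartz"
  shows "(\<integral>t. H t * G t \<partial>lborel) * \<Lambda> \<phi> = (\<integral>y. \<integral>\<eta>. cross \<phi> H y \<eta> * stft G \<Lambda> y \<eta> \<partial>lborel \<partial>lborel)"
proof -
  let ?HG = "\<lambda>t. H t * G t"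
  have HG: "?HG \<in> schwartz" by (rule schwartz_mult[OF H G])
  define D where "D n y t = leibniz n (\<lambda>j t. nth_deriv j ?HG (t - y)) (\<lambda>i. nth_deriv i \<phi>) t" for n y t
  have "schwartz_family_weighted D"
    unfolding schwartz_family_weighted_def
  proof (intro conjI allI)
    fix n
    have "continuous_on UNIV (\<lambda>p. leibniz n (\<lambda>j t. nth_deriv j ?HG (t - fst p)) (\<lambda>i. nth_deriv i \<phi>) (snd p))"
    proof (rule continuous_on_leibniz)
      show "continuous_on UNIV (\<lambda>p. nth_deriv i ?HG (snd p - fst p))" for i
        by (rule continuous_on_compose2[OF schwartz_nth_deriv_continuous[OF HG, of UNIV]])
          (auto intro!: continuous_intros)
      show "continuous_on UNIV (\<lambda>p. nth_deriv i \<phi> (snd p))" for i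
        by (rule continuous_on_compose2[OF schwartz_nth_deriv_continuous[OF \<phi>, of UNIV]])
          (auto intro!: continuous_intros)
    qed
    then show "continuous_on UNIV (\<lambda>(y, t). D n y t)" by (simp add: D_def case_prod_beta)
  next
    fix y show "deriv_seq (\<lambda>n. D n y)"
      unfolding D_def by (intro deriv_seq_leibniz deriv_seq_translate schwartz_deriv_seq HG \<phi>)
  next
    fix k n
    obtain B where B: "0 \<le> B" "\<And>i t. i \<le> n \<Longrightarrow> (1 + t\<^sup>2) ^ (k + 1) * cmod (nth_deriv i \<phi> t) \<le> B"
      using schwartz_bound_upto[OF \<phi>] by blast
    \<comment> \<open>One power of the weight on the product of the windows gives
      \<open>kern (t - y)\<close>, the spare power on \<open>\<phi>\<close> gives
      \<open>kern t\<close>; \<open>kern_shift\<close> turns them into decay in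
      \<open>y\<close>.\<close>
    obtain C where C: "0 \<le> C" "\<And>i t. i \<le> n \<Longrightarrow> (1 + t\<^sup>2) ^ 1 * cmod (nth_deriv i ?HG t) \<le> C"
      using schwartz_bound_upto[OF HG] by blast
    have "(1 + t\<^sup>2) ^ k * cmod (D n y t) \<le> 2 ^ n * 2 * C * B * kern y" for y t
    proof -
      have "(1 + t\<^sup>2) ^ k * cmod (D n y t) \<le> 2 ^ n * ((C * kern (t - y)) * (B * kern t))"
        unfolding D_def
      proof (rule leibniz_weight_le)
        show "0 < (1 + t\<^sup>2) ^ k" by (simp add: add_pos_nonneg)
        fix i assume i: "i \<le> n"
        show "cmod (nth_deriv i ?HG (t - y)) \<le> C * kern (t - y)"
          using C(2)[OF i, of "t - y"] by (intro le_kernI) simp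
        show "(1 + t\<^sup>2) ^ k * cmod (nth_deriv i \<phi> t) \<le> B * kern t"
          by (rule kern_power_weight[OF B(2)[OF i]])
      qed
      also have "\<dots> = 2 ^ n * C * B * (kern t * kern (t - y))" by (simp only: mult_ac)
      also have "\<dots> \<le> 2 ^ n * C * B * (2 * kern y)"
        using B(1) C(1) by (intro mult_left_mono kern_shift) auto
      finally show ?thesis by (simp only: mult_ac)
    qed
    then show "\<exists>B. \<forall>y t. (1 + t\<^sup>2) ^ k * cmod (D n y t) \<le> B * kern y" by blast
  qed
  from tempered_integral_line[OF this \<Lambda>]
  have "\<Lambda> (\<lambda>t. \<integral>y. D 0 y t \<partial>lborel) = (\<integral>y. \<Lambda> (D 0 y) \<partial>lborel)" .
  moreover have "(\<lambda>t. \<integral>y. D 0 y t \<partial>lborel) = (\<lambda>t. (\<integral>t. H t * G t \<partial>lborel) * \<phi> t)"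
  proof
    fix t
    have "(\<integral>y. D 0 y t \<partial>lborel) = (\<integral>y. H (t - y) * G (t - y) \<partial>lborel) * \<phi> t"
      by (simp add: D_def)
    also have "(\<integral>y. H (t - y) * G (t - y) \<partial>lborel) = (\<integral>t. H t * G t \<partial>lborel)"
      by (subst (2) lborel_integral_real_affine[where c="- 1" and t=t]) auto
    finally show "(\<integral>y. D 0 y t \<partial>lborel) = (\<integral>t. H t * G t \<partial>lborel) * \<phi> t" .
  qed
  moreover have "D 0 y = (\<lambda>t. \<phi> t * (H (t - y) * G (t - y)))" for y
    by (auto simp: D_def mult_ac)
  ultimately show ?thesis
    by (simp only: stft_inversion_inner[OF assms] tempered_cmult[OF \<Lambda>])
qed

section \<open>Change of window\<close>

lemma norm_integral_le_nn_integral: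
  fixes f :: "'a \<Rightarrow> 'b::{banach, second_countable_topology}"
  shows "ennreal (norm (\<integral>x. f x \<partial>M)) \<le> (\<integral>\<^sup>+x. ennreal (norm (f x)) \<partial>M)"
  by (cases "integrable M f") (auto simp: integral_norm_bound_ennreal not_integrable_integral_eq)

text \<open>Otherwise the continuous function \<open>G\<close> vanishes almost everywhere, and the
  open set where it differs from 0 is null, hence empty.\<close>

lemma schwartz_window_integral_pos:
  assumes G: "G \<in> schwartz" and nz: "G \<noteq> (\<lambda>t. 0)"
  shows "(\<integral>t. cnj (G t) * G t \<partial>lborel) \<noteq> 0"
proof
  assume 0: "(\<integral>t. cnj (G t) * G t \<partial>lborel) = 0"
  have "cnj (G t) * G t = of_real ((cmod (G t))\<^sup>2)" for t
    by (metis complex_norm_square mult.commute)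
  with 0 have "(\<integral>t. of_real ((cmod (G t))\<^sup>2) \<partial>lborel) = (0 :: complex)" by (simp only:)
  then have 1: "(\<integral>t. (cmod (G t))\<^sup>2 \<partial>lborel) = 0"
    by (simp only: integral_complex_of_real of_real_eq_0_iff)
  have "integrable lborel (\<lambda>t. cnj (G t) * G t)"
    by (intro schwartz_integrable schwartz_mult schwartz_cnj G)
  from integrable_norm[OF this] have "integrable lborel (\<lambda>t. (cmod (G t))\<^sup>2)"
    by (simp add: norm_mult power2_eq_square)
  with 1 have "AE t in lborel. (cmod (G t))\<^sup>2 = 0"
    by (subst (asm) integral_nonneg_eq_0_iff_AE) auto
  then have "AE t in lborel. t \<notin> {t. G t \<noteq> 0}" by simp
  moreover have op: "open {t. G t \<noteq> 0}"
    using schwartz_continuous[OF G, of UNIV] by (intro open_Collect_neq) auto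
  ultimately have "{t. G t \<noteq> 0} \<in> null_sets lborel"
    by (simp add: AE_iff_null_sets)
  then have "negligible {t. G t \<noteq> 0}"
    by (simp add: negligible_iff_null_sets null_sets_completionI)
  with op have "{t. G t \<noteq> 0} = {}" using open_not_negligible by blast
  with nz show False by auto
qed

text \<open>The order of integration is exchanged on the way, to that of the modulation norms:
  position inside, frequency outside.\<close>

lemma tempered_le_stft:
  assumes \<Lambda>: "\<Lambda> \<in> tempered" and \<phi>: "\<phi> \<in> schwartz" and H: "H \<in> schwartz" and G: "G \<in> schwartz"
  shows "ennreal (cmod (\<integral>t. H t * G t \<partial>lborel) * cmod (\<Lambda> \<phi>)) \<le>
    (\<integral>\<^sup>+\<eta>. \<integral>\<^sup>+y. ennreal (cmod (cross \<phi> H y \<eta>)) * ennreal (cmod (stft G \<Lambda> y \<eta>)) \<partial>lborel \<partial>lborel)"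
proof -
  have [measurable]: "(\<lambda>(y, \<eta>). cross \<phi> H y \<eta>) \<in> borel_measurable (borel \<Otimes>\<^sub>M borel)"
    unfolding cross_eq_stft[OF H] case_prod_beta
    by (intro measurable_stft tempered_distr_of \<phi> H) measurable
  have [measurable]: "(\<lambda>(y, \<eta>). stft G \<Lambda> y \<eta>) \<in> borel_measurable (borel \<Otimes>\<^sub>M borel)"
    unfolding case_prod_beta by (intro measurable_stft \<Lambda> G) measurable
  have "ennreal (cmod (\<integral>t. H t * G t \<partial>lborel) * cmod (\<Lambda> \<phi>)) =
     ennreal (cmod (\<integral>y. \<integral>\<eta>. cross \<phi> H y \<eta> * stft G \<Lambda> y \<eta> \<partial>lborel \<partial>lborel))"
    by (simp only: stft_inversion[OF assms, symmetric] norm_mult)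
  also have "\<dots> \<le> (\<integral>\<^sup>+y. ennreal (cmod (\<integral>\<eta>. cross \<phi> H y \<eta> * stft G \<Lambda> y \<eta> \<partial>lborel)) \<partial>lborel)"
    by (rule norm_integral_le_nn_integral)
  also have "\<dots> \<le> (\<integral>\<^sup>+y. \<integral>\<^sup>+\<eta>. ennreal (cmod (cross \<phi> H y \<eta>)) * ennreal (cmod (stft G \<Lambda> y \<eta>)) \<partial>lborel \<partial>lborel)"
    by (intro nn_integral_mono order_trans[OF norm_integral_le_nn_integral]) (simp add: norm_mult ennreal_mult)
  also have "\<dots> = (\<integral>\<^sup>+\<eta>. \<integral>\<^sup>+y. ennreal (cmod (cross \<phi> H y \<eta>)) * ennreal (cmod (stft G \<Lambda> y \<eta>)) \<partial>lborel \<partial>lborel)"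
    by (rule lborel_pair.Fubini'[symmetric]) measurable
  finally show ?thesis .
qed

text \<open>Covariance of the transform: the shift of the integration variable leaves a phase that
  is constant in it and is lost in the modulus.\<close>

lemma norm_cross_time_freq: "cmod (cross (time_freq x \<omega> \<phi>) H y \<eta>) = cmod (cross \<phi> H (y - x) (\<eta> - \<omega>))"
proof -
  have "cross (time_freq x \<omega> \<phi>) H y \<eta> =
     (\<integral>s. cis (2 * pi * \<omega> * s) * \<phi> (s - x) * H (s - y) * cis (- (2 * pi * \<eta> * s)) \<partial>lborel)"
    by (simp add: cross_def fourier_def time_freq_def modul_def translate_def)
  also have "\<dots> = (\<integral>s. cis (2 * pi * \<omega> * (x + 1 * s)) * \<phi> (x + 1 * s - x) * H (x + 1 * s - y) * cis (- (2 * pi * \<eta> * (x + 1 * s))) \<partial>lborel)"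
    by (subst lborel_integral_real_affine[where c=1 and t=x]) auto
  also have "\<dots> = (\<integral>s. cis (- (2 * pi * (\<eta> - \<omega>) * x)) * (\<phi> s * H (s - (y - x)) * cis (- (2 * pi * (\<eta> - \<omega>) * s))) \<partial>lborel)"
  proof (intro Bochner_Integration.integral_cong refl)
    fix s
    have "cis (2 * pi * \<omega> * (x + 1 * s)) * cis (- (2 * pi * \<eta> * (x + 1 * s))) =
       cis (- (2 * pi * (\<eta> - \<omega>) * x)) * cis (- (2 * pi * (\<eta> - \<omega>) * s))"
      by (simp add: cis_mult algebra_simps)
    then have "cis (2 * pi * \<omega> * (x + 1 * s)) * cis (- (2 * pi * \<eta> * (x + 1 * s))) * (\<phi> s * H (s - (y - x))) =
       cis (- (2 * pi * (\<eta> - \<omega>) * x)) * cis (- (2 * pi * (\<eta> - \<omega>) * s)) * (\<phi> s * H (s - (y - x)))" by simp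
    then show "cis (2 * pi * \<omega> * (x + 1 * s)) * \<phi> (x + 1 * s - x) * H (x + 1 * s - y) * cis (- (2 * pi * \<eta> * (x + 1 * s))) =
       cis (- (2 * pi * (\<eta> - \<omega>) * x)) * (\<phi> s * H (s - (y - x)) * cis (- (2 * pi * (\<eta> - \<omega>) * s)))"
      by (simp add: mult_ac diff_diff_eq2 add.commute)
  qed
  finally show ?thesis by (simp add: cross_def fourier_def norm_mult)
qed

text \<open>Convolution with \<open>kern\<close> in both variables, nested in the order of the
  modulation norms. Values in \<open>ennreal\<close> keep it meaningful for transforms not yet known
  to be integrable.\<close>

definition smear :: "(real \<Rightarrow> real \<Rightarrow> ennreal) \<Rightarrow> real \<Rightarrow> real \<Rightarrow> ennreal" where
  "smear V x \<omega> = (\<integral>\<^sup>+\<eta>. ennreal (kern (\<omega> - \<eta>)) * (\<integral>\<^sup>+y. V y \<eta> * ennreal (kern (x - y)) \<partial>lborel) \<partial>lborel)"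

lemma kern_diff_commute: "kern (x - y) = kern (y - x)"
  by (simp add: kern_def power2_commute)

text \<open>Inversion with \<open>H = cnj G\<close> expresses the test function
  \<open>time_freq x \<omega> \<psi>\<close> through shifts of \<open>G\<close>; covariance and
  \<open>cross_decay\<close> bound the coefficients. \<open>C\<close> depends on the windows but not
  on \<Lambda>, which makes it usable for operator bounds.\<close>

theorem stft_change_window:
  assumes \<psi>: "\<psi> \<in> schwartz" and G: "G \<in> schwartz" "G \<noteq> (\<lambda>t. 0)"
  obtains C where "0 \<le> C" "\<And>\<Lambda> x \<omega>. \<Lambda> \<in> tempered \<Longrightarrow>
    ennreal (cmod (stft \<psi> \<Lambda> x \<omega>)) \<le> ennreal C * smear (\<lambda>y \<eta>. ennreal (cmod (stft G \<Lambda> y \<eta>))) x \<omega>"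
proof -
  define H where "H = (\<lambda>t. cnj (G t))"
  define c where "c = cmod (\<integral>t. H t * G t \<partial>lborel)"
  define K where "K = 512 * pi * schwartz_norm 4 \<psi> * schwartz_norm 4 H"
  have H: "H \<in> schwartz" unfolding H_def by (rule schwartz_cnj[OF G(1)])
  have c: "0 < c" unfolding c_def H_def using schwartz_window_integral_pos[OF G] by simp
  have K: "0 \<le> K" unfolding K_def by (intro mult_nonneg_nonneg schwartz_norm_nonneg \<psi> H) auto
  show ?thesis
  proof (rule that[of "K / c"])
    show "0 \<le> K / c" using K c by simp
    fix \<Lambda> x \<omega> assume \<Lambda>: "\<Lambda> \<in> tempered"
    let ?V = "\<lambda>y \<eta>. ennreal (cmod (stft G \<Lambda> y \<eta>))"
    have [measurable]: "(\<lambda>(y, \<eta>). stft G \<Lambda> y \<eta>) \<in> borel_measurable (borel \<Otimes>\<^sub>M borel)"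
      unfolding case_prod_beta by (intro measurable_stft \<Lambda> G) measurable
    have "ennreal (c * cmod (stft \<psi> \<Lambda> x \<omega>)) \<le>
      (\<integral>\<^sup>+\<eta>. \<integral>\<^sup>+y. ennreal (cmod (cross (time_freq x \<omega> \<psi>) H y \<eta>)) * ?V y \<eta> \<partial>lborel \<partial>lborel)"
      unfolding c_def stft_def[of \<psi>] using \<psi> by (intro tempered_le_stft \<Lambda> H G) simp
    also have "\<dots> \<le> (\<integral>\<^sup>+\<eta>. \<integral>\<^sup>+y. (ennreal K * ennreal (kern (\<omega> - \<eta>))) * (?V y \<eta> * ennreal (kern (x - y))) \<partial>lborel \<partial>lborel)"
    proof (intro nn_integral_mono)
      fix \<eta> y
      have "ennreal (cmod (cross (time_freq x \<omega> \<psi>) H y \<eta>)) \<le> ennreal (K * (kern (y - x) * kern (\<eta> - \<omega>)))"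
        unfolding norm_cross_time_freq K_def by (intro ennreal_leI cross_decay \<psi> H)
      also have "\<dots> = ennreal K * ennreal (kern (\<omega> - \<eta>)) * ennreal (kern (x - y))"
        using K by (simp add: ennreal_mult kern_nonneg kern_diff_commute[of y] kern_diff_commute[of \<eta>] mult_ac)
      finally have "ennreal (cmod (cross (time_freq x \<omega> \<psi>) H y \<eta>)) * ?V y \<eta> \<le>
        (ennreal K * ennreal (kern (\<omega> - \<eta>)) * ennreal (kern (x - y))) * ?V y \<eta>"
        by (rule mult_right_mono) simp
      then show "ennreal (cmod (cross (time_freq x \<omega> \<psi>) H y \<eta>)) * ?V y \<eta> \<le>
        (ennreal K * ennreal (kern (\<omega> - \<eta>))) * (?V y \<eta> * ennreal (kern (x - y)))"
        by (simp only: mult_ac)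
    qed
    also have "\<dots> = ennreal K * smear ?V x \<omega>"
      unfolding smear_def by (simp add: nn_integral_cmult mult.assoc)
    finally have "ennreal (1 / c) * ennreal (c * cmod (stft \<psi> \<Lambda> x \<omega>)) \<le> ennreal (1 / c) * (ennreal K * smear ?V x \<omega>)"
      by (intro mult_left_mono) auto
    moreover have "ennreal (1 / c) * ennreal (c * cmod (stft \<psi> \<Lambda> x \<omega>)) = ennreal (cmod (stft \<psi> \<Lambda> x \<omega>))"
      using c by (simp add: ennreal_mult[symmetric])
    moreover have "ennreal (1 / c) * ennreal K = ennreal (K / c)"
      using c K by (simp add: ennreal_mult[symmetric])
    ultimately show "ennreal (cmod (stft \<psi> \<Lambda> x \<omega>)) \<le> ennreal (K / c) * smear ?V x \<omega>"
      by (simp only: mult.assoc[symmetric])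
  qed
qed

section \<open>Integrals of smeared transforms\<close>

lemma nn_integral_kern: "(\<integral>\<^sup>+x. ennreal (kern x) \<partial>lborel) = ennreal pi"
  using nn_integral_eq_integral[OF integrable_kern] by (simp add: integral_kern kern_nonneg)

lemma nn_integral_kern_shift: "(\<integral>\<^sup>+x. ennreal (kern (x - y)) \<partial>lborel) = ennreal pi"
  using nn_integral_real_affine[of "\<lambda>x. ennreal (kern x)" 1 "- y"] nn_integral_kern by simp

lemma nn_integral_kern_conv:
  assumes [measurable]: "F \<in> borel_measurable borel"
  shows "(\<integral>\<^sup>+x. \<integral>\<^sup>+y. F y * ennreal (kern (x - y)) \<partial>lborel \<partial>lborel) = ennreal pi * (\<integral>\<^sup>+y. F y \<partial>lborel)"
proof -
  have "(\<integral>\<^sup>+x. \<integral>\<^sup>+y. F y * ennreal (kern (x - y)) \<partial>lborel \<partial>lborel) =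
     (\<integral>\<^sup>+y. \<integral>\<^sup>+x. F y * ennreal (kern (x - y)) \<partial>lborel \<partial>lborel)"
    by (rule lborel_pair.Fubini') measurable
  also have "\<dots> = (\<integral>\<^sup>+y. F y * ennreal pi \<partial>lborel)"
    by (simp add: nn_integral_cmult nn_integral_kern_shift)
  finally show ?thesis by (simp add: nn_integral_multc) (simp add: mult.commute)
qed

text \<open>What is left of \<open>smear V\<close> at a frequency after the position kernel is
  either bounded by 1 or integrated out; both uses recur in the embedding into the mixed
  norms.\<close>

definition marginal :: "(real \<Rightarrow> real \<Rightarrow> ennreal) \<Rightarrow> real \<Rightarrow> ennreal" where
  "marginal V \<omega> = (\<integral>\<^sup>+\<eta>. (\<integral>\<^sup>+y. V y \<eta> \<partial>lborel) * ennreal (kern (\<omega> - \<eta>)) \<partial>lborel)"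

context
  fixes V :: "real \<Rightarrow> real \<Rightarrow> ennreal"
  assumes V [measurable]: "(\<lambda>(y, \<eta>). V y \<eta>) \<in> borel_measurable (borel \<Otimes>\<^sub>M borel)"
begin

lemma measurable_marginal [measurable]: "marginal V \<in> borel_measurable borel"
  unfolding marginal_def[abs_def] by measurable

lemma smear_le_marginal: "smear V x \<omega> \<le> marginal V \<omega>"
  unfolding smear_def marginal_def
proof (intro nn_integral_mono)
  fix \<eta>
  have "(\<integral>\<^sup>+y. V y \<eta> * ennreal (kern (x - y)) \<partial>lborel) \<le> (\<integral>\<^sup>+y. V y \<eta> \<partial>lborel)"
    using kern_le_1 by (intro nn_integral_mono) (auto intro: order_trans[OF mult_left_mono[of _ 1]])
  then show "ennreal (kern (\<omega> - \<eta>)) * (\<integral>\<^sup>+y. V y \<eta> * ennreal (kern (x - y)) \<partial>lborel) \<le>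
    (\<integral>\<^sup>+y. V y \<eta> \<partial>lborel) * ennreal (kern (\<omega> - \<eta>))"
    by (subst mult.commute) (rule mult_right_mono, auto)
qed

lemma nn_integral_smear: "(\<integral>\<^sup>+x. smear V x \<omega> \<partial>lborel) = ennreal pi * marginal V \<omega>"
proof -
  have "(\<integral>\<^sup>+x. smear V x \<omega> \<partial>lborel) =
    (\<integral>\<^sup>+\<eta>. \<integral>\<^sup>+x. ennreal (kern (\<omega> - \<eta>)) * (\<integral>\<^sup>+y. V y \<eta> * ennreal (kern (x - y)) \<partial>lborel) \<partial>lborel \<partial>lborel)"
    unfolding smear_def by (rule lborel_pair.Fubini') measurable
  also have "\<dots> = (\<integral>\<^sup>+\<eta>. ennreal (kern (\<omega> - \<eta>)) * (ennreal pi * (\<integral>\<^sup>+y. V y \<eta> \<partial>lborel)) \<partial>lborel)"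
    by (simp add: nn_integral_cmult nn_integral_kern_conv)
  also have "\<dots> = (\<integral>\<^sup>+\<eta>. ennreal pi * ((\<integral>\<^sup>+y. V y \<eta> \<partial>lborel) * ennreal (kern (\<omega> - \<eta>))) \<partial>lborel)"
    by (simp add: mult_ac)
  also have "\<dots> = ennreal pi * marginal V \<omega>"
    unfolding marginal_def by (rule nn_integral_cmult) measurable
  finally show ?thesis .
qed

lemma marginal_le: "marginal V \<omega> \<le> (\<integral>\<^sup>+\<eta>. \<integral>\<^sup>+y. V y \<eta> \<partial>lborel \<partial>lborel)"
  unfolding marginal_def using kern_le_1
  by (intro nn_integral_mono) (auto intro: order_trans[OF mult_left_mono[of _ 1]])

lemma nn_integral_marginal: "(\<integral>\<^sup>+\<omega>. marginal V \<omega> \<partial>lborel) = ennreal pi * (\<integral>\<^sup>+\<eta>. \<integral>\<^sup>+y. V y \<eta> \<partial>lborel \<partial>lborel)"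
  unfolding marginal_def by (rule nn_integral_kern_conv) measurable

end

text \<open>The Feichtinger norm in terms of the transform; \<open>S0_norm g\<close> is the same
  with the reflected window (\<open>S0_norm_eq\<close>).\<close>

definition stft_norm :: "(real \<Rightarrow> complex) \<Rightarrow> functional \<Rightarrow> ennreal" where
  "stft_norm \<psi> \<Lambda> = (\<integral>\<^sup>+\<omega>. \<integral>\<^sup>+x. ennreal (cmod (stft \<psi> \<Lambda> x \<omega>)) \<partial>lborel \<partial>lborel)"

lemma measurable_norm_stft:
  assumes "\<Lambda> \<in> tempered" "\<psi> \<in> schwartz"
  shows "(\<lambda>(y, \<eta>). ennreal (cmod (stft \<psi> \<Lambda> y \<eta>))) \<in> borel_measurable (borel \<Otimes>\<^sub>M borel)"
proof -
  have [measurable]: "(\<lambda>(y, \<eta>). stft \<psi> \<Lambda> y \<eta>) \<in> borel_measurable (borel \<Otimes>\<^sub>M borel)"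
    unfolding case_prod_beta by (intro measurable_stft assms) measurable
  show ?thesis by measurable
qed

lemma stft_norm_le_smear:
  assumes V [measurable]: "(\<lambda>(y, \<eta>). V y \<eta>) \<in> borel_measurable (borel \<Otimes>\<^sub>M borel)" and C: "0 \<le> C"
    and le: "\<And>x \<omega>. ennreal (cmod (stft \<psi> \<Lambda> x \<omega>)) \<le> ennreal C * smear V x \<omega>"
  shows "stft_norm \<psi> \<Lambda> \<le> ennreal (C * pi\<^sup>2) * (\<integral>\<^sup>+\<eta>. \<integral>\<^sup>+y. V y \<eta> \<partial>lborel \<partial>lborel)"
proof -
  have [measurable]: "(\<lambda>x. smear V x \<omega>) \<in> borel_measurable borel" for \<omega>
    unfolding smear_def by measurable
  note [measurable] = measurable_marginal[OF V]
  have "stft_norm \<psi> \<Lambda> \<le> (\<integral>\<^sup>+\<omega>. \<integral>\<^sup>+x. ennreal C * smear V x \<omega> \<partial>lborel \<partial>lborel)"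
    unfolding stft_norm_def by (intro nn_integral_mono le)
  also have "\<dots> = (\<integral>\<^sup>+\<omega>. ennreal C * (ennreal pi * marginal V \<omega>) \<partial>lborel)"
    by (simp add: nn_integral_cmult nn_integral_smear[OF V])
  also have "\<dots> = ennreal C * (ennreal pi * (ennreal pi * (\<integral>\<^sup>+\<eta>. \<integral>\<^sup>+y. V y \<eta> \<partial>lborel \<partial>lborel)))"
    by (simp add: nn_integral_cmult nn_integral_marginal[OF V])
  also have "\<dots> = ennreal (C * pi\<^sup>2) * (\<integral>\<^sup>+\<eta>. \<integral>\<^sup>+y. V y \<eta> \<partial>lborel \<partial>lborel)"
    using C by (simp add: ennreal_mult power2_eq_square mult.assoc)
  finally show ?thesis .
qed

lemma stft_norm_change_window:
  assumes "\<psi> \<in> schwartz" "G \<in> schwartz" "G \<noteq> (\<lambda>t. 0)"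
  obtains C where "0 \<le> C" "\<And>\<Lambda>. \<Lambda> \<in> tempered \<Longrightarrow> stft_norm \<psi> \<Lambda> \<le> ennreal C * stft_norm G \<Lambda>"
proof -
  obtain C where C: "0 \<le> C" "\<And>\<Lambda> x \<omega>. \<Lambda> \<in> tempered \<Longrightarrow>
    ennreal (cmod (stft \<psi> \<Lambda> x \<omega>)) \<le> ennreal C * smear (\<lambda>y \<eta>. ennreal (cmod (stft G \<Lambda> y \<eta>))) x \<omega>"
    using stft_change_window[OF assms] by blast
  show ?thesis
  proof (rule that[of "C * pi\<^sup>2"])
    show "0 \<le> C * pi\<^sup>2" using C(1) by simp
    show "stft_norm \<psi> \<Lambda> \<le> ennreal (C * pi\<^sup>2) * stft_norm G \<Lambda>" if "\<Lambda> \<in> tempered" for \<Lambda>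
      using stft_norm_le_smear[OF measurable_norm_stft[OF that assms(2)] C(1) C(2)[OF that]]
      by (simp add: stft_norm_def)
  qed
qed

section \<open>Operations on distributions and the Feichtinger norm\<close>

lemma conv_modul:
  assumes "\<Lambda> \<in> tempered"
  shows "conv \<Lambda> (modul \<omega> g) x = cis (2 * pi * \<omega> * x) * stft (reflect g) \<Lambda> x (- \<omega>)"
proof -
  have "translate x (reflect (modul \<omega> g)) = (\<lambda>t. cis (2 * pi * \<omega> * x) * time_freq x (- \<omega>) (reflect g) t)"
  proof
    fix t
    have "cis (2 * pi * \<omega> * x) * cis (2 * pi * (- \<omega>) * t) = cis (2 * pi * \<omega> * - (t - x))"
      by (simp add: cis_mult algebra_simps)
    then show "translate x (reflect (modul \<omega> g)) t = cis (2 * pi * \<omega> * x) * time_freq x (- \<omega>) (reflect g) t"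
      by (simp add: translate_def reflect_def modul_def time_freq_def mult.assoc[symmetric])
  qed
  then show ?thesis by (simp add: conv_def stft_def tempered_cmult[OF assms])
qed

lemma S0_norm_eq:
  assumes "\<Lambda> \<in> tempered" "g \<in> schwartz"
  shows "S0_norm g \<Lambda> = stft_norm (reflect g) \<Lambda>"
proof -
  have g: "reflect g \<in> schwartz" using assms(2) by simp
  note [measurable (raw)] = measurable_stft[OF assms(1) g]
  have "stft_norm (reflect g) \<Lambda> = (\<integral>\<^sup>+\<omega>. \<integral>\<^sup>+x. ennreal (cmod (stft (reflect g) \<Lambda> x (- \<omega>))) \<partial>lborel \<partial>lborel)"
    unfolding stft_norm_def by (subst nn_integral_real_affine[where c="- 1" and t=0]) auto
  then show ?thesis by (simp add: S0_norm_def conv_modul[OF assms(1)] norm_mult)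
qed

text \<open>Completing the square: a chirp shears the time-frequency plane along the frequency axis
  and moves into the window.\<close>

lemma stft_chirp:
  assumes "\<Lambda> \<in> tempered"
  shows "stft \<psi> (distr_chirp \<alpha> \<Lambda>) x \<omega> = cis (- (pi * \<alpha> * x\<^sup>2)) * stft (chirp \<alpha> \<psi>) \<Lambda> x (\<omega> + \<alpha> * x)"
proof -
  have "chirp \<alpha> (time_freq x \<omega> \<psi>) = (\<lambda>t. cis (- (pi * \<alpha> * x\<^sup>2)) * time_freq x (\<omega> + \<alpha> * x) (chirp \<alpha> \<psi>) t)"
  proof
    fix t
    have "cis (pi * \<alpha> * t\<^sup>2) * cis (2 * pi * \<omega> * t) =
      cis (- (pi * \<alpha> * x\<^sup>2)) * cis (2 * pi * (\<omega> + \<alpha> * x) * t) * cis (pi * \<alpha> * (t - x)\<^sup>2)"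
      by (simp add: cis_mult power2_eq_square algebra_simps)
    then show "chirp \<alpha> (time_freq x \<omega> \<psi>) t = cis (- (pi * \<alpha> * x\<^sup>2)) * time_freq x (\<omega> + \<alpha> * x) (chirp \<alpha> \<psi>) t"
      by (simp add: translate_def modul_def chirp_def time_freq_def mult.assoc[symmetric])
  qed
  then show ?thesis by (simp add: distr_chirp_def stft_def tempered_cmult[OF assms])
qed

text \<open>A shear preserves area. The frequency integral is brought inside first, because for
  fixed \<open>x\<close> the shear is a translation in frequency.\<close>

lemma stft_norm_chirp:
  assumes "\<Lambda> \<in> tempered" "\<psi> \<in> schwartz"
  shows "stft_norm \<psi> (distr_chirp \<alpha> \<Lambda>) = stft_norm (chirp \<alpha> \<psi>) \<Lambda>"
proof -
  let ?V = "\<lambda>x \<omega>. ennreal (cmod (stft (chirp \<alpha> \<psi>) \<Lambda> x \<omega>))"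
  have \<psi>: "chirp \<alpha> \<psi> \<in> schwartz" using assms(2) by simp
  note [measurable (raw)] = measurable_stft[OF assms(1) \<psi>]
  have "stft_norm \<psi> (distr_chirp \<alpha> \<Lambda>) = (\<integral>\<^sup>+\<omega>. \<integral>\<^sup>+x. ?V x (\<omega> + \<alpha> * x) \<partial>lborel \<partial>lborel)"
    by (simp add: stft_norm_def stft_chirp[OF assms(1)] norm_mult)
  also have "\<dots> = (\<integral>\<^sup>+x. \<integral>\<^sup>+\<omega>. ?V x (\<omega> + \<alpha> * x) \<partial>lborel \<partial>lborel)"
    by (rule lborel_pair.Fubini') measurable
  also have "\<dots> = (\<integral>\<^sup>+x. \<integral>\<^sup>+\<omega>. ?V x \<omega> \<partial>lborel \<partial>lborel)"
  proof (rule nn_integral_cong)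
    fix x
    show "(\<integral>\<^sup>+\<omega>. ?V x (\<omega> + \<alpha> * x) \<partial>lborel) = (\<integral>\<^sup>+\<omega>. ?V x \<omega> \<partial>lborel)"
      by (subst (2) nn_integral_real_affine[where c=1 and t="\<alpha> * x"]) (auto simp: add.commute)
  qed
  also have "\<dots> = stft_norm (chirp \<alpha> \<psi>) \<Lambda>"
    unfolding stft_norm_def by (rule lborel_pair.Fubini'[symmetric]) measurable
  finally show ?thesis .
qed

lemma stft_translate:
  assumes "\<Lambda> \<in> tempered"
  shows "stft \<psi> (distr_translate s \<Lambda>) x \<omega> = cis (2 * pi * \<omega> * s) * stft \<psi> \<Lambda> (x - s) \<omega>"
proof -
  have "translate (- s) (time_freq x \<omega> \<psi>) = (\<lambda>t. cis (2 * pi * \<omega> * s) * time_freq (x - s) \<omega> \<psi> t)"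
  proof
    fix t
    have "cis (2 * pi * \<omega> * (t + s)) = cis (2 * pi * \<omega> * s) * cis (2 * pi * \<omega> * t)"
      by (simp add: cis_mult algebra_simps)
    then show "translate (- s) (time_freq x \<omega> \<psi>) t = cis (2 * pi * \<omega> * s) * time_freq (x - s) \<omega> \<psi> t"
      by (simp add: translate_def modul_def time_freq_def mult.assoc[symmetric] diff_diff_eq2 diff_add_eq)
  qed
  then show ?thesis by (simp add: distr_translate_def stft_def tempered_cmult[OF assms])
qed

lemma stft_norm_translate:
  assumes "\<Lambda> \<in> tempered" "\<psi> \<in> schwartz"
  shows "stft_norm \<psi> (distr_translate s \<Lambda>) = stft_norm \<psi> \<Lambda>"
proof -
  note [measurable (raw)] = measurable_stft[OF assms]
  have "(\<integral>\<^sup>+x. ennreal (cmod (stft \<psi> \<Lambda> (x - s) \<omega>)) \<partial>lborel) = (\<integral>\<^sup>+x. ennreal (cmod (stft \<psi> \<Lambda> x \<omega>)) \<partial>lborel)" for \<omega>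
    by (subst (2) nn_integral_real_affine[where c=1 and t="- s"]) auto
  then show ?thesis by (simp add: stft_norm_def stft_translate[OF assms(1)] norm_mult)
qed

lemma stft_reflect: "stft \<psi> (distr_reflect \<Lambda>) x \<omega> = stft (reflect \<psi>) \<Lambda> (- x) (- \<omega>)"
proof -
  have "reflect (time_freq x \<omega> \<psi>) = time_freq (- x) (- \<omega>) (reflect \<psi>)"
    by (auto simp: reflect_def time_freq_def modul_def translate_def fun_eq_iff)
  then show ?thesis by (simp add: stft_def distr_reflect_def)
qed

lemma stft_norm_reflect:
  assumes "\<Lambda> \<in> tempered" "\<psi> \<in> schwartz"
  shows "stft_norm \<psi> (distr_reflect \<Lambda>) = stft_norm (reflect \<psi>) \<Lambda>"
proof -
  have "reflect \<psi> \<in> schwartz" using assms(2) by simp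
  note [measurable (raw)] = measurable_stft[OF assms(1) this]
  have "stft_norm \<psi> (distr_reflect \<Lambda>) = (\<integral>\<^sup>+\<omega>. \<integral>\<^sup>+x. ennreal (cmod (stft (reflect \<psi>) \<Lambda> (- x) (- \<omega>))) \<partial>lborel \<partial>lborel)"
    by (simp add: stft_norm_def stft_reflect)
  also have "\<dots> = (\<integral>\<^sup>+\<omega>. \<integral>\<^sup>+x. ennreal (cmod (stft (reflect \<psi>) \<Lambda> (- x) \<omega>)) \<partial>lborel \<partial>lborel)"
    by (subst (2) nn_integral_real_affine[where c="- 1" and t=0]) auto
  also have "\<dots> = stft_norm (reflect \<psi>) \<Lambda>"
    unfolding stft_norm_def
    by (rule nn_integral_cong, subst (2) nn_integral_real_affine[where c="- 1" and t=0]) auto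
  finally show ?thesis .
qed

lemma stft_norm_add:
  assumes "\<Lambda> \<in> tempered" "\<Gamma> \<in> tempered" "\<psi> \<in> schwartz"
  shows "stft_norm \<psi> (\<lambda>\<phi>. \<Lambda> \<phi> + \<Gamma> \<phi>) \<le> stft_norm \<psi> \<Lambda> + stft_norm \<psi> \<Gamma>"
proof -
  note [measurable (raw)] = measurable_stft[OF assms(1,3)] measurable_stft[OF assms(2,3)]
  have "stft_norm \<psi> (\<lambda>\<phi>. \<Lambda> \<phi> + \<Gamma> \<phi>) \<le>
     (\<integral>\<^sup>+\<omega>. \<integral>\<^sup>+x. ennreal (cmod (stft \<psi> \<Lambda> x \<omega>)) + ennreal (cmod (stft \<psi> \<Gamma> x \<omega>)) \<partial>lborel \<partial>lborel)"
    unfolding stft_norm_def stft_def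
    by (intro nn_integral_mono) (auto simp: ennreal_plus[symmetric] norm_triangle_ineq simp del: ennreal_plus)
  also have "\<dots> = stft_norm \<psi> \<Lambda> + stft_norm \<psi> \<Gamma>"
    by (simp add: stft_norm_def nn_integral_add)
  finally show ?thesis .
qed

lemma stft_norm_scale:
  assumes "\<Lambda> \<in> tempered" "\<psi> \<in> schwartz"
  shows "stft_norm \<psi> (\<lambda>\<phi>. k * \<Lambda> \<phi>) = ennreal (cmod k) * stft_norm \<psi> \<Lambda>"
proof -
  note [measurable (raw)] = measurable_stft[OF assms]
  show ?thesis by (simp add: stft_norm_def stft_def[of \<psi> "\<lambda>\<phi>. k * \<Lambda> \<phi>"] stft_def[of \<psi> \<Lambda>, symmetric]
    norm_mult ennreal_mult nn_integral_cmult)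
qed

lemma stft_distr_of: "G \<in> schwartz \<Longrightarrow> stft G (distr_of h) y \<eta> = cross h G y (- \<eta>)"
  using cross_eq_stft[of G h y "- \<eta>"] by simp

text \<open>\<open>cross_decay\<close> integrated over the plane: each variable contributes a
  further factor \<open>pi\<close>.\<close>

lemma stft_norm_distr_of:
  assumes "h \<in> schwartz" "G \<in> schwartz"
  shows "stft_norm G (distr_of h) \<le> ennreal (512 * pi ^ 3 * schwartz_norm 4 h * schwartz_norm 4 G)"
proof -
  define K where "K = 512 * pi * schwartz_norm 4 h * schwartz_norm 4 G"
  have K: "0 \<le> K" unfolding K_def by (intro mult_nonneg_nonneg schwartz_norm_nonneg assms) auto
  have "stft_norm G (distr_of h) \<le> (\<integral>\<^sup>+\<omega>. \<integral>\<^sup>+x. ennreal K * ennreal (kern \<omega>) * ennreal (kern x) \<partial>lborel \<partial>lborel)"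
    unfolding stft_norm_def stft_distr_of[OF assms(2)]
  proof (intro nn_integral_mono)
    fix \<omega> x
    have "cmod (cross h G x (- \<omega>)) \<le> K * (kern x * kern \<omega>)"
      using cross_decay[OF assms, of x "- \<omega>"] by (simp add: K_def)
    then show "ennreal (cmod (cross h G x (- \<omega>))) \<le> ennreal K * ennreal (kern \<omega>) * ennreal (kern x)"
      using K by (simp add: ennreal_mult[symmetric] kern_nonneg ennreal_leI mult_ac)
  qed
  also have "\<dots> = ennreal K * ennreal pi * ennreal pi"
    by (simp add: nn_integral_cmult nn_integral_multc nn_integral_kern)
  also have "\<dots> = ennreal (512 * pi ^ 3 * schwartz_norm 4 h * schwartz_norm 4 G)"
    using K by (simp add: ennreal_mult[symmetric] K_def power3_eq_cube mult_ac)
  finally show ?thesis .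
qed

text \<open>A time-frequency shift only translates the modulus of the transform. This invariance
  makes the bound on the atoms independent of the frequency.\<close>

lemma stft_norm_time_freq:
  assumes "h \<in> schwartz" "G \<in> schwartz"
  shows "stft_norm G (distr_of (time_freq y \<eta> h)) = stft_norm G (distr_of h)"
proof -
  let ?V = "\<lambda>x \<omega>. ennreal (cmod (stft G (distr_of h) x \<omega>))"
  note [measurable (raw)] = measurable_stft[OF tempered_distr_of[OF assms(1)] assms(2)]
  have "cmod (stft G (distr_of (time_freq y \<eta> h)) x \<omega>) = cmod (stft G (distr_of h) (x - y) (\<omega> + \<eta>))" for x \<omega>
    using norm_cross_time_freq[of y \<eta> h G x "- \<omega>"] by (simp add: stft_distr_of[OF assms(2)])
  then have "stft_norm G (distr_of (time_freq y \<eta> h)) = (\<integral>\<^sup>+\<omega>. \<integral>\<^sup>+x. ?V (x - y) (\<omega> + \<eta>) \<partial>lborel \<partial>lborel)"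
    by (simp add: stft_norm_def)
  also have "\<dots> = (\<integral>\<^sup>+\<omega>. \<integral>\<^sup>+x. ?V (x - y) \<omega> \<partial>lborel \<partial>lborel)"
    by (subst (2) nn_integral_real_affine[where c=1 and t=\<eta>]) (auto simp: add.commute)
  also have "\<dots> = stft_norm G (distr_of h)"
    unfolding stft_norm_def
    by (rule nn_integral_cong, subst (2) nn_integral_real_affine[where c=1 and t="- y"]) auto
  finally show ?thesis .
qed

section \<open>The Feichtinger algebra\<close>

lemma S0_iff: "g \<in> schwartz \<Longrightarrow> f \<in> S0 g \<longleftrightarrow> f \<in> tempered \<and> stft_norm (reflect g) f < \<infinity>"
  by (auto simp: S0_def S0_norm_eq)

lemma reflect_nonzero: "g \<noteq> (\<lambda>t. 0) \<Longrightarrow> reflect g \<noteq> (\<lambda>t. 0)"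
  by (metis reflect_def reflect_reflect ext)

lemma S0_tempered: "f \<in> S0 g \<Longrightarrow> f \<in> tempered"
  by (simp add: S0_def)

lemma S0_finite: "f \<in> S0 g \<Longrightarrow> S0_norm g f < \<infinity>"
  by (simp add: S0_def)

lemma S0_add:
  assumes "g \<in> schwartz" "f \<in> S0 g" "h \<in> S0 g"
  shows "(\<lambda>\<phi>. f \<phi> + h \<phi>) \<in> S0 g"
  using assms stft_norm_add[of f h "reflect g"]
  by (auto simp: S0_iff intro!: tempered_plus elim: order.strict_trans1)

lemma S0_scale:
  assumes "g \<in> schwartz" "f \<in> S0 g"
  shows "(\<lambda>\<phi>. k * f \<phi>) \<in> S0 g"
  using assms by (auto simp: S0_iff stft_norm_scale ennreal_mult_less_top intro!: tempered_scale)

lemma S0_translate: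
  assumes "g \<in> schwartz" "f \<in> S0 g"
  shows "distr_translate x f \<in> S0 g" "S0_norm g (distr_translate x f) = S0_norm g f"
  using assms by (auto simp: S0_iff S0_norm_eq stft_norm_translate tempered_translate)

text \<open>Scheme for reflection and chirps, whose only effect on the norm is to replace the
  window; the change of window then bounds them.\<close>

lemma S0_bounded_op:
  assumes g: "g \<in> schwartz" "g \<noteq> (\<lambda>t. 0)" and \<psi>: "\<psi> \<in> schwartz"
    and L: "\<And>f. f \<in> tempered \<Longrightarrow> L f \<in> tempered" "\<And>f. f \<in> tempered \<Longrightarrow> stft_norm (reflect g) (L f) = stft_norm \<psi> f"
  obtains C where "0 \<le> C" "\<And>f. f \<in> S0 g \<Longrightarrow> L f \<in> S0 g" "\<And>f. f \<in> S0 g \<Longrightarrow> S0_norm g (L f) \<le> ennreal C * S0_norm g f"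
proof -
  have G: "reflect g \<in> schwartz" "reflect g \<noteq> (\<lambda>t. 0)" using g reflect_nonzero by auto
  obtain C where C: "0 \<le> C" "\<And>\<Lambda>. \<Lambda> \<in> tempered \<Longrightarrow> stft_norm \<psi> \<Lambda> \<le> ennreal C * stft_norm (reflect g) \<Lambda>"
    using stft_norm_change_window[OF \<psi> G] by blast
  have le: "S0_norm g (L f) \<le> ennreal C * S0_norm g f" if "f \<in> S0 g" for f
    using C(2)[OF S0_tempered[OF that]] L S0_tempered[OF that] g(1) by (simp add: S0_norm_eq)
  moreover have "L f \<in> S0 g" if "f \<in> S0 g" for f
  proof -
    have "ennreal C * S0_norm g f < \<infinity>" using S0_finite[OF that] by (simp add: ennreal_mult_less_top)
    with le[OF that] have "S0_norm g (L f) < \<infinity>" by (rule order.strict_trans1)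
    then show ?thesis using L(1) S0_tempered[OF that] by (simp add: S0_def)
  qed
  ultimately show ?thesis using that C(1) by blast
qed

lemma S0_reflect:
  assumes "g \<in> schwartz" "g \<noteq> (\<lambda>t. 0)"
  obtains C where "0 \<le> C" "\<And>f. f \<in> S0 g \<Longrightarrow> distr_reflect f \<in> S0 g"
    "\<And>f. f \<in> S0 g \<Longrightarrow> S0_norm g (distr_reflect f) \<le> ennreal C * S0_norm g f"
  using assms S0_bounded_op[OF assms, of g distr_reflect]
  by (auto simp: tempered_reflect stft_norm_reflect)

lemma S0_chirp:
  assumes "g \<in> schwartz" "g \<noteq> (\<lambda>t. 0)"
  obtains C where "0 \<le> C" "\<And>f. f \<in> S0 g \<Longrightarrow> distr_chirp \<alpha> f \<in> S0 g"
    "\<And>f. f \<in> S0 g \<Longrightarrow> S0_norm g (distr_chirp \<alpha> f) \<le> ennreal C * S0_norm g f"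
  using assms S0_bounded_op[OF assms, of "chirp \<alpha> (reflect g)" "distr_chirp \<alpha>"]
  by (auto simp: tempered_chirp stft_norm_chirp)

lemma S0_distr_of:
  assumes "g \<in> schwartz" "h \<in> schwartz"
  shows "distr_of h \<in> S0 g"
    "S0_norm g (distr_of h) \<le> ennreal (512 * pi ^ 3 * schwartz_norm 4 h * schwartz_norm 4 (reflect g))"
proof -
  show le: "S0_norm g (distr_of h) \<le> ennreal (512 * pi ^ 3 * schwartz_norm 4 h * schwartz_norm 4 (reflect g))"
    using stft_norm_distr_of[of h "reflect g"] assms by (simp add: S0_norm_eq tempered_distr_of)
  then have "S0_norm g (distr_of h) < \<infinity>" using ennreal_less_top order.strict_trans1 by fastforce
  then show "distr_of h \<in> S0 g" using assms by (simp add: S0_def tempered_distr_of)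
qed

lemma S0_norm_time_freq:
  assumes "g \<in> schwartz" "h \<in> schwartz"
  shows "S0_norm g (distr_of (time_freq y \<eta> h)) = S0_norm g (distr_of h)"
  using assms by (simp add: S0_norm_eq tempered_distr_of stft_norm_time_freq)

lemma integrable_distr_of:
  assumes "h \<in> schwartz" "\<phi> \<in> schwartz"
  shows "integrable lborel (\<lambda>t. h t * \<phi> t)"
  by (intro schwartz_integrable schwartz_mult assms)

lemma distr_of_add:
  assumes "h \<in> schwartz" "k \<in> schwartz"
  shows "distr_of (\<lambda>t. h t + k t) = (\<lambda>\<phi>. distr_of h \<phi> + distr_of k \<phi>)"
  by (auto simp: distr_of_def fun_eq_iff distrib_right integrable_distr_of assms)

lemma distr_of_cmult: "distr_of (\<lambda>t. c * h t) = (\<lambda>\<phi>. c * distr_of h \<phi>)"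
  by (auto simp: distr_of_def fun_eq_iff mult.assoc)

lemma distr_of_translate: "distr_of (translate y h) = distr_translate y (distr_of h)"
proof
  fix \<phi>
  show "distr_of (translate y h) \<phi> = distr_translate y (distr_of h) \<phi>"
    unfolding distr_translate_def distr_of_def
    by (subst (2) lborel_integral_real_affine[where c=1 and t="- y"]) (auto simp: translate_def)
qed

lemma distr_of_reflect: "distr_of (reflect h) = distr_reflect (distr_of h)"
proof
  fix \<phi>
  show "distr_of (reflect h) \<phi> = distr_reflect (distr_of h) \<phi>"
    unfolding distr_reflect_def distr_of_def
    by (subst (2) lborel_integral_real_affine[where c="- 1" and t=0]) (auto simp: reflect_def)
qed

text \<open>Symmetry of the pairing, used to let the test function act as the distribution, so that
  \<open>tempered_synthesis\<close> applies to it.\<close>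

lemma distr_of_commute: "\<phi> \<in> schwartz \<Longrightarrow> h \<in> schwartz \<Longrightarrow> distr_of h \<phi> = distr_of \<phi> h"
  by (simp add: distr_of_def mult.commute)

subsection \<open>Integrals over the time-frequency plane\<close>

lemma nn_integral_plane:
  fixes f :: "real \<times> real \<Rightarrow> ennreal"
  assumes "f \<in> borel_measurable borel"
  shows "(\<integral>\<^sup>+p. f p \<partial>lborel) = (\<integral>\<^sup>+\<eta>. \<integral>\<^sup>+y. f (y, \<eta>) \<partial>lborel \<partial>lborel)"
proof -
  have f: "f \<in> borel_measurable (lborel \<Otimes>\<^sub>M lborel)" using assms by (simp add: lborel_prod)
  show ?thesis
    unfolding lborel_prod[symmetric] by (rule lborel_pair.nn_integral_snd[OF f, symmetric])
qed

lemma integral_plane: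
  fixes f :: "real \<times> real \<Rightarrow> complex"
  assumes "integrable lborel f"
  shows "(\<integral>p. f p \<partial>lborel) = (\<integral>y. \<integral>\<eta>. f (y, \<eta>) \<partial>lborel \<partial>lborel)"
proof -
  have f: "integrable (lborel \<Otimes>\<^sub>M lborel) f" using assms by (simp add: lborel_prod)
  show ?thesis
    unfolding lborel_prod[symmetric] by (rule lborel_pair.integral_fst'[OF f, symmetric])
qed

lemma measurable_stft_plane:
  assumes "\<Lambda> \<in> tempered" "\<psi> \<in> schwartz"
  shows "(\<lambda>p. stft \<psi> \<Lambda> (fst p) (snd p)) \<in> borel_measurable borel"
  by (rule measurable_continuous_UNIV[OF continuous_stft[OF assms]])

lemma stft_norm_plane:
  assumes "\<Lambda> \<in> tempered" "\<psi> \<in> schwartz"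
  shows "stft_norm \<psi> \<Lambda> = (\<integral>\<^sup>+p. ennreal (cmod (stft \<psi> \<Lambda> (fst p) (snd p))) \<partial>lborel)"
proof -
  note [measurable] = measurable_stft_plane[OF assms]
  show ?thesis by (subst nn_integral_plane) (auto simp: stft_norm_def)
qed

lemma integrable_stft_plane:
  assumes "\<Lambda> \<in> tempered" "\<psi> \<in> schwartz" "stft_norm \<psi> \<Lambda> < \<infinity>"
  shows "integrable lborel (\<lambda>p. stft \<psi> \<Lambda> (fst p) (snd p))"
  unfolding integrable_iff_bounded using measurable_stft_plane[OF assms(1,2)] assms(3) stft_norm_plane[OF assms(1,2)]
  by simp

lemma integrable_mult_bounded:
  fixes f h :: "'a \<Rightarrow> complex"
  assumes "integrable M f" "h \<in> borel_measurable M" "\<And>x. cmod (h x) \<le> B"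
  shows "integrable M (\<lambda>x. f x * h x)"
proof (rule Bochner_Integration.integrable_bound)
  show "integrable M (\<lambda>x. B * cmod (f x))" using assms(1) by simp
  show "AE x in M. norm (f x * h x) \<le> norm (B * cmod (f x))"
  proof (intro AE_I2)
    fix x
    have "norm (f x * h x) \<le> cmod (f x) * B"
      unfolding norm_mult by (intro mult_left_mono assms) simp
    then show "norm (f x * h x) \<le> norm (B * cmod (f x))"
      by (smt (verit) mult.commute real_norm_def)
  qed
qed (use assms in auto)

lemma measurable_cross_plane:
  assumes "\<phi> \<in> schwartz" "H \<in> schwartz"
  shows "(\<lambda>p. cross \<phi> H (fst p) (snd p)) \<in> borel_measurable borel"
  by (intro measurable_continuous_UNIV continuous_cross assms continuous_intros)

lemma cross_bounded:
  assumes "\<phi> \<in> schwartz" "H \<in> schwartz"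
  shows "cmod (cross \<phi> H y \<eta>) \<le> 512 * pi * schwartz_norm 4 \<phi> * schwartz_norm 4 H"
proof -
  have "kern y * kern \<eta> \<le> 1" using kern_le_1 kern_nonneg by (simp add: mult_le_one)
  then have "512 * pi * schwartz_norm 4 \<phi> * schwartz_norm 4 H * (kern y * kern \<eta>) \<le> 512 * pi * schwartz_norm 4 \<phi> * schwartz_norm 4 H"
    by (intro mult_left_le) (auto intro!: mult_nonneg_nonneg schwartz_norm_nonneg assms)
  with cross_decay[OF assms, of y \<eta>] show ?thesis by linarith
qed

lemma integrable_cross_stft:
  assumes "\<Lambda> \<in> tempered" "\<phi> \<in> schwartz" "H \<in> schwartz" "G \<in> schwartz" "stft_norm G \<Lambda> < \<infinity>"
  shows "integrable lborel (\<lambda>p. stft G \<Lambda> (fst p) (snd p) * cross \<phi> H (fst p) (snd p))"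
  using measurable_cross_plane[OF assms(2,3)]
  by (intro integrable_mult_bounded[OF integrable_stft_plane[OF assms(1,4,5)] _ cross_bounded[OF assms(2,3)]]) simp

lemma stft_inversion_plane:
  assumes "\<Lambda> \<in> tempered" "\<phi> \<in> schwartz" "H \<in> schwartz" "G \<in> schwartz" "stft_norm G \<Lambda> < \<infinity>"
  shows "(\<integral>t. H t * G t \<partial>lborel) * \<Lambda> \<phi> = (\<integral>p. stft G \<Lambda> (fst p) (snd p) * cross \<phi> H (fst p) (snd p) \<partial>lborel)"
  unfolding stft_inversion[OF assms(1-4)] integral_plane[OF integrable_cross_stft[OF assms]]
  by (simp add: mult.commute)

subsection \<open>Approximation by Schwartz functions\<close>

lemma schwartz_family_compose:
  assumes D: "schwartz_family W D" and \<tau>: "continuous_on V \<tau>" "\<tau> ` V \<subseteq> W"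
  shows "schwartz_family V (\<lambda>n v. D n (\<tau> v))"
  unfolding schwartz_family_def
proof (intro conjI allI ballI)
  fix n
  have "continuous_on (V \<times> UNIV) (\<lambda>x. (\<lambda>(w, t). D n w t) (\<tau> (fst x), snd x))"
    using \<tau>(2) by (intro continuous_on_compose2[OF schwartz_familyD(1)[OF D, of n]])
      (auto intro!: continuous_intros continuous_on_compose2[OF \<tau>(1)])
  then show "continuous_on (V \<times> UNIV) (\<lambda>(v, t). D n (\<tau> v) t)" by (simp add: case_prod_beta)
next
  fix v assume "v \<in> V" then show "deriv_seq (\<lambda>n. D n (\<tau> v))"
    using schwartz_familyD(2)[OF D, of "\<tau> v"] \<tau>(2) by blast
next
  fix k n
  obtain B where "\<And>w t. w \<in> W \<Longrightarrow> (1 + t\<^sup>2) ^ k * cmod (D n w t) \<le> B"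
    using schwartz_familyD(4)[OF D] by blast
  then show "\<exists>B. \<forall>v\<in>V. \<forall>t. (1 + t\<^sup>2) ^ k * cmod (D n (\<tau> v) t) \<le> B"
    using \<tau>(2) by (intro exI[of _ B]) auto
qed

lemma schwartz_family_mult:
  assumes D: "schwartz_family W D" and a: "continuous_on W a" "\<And>w. w \<in> W \<Longrightarrow> cmod (a w) \<le> M"
  shows "schwartz_family W (\<lambda>n w t. a w * D n w t)"
  unfolding schwartz_family_def
proof (intro conjI allI ballI)
  fix n
  have "continuous_on (W \<times> UNIV) (\<lambda>x. a (fst x) * (\<lambda>(w, t). D n w t) x)"
    by (intro continuous_on_mult schwartz_familyD(1)[OF D] continuous_on_compose2[OF a(1)] continuous_on_fst continuous_on_id) auto
  then show "continuous_on (W \<times> UNIV) (\<lambda>(w, t). a w * D n w t)" by (simp add: case_prod_beta)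
next
  fix w assume "w \<in> W" then show "deriv_seq (\<lambda>n t. a w * D n w t)"
    by (intro deriv_seq_cmult schwartz_familyD(2)[OF D])
next
  fix k n
  obtain B where B: "\<And>w t. w \<in> W \<Longrightarrow> (1 + t\<^sup>2) ^ k * cmod (D n w t) \<le> B"
    using schwartz_familyD(4)[OF D] by blast
  have "(1 + t\<^sup>2) ^ k * cmod (a w * D n w t) \<le> M * B" if w: "w \<in> W" for w t
  proof -
    have "0 \<le> M" using order_trans[OF norm_ge_zero a(2)[OF w]] .
    have "(1 + t\<^sup>2) ^ k * cmod (a w * D n w t) = cmod (a w) * ((1 + t\<^sup>2) ^ k * cmod (D n w t))"
      by (simp add: norm_mult)
    also have "\<dots> \<le> M * B" using B[OF w, of t] a(2)[OF w] \<open>0 \<le> M\<close> by (intro mult_mono) auto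
    finally show ?thesis .
  qed
  then show "\<exists>B. \<forall>w\<in>W. \<forall>t. (1 + t\<^sup>2) ^ k * cmod (a w * D n w t) \<le> B" by blast
qed

lemma schwartz_family_integral:
  fixes a b :: real
  assumes E: "schwartz_family ({a..b} \<times> {a..b}) E" and ab: "a \<le> b"
  shows "schwartz_family {a..b} (\<lambda>n y t. integral {a..b} (\<lambda>\<eta>. E n (y, \<eta>) t))"
  unfolding schwartz_family_def
proof (intro conjI allI ballI)
  fix n
  have "continuous_on (({a..b} \<times> UNIV) \<times> {a..b}) (\<lambda>x. (\<lambda>(p, t). E n p t) ((fst (fst x), snd x), snd (fst x)))"
    by (rule continuous_on_compose2[OF schwartz_familyD(1)[OF E, of n]]) (auto intro!: continuous_intros)
  then have "continuous_on (({a..b} \<times> UNIV) \<times> cbox a b) (\<lambda>(q, \<eta>). E n (fst q, \<eta>) (snd q))"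
    by (simp add: case_prod_beta cbox_interval)
  from integral_continuous_on_param[OF this]
  show "continuous_on ({a..b} \<times> UNIV) (\<lambda>(y, t). integral {a..b} (\<lambda>\<eta>. E n (y, \<eta>) t))"
    by (simp add: case_prod_beta cbox_interval)
next
  fix y assume y: "y \<in> {a..b}"
  have "schwartz_family {a..b} (\<lambda>n \<eta>. E n (y, \<eta>))"
    using y by (intro schwartz_family_compose[OF E]) (auto intro!: continuous_intros)
  then show "deriv_seq (\<lambda>n t. integral {a..b} (\<lambda>\<eta>. E n (y, \<eta>) t))" by (rule deriv_seq_integral)
next
  fix k n
  obtain B where B: "\<And>p t. p \<in> {a..b} \<times> {a..b} \<Longrightarrow> (1 + t\<^sup>2) ^ k * cmod (E n p t) \<le> B"
    using schwartz_familyD(4)[OF E] by blast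
  have "(1 + t\<^sup>2) ^ k * cmod (integral {a..b} (\<lambda>\<eta>. E n (y, \<eta>) t)) \<le> B * (b - a)" if y: "y \<in> {a..b}" for y t
  proof (rule weighted_integral_le[OF ab])
    have "schwartz_family {a..b} (\<lambda>n \<eta>. E n (y, \<eta>))"
      using y by (intro schwartz_family_compose[OF E]) (auto intro!: continuous_intros)
    then show "continuous_on {a..b} (\<lambda>\<eta>. E n (y, \<eta>) t)" by (rule schwartz_family_continuous_param)
  qed (use B y in auto)
  then show "\<exists>B. \<forall>y\<in>{a..b}. \<forall>t. (1 + t\<^sup>2) ^ k * cmod (integral {a..b} (\<lambda>\<eta>. E n (y, \<eta>) t)) \<le> B" by blast
qed

lemma tempered_integral_square:
  fixes a b :: real
  assumes \<Lambda>: "\<Lambda> \<in> tempered" and E: "schwartz_family ({a..b} \<times> {a..b}) E" and ab: "a \<le> b"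
  shows "\<Lambda> (\<lambda>t. integral {a..b} (\<lambda>y. integral {a..b} (\<lambda>\<eta>. E 0 (y, \<eta>) t))) =
    integral {a..b} (\<lambda>y. integral {a..b} (\<lambda>\<eta>. \<Lambda> (E 0 (y, \<eta>))))"
proof -
  have "\<Lambda> (\<lambda>t. integral {a..b} (\<lambda>\<eta>. E 0 (y, \<eta>) t)) = integral {a..b} (\<lambda>\<eta>. \<Lambda> (E 0 (y, \<eta>)))" if "y \<in> {a..b}" for y
  proof -
    have "schwartz_family {a..b} (\<lambda>n \<eta>. E n (y, \<eta>))"
      using that by (intro schwartz_family_compose[OF E]) (auto intro!: continuous_intros)
    from tempered_integral[OF \<Lambda> this ab] show ?thesis .
  qed
  then have "integral {a..b} (\<lambda>y. \<Lambda> (\<lambda>t. integral {a..b} (\<lambda>\<eta>. E 0 (y, \<eta>) t))) =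
     integral {a..b} (\<lambda>y. integral {a..b} (\<lambda>\<eta>. \<Lambda> (E 0 (y, \<eta>))))"
    by (rule Henstock_Kurzweil_Integration.integral_cong)
  with tempered_integral[OF \<Lambda> schwartz_family_integral[OF E ab] ab] show ?thesis by simp
qed

text \<open>Passage from iterated gauge integrals over a compact square to the Lebesgue integral
  over the plane, where dominated convergence is available.\<close>

lemma integral_square_eq:
  fixes F :: "real \<times> real \<Rightarrow> complex"
  assumes F: "continuous_on UNIV F"
  shows "integral {a..b} (\<lambda>y. integral {a..b} (\<lambda>\<eta>. F (y, \<eta>))) = (\<integral>p. indicator ({a..b} \<times> {a..b}) p *\<^sub>R F p \<partial>lborel)"
proof -
  have "continuous_on UNIV (\<lambda>x. (\<lambda>(y, \<eta>). F (y, \<eta>)) x)" using F by simp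
  then have c: "continuous_on UNIV (\<lambda>y. integral {a..b} (\<lambda>\<eta>. F (y, \<eta>)))"
    using integral_continuous_on_param[of UNIV a b "\<lambda>y \<eta>. F (y, \<eta>)"]
    by (simp add: cbox_interval continuous_on_subset)
  have c': "continuous_on UNIV (\<lambda>\<eta>. F (y, \<eta>))" for y
    by (rule continuous_on_compose2[OF F]) (auto intro!: continuous_intros)
  have i: "integrable lborel (\<lambda>p. indicator ({a..b} \<times> {a..b}) p *\<^sub>R F p)"
    by (rule borel_integrable_compact[OF compact_Times continuous_on_subset[OF F]]) auto
  have "integral {a..b} (\<lambda>y. integral {a..b} (\<lambda>\<eta>. F (y, \<eta>))) =
     (\<integral>y. indicator {a..b} y *\<^sub>R (\<integral>\<eta>. indicator {a..b} \<eta> *\<^sub>R F (y, \<eta>) \<partial>lborel) \<partial>lborel)"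
    using integral_Icc_eq[OF continuous_on_subset[OF c], of a b] integral_Icc_eq[OF continuous_on_subset[OF c'], of a b]
    by simp
  also have "\<dots> = (\<integral>y. \<integral>\<eta>. indicator ({a..b} \<times> {a..b}) (y, \<eta>) *\<^sub>R F (y, \<eta>) \<partial>lborel \<partial>lborel)"
    by (simp add: indicator_times flip: integral_scaleR_right)
  also have "\<dots> = (\<integral>p. indicator ({a..b} \<times> {a..b}) p *\<^sub>R F p \<partial>lborel)"
    by (rule integral_plane[OF i, symmetric])
  finally show ?thesis .
qed

definition square :: "nat \<Rightarrow> (real \<times> real) set" where
  "square m = {- real m..real m} \<times> {- real m..real m}"

text \<open>The inversion integral cut off to a square, where continuity of the coefficients
  \<open>W\<close> is enough for a Schwartz window to yield a Schwartz function. The sign of the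
  frequency is that of \<open>cross_eq_stft\<close>.\<close>

definition synthesis :: "(real \<Rightarrow> complex) \<Rightarrow> (real \<times> real \<Rightarrow> complex) \<Rightarrow> nat \<Rightarrow> real \<Rightarrow> complex" where
  "synthesis H W m t =
     integral {- real m..real m} (\<lambda>y. integral {- real m..real m} (\<lambda>\<eta>. W (y, \<eta>) * time_freq y (- \<eta>) H t))"

lemma
  assumes H: "H \<in> schwartz" and W: "continuous_on UNIV W"
  shows schwartz_synthesis: "synthesis H W m \<in> schwartz"
    and tempered_synthesis: "\<Lambda> \<in> tempered \<Longrightarrow> \<Lambda> (synthesis H W m) =
      (\<integral>p. indicator (square m) p *\<^sub>R (W p * \<Lambda> (time_freq (fst p) (- snd p) H)) \<partial>lborel)"
proof -
  let ?I = "{- real m..real m}"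
  define E where "E n p t = W p * time_freq_seq H n (fst p, - snd p) t" for n p t
  have E0: "E 0 (y, \<eta>) t = W (y, \<eta>) * time_freq y (- \<eta>) H t" for y \<eta> t by (simp add: E_def time_freq_seq_0)
  have comp: "compact (W ` (?I \<times> ?I))"
    by (intro compact_continuous_image compact_Times continuous_on_subset[OF W]) auto
  then obtain M where M: "\<And>p. p \<in> ?I \<times> ?I \<Longrightarrow> cmod (W p) \<le> M"
    using compact_imp_bounded[OF comp] unfolding bounded_iff by blast
  have bdd: "bounded ((\<lambda>p. (fst p, - snd p)) ` (?I \<times> ?I))"
    by (intro compact_imp_bounded compact_continuous_image compact_Times) (auto intro!: continuous_intros)
  have E: "schwartz_family (?I \<times> ?I) E"
    unfolding E_def
    by (intro schwartz_family_mult[OF _ _ M] continuous_on_subset[OF W]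
        schwartz_family_compose[OF time_freq_family[OF H bdd]])
      (auto intro!: continuous_intros)
  have s: "synthesis H W m = (\<lambda>t. integral ?I (\<lambda>y. integral ?I (\<lambda>\<eta>. E 0 (y, \<eta>) t)))"
    by (simp add: synthesis_def[abs_def] E0)
  show "synthesis H W m \<in> schwartz"
    unfolding s by (rule schwartz_integral[OF schwartz_family_integral[OF E]]) auto
  assume \<Lambda>: "\<Lambda> \<in> tempered"
  let ?F = "\<lambda>p. W p * stft H \<Lambda> (fst p) (- snd p)"
  have cF: "continuous_on UNIV ?F"
    by (intro continuous_on_mult W continuous_stft_compose \<Lambda> H continuous_intros)
  have LE: "\<Lambda> (E 0 (y, \<eta>)) = ?F (y, \<eta>)" for y \<eta>
    using tempered_cmult[OF \<Lambda>] by (simp add: E0[abs_def] stft_def)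
  have "\<Lambda> (synthesis H W m) = integral ?I (\<lambda>y. integral ?I (\<lambda>\<eta>. ?F (y, \<eta>)))"
    unfolding s by (simp only: tempered_integral_square[OF \<Lambda> E] LE)
  also have "\<dots> = (\<integral>p. indicator (square m) p *\<^sub>R ?F p \<partial>lborel)"
    unfolding square_def by (rule integral_square_eq[OF cF])
  finally show "\<Lambda> (synthesis H W m) =
      (\<integral>p. indicator (square m) p *\<^sub>R (W p * \<Lambda> (time_freq (fst p) (- snd p) H)) \<partial>lborel)"
    by (simp add: stft_def)
qed

lemma square_measurable [measurable]: "square m \<in> sets borel"
  unfolding square_def by (intro borel_closed closed_Times) auto

lemma eventually_in_square: "\<forall>\<^sub>F m in sequentially. p \<in> square m"
proof -
  obtain M where M: "\<bar>fst p\<bar> + \<bar>snd p\<bar> \<le> real M" using real_arch_simple by blast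
  show ?thesis
  proof (rule eventually_sequentiallyI[of M])
    fix m assume "M \<le> m"
    with M have "\<bar>fst p\<bar> + \<bar>snd p\<bar> \<le> real m" by linarith
    then show "p \<in> square m" unfolding square_def by (cases p) auto
  qed
qed

text \<open>Schwartz functions are dense in the Feichtinger algebra: truncate the inversion formula.\<close>

theorem S0_approximation:
  assumes g: "g \<in> schwartz" and H: "H \<in> schwartz" and G: "G \<in> schwartz"
    and c: "(\<integral>t. H t * G t \<partial>lborel) = c" "c \<noteq> 0"
    and f: "f \<in> tempered" "stft_norm G f < \<infinity>"
  shows "(\<lambda>m. S0_norm g (\<lambda>\<phi>. f \<phi> + - 1 * distr_of (\<lambda>t. inverse c * synthesis H (\<lambda>p. stft G f (fst p) (snd p)) m t) \<phi>)) \<longlonglongrightarrow> 0"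
proof -
  let ?W = "\<lambda>p. stft G f (fst p) (snd p)"
  let ?h = "\<lambda>m t. inverse c * synthesis H ?W m t"
  \<comment> \<open>Written as a sum with a multiple by \<open>- 1\<close>, the form in which
    closure and linearity are stated.\<close>
  define d where "d m = (\<lambda>\<phi>. f \<phi> + - 1 * distr_of (?h m) \<phi>)" for m
  have W: "continuous_on UNIV ?W" by (rule continuous_stft[OF f(1) G])
  note [measurable] = measurable_continuous_UNIV[OF W]
  have h: "?h m \<in> schwartz" for m by (intro schwartz_cmult schwartz_synthesis H W)
  have d: "d m \<in> tempered" for m
    unfolding d_def by (intro tempered_plus tempered_scale f tempered_distr_of h)
  have G': "reflect g \<in> schwartz" using g by simp
  define K where "K = 512 * pi * schwartz_norm 4 (reflect g) * schwartz_norm 4 H"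
  have K: "0 \<le> K" unfolding K_def by (intro mult_nonneg_nonneg schwartz_norm_nonneg G' H) auto
  define V where "V m y \<eta> = ennreal (indicator (- square m) (y, \<eta>) * cmod (stft G f y \<eta>))" for m y \<eta>
  have V_meas [measurable]: "(\<lambda>(y, \<eta>). V m y \<eta>) \<in> borel_measurable (borel \<Otimes>\<^sub>M borel)" for m
  proof -
    have "(\<lambda>p. ennreal (indicator (- square m) p * cmod (?W p))) \<in> borel_measurable borel" by measurable
    then show ?thesis by (simp add: V_def case_prod_unfold borel_prod)
  qed
  \<comment> \<open>The truncation error is the part of the inversion integral outside the
    square.\<close>
  have dphi: "c * d m \<phi> = (\<integral>p. indicator (- square m) p *\<^sub>R (?W p * cross \<phi> H (fst p) (snd p)) \<partial>lborel)"
    if \<phi>: "\<phi> \<in> schwartz" for m \<phi>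
  proof -
    have i: "integrable lborel (\<lambda>p. ?W p * cross \<phi> H (fst p) (snd p))"
      by (rule integrable_cross_stft[OF f(1) \<phi> H G f(2)])
    have i': "integrable lborel (\<lambda>p. indicator (square m) p *\<^sub>R (?W p * cross \<phi> H (fst p) (snd p)))"
      by (intro integrable_mult_indicator i) simp
    have "distr_of (?h m) \<phi> = distr_of \<phi> (?h m)" by (rule distr_of_commute[OF \<phi> h])
    also have "\<dots> = inverse c * distr_of \<phi> (synthesis H ?W m)"
      by (rule tempered_cmult[OF tempered_distr_of[OF \<phi>]])
    also have "distr_of \<phi> (synthesis H ?W m) = (\<integral>p. indicator (square m) p *\<^sub>R (?W p * cross \<phi> H (fst p) (snd p)) \<partial>lborel)"
      by (subst tempered_synthesis[OF H W tempered_distr_of[OF \<phi>]]) (simp add: cross_eq_stft[OF H] stft_def[of H])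
    finally have "c * d m \<phi> = c * f \<phi> - (\<integral>p. indicator (square m) p *\<^sub>R (?W p * cross \<phi> H (fst p) (snd p)) \<partial>lborel)"
      using c(2) by (simp add: d_def right_diff_distrib mult.assoc[symmetric])
    also have "c * f \<phi> = (\<integral>p. ?W p * cross \<phi> H (fst p) (snd p) \<partial>lborel)"
      using stft_inversion_plane[OF f(1) \<phi> H G f(2)] c(1) by simp
    also have "\<dots> - (\<integral>p. indicator (square m) p *\<^sub>R (?W p * cross \<phi> H (fst p) (snd p)) \<partial>lborel) =
      (\<integral>p. ?W p * cross \<phi> H (fst p) (snd p) - indicator (square m) p *\<^sub>R (?W p * cross \<phi> H (fst p) (snd p)) \<partial>lborel)"
      using i i' by simp
    also have "\<dots> = (\<integral>p. indicator (- square m) p *\<^sub>R (?W p * cross \<phi> H (fst p) (snd p)) \<partial>lborel)"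
      by (intro Bochner_Integration.integral_cong) (auto simp: indicator_def)
    finally show ?thesis .
  qed
  \<comment> \<open>As in the change of window, but with the transform of \<open>f\<close> cut off
    to the complement of the square; what remains is a tail of a convergent integral.\<close>
  have bound: "S0_norm g (d m) \<le> ennreal (K / cmod c * pi\<^sup>2) * (\<integral>\<^sup>+p. ennreal (indicator (- square m) p * cmod (?W p)) \<partial>lborel)" for m
  proof -
    have "stft_norm (reflect g) (d m) \<le> ennreal (K / cmod c * pi\<^sup>2) * (\<integral>\<^sup>+\<eta>. \<integral>\<^sup>+y. V m y \<eta> \<partial>lborel \<partial>lborel)"
    proof (rule stft_norm_le_smear[OF V_meas])
      show "0 \<le> K / cmod c" using K by simp
      fix x \<omega>
      let ?\<phi> = "time_freq x \<omega> (reflect g)"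
      have \<phi>: "?\<phi> \<in> schwartz" using G' by simp
      note [measurable] = measurable_cross_plane[OF \<phi> H]
      have "ennreal (cmod c * cmod (d m ?\<phi>)) \<le>
        (\<integral>\<^sup>+p. ennreal (cmod (indicator (- square m) p *\<^sub>R (?W p * cross ?\<phi> H (fst p) (snd p)))) \<partial>lborel)"
        unfolding norm_mult[symmetric] dphi[OF \<phi>] by (rule norm_integral_le_nn_integral)
      also have "\<dots> = (\<integral>\<^sup>+\<eta>. \<integral>\<^sup>+y. ennreal (cmod (indicator (- square m) (y, \<eta>) *\<^sub>R (stft G f y \<eta> * cross ?\<phi> H y \<eta>))) \<partial>lborel \<partial>lborel)"
        by (subst nn_integral_plane) auto
      also have "\<dots> \<le> (\<integral>\<^sup>+\<eta>. \<integral>\<^sup>+y. (ennreal K * ennreal (kern (\<omega> - \<eta>))) * (V m y \<eta> * ennreal (kern (x - y))) \<partial>lborel \<partial>lborel)"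
      proof (intro nn_integral_mono)
        fix \<eta> y
        have "cmod (cross ?\<phi> H y \<eta>) \<le> K * (kern (x - y) * kern (\<omega> - \<eta>))"
          unfolding norm_cross_time_freq K_def kern_diff_commute[of x] kern_diff_commute[of \<omega>] by (intro cross_decay G' H)
        then have "cmod (indicator (- square m) (y, \<eta>) *\<^sub>R (stft G f y \<eta> * cross ?\<phi> H y \<eta>)) \<le>
          indicator (- square m) (y, \<eta>) * cmod (stft G f y \<eta>) * (K * (kern (x - y) * kern (\<omega> - \<eta>)))"
          by (auto simp: norm_mult indicator_def intro: mult_left_mono)
        then have "ennreal (cmod (indicator (- square m) (y, \<eta>) *\<^sub>R (stft G f y \<eta> * cross ?\<phi> H y \<eta>))) \<le>
          ennreal (indicator (- square m) (y, \<eta>) * cmod (stft G f y \<eta>) * (K * (kern (x - y) * kern (\<omega> - \<eta>))))"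
          by (rule ennreal_leI)
        also have "\<dots> = (ennreal K * ennreal (kern (\<omega> - \<eta>))) * (V m y \<eta> * ennreal (kern (x - y)))"
          using K by (simp add: V_def ennreal_mult kern_nonneg mult_ac)
        finally show "ennreal (cmod (indicator (- square m) (y, \<eta>) *\<^sub>R (stft G f y \<eta> * cross ?\<phi> H y \<eta>))) \<le>
          (ennreal K * ennreal (kern (\<omega> - \<eta>))) * (V m y \<eta> * ennreal (kern (x - y)))" .
      qed
      also have "\<dots> = ennreal K * smear (V m) x \<omega>"
        unfolding smear_def by (simp add: nn_integral_cmult mult.assoc)
      finally have "ennreal (1 / cmod c) * ennreal (cmod c * cmod (d m ?\<phi>)) \<le> ennreal (1 / cmod c) * (ennreal K * smear (V m) x \<omega>)"
        by (intro mult_left_mono) auto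
      moreover have "ennreal (1 / cmod c) * ennreal (cmod c * cmod (d m ?\<phi>)) = ennreal (cmod (d m ?\<phi>))"
        using c(2) by (simp add: ennreal_mult[symmetric])
      moreover have "ennreal (1 / cmod c) * ennreal K = ennreal (K / cmod c)"
        using K by (simp add: ennreal_mult[symmetric])
      ultimately show "ennreal (cmod (stft (reflect g) (d m) x \<omega>)) \<le> ennreal (K / cmod c) * smear (V m) x \<omega>"
        by (simp only: stft_def mult.assoc[symmetric])
    qed
    moreover have "(\<integral>\<^sup>+\<eta>. \<integral>\<^sup>+y. V m y \<eta> \<partial>lborel \<partial>lborel) = (\<integral>\<^sup>+p. ennreal (indicator (- square m) p * cmod (?W p)) \<partial>lborel)"
      by (subst nn_integral_plane) (auto simp: V_def)
    ultimately show ?thesis using d g by (simp add: S0_norm_eq)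
  qed
  have "(\<lambda>m. \<integral>\<^sup>+p. ennreal (indicator (- square m) p * cmod (?W p)) \<partial>lborel) \<longlonglongrightarrow> (\<integral>\<^sup>+p. 0 \<partial>(lborel :: (real \<times> real) measure))"
  proof (rule nn_integral_dominated_convergence[where w="\<lambda>p. ennreal (cmod (?W p))"])
    show "(\<integral>\<^sup>+p. ennreal (cmod (?W p)) \<partial>lborel) < \<infinity>"
      using f(2) stft_norm_plane[OF f(1) G] by simp
    show "AE p in lborel. (\<lambda>m. ennreal (indicator (- square m) p * cmod (?W p))) \<longlonglongrightarrow> 0"
    proof (intro AE_I2 tendsto_eventually)
      fix p
      show "\<forall>\<^sub>F m in sequentially. ennreal (indicator (- square m) p * cmod (?W p)) = 0"
        using eventually_in_square[of p] by eventually_elim simp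
    qed
    show "AE p in lborel. ennreal (indicator (- square m) p * cmod (?W p)) \<le> ennreal (cmod (?W p))" for m
      by (intro AE_I2) (auto simp: indicator_def)
  qed measurable
  then have "(\<lambda>m. ennreal (K / cmod c * pi\<^sup>2) * (\<integral>\<^sup>+p. ennreal (indicator (- square m) p * cmod (?W p)) \<partial>lborel)) \<longlonglongrightarrow> ennreal (K / cmod c * pi\<^sup>2) * 0"
    by (intro ennreal_tendsto_cmult) (auto simp: ennreal_less_top)
  then have lim: "(\<lambda>m. ennreal (K / cmod c * pi\<^sup>2) * (\<integral>\<^sup>+p. ennreal (indicator (- square m) p * cmod (?W p)) \<partial>lborel)) \<longlonglongrightarrow> 0"
    by simp
  show ?thesis
    unfolding d_def[symmetric]
  proof (rule tendsto_sandwich[OF _ _ tendsto_const lim])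
    show "\<forall>\<^sub>F m in sequentially. S0_norm g (d m) \<le>
      ennreal (K / cmod c * pi\<^sup>2) * (\<integral>\<^sup>+p. ennreal (indicator (- square m) p * cmod (?W p)) \<partial>lborel)"
      by (intro always_eventually allI bound)
  qed simp
qed

section \<open>Translation-invariant operators on the Feichtinger algebra\<close>

lemma time_freq_close:
  assumes "\<psi> \<in> schwartz" "0 < e"
  shows "\<exists>d>0. \<forall>w. dist w w0 < d \<longrightarrow>
    schwartz_norm N (\<lambda>t. time_freq (fst w) (snd w) \<psi> t - time_freq (fst w0) (snd w0) \<psi> t) \<le> e"
proof -
  let ?e = "e / (real N + 1)\<^sup>2"
  have fam: "schwartz_family (ball w0 1) (time_freq_seq \<psi>)"
    by (rule time_freq_family[OF assms(1) bounded_ball])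
  have "0 < ?e" using assms(2) by (simp add: add_nonneg_pos)
  from schwartz_family_close_upto[OF fam _ this, of w0 N N]
  obtain d where d: "0 < d" "\<And>w n t. w \<in> ball w0 1 \<Longrightarrow> dist w w0 < d \<Longrightarrow> n \<le> N \<Longrightarrow>
      (1 + t\<^sup>2) ^ N * cmod (time_freq_seq \<psi> n w t - time_freq_seq \<psi> n w0 t) \<le> ?e" by auto
  show ?thesis
  proof (intro exI[of _ "min d 1"] conjI allI impI)
    show "0 < min d 1" using d(1) by simp
    fix w assume w: "dist w w0 < min d 1"
    have "schwartz_norm N ((\<lambda>n t. time_freq_seq \<psi> n w t - time_freq_seq \<psi> n w0 t) 0) \<le> (real N + 1)\<^sup>2 * ?e"
      using w by (intro schwartz_norm_le deriv_seq_diff deriv_seq_time_freq assms d(2)) (auto simp: dist_commute)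
    also have "(real N + 1)\<^sup>2 * ?e = e" by (simp add: add_nonneg_eq_0_iff)
    finally show "schwartz_norm N (\<lambda>t. time_freq (fst w) (snd w) \<psi> t - time_freq (fst w0) (snd w0) \<psi> t) \<le> e"
      by (simp add: time_freq_seq_0)
  qed
qed

text \<open>The target space enters through bounded transforms, with a constant for each window;
  this property is shared by all the target modulation spaces, whatever their exponents.\<close>

locale translation_invariant_op =
  fixes g :: "real \<Rightarrow> complex" and S :: "functional \<Rightarrow> functional"
  assumes g: "g \<in> schwartz" "g \<noteq> (\<lambda>t. 0)"
    and add: "f \<in> S0 g \<Longrightarrow> h \<in> S0 g \<Longrightarrow> S (\<lambda>\<phi>. f \<phi> + h \<phi>) = (\<lambda>\<phi>. S f \<phi> + S h \<phi>)"
    and scale: "f \<in> S0 g \<Longrightarrow> S (\<lambda>\<phi>. k * f \<phi>) = (\<lambda>\<phi>. k * S f \<phi>)"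
    and tempered: "f \<in> S0 g \<Longrightarrow> S f \<in> tempered"
    and stft_bounded: "\<psi> \<in> schwartz \<Longrightarrow>
      \<exists>C. \<forall>f\<in>S0 g. \<forall>x \<omega>. ennreal (cmod (stft \<psi> (S f) x \<omega>)) \<le> ennreal C * S0_norm g f"
    and translate: "f \<in> S0 g \<Longrightarrow> S (distr_translate x f) = distr_translate x (S f)"
begin

lemma G: "reflect g \<in> schwartz" "reflect g \<noteq> (\<lambda>t. 0)"
  using g reflect_nonzero by auto

lemma stft_bound:
  assumes "\<psi> \<in> schwartz"
  obtains C where "0 \<le> C" "\<And>f x \<omega>. f \<in> S0 g \<Longrightarrow> ennreal (cmod (stft \<psi> (S f) x \<omega>)) \<le> ennreal C * S0_norm g f"
proof -
  obtain C where C: "\<And>f x \<omega>. f \<in> S0 g \<Longrightarrow> ennreal (cmod (stft \<psi> (S f) x \<omega>)) \<le> ennreal C * S0_norm g f"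
    using stft_bounded[OF assms] by blast
  have "ennreal (cmod (stft \<psi> (S f) x \<omega>)) \<le> ennreal \<bar>C\<bar> * S0_norm g f" if "f \<in> S0 g" for f x \<omega>
    by (rule order_trans[OF C[OF that]]) (auto intro!: mult_right_mono ennreal_leI)
  with that[of "\<bar>C\<bar>"] show ?thesis by simp
qed

text \<open>In the inversion formula for \<open>S f \<phi>\<close> the transform of
  \<open>S f\<close> is bounded, and by \<open>cross_decay\<close> the coefficients of
  \<open>\<phi>\<close> are integrable, with mass at most a multiple of
  \<open>schwartz_norm 4 \<phi>\<close>. The estimate is joint in both arguments: it makes
  \<open>pairing\<close> tempered and allows limits in \<open>f\<close>.\<close>

lemma op_bound:
  obtains C where "0 \<le> C"
    "\<And>f \<phi>. f \<in> S0 g \<Longrightarrow> \<phi> \<in> schwartz \<Longrightarrow> ennreal (cmod (S f \<phi>)) \<le> ennreal (C * schwartz_norm 4 \<phi>) * S0_norm g f"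
proof -
  define G where "G = reflect g"
  define H where "H = (\<lambda>t. cnj (G t))"
  define c where "c = cmod (\<integral>t. H t * G t \<partial>lborel)"
  have G': "G \<in> schwartz" using G by (simp add: G_def)
  have H: "H \<in> schwartz" unfolding H_def by (rule schwartz_cnj[OF G'])
  have c: "0 < c" unfolding c_def H_def using schwartz_window_integral_pos[of G] G by (simp add: G_def)
  obtain C where C: "0 \<le> C" "\<And>f x \<omega>. f \<in> S0 g \<Longrightarrow> ennreal (cmod (stft G (S f) x \<omega>)) \<le> ennreal C * S0_norm g f"
    using stft_bound[OF G'] by blast
  define K where "K = 512 * pi * schwartz_norm 4 H"
  have K: "0 \<le> K" unfolding K_def by (intro mult_nonneg_nonneg schwartz_norm_nonneg H) auto
  show ?thesis
  proof (rule that[of "K * pi\<^sup>2 * C / c"])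
    show "0 \<le> K * pi\<^sup>2 * C / c" using K C c by simp
    fix f \<phi> assume f: "f \<in> S0 g" and \<phi>: "\<phi> \<in> schwartz"
    define P where "P = schwartz_norm 4 \<phi>"
    have P: "0 \<le> P" unfolding P_def by (rule schwartz_norm_nonneg[OF \<phi>])
    have "ennreal (c * cmod (S f \<phi>)) \<le>
      (\<integral>\<^sup>+\<eta>. \<integral>\<^sup>+y. ennreal (cmod (cross \<phi> H y \<eta>)) * ennreal (cmod (stft G (S f) y \<eta>)) \<partial>lborel \<partial>lborel)"
      unfolding c_def by (intro tempered_le_stft tempered f \<phi> H G')
    also have "\<dots> \<le> (\<integral>\<^sup>+\<eta>. \<integral>\<^sup>+y. (ennreal (K * P * C) * S0_norm g f * ennreal (kern \<eta>)) * ennreal (kern y) \<partial>lborel \<partial>lborel)"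
    proof (intro nn_integral_mono)
      fix \<eta> y
      have "ennreal (cmod (cross \<phi> H y \<eta>)) * ennreal (cmod (stft G (S f) y \<eta>)) \<le>
        ennreal (K * P * (kern y * kern \<eta>)) * (ennreal C * S0_norm g f)"
        using cross_decay[OF \<phi> H, of y \<eta>] by (intro mult_mono C f ennreal_leI) (auto simp: K_def P_def mult_ac)
      also have "\<dots> = (ennreal (K * P * C) * S0_norm g f * ennreal (kern \<eta>)) * ennreal (kern y)"
        using K P C by (simp add: ennreal_mult kern_nonneg mult_ac)
      finally show "ennreal (cmod (cross \<phi> H y \<eta>)) * ennreal (cmod (stft G (S f) y \<eta>)) \<le>
        (ennreal (K * P * C) * S0_norm g f * ennreal (kern \<eta>)) * ennreal (kern y)" .
    qed
    also have "\<dots> = ennreal (K * P * C) * S0_norm g f * ennreal pi * ennreal pi"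
      by (simp add: nn_integral_cmult nn_integral_multc nn_integral_kern)
    also have "\<dots> = ennreal (K * P * C * pi * pi) * S0_norm g f"
      using K P C by (simp add: ennreal_mult mult_ac)
    finally have "ennreal (1 / c) * ennreal (c * cmod (S f \<phi>)) \<le> ennreal (1 / c) * (ennreal (K * P * C * pi * pi) * S0_norm g f)"
      by (intro mult_left_mono) auto
    moreover have "ennreal (1 / c) * ennreal (c * cmod (S f \<phi>)) = ennreal (cmod (S f \<phi>))"
      using c by (simp add: ennreal_mult[symmetric])
    moreover have "ennreal (1 / c) * ennreal (K * P * C * pi * pi) = ennreal (K * pi\<^sup>2 * C / c * P)"
      using c K P C by (simp add: ennreal_mult[symmetric] power2_eq_square mult_ac)
    ultimately show "ennreal (cmod (S f \<phi>)) \<le> ennreal (K * pi\<^sup>2 * C / c * schwartz_norm 4 \<phi>) * S0_norm g f"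
      by (simp only: mult.assoc[symmetric] P_def)
  qed
qed

lemma distr_of_S0: "h \<in> schwartz \<Longrightarrow> distr_of h \<in> S0 g"
  by (rule S0_distr_of(1)[OF g(1)])

text \<open>With the output test function frozen, the operator becomes a scalar tempered
  distribution of the input, through which integrals may be pulled.\<close>

definition pairing :: "(real \<Rightarrow> complex) \<Rightarrow> functional" where
  "pairing \<phi> h = (if h \<in> schwartz then S (distr_of h) \<phi> else 0)"

lemma tempered_pairing:
  assumes \<phi>: "\<phi> \<in> schwartz"
  shows "pairing \<phi> \<in> tempered"
proof -
  obtain C where C: "0 \<le> C"
    "\<And>f \<phi>. f \<in> S0 g \<Longrightarrow> \<phi> \<in> schwartz \<Longrightarrow> ennreal (cmod (S f \<phi>)) \<le> ennreal (C * schwartz_norm 4 \<phi>) * S0_norm g f"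
    using op_bound by blast
  define P where "P = schwartz_norm 4 \<phi>"
  have P: "0 \<le> P" unfolding P_def by (rule schwartz_norm_nonneg[OF \<phi>])
  define Q where "Q = schwartz_norm 4 (reflect g)"
  have Q: "0 \<le> Q" unfolding Q_def by (rule schwartz_norm_nonneg[OF G(1)])
  show ?thesis
  proof (rule temperedI[where N=4 and K="C * P * (512 * pi ^ 3) * Q"])
    fix h assume h: "h \<in> schwartz"
    define R where "R = schwartz_norm 4 h"
    have R: "0 \<le> R" unfolding R_def by (rule schwartz_norm_nonneg[OF h])
    have "ennreal (cmod (S (distr_of h) \<phi>)) \<le> ennreal (C * P) * S0_norm g (distr_of h)"
      unfolding P_def by (rule C(2)[OF distr_of_S0[OF h] \<phi>])
    also have "\<dots> \<le> ennreal (C * P) * ennreal (512 * pi ^ 3 * R * Q)"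
      unfolding R_def Q_def by (intro mult_left_mono S0_distr_of(2) g h) auto
    also have "\<dots> = ennreal (C * P * (512 * pi ^ 3) * Q * R)"
      using C(1) P Q R by (simp add: ennreal_mult[symmetric] mult_ac)
    finally show "cmod (pairing \<phi> h) \<le> C * P * (512 * pi ^ 3) * Q * schwartz_norm 4 h"
      using C(1) P Q R h by (subst (asm) ennreal_le_iff) (auto simp: pairing_def R_def)
  qed (auto simp: pairing_def schwartz_add schwartz_cmult distr_of_add distr_of_cmult add scale distr_of_S0)
qed

text \<open>Translates of \<open>h1\<close> pass through \<open>pairing \<phi>\<close>, invariance
  moves the translation onto \<open>\<phi>\<close>, and the result is a convolution with
  \<open>\<phi>\<close>. Commuting that convolution makes \<open>\<phi>\<close> the density, which
  exhibits the image as a function.\<close>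

lemma op_convolution:
  assumes h: "h1 \<in> schwartz" "h2 \<in> schwartz" and \<phi>: "\<phi> \<in> schwartz"
  shows "S (distr_of (convolution h1 h2)) \<phi> = (\<integral>x. \<phi> x * S (distr_of h1) (translate x (reflect h2)) \<partial>lborel)"
proof -
  define \<Lambda> where "\<Lambda> = S (distr_of h1)"
  have \<Lambda>: "\<Lambda> \<in> tempered" unfolding \<Lambda>_def by (rule tempered[OF distr_of_S0[OF h(1)]])
  have "S (distr_of (convolution h1 h2)) \<phi> = pairing \<phi> (convolution h2 h1)"
    using h by (simp add: pairing_def convolution_schwartz convolution_commute[of h1])
  also have "\<dots> = (\<integral>y. h2 y * pairing \<phi> (translate y h1) \<partial>lborel)"
    by (rule tempered_convolution[OF tempered_pairing[OF \<phi>] h(2,1)])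
  also have "\<dots> = (\<integral>y. h2 y * \<Lambda> (translate (- y) \<phi>) \<partial>lborel)"
    using h by (simp add: pairing_def distr_of_translate translate distr_of_S0) (simp add: distr_translate_def \<Lambda>_def)
  also have "\<dots> = (\<integral>y. reflect h2 y * \<Lambda> (translate y \<phi>) \<partial>lborel)"
    by (subst lborel_integral_real_affine[where c="- 1" and t=0]) (auto simp: reflect_def)
  also have "\<dots> = \<Lambda> (convolution (reflect h2) \<phi>)"
    by (rule tempered_convolution[OF \<Lambda> _ \<phi>, symmetric]) (use h in simp)
  also have "\<dots> = (\<integral>x. \<phi> x * \<Lambda> (translate x (reflect h2)) \<partial>lborel)"
    by (subst convolution_commute, rule tempered_convolution[OF \<Lambda> \<phi>]) (use h in simp)
  finally show ?thesis by (simp add: \<Lambda>_def)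
qed

section \<open>Images of the time-frequency shifts of a Gaussian window\<close>

definition \<gamma> :: "real \<Rightarrow> complex" where "\<gamma> t = of_real (exp (- t\<^sup>2))"

definition H :: "real \<Rightarrow> complex" where "H = convolution \<gamma> \<gamma>"

lemma \<gamma>: "\<gamma> \<in> schwartz"
  using schwartz_gauss[of 1] by (simp add: \<gamma>_def[abs_def])

lemma reflect_\<gamma>: "reflect \<gamma> = \<gamma>"
  by (simp add: fun_eq_iff reflect_def \<gamma>_def)

lemma H: "H \<in> schwartz"
  unfolding H_def by (intro convolution_schwartz \<gamma>)

text \<open>At 0 the convolution of the real even function \<open>\<gamma>\<close> with itself is
  the integral of its square.\<close>

lemma H_nonzero: "H \<noteq> (\<lambda>t. 0)"
proof -
  have "\<gamma> 0 \<noteq> 0" by (simp add: \<gamma>_def)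
  then have "(\<integral>t. cnj (\<gamma> t) * \<gamma> t \<partial>lborel) \<noteq> 0"
    by (intro schwartz_window_integral_pos \<gamma>) auto
  moreover have "cnj (\<gamma> t) * \<gamma> t = \<gamma> t * \<gamma> (0 - t)" for t by (simp add: \<gamma>_def)
  ultimately have "H 0 \<noteq> 0" by (simp add: H_def convolution_def)
  then show ?thesis using fun_cong[of H "\<lambda>t. 0" 0] by blast
qed

text \<open>A character is multiplicative. Hence every modulation of \<open>H\<close> is again a
  convolution, and \<open>op_convolution\<close> applies to it.\<close>

lemma modul_convolution: "modul \<eta> (convolution h k) = convolution (modul \<eta> h) (modul \<eta> k)"
proof
  fix t
  have "modul \<eta> (convolution h k) t = (\<integral>x. cis (2 * pi * \<eta> * t) * (h x * k (t - x)) \<partial>lborel)"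
    by (simp add: modul_def convolution_def)
  also have "\<dots> = (\<integral>x. (cis (2 * pi * \<eta> * x) * h x) * (cis (2 * pi * \<eta> * (t - x)) * k (t - x)) \<partial>lborel)"
  proof (intro Bochner_Integration.integral_cong refl)
    fix x
    have "cis (2 * pi * \<eta> * t) = cis (2 * pi * \<eta> * x) * cis (2 * pi * \<eta> * (t - x))"
      by (simp add: cis_mult right_diff_distrib)
    then show "cis (2 * pi * \<eta> * t) * (h x * k (t - x)) =
      (cis (2 * pi * \<eta> * x) * h x) * (cis (2 * pi * \<eta> * (t - x)) * k (t - x))"
      by (simp only: mult_ac)
  qed
  finally show "modul \<eta> (convolution h k) t = convolution (modul \<eta> h) (modul \<eta> k) t"
    by (simp add: convolution_def modul_def)
qed

text \<open>Since \<open>H = \<gamma> * \<gamma>\<close>, the image of every time-frequency shift of \<open>H\<close> is a function, namely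
  a convolution of a tempered distribution with a Schwartz function.\<close>

definition atom :: "real \<Rightarrow> real \<Rightarrow> real \<Rightarrow> complex" where
  "atom y \<eta> x = cis (- (2 * pi * \<eta> * y)) *
     S (distr_of (modul (- \<eta>) \<gamma>)) (translate (x - y) (reflect (modul (- \<eta>) \<gamma>)))"

lemma op_time_freq:
  assumes \<phi>: "\<phi> \<in> schwartz"
  shows "S (distr_of (time_freq y (- \<eta>) H)) \<phi> = (\<integral>x. atom y \<eta> x * \<phi> x \<partial>lborel)"
proof -
  let ?\<gamma> = "modul (- \<eta>) \<gamma>"
  let ?k = "cis (- (2 * pi * \<eta> * y))"
  have \<gamma>': "?\<gamma> \<in> schwartz" using \<gamma> by simp
  have H': "modul (- \<eta>) H \<in> schwartz" using H by simp
  \<comment> \<open>Exchanging modulation and translation costs a constant phase; the translation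
    has to be outermost for invariance to apply.\<close>
  have "time_freq y (- \<eta>) H = (\<lambda>t. ?k * translate y (modul (- \<eta>) H) t)"
  proof
    fix t
    have "cis (2 * pi * (- \<eta>) * t) = ?k * cis (2 * pi * (- \<eta>) * (t - y))"
      by (simp add: cis_mult algebra_simps)
    then show "time_freq y (- \<eta>) H t = ?k * translate y (modul (- \<eta>) H) t"
      by (simp add: time_freq_def modul_def translate_def mult.assoc)
  qed
  then have "S (distr_of (time_freq y (- \<eta>) H)) \<phi> = ?k * S (distr_of (modul (- \<eta>) H)) (translate (- y) \<phi>)"
    using distr_of_S0[OF H'] S0_translate(1)[OF g(1) distr_of_S0[OF H'], of y]
    by (simp add: distr_of_cmult distr_of_translate scale translate) (simp add: distr_translate_def)
  also have "modul (- \<eta>) H = convolution ?\<gamma> ?\<gamma>" unfolding H_def by (rule modul_convolution)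
  also have "S (distr_of (convolution ?\<gamma> ?\<gamma>)) (translate (- y) \<phi>) =
     (\<integral>x. translate (- y) \<phi> x * S (distr_of ?\<gamma>) (translate x (reflect ?\<gamma>)) \<partial>lborel)"
    using \<phi> by (intro op_convolution \<gamma>') simp
  also have "\<dots> = (\<integral>x. \<phi> x * S (distr_of ?\<gamma>) (translate (x - y) (reflect ?\<gamma>)) \<partial>lborel)"
    by (subst (2) lborel_integral_real_affine[where c=1 and t=y]) (auto simp: translate_def add.commute)
  also have "?k * \<dots> = (\<integral>x. atom y \<eta> x * \<phi> x \<partial>lborel)"
    unfolding integral_mult_right_zero[symmetric] by (simp add: atom_def mult_ac)
  finally show ?thesis .
qed

text \<open>In the definition both the window and the distribution move with \<open>\<eta>\<close>.
  Here the window is fixed, so that \<open>stft_bound\<close> gives one constant for all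
  \<open>\<eta>\<close>; the distribution still varies, but as the image of a family of constant
  norm.\<close>

lemma atom_eq:
  "atom y \<eta> x = cis (- (2 * pi * \<eta> * x)) * stft \<gamma> (S (distr_of (time_freq 0 (- \<eta>) \<gamma>))) (x - y) \<eta>"
proof -
  have S: "S (distr_of (modul (- \<eta>) \<gamma>)) \<in> tempered"
    using \<gamma> by (intro tempered distr_of_S0) simp
  have "translate (x - y) (reflect (modul (- \<eta>) \<gamma>)) = (\<lambda>t. cis (- (2 * pi * \<eta> * (x - y))) * time_freq (x - y) \<eta> \<gamma> t)"
  proof
    fix t
    have "cis (2 * pi * (- \<eta>) * (- (t - (x - y)))) = cis (- (2 * pi * \<eta> * (x - y))) * cis (2 * pi * \<eta> * t)"
      by (simp add: cis_mult algebra_simps)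
    then show "translate (x - y) (reflect (modul (- \<eta>) \<gamma>)) t = cis (- (2 * pi * \<eta> * (x - y))) * time_freq (x - y) \<eta> \<gamma> t"
      using fun_cong[OF reflect_\<gamma>, of "t - (x - y)"]
      by (simp add: translate_def reflect_def modul_def time_freq_def mult.assoc)
  qed
  then have "atom y \<eta> x = cis (- (2 * pi * \<eta> * y)) * (cis (- (2 * pi * \<eta> * (x - y))) *
     stft \<gamma> (S (distr_of (modul (- \<eta>) \<gamma>))) (x - y) \<eta>)"
    by (simp add: atom_def stft_def tempered_cmult[OF S])
  also have "\<dots> = cis (- (2 * pi * \<eta> * x)) * stft \<gamma> (S (distr_of (modul (- \<eta>) \<gamma>))) (x - y) \<eta>"
  proof -
    have "cis (- (2 * pi * \<eta> * y)) * cis (- (2 * pi * \<eta> * (x - y))) = cis (- (2 * pi * \<eta> * x))"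
      by (simp add: cis_mult algebra_simps)
    then show ?thesis by (simp only: mult.assoc[symmetric])
  qed
  finally show ?thesis by (simp add: time_freq_def)
qed

lemma atom_bounded:
  obtains M where "0 \<le> M" "\<And>y \<eta> x. cmod (atom y \<eta> x) \<le> M"
proof -
  obtain C where C: "0 \<le> C" "\<And>f x \<omega>. f \<in> S0 g \<Longrightarrow> ennreal (cmod (stft \<gamma> (S f) x \<omega>)) \<le> ennreal C * S0_norm g f"
    using stft_bound[OF \<gamma>] by blast
  define n where "n = enn2real (S0_norm g (distr_of \<gamma>))"
  have n: "S0_norm g (distr_of \<gamma>) = ennreal n" "0 \<le> n"
    using S0_finite[OF distr_of_S0[OF \<gamma>]] by (auto simp: n_def)
  have "cmod (atom y \<eta> x) \<le> C * n" for y \<eta> x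
  proof -
    have "ennreal (cmod (atom y \<eta> x)) \<le> ennreal C * S0_norm g (distr_of (time_freq 0 (- \<eta>) \<gamma>))"
      unfolding atom_eq norm_mult using \<gamma> C(2) distr_of_S0 by simp
    also have "\<dots> = ennreal (C * n)"
      using C(1) n by (simp add: S0_norm_time_freq[OF g(1) \<gamma>] ennreal_mult)
    finally show ?thesis using C(1) n by simp
  qed
  with that[of "C * n"] C(1) n show ?thesis by simp
qed

text \<open>The distribution itself varies with \<open>p\<close>. Its variation is controlled,
  uniformly over the plane, by \<open>stft_bound\<close> and the Schwartz norm of the change of the
  modulated Gaussian; the rest is continuity of the transform of one fixed distribution.\<close>

lemma continuous_op_stft: "continuous_on UNIV (\<lambda>p. stft \<gamma> (S (distr_of (time_freq 0 (- fst p) \<gamma>))) (snd p) (fst p))"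
proof (unfold continuous_on_iff, intro ballI allI impI)
  fix p0 :: "real \<times> real" and e :: real assume e: "0 < e"
  let ?\<gamma> = "\<lambda>p. time_freq 0 (- fst p) \<gamma>"
  let ?b = "\<lambda>p. stft \<gamma> (S (distr_of (?\<gamma> p))) (snd p) (fst p)"
  define \<Lambda> where "\<Lambda> = S (distr_of (?\<gamma> p0))"
  have \<gamma>': "?\<gamma> p \<in> schwartz" for p :: "real \<times> real" using \<gamma> by simp
  have \<Lambda>: "\<Lambda> \<in> tempered" unfolding \<Lambda>_def by (intro tempered distr_of_S0 \<gamma>')
  obtain C where C: "0 \<le> C" "\<And>f x \<omega>. f \<in> S0 g \<Longrightarrow> ennreal (cmod (stft \<gamma> (S f) x \<omega>)) \<le> ennreal C * S0_norm g f"
    using stft_bound[OF \<gamma>] by blast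
  define Q where "Q = C * (512 * pi ^ 3 * schwartz_norm 4 (reflect g))"
  have Q: "0 \<le> Q" unfolding Q_def by (intro mult_nonneg_nonneg C schwartz_norm_nonneg G) auto
  \<comment> \<open>The factor 2 leaves half of \<open>e\<close> for the fixed distribution;
    \<open>Q + 1\<close> covers \<open>Q = 0\<close>.\<close>
  have "0 < e / (2 * (Q + 1))" using e Q by simp
  from time_freq_close[OF \<gamma> this, of "(0, - fst p0)" 4]
  obtain d1 where d1: "0 < d1" "\<And>w. dist w (0, - fst p0) < d1 \<Longrightarrow>
    schwartz_norm 4 (\<lambda>t. time_freq (fst w) (snd w) \<gamma> t - ?\<gamma> p0 t) \<le> e / (2 * (Q + 1))" by auto
  have "continuous_on UNIV (\<lambda>p. stft \<gamma> \<Lambda> (snd p) (fst p))"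
    by (intro continuous_stft_compose \<Lambda> \<gamma> continuous_intros)
  then obtain d2 where d2: "0 < d2" "\<And>p. dist p p0 < d2 \<Longrightarrow>
      dist (stft \<gamma> \<Lambda> (snd p) (fst p)) (stft \<gamma> \<Lambda> (snd p0) (fst p0)) < e / 2"
    unfolding continuous_on_iff using e half_gt_zero by (metis UNIV_I)
  show "\<exists>d>0. \<forall>p\<in>UNIV. dist p p0 < d \<longrightarrow> dist (?b p) (?b p0) < e"
  proof (intro exI[of _ "min d1 d2"] conjI ballI impI)
    show "0 < min d1 d2" using d1 d2 by simp
    fix p assume p: "dist p p0 < min d1 d2"
    let ?k = "\<lambda>t. ?\<gamma> p t - ?\<gamma> p0 t"
    have k: "?k \<in> schwartz" by (intro schwartz_diff \<gamma>')
    have "dist (0, - fst p) (0, - fst p0) = dist (fst p) (fst p0)"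
      by (simp add: dist_prod_def dist_real_def abs_minus_commute)
    also have "\<dots> < d1" using p dist_fst_le[of p p0] by linarith
    finally have nk: "schwartz_norm 4 ?k \<le> e / (2 * (Q + 1))" using d1(2)[of "(0, - fst p)"] by simp
    have "distr_of (?\<gamma> p) = (\<lambda>\<phi>. distr_of ?k \<phi> + distr_of (?\<gamma> p0) \<phi>)"
      unfolding distr_of_add[OF k \<gamma>', symmetric] by simp
    then have "S (distr_of (?\<gamma> p)) = (\<lambda>\<phi>. S (distr_of ?k) \<phi> + \<Lambda> \<phi>)"
      unfolding \<Lambda>_def by (simp only: add[OF distr_of_S0[OF k] distr_of_S0[OF \<gamma>']])
    then have b: "?b p = stft \<gamma> (S (distr_of ?k)) (snd p) (fst p) + stft \<gamma> \<Lambda> (snd p) (fst p)"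
      by (simp add: stft_def)
    have "ennreal (cmod (stft \<gamma> (S (distr_of ?k)) (snd p) (fst p))) \<le> ennreal C * S0_norm g (distr_of ?k)"
      by (intro C distr_of_S0 k)
    also have "\<dots> \<le> ennreal C * ennreal (512 * pi ^ 3 * schwartz_norm 4 ?k * schwartz_norm 4 (reflect g))"
      by (intro mult_left_mono S0_distr_of(2) g k) auto
    also have "\<dots> = ennreal (Q * schwartz_norm 4 ?k)"
      using C(1) schwartz_norm_nonneg[OF k] schwartz_norm_nonneg[OF G(1)]
      by (subst ennreal_mult[symmetric]) (auto simp: Q_def mult_ac intro!: mult_nonneg_nonneg)
    finally have "cmod (stft \<gamma> (S (distr_of ?k)) (snd p) (fst p)) \<le> Q * schwartz_norm 4 ?k"
      using mult_nonneg_nonneg[OF Q schwartz_norm_nonneg[OF k]] by (simp only: ennreal_le_iff)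
    also have "\<dots> \<le> Q * (e / (2 * (Q + 1)))" by (intro mult_left_mono nk Q)
    also have "\<dots> \<le> e / 2" using Q e by (simp add: field_simps)
    finally have 1: "cmod (stft \<gamma> (S (distr_of ?k)) (snd p) (fst p)) \<le> e / 2" .
    have 2: "cmod (stft \<gamma> \<Lambda> (snd p) (fst p) - stft \<gamma> \<Lambda> (snd p0) (fst p0)) < e / 2"
      using d2(2)[of p] p by (simp add: dist_norm)
    have "dist (?b p) (?b p0) = cmod (stft \<gamma> (S (distr_of ?k)) (snd p) (fst p) +
       (stft \<gamma> \<Lambda> (snd p) (fst p) - stft \<gamma> \<Lambda> (snd p0) (fst p0)))"
      unfolding b by (simp add: dist_norm \<Lambda>_def add_diff_eq)
    also have "\<dots> \<le> cmod (stft \<gamma> (S (distr_of ?k)) (snd p) (fst p)) +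
       cmod (stft \<gamma> \<Lambda> (snd p) (fst p) - stft \<gamma> \<Lambda> (snd p0) (fst p0))"
      by (rule norm_triangle_ineq)
    also have "\<dots> < e" using 1 2 by linarith
    finally show "dist (?b p) (?b p0) < e" .
  qed
qed

lemma continuous_atom: "continuous_on UNIV (\<lambda>q. atom (fst (fst q)) (snd (fst q)) (snd q))"
proof -
  have "continuous_on UNIV (\<lambda>q :: (real \<times> real) \<times> real. (\<lambda>p. stft \<gamma> (S (distr_of (time_freq 0 (- fst p) \<gamma>))) (snd p) (fst p))
      (snd (fst q), snd q - fst (fst q)))"
    by (rule continuous_on_compose2[OF continuous_op_stft]) (auto intro!: continuous_intros)
  then show ?thesis
    unfolding atom_eq by (auto intro!: continuous_intros)
qed

lemma continuous_atom_compose: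
  assumes "continuous_on U a" "continuous_on U b" "continuous_on U d"
  shows "continuous_on U (\<lambda>q. atom (a q) (b q) (d q))"
  using continuous_on_compose2[OF continuous_atom continuous_on_Pair[OF continuous_on_Pair[OF assms(1,2)] assms(3)]] by simp

subsection \<open>The convolution kernel\<close>

abbreviation analysis :: "functional \<Rightarrow> real \<times> real \<Rightarrow> complex" where
  "analysis f p \<equiv> stft (\<lambda>t. cnj (H t)) f (fst p) (snd p)"

definition c :: complex where "c = (\<integral>t. H t * cnj (H t) \<partial>lborel)"

text \<open>The inversion formula with the operator applied to each shift of \<open>H\<close>; since
  the atoms are functions, the integral has a value at every point \<open>x\<close>.\<close>

definition symbol :: "functional \<Rightarrow> real \<Rightarrow> complex" where
  "symbol f x = inverse c * (\<integral>p. analysis f p * atom (fst p) (snd p) x \<partial>lborel)"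

lemma c_nonzero: "c \<noteq> 0"
  using schwartz_window_integral_pos[OF H H_nonzero] by (simp add: c_def mult.commute)

lemma cnj_H: "(\<lambda>t. cnj (H t)) \<in> schwartz"
  by (rule schwartz_cnj[OF H])

lemma analysis_norm:
  obtains C where "0 \<le> C" "\<And>f. f \<in> S0 g \<Longrightarrow> stft_norm (\<lambda>t. cnj (H t)) f \<le> ennreal C * S0_norm g f"
proof -
  obtain C where C: "0 \<le> C" "\<And>\<Lambda>. \<Lambda> \<in> tempered \<Longrightarrow> stft_norm (\<lambda>t. cnj (H t)) \<Lambda> \<le> ennreal C * stft_norm (reflect g) \<Lambda>"
    using stft_norm_change_window[OF cnj_H G] by blast
  with that show ?thesis using S0_tempered g(1) by (metis S0_norm_eq)
qed

lemma analysis_finite: "f \<in> S0 g \<Longrightarrow> stft_norm (\<lambda>t. cnj (H t)) f < \<infinity>"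
proof -
  assume f: "f \<in> S0 g"
  obtain C where C: "0 \<le> C" "\<And>f. f \<in> S0 g \<Longrightarrow> stft_norm (\<lambda>t. cnj (H t)) f \<le> ennreal C * S0_norm g f"
    using analysis_norm by blast
  have "ennreal C * S0_norm g f < \<infinity>" using S0_finite[OF f] by (simp add: ennreal_mult_less_top)
  with C(2)[OF f] show ?thesis by (rule order.strict_trans1)
qed

lemma integrable_analysis: "f \<in> S0 g \<Longrightarrow> integrable lborel (analysis f)"
  by (intro integrable_stft_plane S0_tempered[of f g] cnj_H analysis_finite)

lemma measurable_atom: "(\<lambda>p. atom (fst p) (snd p) x) \<in> borel_measurable borel"
  by (intro measurable_continuous_UNIV continuous_atom_compose continuous_intros)

lemma integrable_analysis_atom:
  assumes "f \<in> S0 g"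
  shows "integrable lborel (\<lambda>p. analysis f p * atom (fst p) (snd p) x)"
proof -
  obtain M where M: "0 \<le> M" "\<And>y \<eta> x. cmod (atom y \<eta> x) \<le> M" using atom_bounded by blast
  show ?thesis
    by (rule integrable_mult_bounded[OF integrable_analysis[OF assms] _ M(2)])
      (use measurable_atom[of x] in simp)
qed

text \<open>The values of \<open>S\<close> at the truncated syntheses have two limits: through
  \<open>pairing \<phi>\<close> the integral over the whole plane, and through density with
  \<open>op_bound\<close> the value at \<open>f\<close>. Fubini, justified by the bounded atoms,
  then brings the integral over \<open>x\<close> outside.\<close>

lemma op_eq_integral_symbol:
  assumes f: "f \<in> S0 g" and \<phi>: "\<phi> \<in> schwartz"
  shows "S f \<phi> = (\<integral>x. symbol f x * \<phi> x \<partial>lborel)"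
proof -
  let ?W = "analysis f"
  let ?h = "\<lambda>m t. inverse c * synthesis H ?W m t"
  define L where "L p = pairing \<phi> (time_freq (fst p) (- snd p) H)" for p
  note ft = S0_tempered[OF f]
  have W: "continuous_on UNIV ?W" by (rule continuous_stft[OF ft cnj_H])
  note [measurable] = measurable_continuous_UNIV[OF W]
  have h: "?h m \<in> schwartz" for m by (intro schwartz_cmult schwartz_synthesis H W)
  obtain M where M: "0 \<le> M" "\<And>y \<eta> x. cmod (atom y \<eta> x) \<le> M" using atom_bounded by blast
  define I where "I = (\<integral>x. cmod (\<phi> x) \<partial>lborel)"
  have L: "L p = (\<integral>x. atom (fst p) (snd p) x * \<phi> x \<partial>lborel)" for p
    using H by (simp add: L_def pairing_def op_time_freq[OF \<phi>])
  have Lb: "cmod (L p) \<le> M * I" for p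
  proof -
    have "cmod (L p) \<le> (\<integral>x. M * cmod (\<phi> x) \<partial>lborel)"
      unfolding L
    proof (rule Bochner_Integration.integral_norm_bound_integral)
      have "(\<lambda>x. atom (fst p) (snd p) x) \<in> borel_measurable borel"
        by (intro measurable_continuous_UNIV continuous_atom_compose continuous_intros)
      then show "integrable lborel (\<lambda>x. atom (fst p) (snd p) x * \<phi> x)"
        by (rule integrable_mult_schwartz[OF \<phi> _ M(2)])
      show "integrable lborel (\<lambda>x. M * cmod (\<phi> x))" using schwartz_integrable[OF \<phi>] by auto
      show "norm (atom (fst p) (snd p) x * \<phi> x) \<le> M * cmod (\<phi> x)" for x
        unfolding norm_mult by (intro mult_right_mono M) auto
    qed
    then show ?thesis by (simp add: I_def)
  qed
  have "continuous_on UNIV L"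
    unfolding L_def stft_def[symmetric]
    by (intro continuous_stft_compose tempered_pairing \<phi> H continuous_intros)
  note [measurable] = measurable_continuous_UNIV[OF this]
  have iWL: "integrable lborel (\<lambda>p. ?W p * L p)"
    by (rule integrable_mult_bounded[OF integrable_analysis[OF f] _ Lb]) measurable
  have "S (distr_of (?h m)) \<phi> = inverse c * (\<integral>p. indicator (square m) p *\<^sub>R (?W p * L p) \<partial>lborel)" for m
  proof -
    have "S (distr_of (?h m)) \<phi> = pairing \<phi> (?h m)" using h by (simp add: pairing_def)
    also have "\<dots> = inverse c * pairing \<phi> (synthesis H ?W m)" by (rule tempered_cmult[OF tempered_pairing[OF \<phi>]])
    finally show ?thesis by (simp only: tempered_synthesis[OF H W tempered_pairing[OF \<phi>]] L_def)
  qed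
  moreover have "(\<lambda>m. \<integral>p. indicator (square m) p *\<^sub>R (?W p * L p) \<partial>lborel) \<longlonglongrightarrow> (\<integral>p. ?W p * L p \<partial>lborel)"
  proof (rule integral_dominated_convergence[where w="\<lambda>p. cmod (?W p * L p)"])
    show "AE p in lborel. (\<lambda>m. indicator (square m) p *\<^sub>R (?W p * L p)) \<longlonglongrightarrow> ?W p * L p"
    proof (intro AE_I2 tendsto_eventually)
      fix p show "\<forall>\<^sub>F m in sequentially. indicator (square m) p *\<^sub>R (?W p * L p) = ?W p * L p"
        using eventually_in_square[of p] by eventually_elim simp
    qed
    show "integrable lborel (\<lambda>p. cmod (?W p * L p))" using iWL by (rule integrable_norm)
    show "AE p in lborel. norm (indicator (square m) p *\<^sub>R (?W p * L p)) \<le> cmod (?W p * L p)" for m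
      by (intro AE_I2) (auto simp: indicator_def)
  qed measurable
  ultimately have lim1: "(\<lambda>m. S (distr_of (?h m)) \<phi>) \<longlonglongrightarrow> inverse c * (\<integral>p. ?W p * L p \<partial>lborel)"
    by (auto intro: tendsto_intros)
  have lim2: "(\<lambda>m. S (distr_of (?h m)) \<phi>) \<longlonglongrightarrow> S f \<phi>"
  proof -
    define d where "d m = (\<lambda>\<phi>. f \<phi> + - 1 * distr_of (?h m) \<phi>)" for m
    have d: "d m \<in> S0 g" for m unfolding d_def by (intro S0_add S0_scale g f distr_of_S0 h)
    obtain C where C: "0 \<le> C"
      "\<And>f \<phi>. f \<in> S0 g \<Longrightarrow> \<phi> \<in> schwartz \<Longrightarrow> ennreal (cmod (S f \<phi>)) \<le> ennreal (C * schwartz_norm 4 \<phi>) * S0_norm g f"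
      using op_bound by blast
    have "(\<lambda>m. S0_norm g (d m)) \<longlonglongrightarrow> 0"
      unfolding d_def by (rule S0_approximation[OF g(1) H cnj_H _ c_nonzero ft analysis_finite[OF f]]) (simp add: c_def)
    then have "(\<lambda>m. ennreal (C * schwartz_norm 4 \<phi>) * S0_norm g (d m)) \<longlonglongrightarrow> ennreal (C * schwartz_norm 4 \<phi>) * 0"
      by (intro ennreal_tendsto_cmult) (auto simp: ennreal_less_top)
    then have lim: "(\<lambda>m. ennreal (C * schwartz_norm 4 \<phi>) * S0_norm g (d m)) \<longlonglongrightarrow> 0" by simp
    have "(\<lambda>m. ennreal (cmod (S (d m) \<phi>))) \<longlonglongrightarrow> 0"
    proof (rule tendsto_sandwich[OF _ _ tendsto_const lim])
      show "\<forall>\<^sub>F m in sequentially. ennreal (cmod (S (d m) \<phi>)) \<le> ennreal (C * schwartz_norm 4 \<phi>) * S0_norm g (d m)"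
        by (intro always_eventually allI C d \<phi>)
    qed simp
    then have "(\<lambda>m. cmod (S (d m) \<phi>)) \<longlonglongrightarrow> 0" by (simp add: ennreal_tendsto_0_iff)
    then have "(\<lambda>m. S (d m) \<phi>) \<longlonglongrightarrow> 0" by (rule tendsto_norm_zero_cancel)
    moreover have "S (d m) \<phi> = S f \<phi> - S (distr_of (?h m)) \<phi>" for m
      unfolding d_def
      using add[OF f S0_scale[OF g(1) distr_of_S0[OF h[of m]], of "- 1"]] scale[OF distr_of_S0[OF h[of m]], of "- 1"] by simp
    ultimately have "(\<lambda>m. S f \<phi> - S (distr_of (?h m)) \<phi>) \<longlonglongrightarrow> 0" by simp
    from tendsto_diff[OF tendsto_const[of "S f \<phi>"] this] show ?thesis by simp
  qed
  have "S f \<phi> = inverse c * (\<integral>p. ?W p * L p \<partial>lborel)"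
    by (rule LIMSEQ_unique[OF lim2 lim1])
  also have "(\<integral>p. ?W p * L p \<partial>lborel) = (\<integral>p. \<integral>x. ?W p * atom (fst p) (snd p) x * \<phi> x \<partial>lborel \<partial>lborel)"
    unfolding L by (simp add: mult.assoc)
  also have "\<dots> = (\<integral>x. \<integral>p. ?W p * atom (fst p) (snd p) x * \<phi> x \<partial>lborel \<partial>lborel)"
  proof (rule lborel_pair.Fubini_integral[symmetric])
    \<comment> \<open>A product of integrable functions of separate variables; the bounded atom is
      multiplied in afterwards.\<close>
    have i: "integrable (lborel \<Otimes>\<^sub>M lborel) (\<lambda>q. ?W (fst q) * \<phi> (snd q))"
    proof (rule lborel_pair.Fubini_integrable)
      have [measurable]: "\<phi> \<in> borel_measurable borel" by (rule schwartz_measurable[OF \<phi>])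
      show "(\<lambda>q. ?W (fst q) * \<phi> (snd q)) \<in> borel_measurable (lborel \<Otimes>\<^sub>M lborel)"
      proof -
        have "continuous_on UNIV (\<lambda>q. ?W (fst q) * \<phi> (snd q))"
          by (intro continuous_on_mult continuous_on_compose2[OF W] continuous_on_compose2[OF schwartz_continuous[OF \<phi>, of UNIV]] continuous_on_fst continuous_on_snd continuous_on_id) auto
        then show ?thesis unfolding lborel_prod by (simp add: measurable_continuous_UNIV)
      qed
      show "integrable lborel (\<lambda>p. \<integral>x. norm (?W (fst (p, x)) * \<phi> (snd (p, x))) \<partial>lborel)"
        using integrable_analysis[OF f] by (simp add: norm_mult)
      show "AE p in lborel. integrable lborel (\<lambda>x. ?W (fst (p, x)) * \<phi> (snd (p, x)))"
        using schwartz_integrable[OF \<phi>] by simp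
    qed
    have "(\<lambda>q. atom (fst (fst q)) (snd (fst q)) (snd q)) \<in> borel_measurable (lborel \<Otimes>\<^sub>M lborel)"
      unfolding lborel_prod using measurable_continuous_UNIV[OF continuous_atom] by simp
    from integrable_mult_bounded[OF i this M(2)]
    show "integrable (lborel \<Otimes>\<^sub>M lborel) (\<lambda>(p, x). ?W p * atom (fst p) (snd p) x * \<phi> x)"
      by (simp add: case_prod_unfold mult_ac)
  qed
  also have "\<dots> = (\<integral>x. (\<integral>p. ?W p * atom (fst p) (snd p) x \<partial>lborel) * \<phi> x \<partial>lborel)"
    by (simp only: integral_mult_left_zero)
  also have "inverse c * \<dots> = (\<integral>x. symbol f x * \<phi> x \<partial>lborel)"
    unfolding symbol_def mult.assoc by (rule integral_mult_right_zero[symmetric])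
  finally show ?thesis .
qed

end

section \<open>Functionals on the Feichtinger algebra and their uniqueness\<close>

lemma S0_dualD:
  assumes "u \<in> S0_dual g"
  shows "f \<in> S0 g \<Longrightarrow> h \<in> S0 g \<Longrightarrow> u (\<lambda>\<phi>. f \<phi> + h \<phi>) = u f + u h"
    and "f \<in> S0 g \<Longrightarrow> u (\<lambda>\<phi>. k * f \<phi>) = k * u f"
    and "f \<notin> S0 g \<Longrightarrow> u f = 0"
    and "\<exists>K. 0 \<le> K \<and> (\<forall>f\<in>S0 g. ennreal (cmod (u f)) \<le> ennreal K * S0_norm g f)"
proof -
  obtain K where K: "\<forall>f\<in>S0 g. ennreal (cmod (u f)) \<le> ennreal K * S0_norm g f"
    using assms unfolding S0_dual_def by blast
  have "ennreal (cmod (u f)) \<le> ennreal \<bar>K\<bar> * S0_norm g f" if "f \<in> S0 g" for f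
    by (rule order_trans[OF K[rule_format, OF that]]) (auto intro!: mult_right_mono ennreal_leI)
  then show "\<exists>K. 0 \<le> K \<and> (\<forall>f\<in>S0 g. ennreal (cmod (u f)) \<le> ennreal K * S0_norm g f)"
    by (intro exI[of _ "\<bar>K\<bar>"]) auto
qed (use assms in \<open>auto simp: S0_dual_def\<close>)

text \<open>A functional on the Feichtinger algebra seen as a tempered distribution; this makes the
  continuity results for the transform available.\<close>

definition restrict_dual :: "(functional \<Rightarrow> complex) \<Rightarrow> functional" where
  "restrict_dual u h = (if h \<in> schwartz then u (distr_of h) else 0)"

lemma tempered_restrict_dual:
  assumes g: "g \<in> schwartz" and u: "u \<in> S0_dual g"
  shows "restrict_dual u \<in> tempered"
proof -
  obtain K where K: "0 \<le> K" "\<And>f. f \<in> S0 g \<Longrightarrow> ennreal (cmod (u f)) \<le> ennreal K * S0_norm g f"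
    using S0_dualD(4)[OF u] by blast
  have G: "reflect g \<in> schwartz" using g by simp
  define Q where "Q = schwartz_norm 4 (reflect g)"
  have Q: "0 \<le> Q" unfolding Q_def by (rule schwartz_norm_nonneg[OF G])
  show ?thesis
  proof (rule temperedI[where N=4 and K="K * (512 * pi ^ 3) * Q"])
    fix h assume h: "h \<in> schwartz"
    define R where "R = schwartz_norm 4 h"
    have R: "0 \<le> R" unfolding R_def by (rule schwartz_norm_nonneg[OF h])
    have "ennreal (cmod (u (distr_of h))) \<le> ennreal K * S0_norm g (distr_of h)"
      by (intro K S0_distr_of g h)
    also have "\<dots> \<le> ennreal K * ennreal (512 * pi ^ 3 * R * Q)"
      unfolding R_def Q_def by (intro mult_left_mono S0_distr_of(2) g h) auto
    also have "\<dots> = ennreal (K * (512 * pi ^ 3) * Q * R)"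
      using K(1) Q R by (simp add: ennreal_mult[symmetric] mult_ac)
    finally show "cmod (restrict_dual u h) \<le> K * (512 * pi ^ 3) * Q * schwartz_norm 4 h"
      using K(1) Q R h by (subst (asm) ennreal_le_iff) (auto simp: restrict_dual_def R_def)
  qed (auto simp: restrict_dual_def schwartz_add schwartz_cmult distr_of_add distr_of_cmult
      S0_dualD(1,2)[OF u] S0_distr_of(1)[OF g])
qed

text \<open>Gaussians shrinking to 0 form an approximate identity and are admissible test functions;
  boundedness supplies the dominating function.\<close>

lemma continuous_zero_of_integrals:
  fixes E :: "real \<Rightarrow> complex"
  assumes cont: "continuous_on UNIV E" and bdd: "\<And>x. cmod (E x) \<le> B"
    and zero: "\<And>\<phi>. \<phi> \<in> schwartz \<Longrightarrow> (\<integral>x. E x * \<phi> x \<partial>lborel) = 0"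
  shows "E 0 = 0"
proof -
  let ?N = std_normal_density
  define \<delta> where "\<delta> m = inverse (real (Suc m))" for m
  have \<delta>: "\<delta> m > 0" for m by (simp add: \<delta>_def)
  have \<delta>0: "\<delta> \<longlonglongrightarrow> 0" unfolding \<delta>_def by (rule LIMSEQ_inverse_real_of_nat)
  note [measurable] = measurable_continuous_UNIV[OF cont]
  have z: "(\<integral>u. E (\<delta> m * u) * ?N u \<partial>lborel) = 0" for m
  proof -
    have "(\<lambda>t. of_real (1 / sqrt (2 * pi)) * complex_of_real (exp (- (1 / (2 * (\<delta> m)\<^sup>2)) * t\<^sup>2))) \<in> schwartz"
      using \<delta>[of m] by (intro schwartz_cmult schwartz_gauss) simp
    also have "(\<lambda>t. of_real (1 / sqrt (2 * pi)) * complex_of_real (exp (- (1 / (2 * (\<delta> m)\<^sup>2)) * t\<^sup>2))) =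
      (\<lambda>t. complex_of_real (?N (t / \<delta> m)))"
      by (simp add: std_normal_density_def fun_eq_iff power_divide)
    finally have "(\<integral>x. E x * ?N (x / \<delta> m) \<partial>lborel) = 0" by (rule zero)
    also have "(\<integral>x. E x * ?N (x / \<delta> m) \<partial>lborel) = \<delta> m *\<^sub>R (\<integral>u. E (\<delta> m * u) * ?N u \<partial>lborel)"
      using \<delta>[of m] by (subst lborel_integral_real_affine[where c="\<delta> m" and t=0]) auto
    finally show ?thesis using \<delta>[of m] by simp
  qed
  have "(\<lambda>m. \<integral>u. E (\<delta> m * u) * ?N u \<partial>lborel) \<longlonglongrightarrow> (\<integral>u. E 0 * ?N u \<partial>lborel)"
  proof (rule integral_dominated_convergence[where w="\<lambda>u. B * ?N u"])
    show "integrable lborel (\<lambda>u. B * ?N u)" by simp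
    show "AE u in lborel. (\<lambda>m. E (\<delta> m * u) * ?N u) \<longlonglongrightarrow> E 0 * ?N u"
    proof (intro AE_I2 tendsto_intros)
      fix u
      have "(\<lambda>m. \<delta> m * u) \<longlonglongrightarrow> 0 * u" by (intro tendsto_intros \<delta>0)
      moreover have "isCont E 0" using cont by (simp add: continuous_on_eq_continuous_at)
      ultimately show "(\<lambda>m. E (\<delta> m * u)) \<longlonglongrightarrow> E 0" by (intro isCont_tendsto_compose[of 0 E]) auto
    qed
    show "AE u in lborel. norm (E (\<delta> m * u) * ?N u) \<le> B * ?N u" for m
      by (intro AE_I2) (simp add: norm_mult mult_right_mono bdd)
    have "continuous_on UNIV (\<lambda>u. E (\<delta> m * u) * ?N u)" for m
      by (intro continuous_intros continuous_on_compose2[OF cont]) auto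
    then show "(\<lambda>u. E (\<delta> m * u) * ?N u) \<in> borel_measurable lborel" for m
      by (simp add: measurable_continuous_UNIV)
  qed measurable
  also have "(\<integral>u. E 0 * ?N u \<partial>lborel) = E 0" by simp
  finally have "(\<lambda>m. 0) \<longlonglongrightarrow> E 0" by (simp only: z)
  from LIMSEQ_unique[OF this tendsto_const] show ?thesis .
qed

lemma S0_conv_distr_of:
  assumes "h \<in> schwartz"
  shows "S0_conv u (distr_of h) x = restrict_dual u (translate x (reflect h))"
  using assms by (simp add: S0_conv_def restrict_dual_def distr_of_reflect[symmetric] distr_of_translate[symmetric])

lemma
  assumes g: "g \<in> schwartz" "g \<noteq> (\<lambda>t. 0)" and u: "u \<in> S0_dual g" and h: "h \<in> schwartz"
  shows continuous_S0_conv: "continuous_on UNIV (S0_conv u (distr_of h))"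
    and bounded_S0_conv: "\<exists>B. \<forall>x. cmod (S0_conv u (distr_of h) x) \<le> B"
proof -
  have h': "reflect h \<in> schwartz" using h by simp
  have "continuous_on UNIV (\<lambda>x. stft (reflect h) (restrict_dual u) x 0)"
    by (intro continuous_stft_compose tempered_restrict_dual[OF g(1) u] h' continuous_intros)
  then show "continuous_on UNIV (S0_conv u (distr_of h))"
    by (simp add: stft_def time_freq_def S0_conv_distr_of[OF h, abs_def])
  obtain K where K: "0 \<le> K" "\<And>f. f \<in> S0 g \<Longrightarrow> ennreal (cmod (u f)) \<le> ennreal K * S0_norm g f"
    using S0_dualD(4)[OF u] by blast
  have f: "distr_of (reflect h) \<in> S0 g" by (rule S0_distr_of(1)[OF g(1) h'])
  define n where "n = enn2real (S0_norm g (distr_of (reflect h)))"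
  have n: "S0_norm g (distr_of (reflect h)) = ennreal n" "0 \<le> n"
    using S0_finite[OF f] by (auto simp: n_def)
  have "cmod (S0_conv u (distr_of h) x) \<le> K * n" for x
  proof -
    have "S0_conv u (distr_of h) x = u (distr_translate x (distr_of (reflect h)))"
      by (simp add: S0_conv_def distr_of_reflect)
    moreover have "ennreal (cmod (u (distr_translate x (distr_of (reflect h))))) \<le> ennreal K * ennreal n"
      using K(2)[OF S0_translate(1)[OF g(1) f]] S0_translate(2)[OF g(1) f] n(1) by simp
    ultimately show ?thesis using K(1) n(2) by (simp add: ennreal_mult[symmetric])
  qed
  then show "\<exists>B. \<forall>x. cmod (S0_conv u (distr_of h) x) \<le> B" by blast
qed

text \<open>For continuous functions equality as distributions becomes pointwise equality, and
  boundedness makes the integrals exist. The convolution with the reflected \<open>h\<close> takes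
  the value \<open>u (distr_of h)\<close> at 0, so \<open>u\<close> and \<open>v\<close> agree on
  Schwartz functions; density does the rest.\<close>

lemma S0_dual_eqI:
  assumes g: "g \<in> schwartz" "g \<noteq> (\<lambda>t. 0)" and u: "u \<in> S0_dual g" and v: "v \<in> S0_dual g"
    and eq: "\<And>f. f \<in> S0 g \<Longrightarrow> distr_of (S0_conv u f) = distr_of (S0_conv v f)"
  shows "u = v"
proof
  fix f
  have schw: "u (distr_of h) = v (distr_of h)" if h: "h \<in> schwartz" for h
  proof -
    have h': "reflect h \<in> schwartz" using h by simp
    let ?a = "S0_conv u (distr_of (reflect h))" and ?b = "S0_conv v (distr_of (reflect h))"
    obtain A where A: "\<And>x. cmod (?a x) \<le> A" using bounded_S0_conv[OF g u h'] by blast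
    obtain B where B: "\<And>x. cmod (?b x) \<le> B" using bounded_S0_conv[OF g v h'] by blast
    note c = continuous_S0_conv[OF g u h'] continuous_S0_conv[OF g v h']
    have "?a 0 - ?b 0 = 0"
    proof (rule continuous_zero_of_integrals)
      show "continuous_on UNIV (\<lambda>x. ?a x - ?b x)" by (intro continuous_on_diff c)
      show "cmod (?a x - ?b x) \<le> A + B" for x
        using norm_triangle_ineq4[of "?a x" "?b x"] A[of x] B[of x] by linarith
      fix \<phi> assume \<phi>: "\<phi> \<in> schwartz"
      have "integrable lborel (\<lambda>x. ?a x * \<phi> x)" "integrable lborel (\<lambda>x. ?b x * \<phi> x)"
        by (rule integrable_mult_schwartz[OF \<phi> measurable_continuous_UNIV[OF c(1)] A]
            integrable_mult_schwartz[OF \<phi> measurable_continuous_UNIV[OF c(2)] B])+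
      moreover have "(\<integral>x. ?a x * \<phi> x \<partial>lborel) = (\<integral>x. ?b x * \<phi> x \<partial>lborel)"
        using fun_cong[OF eq[OF S0_distr_of(1)[OF g(1) h']], of \<phi>] \<phi> by (simp add: distr_of_def)
      ultimately show "(\<integral>x. (?a x - ?b x) * \<phi> x \<partial>lborel) = 0" by (simp add: left_diff_distrib)
    qed
    then show ?thesis using h' h by (simp add: S0_conv_distr_of restrict_dual_def)
  qed
  show "u f = v f"
  proof (cases "f \<in> S0 g")
    case False then show ?thesis using S0_dualD(3)[OF u] S0_dualD(3)[OF v] by simp
  next
    case f: True
    obtain G where G: "G = reflect g" by blast
    have G': "G \<in> schwartz" "G \<noteq> (\<lambda>t. 0)" using g reflect_nonzero G by auto
    define H where "H = (\<lambda>t. cnj (G t))"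
    define c where "c = (\<integral>t. H t * G t \<partial>lborel)"
    have H: "H \<in> schwartz" unfolding H_def by (rule schwartz_cnj[OF G'(1)])
    have c: "c \<noteq> 0" unfolding c_def H_def by (rule schwartz_window_integral_pos[OF G'])
    let ?W = "\<lambda>p. stft G f (fst p) (snd p)"
    let ?h = "\<lambda>m t. inverse c * synthesis H ?W m t"
    define d where "d m = (\<lambda>\<phi>. f \<phi> + - 1 * distr_of (?h m) \<phi>)" for m
    have W: "continuous_on UNIV ?W" by (rule continuous_stft[OF S0_tempered[OF f] G'(1)])
    have h: "?h m \<in> schwartz" for m by (intro schwartz_cmult schwartz_synthesis H W)
    have h0: "distr_of (?h m) \<in> S0 g" for m by (rule S0_distr_of(1)[OF g(1) h])
    have d: "d m \<in> S0 g" for m unfolding d_def by (intro S0_add S0_scale g f h0)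
    have fin: "stft_norm G f < \<infinity>" using f g(1) by (simp add: S0_iff G)
    have d0: "(\<lambda>m. S0_norm g (d m)) \<longlonglongrightarrow> 0"
      unfolding d_def by (rule S0_approximation[OF g(1) H G'(1) _ c S0_tempered[OF f] fin]) (simp add: c_def)
    have lim: "(\<lambda>m. w (distr_of (?h m))) \<longlonglongrightarrow> w f" if w: "w \<in> S0_dual g" for w
    proof -
      obtain K where K: "0 \<le> K" "\<And>f. f \<in> S0 g \<Longrightarrow> ennreal (cmod (w f)) \<le> ennreal K * S0_norm g f"
        using S0_dualD(4)[OF w] by blast
      have "(\<lambda>m. ennreal K * S0_norm g (d m)) \<longlonglongrightarrow> ennreal K * 0"
        by (intro ennreal_tendsto_cmult d0) (auto simp: ennreal_less_top)
      then have lim: "(\<lambda>m. ennreal K * S0_norm g (d m)) \<longlonglongrightarrow> 0" by simp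
      have "(\<lambda>m. ennreal (cmod (w (d m)))) \<longlonglongrightarrow> 0"
      proof (rule tendsto_sandwich[OF _ _ tendsto_const lim])
        show "\<forall>\<^sub>F m in sequentially. ennreal (cmod (w (d m))) \<le> ennreal K * S0_norm g (d m)"
          by (intro always_eventually allI K d)
      qed simp
      then have "(\<lambda>m. cmod (w (d m))) \<longlonglongrightarrow> 0" by (simp add: ennreal_tendsto_0_iff)
      then have "(\<lambda>m. w (d m)) \<longlonglongrightarrow> 0" by (rule tendsto_norm_zero_cancel)
      moreover have "w (d m) = w f - w (distr_of (?h m))" for m
        unfolding d_def S0_dualD(1)[OF w f S0_scale[OF g(1) h0]] S0_dualD(2)[OF w h0] by simp
      ultimately have "(\<lambda>m. w f - w (distr_of (?h m))) \<longlonglongrightarrow> 0" by simp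
      from tendsto_diff[OF tendsto_const[of "w f"] this] show ?thesis by simp
    qed
    have "(\<lambda>m. u (distr_of (?h m))) \<longlonglongrightarrow> v f" using lim[OF v] by (simp add: schw[OF h])
    with lim[OF u] show ?thesis by (rule LIMSEQ_unique)
  qed
qed

lemma integral_plane_shift:
  fixes F :: "real \<times> real \<Rightarrow> complex"
  assumes "F \<in> borel_measurable borel"
  shows "(\<integral>p. F (q + p) \<partial>lborel) = (\<integral>p. F p \<partial>lborel)"
proof -
  have "(\<integral>p. F p \<partial>lborel) = (\<integral>p. F p \<partial>distr lborel borel ((+) q))"
    by (simp add: lborel_distr_plus)
  also have "\<dots> = (\<integral>p. F (q + p) \<partial>lborel)"
    using assms by (intro integral_distr) auto
  finally show ?thesis by simp
qed

lemma reflect_translate_reflect: "distr_reflect (distr_translate x (distr_reflect f)) = distr_translate (- x) f"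
proof
  fix \<phi>
  have "reflect (translate (- x) (reflect \<phi>)) = translate x \<phi>"
    by (auto simp: reflect_def translate_def fun_eq_iff)
  then show "distr_reflect (distr_translate x (distr_reflect f)) \<phi> = distr_translate (- x) f \<phi>"
    by (simp add: distr_reflect_def distr_translate_def)
qed

section \<open>From the symbol to the convolution kernel\<close>

context translation_invariant_op
begin

text \<open>Translating \<open>f\<close> shifts its coefficients in position and multiplies them by
  a phase. This is the phase by which an atom changes when its position and its argument are both
  moved by \<open>x\<close>.\<close>

lemma symbol_translate:
  assumes f: "f \<in> S0 g"
  shows "symbol (distr_translate (- x) f) 0 = symbol f x"
proof -
  define F where "F p = analysis f p * atom (fst p) (snd p) x" for p
  have "continuous_on UNIV F"
    unfolding F_def by (intro continuous_on_mult continuous_stft S0_tempered[OF f] cnj_H continuous_atom_compose continuous_intros)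
  then have F: "F \<in> borel_measurable borel" by (rule measurable_continuous_UNIV)
  have "analysis (distr_translate (- x) f) p * atom (fst p) (snd p) 0 = F ((x, 0) + p)" for p
  proof -
    have "cis (- (2 * pi * snd p * (x + fst p))) = cis (2 * pi * snd p * (- x)) * cis (- (2 * pi * snd p * fst p))"
      by (simp add: cis_mult algebra_simps)
    then have "cis (2 * pi * snd p * (- x)) * atom (fst p) (snd p) 0 = atom (x + fst p) (snd p) x"
      by (simp add: atom_def mult.assoc)
    then show ?thesis
      unfolding stft_translate[OF S0_tempered[OF f]] F_def by (simp add: mult_ac add.commute)
  qed
  then show ?thesis
    using integral_plane_shift[OF F, of "(x, 0)"] by (simp add: symbol_def F_def)
qed

lemma symbol_add:
  assumes "f \<in> S0 g" "h \<in> S0 g"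
  shows "symbol (\<lambda>\<phi>. f \<phi> + h \<phi>) x = symbol f x + symbol h x"
proof -
  have "analysis (\<lambda>\<phi>. f \<phi> + h \<phi>) p = analysis f p + analysis h p" for p by (simp add: stft_def)
  then show ?thesis
    using integrable_analysis_atom[OF assms(1), of x] integrable_analysis_atom[OF assms(2), of x]
    by (simp add: symbol_def distrib_right distrib_left)
qed

lemma symbol_scale: "symbol (\<lambda>\<phi>. k * f \<phi>) x = k * symbol f x"
  by (simp add: symbol_def stft_def mult.assoc)

lemma symbol_bound:
  obtains C where "0 \<le> C" "\<And>f x. f \<in> S0 g \<Longrightarrow> ennreal (cmod (symbol f x)) \<le> ennreal C * S0_norm g f"
proof -
  obtain M where M: "0 \<le> M" "\<And>y \<eta> x. cmod (atom y \<eta> x) \<le> M" using atom_bounded by blast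
  obtain C where C: "0 \<le> C" "\<And>f. f \<in> S0 g \<Longrightarrow> stft_norm (\<lambda>t. cnj (H t)) f \<le> ennreal C * S0_norm g f"
    using analysis_norm by blast
  show ?thesis
  proof (rule that[of "cmod (inverse c) * M * C"])
    show "0 \<le> cmod (inverse c) * M * C" using M(1) C(1) by simp
    fix f x assume f: "f \<in> S0 g"
    have "ennreal (cmod (\<integral>p. analysis f p * atom (fst p) (snd p) x \<partial>lborel)) \<le>
      (\<integral>\<^sup>+p. ennreal (cmod (analysis f p * atom (fst p) (snd p) x)) \<partial>lborel)"
      by (rule norm_integral_le_nn_integral)
    also have "\<dots> \<le> (\<integral>\<^sup>+p. ennreal M * ennreal (cmod (analysis f p)) \<partial>lborel)"
      using M by (intro nn_integral_mono) (simp add: ennreal_mult[symmetric] norm_mult mult.commute ennreal_leI mult_right_mono)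
    also have "\<dots> = ennreal M * stft_norm (\<lambda>t. cnj (H t)) f"
      using measurable_stft_plane[OF S0_tempered[OF f] cnj_H]
      by (simp add: stft_norm_plane[OF S0_tempered[OF f] cnj_H] nn_integral_cmult)
    also have "\<dots> \<le> ennreal M * (ennreal C * S0_norm g f)"
      by (intro mult_left_mono C f) simp
    finally have "ennreal (cmod (inverse c)) * ennreal (cmod (\<integral>p. analysis f p * atom (fst p) (snd p) x \<partial>lborel)) \<le>
      ennreal (cmod (inverse c)) * (ennreal M * (ennreal C * S0_norm g f))"
      by (intro mult_left_mono) auto
    then show "ennreal (cmod (symbol f x)) \<le> ennreal (cmod (inverse c) * M * C) * S0_norm g f"
      using M(1) C(1) unfolding symbol_def norm_mult by (simp add: ennreal_mult mult.assoc)
  qed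
qed

text \<open>The reflection undoes the one in \<open>S0_conv\<close>, so that the convolution at
  \<open>x\<close> becomes the symbol at \<open>x\<close> (\<open>S0_conv_kernel\<close>).\<close>

definition kernel :: "functional \<Rightarrow> complex" where
  "kernel h = (if h \<in> S0 g then symbol (distr_reflect h) 0 else 0)"

lemma S0_reflect_closed: "f \<in> S0 g \<Longrightarrow> distr_reflect f \<in> S0 g"
  using S0_reflect[OF g] by blast

lemma S0_conv_kernel:
  assumes f: "f \<in> S0 g"
  shows "S0_conv kernel f = symbol f"
proof
  fix x
  have "distr_translate x (distr_reflect f) \<in> S0 g"
    by (intro S0_translate g S0_reflect_closed f)
  then show "S0_conv kernel f x = symbol f x"
    using symbol_translate[OF f] by (simp add: S0_conv_def kernel_def reflect_translate_reflect)
qed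

lemma kernel_dual: "kernel \<in> S0_dual g"
proof -
  obtain C where C: "0 \<le> C" "\<And>f x. f \<in> S0 g \<Longrightarrow> ennreal (cmod (symbol f x)) \<le> ennreal C * S0_norm g f"
    using symbol_bound by blast
  obtain D where D: "0 \<le> D" "\<And>f. f \<in> S0 g \<Longrightarrow> distr_reflect f \<in> S0 g"
    "\<And>f. f \<in> S0 g \<Longrightarrow> S0_norm g (distr_reflect f) \<le> ennreal D * S0_norm g f"
    using S0_reflect[OF g] by blast
  have "ennreal (cmod (kernel f)) \<le> ennreal (C * D) * S0_norm g f" if f: "f \<in> S0 g" for f
  proof -
    have "ennreal (cmod (kernel f)) \<le> ennreal C * S0_norm g (distr_reflect f)"
      using f C(2)[OF D(2)[OF f], of 0] by (simp add: kernel_def)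
    also have "\<dots> \<le> ennreal C * (ennreal D * S0_norm g f)" by (intro mult_left_mono D f) simp
    finally show ?thesis using C(1) D(1) by (simp add: ennreal_mult mult.assoc)
  qed
  moreover have "kernel (\<lambda>\<phi>. f \<phi> + h \<phi>) = kernel f + kernel h" if "f \<in> S0 g" "h \<in> S0 g" for f h
    using symbol_add[OF D(2) D(2), OF that] that S0_add[OF g(1) that]
    by (simp add: kernel_def distr_reflect_def)
  moreover have "kernel (\<lambda>\<phi>. k * f \<phi>) = k * kernel f" if "f \<in> S0 g" for f k
    using symbol_scale[of k "distr_reflect f" 0] that S0_scale[OF g(1) that]
    by (simp add: kernel_def distr_reflect_def)
  ultimately show ?thesis unfolding S0_dual_def by (auto simp: kernel_def)
qed

theorem op_eq_kernel:
  assumes f: "f \<in> S0 g"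
  shows "S f = distr_of (S0_conv kernel f)"
proof
  fix \<phi>
  show "S f \<phi> = distr_of (S0_conv kernel f) \<phi>"
  proof (cases "\<phi> \<in> schwartz")
    case True
    then show ?thesis by (simp add: op_eq_integral_symbol[OF f] S0_conv_kernel[OF f] distr_of_def)
  next
    case False
    then show ?thesis using tempered_outside[OF tempered[OF f]] by (simp add: distr_of_def)
  qed
qed

theorem ex1_kernel: "\<exists>!u. u \<in> S0_dual g \<and> (\<forall>f\<in>S0 g. S f = distr_of (S0_conv u f))"
proof (rule ex1I[of _ kernel])
  show "kernel \<in> S0_dual g \<and> (\<forall>f\<in>S0 g. S f = distr_of (S0_conv kernel f))"
    using kernel_dual op_eq_kernel by blast
  fix u assume "u \<in> S0_dual g \<and> (\<forall>f\<in>S0 g. S f = distr_of (S0_conv u f))"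
  then show "u = kernel" using op_eq_kernel by (intro S0_dual_eqI[OF g _ kernel_dual]) auto
qed

end

section \<open>Modulation spaces\<close>

lemma ennreal_powr_ennreal: "0 \<le> v \<Longrightarrow> ennreal_powr (ennreal v) e = ennreal (v powr e)"
  by (simp add: ennreal_powr_def)

lemma ennreal_powr_top [simp]: "ennreal_powr top e = top"
  by (simp add: ennreal_powr_def)

lemma measurable_ennreal_powr [measurable]:
  assumes [measurable]: "f \<in> borel_measurable M"
  shows "(\<lambda>x. ennreal_powr (f x) e) \<in> borel_measurable M"
  unfolding ennreal_powr_def by measurable

lemma ennreal_powr_powr: "ennreal_powr (ennreal_powr y e) e' = ennreal_powr y (e * e')"
  by (cases y) (auto simp: ennreal_powr_ennreal powr_powr)

lemma ennreal_powr_mult: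
  assumes "0 < k"
  shows "ennreal_powr (ennreal k * y) e = ennreal (k powr e) * ennreal_powr y e"
proof (cases y)
  case (real v)
  then show ?thesis using assms by (simp add: ennreal_mult[symmetric] ennreal_powr_ennreal powr_mult)
next
  case top
  then show ?thesis using assms by (simp add: ennreal_mult_top)
qed

lemma ennreal_powr_le:
  assumes "y \<le> ennreal z" "0 \<le> z" "0 \<le> e"
  shows "ennreal_powr y e \<le> ennreal (z powr e)"
proof (cases y)
  case (real v)
  then show ?thesis using assms by (simp add: ennreal_powr_ennreal powr_mono2 ennreal_leI)
next
  case top
  then show ?thesis using assms by (simp add: top_unique)
qed

lemma powr_le_mult:
  fixes v :: real
  assumes "0 \<le> v" "v \<le> M" "1 \<le> r"
  shows "v powr r \<le> M powr (r - 1) * v"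
proof (cases "v = 0")
  case False
  then have "v powr r = v powr (r - 1) * v"
    using assms by (simp add: powr_diff)
  also have "\<dots> \<le> M powr (r - 1) * v"
    using assms by (intro mult_right_mono powr_mono2) auto
  finally show ?thesis .
qed simp

definition mixed_norm :: "real \<Rightarrow> real \<Rightarrow> (real \<Rightarrow> real \<Rightarrow> complex) \<Rightarrow> ennreal" where
  "mixed_norm r s F = ennreal_powr
     (\<integral>\<^sup>+\<eta>. ennreal_powr (\<integral>\<^sup>+y. ennreal (cmod (F y \<eta>) powr r) \<partial>lborel) (s / r) \<partial>lborel) (1 / s)"

text \<open>Interpolation between supremum and integral:
  \<open>v powr r \<le> M powr (r - 1) * v\<close> in each variable. The function \<open>h\<close>
  majorises the supremum in \<open>y\<close> and, up to \<open>p\<close>, the integral in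
  \<open>y\<close>; its own supremum and, up to \<open>q\<close>, its integral are bounded by
  \<open>N\<close>.\<close>

lemma mixed_norm_le:
  assumes rs: "1 \<le> r" "1 \<le> s"
    and F [measurable]: "\<And>\<eta>. (\<lambda>y. F y \<eta>) \<in> borel_measurable borel" and h [measurable]: "h \<in> borel_measurable borel"
    and pos: "\<And>\<eta>. 0 \<le> h \<eta>" "0 \<le> p" "0 \<le> q" "0 \<le> N"
    and le: "\<And>y \<eta>. cmod (F y \<eta>) \<le> h \<eta>"
    and int: "\<And>\<eta>. (\<integral>\<^sup>+y. ennreal (cmod (F y \<eta>)) \<partial>lborel) \<le> ennreal (p * h \<eta>)"
    and hN: "\<And>\<eta>. h \<eta> \<le> N" "(\<integral>\<^sup>+\<eta>. ennreal (h \<eta>) \<partial>lborel) \<le> ennreal (q * N)"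
  shows "mixed_norm r s F \<le> ennreal ((p powr (s / r) * q) powr (1 / s) * N)"
proof -
  have powr_Suc: "x powr (e - 1) * x = x powr e" if "0 \<le> x" for x e :: real
    using that by (cases "x = 0") (auto simp: powr_diff)
  have inner: "ennreal_powr (\<integral>\<^sup>+y. ennreal (cmod (F y \<eta>) powr r) \<partial>lborel) (s / r) \<le>
      ennreal (p powr (s / r) * N powr (s - 1)) * ennreal (h \<eta>)" for \<eta>
  proof -
    have "(\<integral>\<^sup>+y. ennreal (cmod (F y \<eta>) powr r) \<partial>lborel) \<le>
      (\<integral>\<^sup>+y. ennreal (h \<eta> powr (r - 1)) * ennreal (cmod (F y \<eta>)) \<partial>lborel)"
      using powr_le_mult[OF norm_ge_zero le rs(1)]
      by (intro nn_integral_mono) (simp add: ennreal_mult[symmetric] ennreal_leI)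
    also have "\<dots> = ennreal (h \<eta> powr (r - 1)) * (\<integral>\<^sup>+y. ennreal (cmod (F y \<eta>)) \<partial>lborel)"
      by (rule nn_integral_cmult) measurable
    also have "\<dots> \<le> ennreal (h \<eta> powr (r - 1)) * ennreal (p * h \<eta>)" by (intro mult_left_mono int) simp
    also have "\<dots> = ennreal (p * h \<eta> powr r)"
      using pos powr_Suc[OF pos(1)[of \<eta>], of r] by (simp add: ennreal_mult[symmetric] mult_ac)
    finally have "ennreal_powr (\<integral>\<^sup>+y. ennreal (cmod (F y \<eta>) powr r) \<partial>lborel) (s / r) \<le>
      ennreal ((p * h \<eta> powr r) powr (s / r))"
      using pos rs by (intro ennreal_powr_le) auto
    also have "(p * h \<eta> powr r) powr (s / r) = p powr (s / r) * h \<eta> powr s"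
      using pos rs by (simp add: powr_mult powr_powr)
    also have "\<dots> \<le> p powr (s / r) * (N powr (s - 1) * h \<eta>)"
      by (intro mult_left_mono powr_le_mult pos hN rs) simp
    finally show ?thesis using pos by (simp add: ennreal_mult[symmetric] mult.assoc ennreal_leI)
  qed
  have "(\<integral>\<^sup>+\<eta>. ennreal_powr (\<integral>\<^sup>+y. ennreal (cmod (F y \<eta>) powr r) \<partial>lborel) (s / r) \<partial>lborel) \<le>
    (\<integral>\<^sup>+\<eta>. ennreal (p powr (s / r) * N powr (s - 1)) * ennreal (h \<eta>) \<partial>lborel)"
    by (intro nn_integral_mono inner)
  also have "\<dots> = ennreal (p powr (s / r) * N powr (s - 1)) * (\<integral>\<^sup>+\<eta>. ennreal (h \<eta>) \<partial>lborel)"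
    by (rule nn_integral_cmult) measurable
  also have "\<dots> \<le> ennreal (p powr (s / r) * N powr (s - 1)) * ennreal (q * N)"
    by (intro mult_left_mono hN) simp
  also have "\<dots> = ennreal (p powr (s / r) * q * N powr s)"
    using pos powr_Suc[OF pos(4), of s] by (simp add: ennreal_mult[symmetric] mult_ac)
  finally have "mixed_norm r s F \<le> ennreal ((p powr (s / r) * q * N powr s) powr (1 / s))"
    unfolding mixed_norm_def using pos rs by (intro ennreal_powr_le) auto
  also have "(p powr (s / r) * q * N powr s) powr (1 / s) = (p powr (s / r) * q) powr (1 / s) * N"
    using pos rs by (simp add: powr_mult powr_powr)
  finally show ?thesis .
qed

text \<open>In place of Hoelder's inequality:
  \<open>x \<le> \<mu> + \<mu> powr (1 - r) * x powr r\<close>, by comparing \<open>x\<close> with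
  the threshold \<open>\<mu>\<close>. With \<open>\<mu>\<close> the r-norm of \<open>F\<close> the
  two terms contribute \<open>p * \<mu>\<close> and \<open>\<mu>\<close>, whence
  \<open>p + 1\<close>; there is no conjugate exponent, and \<open>r = 1\<close> is
  included.\<close>

lemma nn_integral_le_powr:
  fixes F :: "real \<Rightarrow> ennreal" and \<kappa> :: "real \<Rightarrow> real"
  assumes [measurable]: "F \<in> borel_measurable borel" "\<kappa> \<in> borel_measurable borel"
    and \<kappa>: "\<And>y. 0 \<le> \<kappa> y" "\<And>y. \<kappa> y \<le> 1" "(\<integral>\<^sup>+y. ennreal (\<kappa> y) \<partial>lborel) \<le> ennreal p" "0 \<le> p" and r: "1 \<le> r"
  shows "(\<integral>\<^sup>+y. F y * ennreal (\<kappa> y) \<partial>lborel) \<le> ennreal (p + 1) * ennreal_powr (\<integral>\<^sup>+y. ennreal_powr (F y) r \<partial>lborel) (1 / r)"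
proof -
  define I where "I = (\<integral>\<^sup>+y. ennreal_powr (F y) r \<partial>lborel)"
  \<comment> \<open>The threshold has to be positive and finite, so the two extreme values are
    separated.\<close>
  consider "I = \<infinity>" | "I = 0" | v where "I = ennreal v" "0 < v"
    by (cases I) (auto simp: less_le)
  then show ?thesis
  proof cases
    case 1
    then show ?thesis using \<kappa>(4) by (simp add: I_def[symmetric] ennreal_mult_top)
  next
    case 2
    then have "AE y in lborel. ennreal_powr (F y) r = 0"
      unfolding I_def by (subst (asm) nn_integral_0_iff_AE) auto
    then have "AE y in lborel. F y * ennreal (\<kappa> y) = 0"
    proof eventually_elim
      case (elim y)
      then have "F y = 0"
        by (cases "F y") (auto simp: ennreal_powr_ennreal)
      then show ?case by simp
    qed
    then have "(\<integral>\<^sup>+y. F y * ennreal (\<kappa> y) \<partial>lborel) = 0"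
      by (subst nn_integral_0_iff_AE) auto
    then show ?thesis by simp
  next
    case (3 v)
    define \<mu> where "\<mu> = v powr (1 / r)"
    have l: "0 < \<mu>" using 3 by (simp add: \<mu>_def)
    have young: "x \<le> ennreal \<mu> + ennreal (\<mu> powr (1 - r)) * ennreal_powr x r" for x
    proof (cases x)
      case (real z)
      have "z \<le> \<mu> + \<mu> powr (1 - r) * z powr r"
      proof (cases "z \<le> \<mu>")
        case True
        then show ?thesis by (simp add: add_increasing2)
      next
        case False
        then have z: "0 < z" "\<mu> \<le> z" using l by auto
        have "z = z powr (1 - r) * z powr r" using z by (simp add: powr_add[symmetric])
        also have "\<dots> \<le> \<mu> powr (1 - r) * z powr r"
          using z l r by (intro mult_right_mono powr_mono2') auto
        finally show ?thesis using l by linarith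
      qed
      then show ?thesis using real l
        by (simp add: ennreal_powr_ennreal ennreal_mult[symmetric] ennreal_plus[symmetric] ennreal_leI del: ennreal_plus)
    next
      case top
      then show ?thesis using l by (simp add: ennreal_mult_top)
    qed
    have "(\<integral>\<^sup>+y. F y * ennreal (\<kappa> y) \<partial>lborel) \<le>
      (\<integral>\<^sup>+y. ennreal \<mu> * ennreal (\<kappa> y) + ennreal (\<mu> powr (1 - r)) * ennreal_powr (F y) r \<partial>lborel)"
    proof (intro nn_integral_mono)
      fix y
      have "F y * ennreal (\<kappa> y) \<le> (ennreal \<mu> + ennreal (\<mu> powr (1 - r)) * ennreal_powr (F y) r) * ennreal (\<kappa> y)"
        by (intro mult_right_mono young) simp
      also have "\<dots> = ennreal \<mu> * ennreal (\<kappa> y) + ennreal (\<mu> powr (1 - r)) * ennreal_powr (F y) r * ennreal (\<kappa> y)"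
        by (rule distrib_right)
      also have "\<dots> \<le> ennreal \<mu> * ennreal (\<kappa> y) + ennreal (\<mu> powr (1 - r)) * ennreal_powr (F y) r * 1"
        using \<kappa>(2)[of y] by (intro add_left_mono mult_left_mono) auto
      finally show "F y * ennreal (\<kappa> y) \<le> ennreal \<mu> * ennreal (\<kappa> y) + ennreal (\<mu> powr (1 - r)) * ennreal_powr (F y) r"
        by simp
    qed
    also have "\<dots> = ennreal \<mu> * (\<integral>\<^sup>+y. ennreal (\<kappa> y) \<partial>lborel) + ennreal (\<mu> powr (1 - r)) * I"
      unfolding I_def by (simp add: nn_integral_add nn_integral_cmult)
    also have "\<dots> \<le> ennreal \<mu> * ennreal p + ennreal (\<mu> powr (1 - r)) * ennreal v"
      using 3 by (intro add_mono mult_left_mono \<kappa>) auto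
    also have "\<dots> = ennreal (\<mu> * p + \<mu> powr (1 - r) * v)"
      using l \<kappa>(4) 3 by (simp add: ennreal_mult[symmetric] ennreal_plus[symmetric] del: ennreal_plus)
    also have "\<mu> powr (1 - r) * v = \<mu>"
    proof -
      have "v = \<mu> powr r" using 3 r by (simp add: \<mu>_def powr_powr)
      then show ?thesis using l by (simp add: powr_add[symmetric])
    qed
    also have "ennreal (\<mu> * p + \<mu>) = ennreal (p + 1) * ennreal \<mu>"
      using l \<kappa>(4) by (simp add: ennreal_mult[symmetric] algebra_simps)
    also have "ennreal \<mu> = ennreal_powr I (1 / r)" using 3 by (simp add: \<mu>_def ennreal_powr_ennreal)
    finally show ?thesis by (simp add: I_def)
  qed
qed

text \<open>\<open>nn_integral_le_powr\<close> in position and then in frequency, each at the cost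
  \<open>pi + 1\<close>. With the change of window this embeds the modulation spaces into the
  distributions with bounded transform.\<close>

lemma smear_le_mixed_norm:
  assumes rs: "1 \<le> r" "1 \<le> s" and F [measurable]: "(\<lambda>(y, \<eta>). F y \<eta>) \<in> borel_measurable (borel \<Otimes>\<^sub>M borel)"
  shows "smear (\<lambda>y \<eta>. ennreal (cmod (F y \<eta>))) x \<omega> \<le> ennreal ((pi + 1)\<^sup>2) * mixed_norm r s F"
proof -
  define R where "R \<eta> = ennreal_powr (\<integral>\<^sup>+y. ennreal_powr (ennreal (cmod (F y \<eta>))) r \<partial>lborel) (1 / r)" for \<eta>
  have R_meas [measurable]: "R \<in> borel_measurable borel" unfolding R_def[abs_def] by measurable
  have k: "(\<integral>\<^sup>+y. ennreal (kern (x - y)) \<partial>lborel) \<le> ennreal pi" for x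
    using nn_integral_kern_shift[of x] by (simp add: kern_diff_commute[of x])
  have "smear (\<lambda>y \<eta>. ennreal (cmod (F y \<eta>))) x \<omega> \<le>
     (\<integral>\<^sup>+\<eta>. ennreal (pi + 1) * (R \<eta> * ennreal (kern (\<omega> - \<eta>))) \<partial>lborel)"
    unfolding smear_def
  proof (intro nn_integral_mono)
    fix \<eta>
    have "(\<integral>\<^sup>+y. ennreal (cmod (F y \<eta>)) * ennreal (kern (x - y)) \<partial>lborel) \<le> ennreal (pi + 1) * R \<eta>"
      unfolding R_def by (rule nn_integral_le_powr) (auto simp: kern_nonneg kern_le_1 k rs)
    from mult_left_mono[OF this, of "ennreal (kern (\<omega> - \<eta>))"]
    show "ennreal (kern (\<omega> - \<eta>)) * (\<integral>\<^sup>+y. ennreal (cmod (F y \<eta>)) * ennreal (kern (x - y)) \<partial>lborel) \<le>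
      ennreal (pi + 1) * (R \<eta> * ennreal (kern (\<omega> - \<eta>)))" by (simp add: mult_ac)
  qed
  also have "\<dots> = ennreal (pi + 1) * (\<integral>\<^sup>+\<eta>. R \<eta> * ennreal (kern (\<omega> - \<eta>)) \<partial>lborel)"
    by (rule nn_integral_cmult) measurable
  also have "\<dots> \<le> ennreal (pi + 1) * (ennreal (pi + 1) * ennreal_powr (\<integral>\<^sup>+\<eta>. ennreal_powr (R \<eta>) s \<partial>lborel) (1 / s))"
    by (intro mult_left_mono nn_integral_le_powr) (auto simp: kern_nonneg kern_le_1 k rs)
  also have "ennreal_powr (\<integral>\<^sup>+\<eta>. ennreal_powr (R \<eta>) s \<partial>lborel) (1 / s) = mixed_norm r s F"
    by (simp add: R_def mixed_norm_def ennreal_powr_powr ennreal_powr_ennreal)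
  also have "ennreal (pi + 1) * (ennreal (pi + 1) * mixed_norm r s F) = ennreal ((pi + 1)\<^sup>2) * mixed_norm r s F"
    by (simp add: power2_eq_square ennreal_mult mult.assoc add_nonneg_nonneg)
  finally show ?thesis .
qed

text \<open>The embedding of the Feichtinger algebra: the marginal of the smeared transform bounds
  both supremum and integral in position, so \<open>mixed_norm_le\<close> applies with
  \<open>p = q = pi\<close>.\<close>

lemma mixed_norm_stft_le:
  assumes rs: "1 \<le> r" "1 \<le> s" and \<psi>: "\<psi> \<in> schwartz" and G: "G \<in> schwartz" "G \<noteq> (\<lambda>t. 0)"
  obtains Q where "0 \<le> Q" "\<And>\<Lambda>. \<Lambda> \<in> tempered \<Longrightarrow> stft_norm G \<Lambda> < \<infinity> \<Longrightarrow> mixed_norm r s (stft \<psi> \<Lambda>) \<le> ennreal Q * stft_norm G \<Lambda>"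
proof -
  obtain C where C: "0 \<le> C" "\<And>\<Lambda> x \<omega>. \<Lambda> \<in> tempered \<Longrightarrow>
    ennreal (cmod (stft \<psi> \<Lambda> x \<omega>)) \<le> ennreal C * smear (\<lambda>y \<eta>. ennreal (cmod (stft G \<Lambda> y \<eta>))) x \<omega>"
    using stft_change_window[OF \<psi> G] by blast
  let ?Q = "(pi powr (s / r) * pi) powr (1 / s)"
  show ?thesis
  proof (rule that[of "?Q * C"])
    show "0 \<le> ?Q * C" using C(1) by simp
    fix \<Lambda> assume \<Lambda>: "\<Lambda> \<in> tempered" and fin: "stft_norm G \<Lambda> < \<infinity>"
    let ?V = "\<lambda>y \<eta>. ennreal (cmod (stft G \<Lambda> y \<eta>))"
    note V [measurable] = measurable_norm_stft[OF \<Lambda> G(1)]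
    note [measurable] = measurable_marginal[OF V]
    have m: "marginal ?V \<omega> \<le> stft_norm G \<Lambda>" for \<omega>
      using marginal_le[OF V] by (simp add: stft_norm_def)
    define n where "n = enn2real (stft_norm G \<Lambda>)"
    define k where "k \<omega> = enn2real (marginal ?V \<omega>)" for \<omega>
    have n: "stft_norm G \<Lambda> = ennreal n" "0 \<le> n" using fin by (auto simp: n_def)
    have "marginal ?V \<omega> < \<infinity>" for \<omega> using m fin by (rule order.strict_trans1)
    then have k: "marginal ?V \<omega> = ennreal (k \<omega>)" "0 \<le> k \<omega>" for \<omega> by (auto simp: k_def)
    have kn: "k \<omega> \<le> n" for \<omega> using m[of \<omega>] n k by simp
    have [measurable]: "k \<in> borel_measurable borel" unfolding k_def[abs_def] by measurable
    have "mixed_norm r s (stft \<psi> \<Lambda>) \<le> ennreal (?Q * (C * n))"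
    proof (rule mixed_norm_le[OF rs, where h="\<lambda>\<omega>. C * k \<omega>"])
      show "(\<lambda>y. stft \<psi> \<Lambda> y \<eta>) \<in> borel_measurable borel" for \<eta>
        by (intro measurable_stft \<Lambda> \<psi>) auto
      show "cmod (stft \<psi> \<Lambda> x \<omega>) \<le> C * k \<omega>" for x \<omega>
      proof -
        have "ennreal (cmod (stft \<psi> \<Lambda> x \<omega>)) \<le> ennreal C * marginal ?V \<omega>"
          by (rule order_trans[OF C(2)[OF \<Lambda>]]) (intro mult_left_mono smear_le_marginal V, simp)
        then show ?thesis using C(1) k by (simp add: ennreal_mult[symmetric])
      qed
      show "(\<integral>\<^sup>+x. ennreal (cmod (stft \<psi> \<Lambda> x \<omega>)) \<partial>lborel) \<le> ennreal (pi * (C * k \<omega>))" for \<omega>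
      proof -
        have [measurable]: "(\<lambda>x. smear ?V x \<omega>) \<in> borel_measurable borel"
          unfolding smear_def by measurable
        have "(\<integral>\<^sup>+x. ennreal (cmod (stft \<psi> \<Lambda> x \<omega>)) \<partial>lborel) \<le> (\<integral>\<^sup>+x. ennreal C * smear ?V x \<omega> \<partial>lborel)"
          by (intro nn_integral_mono C(2) \<Lambda>)
        also have "\<dots> = ennreal C * (ennreal pi * marginal ?V \<omega>)"
          by (simp add: nn_integral_cmult nn_integral_smear[OF V])
        finally show ?thesis using C(1) k by (simp add: ennreal_mult[symmetric] mult_ac)
      qed
      show "C * k \<omega> \<le> C * n" for \<omega> by (intro mult_left_mono kn C)
      have "(\<integral>\<^sup>+\<omega>. ennreal (C * k \<omega>) \<partial>lborel) = ennreal C * (\<integral>\<^sup>+\<omega>. marginal ?V \<omega> \<partial>lborel)"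
        using C(1) k(2) by (simp add: ennreal_mult k(1) nn_integral_cmult)
      also have "\<dots> = ennreal C * (ennreal pi * stft_norm G \<Lambda>)"
        by (simp add: nn_integral_marginal[OF V] stft_norm_def)
      also have "\<dots> = ennreal (pi * (C * n))"
        using C(1) n by (simp add: ennreal_mult[symmetric] mult_ac)
      finally show "(\<integral>\<^sup>+\<omega>. ennreal (C * k \<omega>) \<partial>lborel) \<le> ennreal (pi * (C * n))" by simp
    qed (use C(1) k(2) n in auto)
    also have "\<dots> = ennreal (?Q * C) * stft_norm G \<Lambda>"
      using C(1) n by (simp add: ennreal_mult[symmetric] mult.assoc)
    finally show "mixed_norm r s (stft \<psi> \<Lambda>) \<le> ennreal (?Q * C) * stft_norm G \<Lambda>" .
  qed
qed

section \<open>Reduction of the A-modulation norm to the classical mixed norm\<close>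

lemma distr_chirp_chirp [simp]: "distr_chirp \<alpha> (distr_chirp \<beta> \<Lambda>) = distr_chirp (\<alpha> + \<beta>) \<Lambda>"
  by (simp add: distr_chirp_def fun_eq_iff add.commute)

lemma distr_chirp_0 [simp]: "distr_chirp 0 \<Lambda> = \<Lambda>"
  by (simp add: distr_chirp_def)

text \<open>Collecting quadratic phases: half of the chirp of rate \<open>2 * \<alpha>\<close> goes
  to the distribution, the other half completes the square with the phase of the A-translation and
  becomes a chirp of the window.\<close>

lemma norm_A_conv:
  assumes b: "par_b A \<noteq> 0" and f: "f \<in> tempered" and \<alpha>: "\<alpha> = par_a A / par_b A"
  shows "cmod (A_conv A f (A_modul A \<omega> g) x) =
    1 / sqrt \<bar>par_b A\<bar> * cmod (stft (chirp \<alpha> (reflect g)) (distr_chirp \<alpha> f) x (- (\<omega> / par_b A)))"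
proof -
  let ?b = "par_b A" and ?a = "par_a A"
  \<comment> \<open>All terms that do not depend on \<open>t\<close>; they form a constant
    phase.\<close>
  define \<theta> where "\<theta> = pi * \<alpha> * x\<^sup>2 + pi / ?b * (?a * \<omega>\<^sup>2 - 2 * par_p A * \<omega> + 2 * \<omega> * x)"
  have "chirp (2 * ?a / ?b) (A_trans A x (reflect (A_modul A \<omega> g))) =
    (\<lambda>t. cis \<theta> * chirp \<alpha> (time_freq x (- (\<omega> / ?b)) (chirp \<alpha> (reflect g))) t)"
  proof
    fix t
    have a: "?a = \<alpha> * ?b" using b \<alpha> by simp
    have "pi * (2 * ?a / ?b) * t\<^sup>2 + (- (2 * pi * ?a / ?b) * x * (t - x) +
        pi / ?b * (?a * \<omega>\<^sup>2 - 2 * par_p A * \<omega> + 2 * \<omega> * - (t - x))) =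
      \<theta> + (pi * \<alpha> * t\<^sup>2 + (2 * pi * (- (\<omega> / ?b)) * t + pi * \<alpha> * (t - x)\<^sup>2))"
      unfolding \<theta>_def a using b by (simp add: field_simps power2_eq_square)
    then have "cis (pi * (2 * ?a / ?b) * t\<^sup>2) * (cis (- (2 * pi * ?a / ?b) * x * (t - x)) *
        cis (pi / ?b * (?a * \<omega>\<^sup>2 - 2 * par_p A * \<omega> + 2 * \<omega> * - (t - x)))) =
      cis \<theta> * (cis (pi * \<alpha> * t\<^sup>2) * (cis (2 * pi * (- (\<omega> / ?b)) * t) * cis (pi * \<alpha> * (t - x)\<^sup>2)))"
      by (simp only: cis_mult)
    from arg_cong[OF this, of "\<lambda>z. z * g (- (t - x))"]
    show "chirp (2 * ?a / ?b) (A_trans A x (reflect (A_modul A \<omega> g))) t =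
      cis \<theta> * chirp \<alpha> (time_freq x (- (\<omega> / ?b)) (chirp \<alpha> (reflect g))) t"
      by (simp only: chirp_def A_trans_def reflect_def A_modul_def time_freq_def modul_def translate_def mult.assoc)
  qed
  then show ?thesis
    by (simp add: A_conv_def tempered_cmult[OF f] norm_mult stft_def distr_chirp_def norm_divide)
qed

lemma A_mod_norm_eq:
  assumes b: "par_b A \<noteq> 0" and \<alpha>: "\<alpha> = par_a A / par_b A" and g: "g \<in> schwartz" and rs: "1 \<le> r" "1 \<le> s"
  obtains k where "0 < k" "\<And>f. f \<in> tempered \<Longrightarrow>
    A_mod_norm A g r s f = ennreal k * mixed_norm r s (stft (chirp \<alpha> (reflect g)) (distr_chirp \<alpha> f))"
proof -
  let ?b = "par_b A"
  define \<beta> where "\<beta> = 1 / sqrt \<bar>?b\<bar>"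
  have \<beta>: "0 < \<beta>" using b by (simp add: \<beta>_def)
  have G: "chirp \<alpha> (reflect g) \<in> schwartz" using g by simp
  show ?thesis
  \<comment> \<open>\<open>\<beta>\<close> is the factor of the A-convolution, raised to the power
    \<open>s\<close> by the norms; the absolute value of \<open>par_b A\<close> is the Jacobian of
    \<open>\<omega> = - par_b A * \<eta>\<close>.\<close>
  proof (rule that[of "(\<beta> powr s * \<bar>?b\<bar>) powr (1 / s)"])
    show "0 < (\<beta> powr s * \<bar>?b\<bar>) powr (1 / s)" using \<beta> b by simp
    fix f assume f: "f \<in> tempered"
    define F where "F = stft (chirp \<alpha> (reflect g)) (distr_chirp \<alpha> f)"
    have [measurable (raw)]: "(\<lambda>x. F (u x) (v x)) \<in> borel_measurable M"
      if "u \<in> borel_measurable M" "v \<in> borel_measurable M" for u v :: "'x \<Rightarrow> real" and M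
      unfolding F_def by (intro measurable_stft tempered_chirp f G that)
    define J where "J \<eta> = ennreal_powr (\<integral>\<^sup>+y. ennreal (cmod (F y \<eta>) powr r) \<partial>lborel) (s / r)" for \<eta>
    have J [measurable]: "J \<in> borel_measurable borel" unfolding J_def[abs_def] by measurable
    have inner: "ennreal_powr (\<integral>\<^sup>+x. ennreal (cmod (A_conv A f (A_modul A \<omega> g) x) powr r) \<partial>lborel) (s / r) =
      ennreal (\<beta> powr s) * J (- (\<omega> / ?b))" for \<omega>
    proof -
      have "(\<integral>\<^sup>+x. ennreal (cmod (A_conv A f (A_modul A \<omega> g) x) powr r) \<partial>lborel) =
        (\<integral>\<^sup>+x. ennreal (\<beta> powr r) * ennreal (cmod (F x (- (\<omega> / ?b))) powr r) \<partial>lborel)"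
        unfolding norm_A_conv[OF b f \<alpha>] F_def \<beta>_def[symmetric] using \<beta> by (simp add: powr_mult ennreal_mult)
      also have "\<dots> = ennreal (\<beta> powr r) * (\<integral>\<^sup>+x. ennreal (cmod (F x (- (\<omega> / ?b))) powr r) \<partial>lborel)"
        by (rule nn_integral_cmult) measurable
      finally show ?thesis using \<beta> rs by (simp add: J_def ennreal_powr_mult powr_powr)
    qed
    have "A_mod_norm A g r s f = ennreal_powr (\<integral>\<^sup>+\<omega>. ennreal (\<beta> powr s) * J (- (\<omega> / ?b)) \<partial>lborel) (1 / s)"
      by (simp add: A_mod_norm_def inner)
    also have "(\<integral>\<^sup>+\<omega>. ennreal (\<beta> powr s) * J (- (\<omega> / ?b)) \<partial>lborel) = ennreal (\<beta> powr s) * (\<integral>\<^sup>+\<omega>. J (- (\<omega> / ?b)) \<partial>lborel)"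
      by (rule nn_integral_cmult) measurable
    also have "(\<integral>\<^sup>+\<omega>. J (- (\<omega> / ?b)) \<partial>lborel) = ennreal \<bar>?b\<bar> * (\<integral>\<^sup>+\<eta>. J \<eta> \<partial>lborel)"
      using b by (subst nn_integral_real_affine[where c="- ?b" and t=0]) auto
    also have "ennreal (\<beta> powr s) * (ennreal \<bar>?b\<bar> * (\<integral>\<^sup>+\<eta>. J \<eta> \<partial>lborel)) = ennreal (\<beta> powr s * \<bar>?b\<bar>) * (\<integral>\<^sup>+\<eta>. J \<eta> \<partial>lborel)"
      by (simp add: ennreal_mult mult.assoc)
    also have "ennreal_powr \<dots> (1 / s) = ennreal ((\<beta> powr s * \<bar>?b\<bar>) powr (1 / s)) * ennreal_powr (\<integral>\<^sup>+\<eta>. J \<eta> \<partial>lborel) (1 / s)"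
      using \<beta> b by (intro ennreal_powr_mult) simp
    also have "ennreal_powr (\<integral>\<^sup>+\<eta>. J \<eta> \<partial>lborel) (1 / s) = mixed_norm r s F"
      by (simp add: mixed_norm_def J_def)
    finally show "A_mod_norm A g r s f = ennreal ((\<beta> powr s * \<bar>?b\<bar>) powr (1 / s)) *
      mixed_norm r s (stft (chirp \<alpha> (reflect g)) (distr_chirp \<alpha> f))" by (simp add: F_def)
  qed
qed

lemma chirp_nonzero:
  assumes "\<psi> \<noteq> (\<lambda>t. 0)"
  shows "chirp \<alpha> \<psi> \<noteq> (\<lambda>t. 0)"
proof
  assume "chirp \<alpha> \<psi> = (\<lambda>t. 0)"
  moreover have "chirp (- \<alpha>) (\<lambda>t. 0) = (\<lambda>t. 0)" by (auto simp: chirp_def)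
  ultimately have "chirp (- \<alpha>) (chirp \<alpha> \<psi>) = (\<lambda>t. 0)" by (simp only:)
  with assms show False by simp
qed

theorem S0_le_A_mod:
  assumes b: "par_b A \<noteq> 0" and g: "g \<in> schwartz" "g \<noteq> (\<lambda>t. 0)" and rs: "1 \<le> r" "1 \<le> s"
  obtains Q where "0 \<le> Q" "\<And>f. f \<in> S0 g \<Longrightarrow> A_mod_norm A g r s f \<le> ennreal Q * S0_norm g f"
    "\<And>f. f \<in> S0 g \<Longrightarrow> f \<in> A_mod_space A g r s"
proof -
  define \<alpha> where "\<alpha> = par_a A / par_b A"
  have G: "reflect g \<in> schwartz" "reflect g \<noteq> (\<lambda>t. 0)" using g reflect_nonzero by auto
  have G': "chirp \<alpha> (reflect g) \<in> schwartz" using g by simp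
  obtain k where k: "0 < k" "\<And>f. f \<in> tempered \<Longrightarrow>
    A_mod_norm A g r s f = ennreal k * mixed_norm r s (stft (chirp \<alpha> (reflect g)) (distr_chirp \<alpha> f))"
    using A_mod_norm_eq[OF b \<alpha>_def g(1) rs] by blast
  obtain Q where Q: "0 \<le> Q" "\<And>\<Lambda>. \<Lambda> \<in> tempered \<Longrightarrow> stft_norm (reflect g) \<Lambda> < \<infinity> \<Longrightarrow>
    mixed_norm r s (stft (chirp \<alpha> (reflect g)) \<Lambda>) \<le> ennreal Q * stft_norm (reflect g) \<Lambda>"
    using mixed_norm_stft_le[OF rs G' G] by blast
  obtain D where D: "0 \<le> D" "\<And>f. f \<in> S0 g \<Longrightarrow> distr_chirp \<alpha> f \<in> S0 g"
    "\<And>f. f \<in> S0 g \<Longrightarrow> S0_norm g (distr_chirp \<alpha> f) \<le> ennreal D * S0_norm g f"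
    using S0_chirp[OF g] by blast
  have le: "A_mod_norm A g r s f \<le> ennreal (k * Q * D) * S0_norm g f" if f: "f \<in> S0 g" for f
  proof -
    note t = S0_tempered[OF D(2)[OF f]]
    have "stft_norm (reflect g) (distr_chirp \<alpha> f) < \<infinity>" using D(2)[OF f] g(1) by (simp add: S0_iff)
    from Q(2)[OF t this]
    have "mixed_norm r s (stft (chirp \<alpha> (reflect g)) (distr_chirp \<alpha> f)) \<le> ennreal Q * S0_norm g (distr_chirp \<alpha> f)"
      using t g(1) by (simp add: S0_norm_eq)
    also have "\<dots> \<le> ennreal Q * (ennreal D * S0_norm g f)" by (intro mult_left_mono D f) simp
    finally have "A_mod_norm A g r s f \<le> ennreal k * (ennreal Q * (ennreal D * S0_norm g f))"
      unfolding k(2)[OF S0_tempered[OF f]] by (rule mult_left_mono) simp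
    then show ?thesis using k(1) Q(1) D(1) by (simp add: ennreal_mult mult.assoc)
  qed
  show ?thesis
  proof (rule that[OF _ le])
    show "0 \<le> k * Q * D" using k(1) Q(1) D(1) by simp
    fix f assume f: "f \<in> S0 g"
    have "ennreal (k * Q * D) * S0_norm g f < \<infinity>" using S0_finite[OF f] by (simp add: ennreal_mult_less_top)
    with le[OF f] have "A_mod_norm A g r s f < \<infinity>" by (rule order.strict_trans1)
    then show "f \<in> A_mod_space A g r s" using S0_tempered[OF f] by (simp add: A_mod_space_def)
  qed
qed

text \<open>The window \<open>\<psi>\<close> is arbitrary because a chirped window has to be
  inserted when the operator commutes with ordinary translations.\<close>

theorem stft_le_A_mod:
  assumes b: "par_b A \<noteq> 0" and g: "g \<in> schwartz" "g \<noteq> (\<lambda>t. 0)" and rs: "1 \<le> r" "1 \<le> s"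
    and \<alpha>: "\<alpha> = par_a A / par_b A" and \<psi>: "\<psi> \<in> schwartz"
  obtains C where "0 \<le> C" "\<And>f x \<omega>. f \<in> tempered \<Longrightarrow>
    ennreal (cmod (stft \<psi> (distr_chirp \<alpha> f) x \<omega>)) \<le> ennreal C * A_mod_norm A g r s f"
proof -
  let ?G = "chirp \<alpha> (reflect g)"
  have G: "?G \<in> schwartz" "?G \<noteq> (\<lambda>t. 0)" using g reflect_nonzero chirp_nonzero by auto
  obtain k where k: "0 < k" "\<And>f. f \<in> tempered \<Longrightarrow> A_mod_norm A g r s f = ennreal k * mixed_norm r s (stft ?G (distr_chirp \<alpha> f))"
    using A_mod_norm_eq[OF b \<alpha> g(1) rs] by blast
  obtain C where C: "0 \<le> C" "\<And>\<Lambda> x \<omega>. \<Lambda> \<in> tempered \<Longrightarrow>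
    ennreal (cmod (stft \<psi> \<Lambda> x \<omega>)) \<le> ennreal C * smear (\<lambda>y \<eta>. ennreal (cmod (stft ?G \<Lambda> y \<eta>))) x \<omega>"
    using stft_change_window[OF \<psi> G] by blast
  show ?thesis
  proof (rule that[of "C * (pi + 1)\<^sup>2 / k"])
    show "0 \<le> C * (pi + 1)\<^sup>2 / k" using C(1) k(1) by simp
    fix f x \<omega> assume f: "f \<in> tempered"
    have t: "distr_chirp \<alpha> f \<in> tempered" by (rule tempered_chirp[OF f])
    have m: "(\<lambda>(y, \<eta>). stft ?G (distr_chirp \<alpha> f) y \<eta>) \<in> borel_measurable (borel \<Otimes>\<^sub>M borel)"
      unfolding case_prod_beta by (intro measurable_stft t G) measurable
    have "ennreal (cmod (stft \<psi> (distr_chirp \<alpha> f) x \<omega>)) \<le>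
      ennreal C * (ennreal ((pi + 1)\<^sup>2) * mixed_norm r s (stft ?G (distr_chirp \<alpha> f)))"
      by (rule order_trans[OF C(2)[OF t]]) (intro mult_left_mono smear_le_mixed_norm rs m, simp)
    also have "mixed_norm r s (stft ?G (distr_chirp \<alpha> f)) = ennreal (1 / k) * A_mod_norm A g r s f"
    proof -
      have "ennreal (1 / k) * ennreal k = 1" using k(1) by (simp add: ennreal_mult[symmetric])
      then show ?thesis unfolding k(2)[OF f] by (simp add: mult.assoc[symmetric])
    qed
    also have "ennreal C * (ennreal ((pi + 1)\<^sup>2) * (ennreal (1 / k) * A_mod_norm A g r s f)) =
      ennreal (C * (pi + 1)\<^sup>2 / k) * A_mod_norm A g r s f"
    proof -
      have "ennreal C * (ennreal ((pi + 1)\<^sup>2) * ennreal (1 / k)) = ennreal (C * (pi + 1)\<^sup>2 / k)"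
        using C(1) k(1) by (simp add: ennreal_mult[symmetric])
      then show ?thesis by (simp add: mult.assoc[symmetric])
    qed
    finally show "ennreal (cmod (stft \<psi> (distr_chirp \<alpha> f) x \<omega>)) \<le> ennreal (C * (pi + 1)\<^sup>2 / k) * A_mod_norm A g r s f" .
  qed
qed

section \<open>Operators between modulation spaces\<close>

text \<open>A chirp shears the plane and changes the window, so a bound over the whole plane passes
  from \<open>distr_chirp \<alpha> \<Lambda>\<close> to \<Lambda>. Operators commuting with ordinary
  translations are thus treated without conjugation.\<close>

lemma stft_unchirp:
  assumes "\<Lambda> \<in> tempered"
  shows "cmod (stft \<psi> \<Lambda> x \<omega>) = cmod (stft (chirp (- \<alpha>) \<psi>) (distr_chirp \<alpha> \<Lambda>) x (\<omega> - \<alpha> * x))"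
  using stft_chirp[OF tempered_chirp[OF assms, of \<alpha>], of \<psi> "- \<alpha>" x \<omega>] by (simp add: norm_mult)

text \<open>Expanding the square of \<open>t + x\<close>: the mixed term is the modulation contained
  in the A-translation, and the term in \<open>x\<^sup>2\<close> is a constant phase.\<close>

lemma chirp_translate:
  assumes \<Lambda>: "\<Lambda> \<in> tempered" and \<alpha>: "\<alpha> = par_a A / par_b A"
  shows "distr_chirp (- \<alpha>) (distr_translate x \<Lambda>) =
    (\<lambda>\<phi>. cis (- (pi * \<alpha> * x\<^sup>2)) * distr_A_trans A x (distr_chirp (- \<alpha>) \<Lambda>) \<phi>)"
proof
  fix \<phi>
  have "translate (- x) (chirp (- \<alpha>) \<phi>) =
    (\<lambda>t. cis (- (pi * \<alpha> * x\<^sup>2)) * chirp (- \<alpha>) (modul (- (par_a A * x / par_b A)) (translate (- x) \<phi>)) t)"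
  proof
    fix t
    have a: "par_a A * x / par_b A = \<alpha> * x" using \<alpha> by simp
    have "cis (pi * (- \<alpha>) * (t - - x)\<^sup>2) =
      cis (- (pi * \<alpha> * x\<^sup>2)) * (cis (pi * (- \<alpha>) * t\<^sup>2) * cis (2 * pi * (- (\<alpha> * x)) * t))"
      by (simp add: cis_mult power2_eq_square algebra_simps)
    then show "translate (- x) (chirp (- \<alpha>) \<phi>) t =
      cis (- (pi * \<alpha> * x\<^sup>2)) * chirp (- \<alpha>) (modul (- (par_a A * x / par_b A)) (translate (- x) \<phi>)) t"
      unfolding a by (simp add: translate_def chirp_def modul_def mult.assoc)
  qed
  then show "distr_chirp (- \<alpha>) (distr_translate x \<Lambda>) \<phi> =
    cis (- (pi * \<alpha> * x\<^sup>2)) * distr_A_trans A x (distr_chirp (- \<alpha>) \<Lambda>) \<phi>"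
    by (simp add: distr_chirp_def distr_translate_def distr_A_trans_def distr_modul_def tempered_cmult[OF \<Lambda>])
qed

lemma A_trans_chirp:
  assumes \<Lambda>: "\<Lambda> \<in> tempered" and \<alpha>: "\<alpha> = par_a A / par_b A"
  shows "distr_A_trans A x (distr_chirp (- \<alpha>) \<Lambda>) =
    (\<lambda>\<phi>. cis (pi * \<alpha> * x\<^sup>2) * distr_chirp (- \<alpha>) (distr_translate x \<Lambda>) \<phi>)"
  unfolding chirp_translate[OF assms] by (simp add: mult.assoc[symmetric] cis_mult)

lemma distr_of_chirp: "distr_of (chirp \<alpha> F) = distr_chirp \<alpha> (distr_of F)"
  by (auto simp: distr_of_def distr_chirp_def chirp_def fun_eq_iff mult_ac)

lemma distr_reflect_chirp: "distr_reflect (distr_chirp \<alpha> \<Lambda>) = distr_chirp \<alpha> (distr_reflect \<Lambda>)"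
proof -
  have "chirp \<alpha> (reflect \<phi>) = reflect (chirp \<alpha> \<phi>)" for \<phi>
    by (auto simp: chirp_def reflect_def)
  then show ?thesis by (simp add: distr_reflect_def distr_chirp_def)
qed

locale modulation_operator =
  fixes A :: lct_params and g :: "real \<Rightarrow> complex" and r1 s1 r2 s2 :: real and T :: "functional \<Rightarrow> functional"
  assumes b: "par_b A \<noteq> 0" and g: "g \<in> schwartz" "g \<noteq> (\<lambda>t. 0)"
    and rs: "1 \<le> r1" "1 \<le> s1" "1 \<le> r2" "1 \<le> s2"
    and T: "bounded_linear_op (A_mod_space A g r1 s1) (A_mod_norm A g r1 s1)
           (A_mod_space A g r2 s2) (A_mod_norm A g r2 s2) T"
begin

definition \<alpha> :: real where "\<alpha> = par_a A / par_b A"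

lemma S0_space: "f \<in> S0 g \<Longrightarrow> f \<in> A_mod_space A g r1 s1"
  using S0_le_A_mod[OF b g rs(1,2)] by blast

lemma T_add: "f \<in> S0 g \<Longrightarrow> h \<in> S0 g \<Longrightarrow> T (\<lambda>\<phi>. f \<phi> + h \<phi>) = (\<lambda>\<phi>. T f \<phi> + T h \<phi>)"
  and T_scale: "f \<in> S0 g \<Longrightarrow> T (\<lambda>\<phi>. k * f \<phi>) = (\<lambda>\<phi>. k * T f \<phi>)"
  and T_tempered: "f \<in> S0 g \<Longrightarrow> T f \<in> tempered"
  using T S0_space unfolding bounded_linear_op_def by (auto simp: A_mod_space_def)

lemma T_bound:
  assumes \<psi>: "\<psi> \<in> schwartz"
  obtains C where "0 \<le> C" "\<And>f x \<omega>. f \<in> S0 g \<Longrightarrow>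
    ennreal (cmod (stft \<psi> (distr_chirp \<alpha> (T f)) x \<omega>)) \<le> ennreal C * S0_norm g f"
proof -
  obtain Q where Q: "0 \<le> Q" "\<And>f. f \<in> S0 g \<Longrightarrow> A_mod_norm A g r1 s1 f \<le> ennreal Q * S0_norm g f"
    "\<And>f. f \<in> S0 g \<Longrightarrow> f \<in> A_mod_space A g r1 s1"
    using S0_le_A_mod[OF b g rs(1,2)] by blast
  obtain C where C: "0 \<le> C" "\<And>f x \<omega>. f \<in> tempered \<Longrightarrow>
    ennreal (cmod (stft \<psi> (distr_chirp \<alpha> f) x \<omega>)) \<le> ennreal C * A_mod_norm A g r2 s2 f"
    using stft_le_A_mod[OF b g rs(3,4) \<alpha>_def \<psi>] by blast
  obtain K where K: "\<And>f. f \<in> S0 g \<Longrightarrow> A_mod_norm A g r2 s2 (T f) \<le> ennreal K * A_mod_norm A g r1 s1 f"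
    using T S0_space unfolding bounded_linear_op_def by blast
  show ?thesis
  proof (rule that[of "C * \<bar>K\<bar> * Q"])
    show "0 \<le> C * \<bar>K\<bar> * Q" using C(1) Q(1) by simp
    fix f x \<omega> assume f: "f \<in> S0 g"
    have "ennreal (cmod (stft \<psi> (distr_chirp \<alpha> (T f)) x \<omega>)) \<le> ennreal C * A_mod_norm A g r2 s2 (T f)"
      by (rule C(2)[OF T_tempered[OF f]])
    also have "\<dots> \<le> ennreal C * (ennreal \<bar>K\<bar> * (ennreal Q * S0_norm g f))"
      by (intro mult_left_mono order_trans[OF K[OF f]] mult_mono Q f ennreal_leI) auto
    also have "\<dots> = ennreal (C * \<bar>K\<bar> * Q) * S0_norm g f"
      using C(1) Q(1) by (simp add: ennreal_mult mult.assoc)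
    finally show "ennreal (cmod (stft \<psi> (distr_chirp \<alpha> (T f)) x \<omega>)) \<le> ennreal (C * \<bar>K\<bar> * Q) * S0_norm g f" .
  qed
qed

theorem translation_invariant:
  assumes "\<And>x f. f \<in> A_mod_space A g r1 s1 \<Longrightarrow> T (distr_translate x f) = distr_translate x (T f)"
  shows "\<exists>!u. u \<in> S0_dual g \<and> (\<forall>f\<in>S0 g. T f = distr_of (S0_conv u f))"
proof -
  interpret translation_invariant_op g T
  proof
    fix \<psi> :: "real \<Rightarrow> complex" assume \<psi>: "\<psi> \<in> schwartz"
    then have "chirp (- \<alpha>) \<psi> \<in> schwartz" by simp
    then obtain C where C: "\<And>f x \<omega>. f \<in> S0 g \<Longrightarrow>
      ennreal (cmod (stft (chirp (- \<alpha>) \<psi>) (distr_chirp \<alpha> (T f)) x \<omega>)) \<le> ennreal C * S0_norm g f"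
      using T_bound by metis
    show "\<exists>C. \<forall>f\<in>S0 g. \<forall>x \<omega>. ennreal (cmod (stft \<psi> (T f) x \<omega>)) \<le> ennreal C * S0_norm g f"
      using C by (intro exI[of _ C] ballI allI) (simp add: stft_unchirp[OF T_tempered, of _ \<psi> _ _ \<alpha>])
  qed (use g T_add T_scale T_tempered assms S0_space in auto)
  show ?thesis by (rule ex1_kernel)
qed

definition unchirped :: "functional \<Rightarrow> functional" where
  "unchirped f = distr_chirp \<alpha> (T (distr_chirp (- \<alpha>) f))"

lemma S0_chirp_closed: "f \<in> S0 g \<Longrightarrow> distr_chirp \<beta> f \<in> S0 g"
  using S0_chirp[OF g, of \<beta>] by blast

lemma S0_chirp_iff: "distr_chirp \<beta> f \<in> S0 g \<longleftrightarrow> f \<in> S0 g"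
  using S0_chirp_closed[of f \<beta>] S0_chirp_closed[of "distr_chirp \<beta> f" "- \<beta>"] by auto

lemma unchirped_op:
  assumes inv: "\<And>x f. f \<in> A_mod_space A g r1 s1 \<Longrightarrow> T (distr_A_trans A x f) = distr_A_trans A x (T f)"
  shows "translation_invariant_op g unchirped"
proof
  fix f assume f: "f \<in> S0 g"
  then have f': "distr_chirp (- \<alpha>) f \<in> S0 g" by (rule S0_chirp_closed)
  show "unchirped f \<in> tempered"
    unfolding unchirped_def by (intro tempered_chirp T_tempered f')
  show "unchirped (\<lambda>\<phi>. k * f \<phi>) = (\<lambda>\<phi>. k * unchirped f \<phi>)" for k
    using T_scale[OF f', of k] by (simp add: unchirped_def distr_chirp_def)
  show "unchirped (\<lambda>\<phi>. f \<phi> + h \<phi>) = (\<lambda>\<phi>. unchirped f \<phi> + unchirped h \<phi>)" if "h \<in> S0 g" for h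
    using T_add[OF f' S0_chirp_closed[OF that, of "- \<alpha>"]] by (simp add: unchirped_def distr_chirp_def)
  fix x
  let ?e = "cis (- (pi * \<alpha> * x\<^sup>2))"
  have A: "distr_A_trans A x (distr_chirp (- \<alpha>) f) \<in> S0 g"
    unfolding A_trans_chirp[OF S0_tempered[OF f] \<alpha>_def]
    by (intro S0_scale S0_chirp_closed S0_translate g f)
  \<comment> \<open>The phase leaves \<open>T\<close> by linearity and is absorbed again when the
    same identity is read backwards on the image.\<close>
  have "T (distr_chirp (- \<alpha>) (distr_translate x f)) = (\<lambda>\<phi>. ?e * T (distr_A_trans A x (distr_chirp (- \<alpha>) f)) \<phi>)"
    unfolding chirp_translate[OF S0_tempered[OF f] \<alpha>_def] by (rule T_scale[OF A])
  also have "\<dots> = (\<lambda>\<phi>. ?e * distr_A_trans A x (distr_chirp (- \<alpha>) (unchirped f)) \<phi>)"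
    by (simp add: inv[OF S0_space[OF f']] unchirped_def)
  also have "\<dots> = distr_chirp (- \<alpha>) (distr_translate x (unchirped f))"
    using \<open>unchirped f \<in> tempered\<close> by (simp add: chirp_translate[OF _ \<alpha>_def])
  finally show "unchirped (distr_translate x f) = distr_translate x (unchirped f)"
    by (simp add: unchirped_def)
next
  fix \<psi> :: "real \<Rightarrow> complex" assume \<psi>: "\<psi> \<in> schwartz"
  obtain C where C: "0 \<le> C" "\<And>f x \<omega>. f \<in> S0 g \<Longrightarrow>
    ennreal (cmod (stft \<psi> (distr_chirp \<alpha> (T f)) x \<omega>)) \<le> ennreal C * S0_norm g f"
    using T_bound[OF \<psi>] by blast
  obtain D where D: "0 \<le> D" "\<And>f. f \<in> S0 g \<Longrightarrow> distr_chirp (- \<alpha>) f \<in> S0 g"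
    "\<And>f. f \<in> S0 g \<Longrightarrow> S0_norm g (distr_chirp (- \<alpha>) f) \<le> ennreal D * S0_norm g f"
    using S0_chirp[OF g, of "- \<alpha>"] by blast
  have "ennreal (cmod (stft \<psi> (unchirped f) x \<omega>)) \<le> ennreal (C * D) * S0_norm g f" if f: "f \<in> S0 g" for f x \<omega>
  proof -
    have "ennreal (cmod (stft \<psi> (unchirped f) x \<omega>)) \<le> ennreal C * S0_norm g (distr_chirp (- \<alpha>) f)"
      unfolding unchirped_def by (intro C S0_chirp_closed f)
    also have "\<dots> \<le> ennreal C * (ennreal D * S0_norm g f)" by (intro mult_left_mono D f) simp
    finally show ?thesis using C(1) D(1) by (simp add: ennreal_mult mult.assoc)
  qed
  then show "\<exists>C. \<forall>f\<in>S0 g. \<forall>x \<omega>. ennreal (cmod (stft \<psi> (unchirped f) x \<omega>)) \<le> ennreal C * S0_norm g f"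
    by blast
qed (use g in auto)

text \<open>The transpose of a chirp, with a scalar that takes up the factor of the A-convolution.
  It is invertible for \<open>k \<noteq> 0\<close>, which transports existence and uniqueness
  together.\<close>

definition chirp_dual :: "complex \<Rightarrow> real \<Rightarrow> (functional \<Rightarrow> complex) \<Rightarrow> functional \<Rightarrow> complex" where
  "chirp_dual k \<beta> u h = k * u (distr_chirp \<beta> h)"

lemma chirp_dual:
  assumes u: "u \<in> S0_dual g"
  shows "chirp_dual k \<beta> u \<in> S0_dual g"
proof -
  obtain K where K: "0 \<le> K" "\<And>f. f \<in> S0 g \<Longrightarrow> ennreal (cmod (u f)) \<le> ennreal K * S0_norm g f"
    using S0_dualD(4)[OF u] by blast
  obtain D where D: "0 \<le> D" "\<And>f. f \<in> S0 g \<Longrightarrow> distr_chirp \<beta> f \<in> S0 g"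
    "\<And>f. f \<in> S0 g \<Longrightarrow> S0_norm g (distr_chirp \<beta> f) \<le> ennreal D * S0_norm g f"
    using S0_chirp[OF g, of \<beta>] by blast
  have "ennreal (cmod (chirp_dual k \<beta> u f)) \<le> ennreal (cmod k * K * D) * S0_norm g f" if f: "f \<in> S0 g" for f
  proof -
    have "ennreal (cmod (chirp_dual k \<beta> u f)) = ennreal (cmod k) * ennreal (cmod (u (distr_chirp \<beta> f)))"
      by (simp add: chirp_dual_def norm_mult ennreal_mult)
    also have "\<dots> \<le> ennreal (cmod k) * (ennreal K * (ennreal D * S0_norm g f))"
      by (intro mult_left_mono order_trans[OF K(2)[OF S0_chirp_closed[OF f]]] D f) auto
    finally show ?thesis using K(1) D(1) by (simp add: ennreal_mult mult.assoc)
  qed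
  moreover have "chirp_dual k \<beta> u (\<lambda>\<phi>. f \<phi> + h \<phi>) = chirp_dual k \<beta> u f + chirp_dual k \<beta> u h"
    if "f \<in> S0 g" "h \<in> S0 g" for f h
    using S0_dualD(1)[OF u S0_chirp_closed[OF that(1), of \<beta>] S0_chirp_closed[OF that(2), of \<beta>]]
    by (simp add: chirp_dual_def distr_chirp_def distrib_left)
  moreover have "chirp_dual k \<beta> u (\<lambda>\<phi>. l * f \<phi>) = l * chirp_dual k \<beta> u f" if "f \<in> S0 g" for f l
    using S0_dualD(2)[OF u S0_chirp_closed[OF that, of \<beta>], of l] by (simp add: chirp_dual_def distr_chirp_def)
  moreover have "chirp_dual k \<beta> u f = 0" if "f \<notin> S0 g" for f
    using S0_dualD(3)[OF u] that by (simp add: chirp_dual_def S0_chirp_iff)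
  ultimately show ?thesis unfolding S0_dual_def by blast
qed

text \<open>Of the chirp of rate \<open>2 * \<alpha>\<close> one half is spent on turning the
  A-translation into a translation, the other acts on \<open>u\<close>. The phase
  \<open>pi * \<alpha> * x\<^sup>2\<close> left over turns the prefactor into the outer chirp of
  rate \<open>- \<alpha>\<close>.\<close>

lemma S0_A_conv_chirp:
  assumes u: "u \<in> S0_dual g" and f: "f \<in> S0 g"
  shows "S0_A_conv A u f =
    chirp (- \<alpha>) (S0_conv (chirp_dual (of_real (1 / sqrt \<bar>par_b A\<bar>)) \<alpha> u) (distr_chirp \<alpha> f))"
proof
  fix x
  define f' where "f' = distr_reflect (distr_chirp \<alpha> f)"
  have f': "f' \<in> S0 g"
    unfolding f'_def using S0_reflect[OF g] S0_chirp_closed[OF f, of \<alpha>] by blast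
  have "distr_reflect f = distr_chirp (- \<alpha>) f'"
    by (simp add: f'_def distr_reflect_chirp)
  then have "distr_chirp (2 * par_a A / par_b A) (distr_A_trans A x (distr_reflect f)) =
    distr_chirp (2 * \<alpha>) (\<lambda>\<phi>. cis (pi * \<alpha> * x\<^sup>2) * distr_chirp (- \<alpha>) (distr_translate x f') \<phi>)"
    by (simp add: A_trans_chirp[OF S0_tempered[OF f'] \<alpha>_def]) (simp add: \<alpha>_def)
  also have "\<dots> = (\<lambda>\<phi>. cis (pi * \<alpha> * x\<^sup>2) * distr_chirp (2 * \<alpha>) (distr_chirp (- \<alpha>) (distr_translate x f')) \<phi>)"
    by (simp add: distr_chirp_def)
  also have "distr_chirp (2 * \<alpha>) (distr_chirp (- \<alpha>) (distr_translate x f')) = distr_chirp \<alpha> (distr_translate x f')"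
    by simp
  finally have 1: "u (distr_chirp (2 * par_a A / par_b A) (distr_A_trans A x (distr_reflect f))) =
    cis (pi * \<alpha> * x\<^sup>2) * u (distr_chirp \<alpha> (distr_translate x f'))"
    by (simp only: S0_dualD(2)[OF u S0_chirp_closed[OF S0_translate(1)[OF g(1) f']]])
  have 2: "cis (pi * (- \<alpha>) * x\<^sup>2) = cis (- (2 * pi * par_a A / par_b A) * x\<^sup>2) * cis (pi * \<alpha> * x\<^sup>2)"
    by (simp add: cis_mult \<alpha>_def field_simps)
  show "S0_A_conv A u f x =
    chirp (- \<alpha>) (S0_conv (chirp_dual (of_real (1 / sqrt \<bar>par_b A\<bar>)) \<alpha> u) (distr_chirp \<alpha> f)) x"
    unfolding S0_A_conv_def chirp_def S0_conv_def chirp_dual_def f'_def[symmetric] 1 2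
    by (simp only: mult_ac)
qed

theorem A_translation_invariant:
  assumes inv: "\<And>x f. f \<in> A_mod_space A g r1 s1 \<Longrightarrow> T (distr_A_trans A x f) = distr_A_trans A x (T f)"
  shows "\<exists>!u. u \<in> S0_dual g \<and> (\<forall>f\<in>S0 g. T f = distr_of (S0_A_conv A u f))"
proof -
  interpret translation_invariant_op g unchirped by (rule unchirped_op[OF inv])
  define k where "k = complex_of_real (1 / sqrt \<bar>par_b A\<bar>)"
  have k: "k \<noteq> 0" using b by (simp add: k_def)
  \<comment> \<open>The two conditions are matched for each \<open>u\<close> separately, so that
    uniqueness can be read off along the bijection \<open>chirp_dual\<close>.\<close>
  have eq: "(\<forall>f\<in>S0 g. T f = distr_of (S0_A_conv A u f)) \<longleftrightarrow>
      (\<forall>f\<in>S0 g. unchirped f = distr_of (S0_conv (chirp_dual k \<alpha> u) f))" (is "?L \<longleftrightarrow> ?R")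
    if u: "u \<in> S0_dual g" for u
  proof
    assume L: ?L
    show ?R
    proof
      fix f assume "f \<in> S0 g"
      then have f': "distr_chirp (- \<alpha>) f \<in> S0 g" by (rule S0_chirp_closed)
      show "unchirped f = distr_of (S0_conv (chirp_dual k \<alpha> u) f)"
        using L f' by (simp add: unchirped_def S0_A_conv_chirp[OF u f'] distr_of_chirp k_def)
    qed
  next
    assume R: ?R
    show ?L
    proof
      fix f assume f: "f \<in> S0 g"
      then have f': "distr_chirp \<alpha> f \<in> S0 g" by (rule S0_chirp_closed)
      have "T f = distr_chirp (- \<alpha>) (unchirped (distr_chirp \<alpha> f))" by (simp add: unchirped_def)
      then show "T f = distr_of (S0_A_conv A u f)"
        using R f' by (simp add: S0_A_conv_chirp[OF u f] distr_of_chirp k_def)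
    qed
  qed
  have inv1: "chirp_dual k \<alpha> (chirp_dual (inverse k) (- \<alpha>) u) = u" for u
    using k by (simp add: chirp_dual_def fun_eq_iff)
  have inv2: "chirp_dual (inverse k) (- \<alpha>) (chirp_dual k \<alpha> u) = u" for u
    using k by (simp add: chirp_dual_def fun_eq_iff)
  obtain v where v: "v \<in> S0_dual g" "\<forall>f\<in>S0 g. unchirped f = distr_of (S0_conv v f)"
    and uniq: "\<And>w. w \<in> S0_dual g \<Longrightarrow> \<forall>f\<in>S0 g. unchirped f = distr_of (S0_conv w f) \<Longrightarrow> w = v"
    using ex1_kernel by blast
  show ?thesis
  proof (rule ex1I[of _ "chirp_dual (inverse k) (- \<alpha>) v"])
    have d: "chirp_dual (inverse k) (- \<alpha>) v \<in> S0_dual g" by (rule chirp_dual[OF v(1)])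
    then show "chirp_dual (inverse k) (- \<alpha>) v \<in> S0_dual g \<and>
      (\<forall>f\<in>S0 g. T f = distr_of (S0_A_conv A (chirp_dual (inverse k) (- \<alpha>) v) f))"
      using v(2) unfolding eq[OF d] inv1 by blast
    fix u assume u: "u \<in> S0_dual g \<and> (\<forall>f\<in>S0 g. T f = distr_of (S0_A_conv A u f))"
    then have "chirp_dual k \<alpha> u = v"
      using eq[of u] by (intro uniq chirp_dual) auto
    then show "u = chirp_dual (inverse k) (- \<alpha>) v" using inv2[of u] by simp
  qed
qed

end

theorem theorem6p1:
  fixes A :: lct_params
    and g :: "real \<Rightarrow> complex"
    and r1 s1 r2 s2 :: real
    and T :: "functional \<Rightarrow> functional"
  assumes "par_a A * par_d A - par_b A * par_c A = 1"
    and "par_b A \<noteq> 0"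
    and "g \<in> schwartz"
    and "g \<noteq> (\<lambda>t. 0)"
    and "1 \<le> r1" and "1 \<le> s1" and "1 \<le> r2" and "1 \<le> s2"
    and "bounded_linear_op (A_mod_space A g r1 s1) (A_mod_norm A g r1 s1)
           (A_mod_space A g r2 s2) (A_mod_norm A g r2 s2) T"
  shows "((\<forall>x. \<forall>f \<in> A_mod_space A g r1 s1. T (distr_A_trans A x f) = distr_A_trans A x (T f)) \<longrightarrow>
            (\<exists>!u. u \<in> S0_dual g \<and> (\<forall>f \<in> S0 g. T f = distr_of (S0_A_conv A u f)))) \<and>
         ((\<forall>x. \<forall>f \<in> A_mod_space A g r1 s1. T (distr_translate x f) = distr_translate x (T f)) \<longrightarrow>
            (\<exists>!u. u \<in> S0_dual g \<and> (\<forall>f \<in> S0 g. T f = distr_of (S0_conv u f))))"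
proof -
  interpret modulation_operator A g r1 s1 r2 s2 T
    using assms by unfold_locales
  show ?thesis using A_translation_invariant translation_invariant by blast
qed

end
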